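(* For every integer partition $\lambda=(\lambda_1\ge\dots\ge\lambda_N\ge0)$, $$g(\Lambda)\,\Pi_\lambda(x)=\gamma(x)\,\Pi_\lambda(x),$$ where $$g(\Lambda)=\Big(\prod_{a=1}^Ne^{\frac{(\log T_a)^2}{2\log q}}\Big)\prod_{a=1}^{N-1}\Big(\frac{\Lambda_{a+1}}{\Lambda_a};q\Big)_\infty^{-1},\qquad \gamma(x)=e^{\sum_{i=1}^N\frac{(\log x_i)^2}{2\log q}} .$$
   Context: $q\in\mathbb C^*$, $|q|<1$, $(u;q)_\infty=\prod_{n\ge0}(1-q^nu)$, $[1,N]=\{1,\dots,N\}$. **Polynomials.** Let $\mathcal D_1(x;q,t)=\sum_{i=1}^N\prod_{j\ne i}\frac{tx_i-x_j}{x_i-x_j}\Gamma_i$, $\Gamma_ix_j=q^{\delta_{ij}}x_j\Gamma_i$. The monic symmetric Macdonald polynomial $P_\lambda(x)$ ($x^\lambda+$ lower terms in dominance order) is the eigenfunction with $\mathcal D_1P_\lambda=e_1(s)P_\lambda$, $s_i=t^{N-i}q^{\lambda_i}$, $e_1(s)=\sum s_i$. The $q$-Whittaker polynomials are $\Pi_\lambda(x)=\lim_{t\to\infty}P_\lambda(x)$. **Action of functions of $(\Lambda,T)$.** $\Lambda_i$ acts on functions of $\lambda$ as multiplication by $q^{\lambda_i}$ and $T_i$ by $\lambda_j\mapsto\lambda_j+\delta_{ij}$, so $T_i\Lambda_j=q^{\delta_{ij}}\Lambda_jT_i$. Infinite expressions in $T$ act on the extension of $\Pi_\lambda$ to formal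 $\lambda$: for formal $\lambda$ (with $\Lambda_i=q^{\lambda_i}$, $s_i=t^{N-i}\Lambda_i$) there is a unique series $x^\lambda\sum_{\beta\in Q_+}c_\beta(s)x^{-\beta}$, $c_0=1$, with $Q_+=\bigoplus_{i<N}\mathbb Z_{\ge0}(e_i-e_{i+1})$, that is an eigenfunction of $\mathcal D_1(x;q,t)$ (expanded in the $x_{i+1}/x_i$) with eigenvalue $e_1(s)$; its $t\to\infty$ limit, $x^\lambda\sum_\beta c_\beta(\Lambda)x^{-\beta}$, specializes to $\Pi_\lambda(x)$ when $\lambda$ is an integer partition. Re-expand it as $x^\lambda\sum_{\delta\in Q_+}\hat c_\delta(x)\Lambda^{-\delta}$. Then $T_i$ acts on $x^\lambda\Lambda^{-\delta}$ by multiplication by $x_iq^{-\delta_i}$, so $e^{(\log T_i)^2/(2\log q)}$ acts on it by multiplication by $e^{(\log x_i-\delta_i\log q)^2/(2\log q)}$, and $(\Lambda_{a+1}/\Lambda_a;q)_\infty^{-1}$ acts by multiplication by its power series in $\Lambda_{a+1}/\Lambda_a$. *)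

theory Defs
  imports "HOL-Complex_Analysis.Complex_Analysis"
begin

text \<open>
  Tuples indexed by \<open>{1..N}\<close> are functions on \<open>nat\<close>; exponent vectors vanish outside \<open>{1..N}\<close>.
\<close>

definition mono_at :: "nat \<Rightarrow> (nat \<Rightarrow> complex) \<Rightarrow> (nat \<Rightarrow> int) \<Rightarrow> complex" where
  "mono_at N x \<mu> = (\<Prod>i\<in>{1..N}. x i powi \<mu> i)"

definition is_partition :: "nat \<Rightarrow> (nat \<Rightarrow> nat) \<Rightarrow> bool" where
  "is_partition N lam \<longleftrightarrow>
     (\<forall>i\<in>{1..<N}. lam (i + 1) \<le> lam i) \<and> (\<forall>i. i \<notin> {1..N} \<longrightarrow> lam i = 0)"

definition simple_root :: "nat \<Rightarrow> nat \<Rightarrow> int" where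
  "simple_root a = (\<lambda>i. of_bool (i = a) - of_bool (i = a + 1))"

definition Qplus :: "nat \<Rightarrow> (nat \<Rightarrow> int) set" where
  "Qplus N = range (\<lambda>(n :: nat \<Rightarrow> nat) i. \<Sum>a\<in>{1..<N}. int (n a) * simple_root a i)"

definition decomps :: "nat \<Rightarrow> (nat \<Rightarrow> int) \<Rightarrow> ((nat \<Rightarrow> int) \<times> (nat \<Rightarrow> int)) set" where
  "decomps N \<kappa> = {(\<nu>, \<beta>). \<nu> \<in> Qplus N \<and> \<beta> \<in> Qplus N \<and> (\<forall>i. \<kappa> i = \<nu> i + \<beta> i)}"


subsection \<open>Macdonald and q-Whittaker polynomials\<close>

definition D1_coeff :: "nat \<Rightarrow> complex \<Rightarrow> nat \<Rightarrow> (nat \<Rightarrow> complex) \<Rightarrow> complex" where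
  "D1_coeff N t i x = (\<Prod>j\<in>{1..N} - {i}. (t * x i - x j) / (x i - x j))"

definition D1 :: "nat \<Rightarrow> complex \<Rightarrow> complex \<Rightarrow> ((nat \<Rightarrow> complex) \<Rightarrow> complex) \<Rightarrow> (nat \<Rightarrow> complex) \<Rightarrow> complex" where
  "D1 N q t f x = (\<Sum>i\<in>{1..N}. D1_coeff N t i x * f (x(i := q * x i)))"

text \<open>\<open>e\<^sub>1(s)\<close> for \<open>s\<^sub>i = t\<^bsup>N-i\<^esup> L\<^sub>i\<close>.\<close>

definition e1_s :: "nat \<Rightarrow> complex \<Rightarrow> (nat \<Rightarrow> complex) \<Rightarrow> complex" where
  "e1_s N t L = (\<Sum>i\<in>{1..N}. t ^ (N - i) * L i)"

text \<open>
  Dominance order on arbitrary exponent vectors: a symmetric polynomial has only monomials dominated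
  by the partition \<open>\<lambda>\<close> iff it is a combination of the monomial symmetric polynomials \<open>m\<^sub>\<mu>\<close> with
  \<open>\<mu> \<le> \<lambda>\<close>.
\<close>

definition dominated :: "nat \<Rightarrow> (nat \<Rightarrow> nat) \<Rightarrow> (nat \<Rightarrow> nat) \<Rightarrow> bool" where
  "dominated N \<nu> lam \<longleftrightarrow>
     (\<forall>i. i \<notin> {1..N} \<longrightarrow> \<nu> i = 0) \<and>
     (\<forall>k\<in>{1..N}. (\<Sum>i\<in>{1..k}. \<nu> i) \<le> (\<Sum>i\<in>{1..k}. lam i)) \<and>
     (\<Sum>i\<in>{1..N}. \<nu> i) = (\<Sum>i\<in>{1..N}. lam i)"

text \<open>A polynomial is given by its coefficient function \<open>p\<close> (of finite support).\<close>

definition poly_at :: "nat \<Rightarrow> ((nat \<Rightarrow> nat) \<Rightarrow> complex) \<Rightarrow> (nat \<Rightarrow> complex) \<Rightarrow> complex" where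
  "poly_at N p x = (\<Sum>\<nu> | p \<nu> \<noteq> 0. p \<nu> * (\<Prod>i\<in>{1..N}. x i ^ \<nu> i))"

definition is_macdonald ::
  "nat \<Rightarrow> complex \<Rightarrow> complex \<Rightarrow> (nat \<Rightarrow> nat) \<Rightarrow> ((nat \<Rightarrow> nat) \<Rightarrow> complex) \<Rightarrow> bool" where
  "is_macdonald N q t lam p \<longleftrightarrow>
     p lam = 1 \<and>
     (\<forall>\<nu>. p \<nu> \<noteq> 0 \<longrightarrow> dominated N \<nu> lam) \<and>
     (\<forall>\<sigma> \<nu>. \<sigma> permutes {1..N} \<longrightarrow> p (\<nu> \<circ> \<sigma>) = p \<nu>) \<and>
     (\<forall>x. inj_on x {1..N} \<longrightarrow>
        D1 N q t (poly_at N p) x = e1_s N t (\<lambda>i. q ^ lam i) * poly_at N p x)"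

text \<open>For fixed \<open>\<lambda>\<close>, \<open>P\<^sub>\<lambda>\<close> is well defined for all but finitely many \<open>t\<close>.\<close>

definition macdonald :: "nat \<Rightarrow> complex \<Rightarrow> complex \<Rightarrow> (nat \<Rightarrow> nat) \<Rightarrow> (nat \<Rightarrow> complex) \<Rightarrow> complex" where
  "macdonald N q t lam = poly_at N (THE p. is_macdonald N q t lam p)"

definition q_whittaker :: "nat \<Rightarrow> complex \<Rightarrow> (nat \<Rightarrow> nat) \<Rightarrow> (nat \<Rightarrow> complex) \<Rightarrow> complex" where
  "q_whittaker N q lam x = Lim at_infinity (\<lambda>t. macdonald N q t lam x)"


subsection \<open>Extension to formal \<open>\<lambda>\<close>\<close>

text \<open>
  \<open>a\<close> is the coefficient family of the expansion \<open>f(x) = \<Sum>\<^sub>\<beta> a\<^sub>\<beta> x\<^bsup>-\<beta>\<^esup>\<close>, \<open>\<beta> \<in> Q\<^sub>+\<close>, i.e. of the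
  power series expansion of \<open>f\<close> in the ratios \<open>x\<^sub>i\<^sub>+\<^sub>1 / x\<^sub>i\<close>.
\<close>

definition has_ratio_expansion ::
  "nat \<Rightarrow> ((nat \<Rightarrow> complex) \<Rightarrow> complex) \<Rightarrow> ((nat \<Rightarrow> int) \<Rightarrow> complex) \<Rightarrow> bool" where
  "has_ratio_expansion N f a \<longleftrightarrow>
     (\<forall>\<beta>. \<beta> \<notin> Qplus N \<longrightarrow> a \<beta> = 0) \<and>
     (\<exists>\<epsilon>>0. \<forall>x. (\<forall>i\<in>{1..N}. x i \<noteq> 0) \<and> (\<forall>i\<in>{1..<N}. norm (x (i + 1)) < \<epsilon> * norm (x i)) \<longrightarrow>
        ((\<lambda>\<beta>. a \<beta> * mono_at N x (\<lambda>i. - \<beta> i)) has_sum f x) (Qplus N))"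

definition ratio_expansion ::
  "nat \<Rightarrow> ((nat \<Rightarrow> complex) \<Rightarrow> complex) \<Rightarrow> (nat \<Rightarrow> int) \<Rightarrow> complex" where
  "ratio_expansion N f = (THE a. has_ratio_expansion N f a)"

text \<open>
  \<open>x\<^sup>\<lambda> \<Sum>\<^sub>\<beta> c\<^sub>\<beta> x\<^bsup>-\<beta>\<^esup>\<close> is an eigenfunction of \<open>D1\<close> with eigenvalue \<open>e\<^sub>1(s)\<close>, where
  \<open>L\<^sub>i = q\<^bsup>\<lambda>\<^sub>i\<^esup>\<close>: the operator \<open>\<Gamma>\<^sub>i\<close> multiplies \<open>x\<^bsup>\<lambda>-\<beta>\<^esup>\<close> by \<open>L\<^sub>i q\<^bsup>-\<beta>\<^sub>i\<^esup>\<close>, and the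
  equation compares the coefficients of \<open>x\<^bsup>\<lambda>-\<kappa>\<^esup>\<close>.
\<close>

definition is_eigenseries ::
  "nat \<Rightarrow> complex \<Rightarrow> complex \<Rightarrow> (nat \<Rightarrow> complex) \<Rightarrow> ((nat \<Rightarrow> int) \<Rightarrow> complex) \<Rightarrow> bool" where
  "is_eigenseries N q t L c \<longleftrightarrow>
     c (\<lambda>_. 0) = 1 \<and>
     (\<forall>\<beta>. \<beta> \<notin> Qplus N \<longrightarrow> c \<beta> = 0) \<and>
     (\<forall>\<kappa>\<in>Qplus N.
        (\<Sum>i\<in>{1..N}. \<Sum>(\<nu>, \<beta>)\<in>decomps N \<kappa>.
           ratio_expansion N (D1_coeff N t i) \<nu> * (L i * q powi (- \<beta> i)) * c \<beta>)
        = e1_s N t L * c \<kappa>)"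

definition eigenseries ::
  "nat \<Rightarrow> complex \<Rightarrow> complex \<Rightarrow> (nat \<Rightarrow> complex) \<Rightarrow> (nat \<Rightarrow> int) \<Rightarrow> complex" where
  "eigenseries N q t L = (THE c. is_eigenseries N q t L c)"

text \<open>
  The eigenseries is unique for formal \<open>\<lambda>\<close> and \<open>t\<close>; for numerical values it is unique if no
  \<open>x\<^bsup>\<lambda>-\<beta>\<^esup>\<close> with \<open>\<beta> \<noteq> 0\<close> has the same leading eigenvalue as \<open>x\<^sup>\<lambda>\<close>. For fixed \<open>L\<close> with nonzero
  entries this excludes countably many \<open>t\<close>, which may however accumulate at infinity, so the limit
  \<open>t \<rightarrow> \<infinity>\<close> of the coefficients is taken through the remaining ones.
\<close>

definition generic_t :: "nat \<Rightarrow> complex \<Rightarrow> (nat \<Rightarrow> complex) \<Rightarrow> complex set" where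
  "generic_t N q L =
     {t. \<forall>\<beta>\<in>Qplus N - {\<lambda>_. 0}. e1_s N t (\<lambda>i. L i * q powi (- \<beta> i)) \<noteq> e1_s N t L}"

definition whittaker_series ::
  "nat \<Rightarrow> complex \<Rightarrow> (nat \<Rightarrow> complex) \<Rightarrow> (nat \<Rightarrow> int) \<Rightarrow> complex" where
  "whittaker_series N q L \<beta> =
     Lim (inf at_infinity (principal (generic_t N q L))) (\<lambda>t. eigenseries N q t L \<beta>)"

text \<open>
  Functions of \<open>x \<in> (\<complex>\<^sup>*)\<^sup>N\<close> and of \<open>log x\<close> are written as functions of \<open>u\<close>, \<open>x\<^sub>i = exp u\<^sub>i\<close>.
  The type below describes series \<open>x\<^sup>\<lambda> \<Sum>\<^sub>\<delta> F\<^sub>\<delta>(x) \<Lambda>\<^bsup>-\<delta>\<^esup>\<close> in which \<open>F\<^sub>\<delta>(x) = \<Sum>\<^sub>\<beta> F \<delta> \<beta> u\<close> is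
  itself a formal sum over \<open>\<beta> \<in> Q\<^sub>+\<close> of functions of \<open>x\<close>.
\<close>

type_synonym ext_series = "(nat \<Rightarrow> int) \<Rightarrow> (nat \<Rightarrow> int) \<Rightarrow> (nat \<Rightarrow> complex) \<Rightarrow> complex"

text \<open>Re-expansion of \<open>\<Sum>\<^sub>\<beta> c\<^sub>\<beta>(\<Lambda>) x\<^bsup>-\<beta>\<^esup>\<close> in powers of the \<open>\<Lambda>\<^sub>a\<^sub>+\<^sub>1 / \<Lambda>\<^sub>a\<close>.\<close>

definition whittaker_ext :: "nat \<Rightarrow> complex \<Rightarrow> ext_series" where
  "whittaker_ext N q \<delta> \<beta> u =
     ratio_expansion N (\<lambda>L. whittaker_series N q L \<beta>) \<delta> * mono_at N (\<lambda>i. exp (u i)) (\<lambda>i. - \<beta> i)"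


subsection \<open>The operator \<open>g(\<Lambda>)\<close>\<close>

definition qpoch_inf :: "complex \<Rightarrow> complex \<Rightarrow> complex" where
  "qpoch_inf q z = (\<Prod>n. 1 - q ^ n * z)"

text \<open>Multiplication by \<open>(\<Lambda>\<^sub>a\<^sub>+\<^sub>1/\<Lambda>\<^sub>a; q)\<^sub>\<infinity>\<^bsup>-1\<^esup>\<close>, where \<open>\<Lambda>\<^sub>a\<^sub>+\<^sub>1/\<Lambda>\<^sub>a = \<Lambda>\<^bsup>-\<alpha>\<^esup>\<close> for the simple root \<open>\<alpha>\<close>.\<close>

definition inv_qpoch_op :: "nat \<Rightarrow> complex \<Rightarrow> nat \<Rightarrow> ext_series \<Rightarrow> ext_series" where
  "inv_qpoch_op N q a F \<delta> \<beta> u =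
     (\<Sum>n | (\<lambda>i. \<delta> i - int n * simple_root a i) \<in> Qplus N.
        fps_nth (fps_expansion (\<lambda>z. inverse (qpoch_inf q z)) 0) n *
        F (\<lambda>i. \<delta> i - int n * simple_root a i) \<beta> u)"

text \<open>\<open>lq\<close> is a logarithm of \<open>q\<close>.\<close>

definition gauss_T_op :: "complex \<Rightarrow> nat \<Rightarrow> ext_series \<Rightarrow> ext_series" where
  "gauss_T_op lq a F \<delta> \<beta> u = exp ((u a - of_int (\<delta> a) * lq)\<^sup>2 / (2 * lq)) * F \<delta> \<beta> u"

definition g_op :: "nat \<Rightarrow> complex \<Rightarrow> complex \<Rightarrow> ext_series \<Rightarrow> ext_series" where
  "g_op N q lq =
     foldr (\<circ>) (map (gauss_T_op lq) [1..<N + 1]) id \<circ>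
     foldr (\<circ>) (map (inv_qpoch_op N q) [1..<N]) id"

definition gamma_fun :: "nat \<Rightarrow> complex \<Rightarrow> (nat \<Rightarrow> complex) \<Rightarrow> complex" where
  "gamma_fun N lq u = exp (\<Sum>i\<in>{1..N}. (u i)\<^sup>2 / (2 * lq))"

text \<open>
  The part of \<open>g(\<Lambda>) \<Pi>\<^sub>\<lambda>(x)\<close> of degree \<open>\<lambda> - \<kappa>\<close> in \<open>x\<close>, at \<open>\<Lambda>\<^sub>i = q\<^bsup>\<lambda>\<^sub>i\<^esup>\<close>. Since
  \<open>exp ((u\<^sub>i - \<delta>\<^sub>i log q)\<^sup>2 / (2 log q)) = exp (u\<^sub>i\<^sup>2 / (2 log q)) x\<^sub>i\<^bsup>-\<delta>\<^sub>i\<^esup> q\<^bsup>\<delta>\<^sub>i\<^sup>2/2\<^esup>\<close>,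
  the \<open>(\<delta>, \<beta>)\<close> term of \<open>g_op N q lq (whittaker_ext N q)\<close> is a constant multiple of
  \<open>\<gamma>(x) x\<^bsup>-\<beta>-\<delta>\<^esup>\<close>, so that \<open>g(\<Lambda>) \<Pi>\<^sub>\<lambda>(x)\<close> is \<open>\<gamma>(x) x\<^sup>\<lambda>\<close> times a formal power series in the
  \<open>x\<^sub>i\<^sub>+\<^sub>1 / x\<^sub>i\<close>, to each coefficient of which only finitely many pairs \<open>(\<delta>, \<beta>)\<close> contribute.
\<close>

definition g_whittaker_part ::
  "nat \<Rightarrow> complex \<Rightarrow> complex \<Rightarrow> (nat \<Rightarrow> nat) \<Rightarrow> (nat \<Rightarrow> int) \<Rightarrow> (nat \<Rightarrow> complex) \<Rightarrow> complex" where
  "g_whittaker_part N q lq lam \<kappa> u =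
     mono_at N (\<lambda>i. exp (u i)) (\<lambda>i. int (lam i)) *
     (\<Sum>(\<delta>, \<beta>)\<in>decomps N \<kappa>.
        g_op N q lq (whittaker_ext N q) \<delta> \<beta> u * mono_at N (\<lambda>i. q ^ lam i) (\<lambda>i. - \<delta> i))"

end

(* Let Psi = x^lambda sum W(delta, beta) Lambda^-delta x^-beta be the extended q-Whittaker series.
   As t -> infinity the eigenvalue equation becomes D0 Psi = Lambda_1 Psi with
   D0 = sum_i prod_(j/=i) x_i/(x_i - x_j) Gamma_i, together with the same equation in x_k, ..., x_N
   for the part of degree 0 in x_1, ..., x_(k-1).  With D1 = sum_i x_i prod_(j/=i) x_i/(x_i - x_j) Gamma_i
   one has D0 D1 = q D1 D0, so (Lambda_1 T_1)^-1 D1 Psi solves the equation of Psi and, by uniqueness,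
   D1 Psi = Lambda_1 T_1 Psi.  Conjugation by gamma turns D0 into a multiple of D1 and conjugation by
   the Gaussian in T turns Lambda_1 T_1 into a multiple of Lambda_1; hence G^-1 gamma Psi, where G is the
   Gaussian part of g, again satisfies the equation of Psi.  It is therefore determined by its part of
   degree 0 in x_1, and this part comes from the terms of W(delta, beta) with beta_1 = delta_1, which are
   powers of D1 (for x_2, ..., x_N) applied to the series in N - 1 variables.  By induction on the number
   of variables G^-1 gamma Psi is prod_a (Lambda_(a+1)/Lambda_a; q)_infinity^-1 Psi.

   It remains to see that the q-Whittaker polynomial is the specialization of Psi.  For large t the
   Macdonald polynomial is a terminating eigenseries, and the recursion for the coefficients of an
   eigenseries passes to the limit.  For the existence of Macdonald polynomials the main point is that
   D_1(x; q, t) preserves symmetric polynomials: after multiplication by a product of differences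
   x_k - x_l it becomes a finite difference operator on coefficients. *)
theory Submission
  imports Defs "HOL-Library.Function_Algebras"
begin

section \<open>Exponent vectors and convolution\<close>

text \<open>Everything is reduced to a statement about numbers W(\<delta>, \<beta>): multiplication
  by a monomial in \<Lambda> or x shifts an index, and \<Gamma>_i multiplies by \<Lambda>_i and a
  power of q. In these terms the claim is that the q-Pochhammer operators turn W(\<delta>, \<beta>)
  into q^(-|\<delta>|^2 / 2) W(\<delta>, \<beta> + \<delta>). The relation D0 D1 = q D1 D0 holds
  because the coefficient of \<Gamma>_i \<Gamma>_j in D0 D1 - q D1 D0 is antisymmetric in i and j.
  The Pochhammer symbol arises from denominators: passing from the m-th power of D1 to the next
  divides by 1 - q^(-(m+1)), and these factors build up (q; q)_m, as in Euler's series for 1 / (z;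
  q)_infinity. Two obstacles shape the rest. Divided by t^(N-1), the eigenvalue equation keeps only
  \<Lambda>_1 in the limit and is void in degree 0 in x_1; the smaller terms become visible only
  after an exact cancellation of the dominant ones. And D_1 of a symmetric polynomial is at hand
  only as a series in x_(i+1) / x_i, on a domain that permutations of the variables leave.\<close>

definition psum :: "(nat \<Rightarrow> int) \<Rightarrow> nat \<Rightarrow> int" where
  "psum \<beta> k = (\<Sum>i\<in>{1..k}. \<beta> i)"

definition ivec :: "nat \<Rightarrow> (nat \<Rightarrow> int) set" where
  "ivec N = {\<beta>. \<forall>i. i \<notin> {1..N} \<longrightarrow> \<beta> i = 0}"

definition rt :: "nat \<Rightarrow> nat \<Rightarrow> nat \<Rightarrow> int" where
  "rt p r = (\<lambda>i. of_bool (i = p) - of_bool (i = r))"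

lemma simple_root_eq_rt: "simple_root a = rt a (Suc a)"
  by (simp add: simple_root_def rt_def)

lemma rt_same [simp]: "rt p p = 0"
  by (simp add: rt_def fun_eq_iff)

lemma psum_add: "psum (a + b) k = psum a k + psum b k"
  and psum_diff: "psum (a - b) k = psum a k - psum b k"
  and psum_zero [simp]: "psum 0 k = 0"
  and psum_0 [simp]: "psum a 0 = 0"
  by (simp_all add: psum_def sum.distrib sum_subtractf)

lemma psum_Suc: "psum \<beta> (Suc k) = psum \<beta> k + \<beta> (Suc k)"
  by (simp add: psum_def)

lemma psum_scale: "psum (\<lambda>i. c * \<beta> i) k = c * psum \<beta> k"
  by (simp add: psum_def sum_distrib_left)

lemma psum_sum: "psum (\<lambda>i. \<Sum>a\<in>A. f a i) k = (\<Sum>a\<in>A. psum (f a) k)"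
  unfolding psum_def by (rule sum.swap)

lemma psum_rt:
  assumes "1 \<le> p" "p \<le> r"
  shows "psum (rt p r) k = of_bool (p \<le> k \<and> k < r)"
proof (induction k)
  case 0
  then show ?case using assms by simp
next
  case (Suc k)
  then show ?case using assms by (auto simp: psum_Suc rt_def)
qed

lemma psum_inj:
  assumes "a \<in> ivec N" "b \<in> ivec N" "\<And>k. psum a k = psum b k"
  shows "a = b"
proof
  fix i
  show "a i = b i"
  proof (cases i)
    case 0
    then show ?thesis using assms by (auto simp: ivec_def)
  next
    case (Suc j)
    then show ?thesis using assms(3)[of j] assms(3)[of i] by (simp add: psum_Suc)
  qed
qed

lemma ivec_add: "a \<in> ivec N \<Longrightarrow> b \<in> ivec N \<Longrightarrow> a + b \<in> ivec N"
  and ivec_diff: "a \<in> ivec N \<Longrightarrow> b \<in> ivec N \<Longrightarrow> a - b \<in> ivec N"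
  and ivec_zero [simp]: "0 \<in> ivec N"
  by (auto simp: ivec_def)

lemma ivec_rt: "p \<in> {1..N} \<Longrightarrow> r \<in> {1..N} \<Longrightarrow> rt p r \<in> ivec N"
  by (auto simp: ivec_def rt_def)

lemma psum_stable: "a \<in> ivec N \<Longrightarrow> N \<le> k \<Longrightarrow> psum a k = psum a N"
  unfolding psum_def by (rule sum.mono_neutral_right) (auto simp: ivec_def)

text \<open>The partial sum at a of a simple root is nonzero only for the root e_a - e_(a+1), so the
  coefficients of the simple roots are the partial sums themselves. All order arguments on
  \<open>Qplus\<close> run through this description.\<close>

lemma Qplus_iff: "\<beta> \<in> Qplus N \<longleftrightarrow> \<beta> \<in> ivec N \<and> (\<forall>k. 0 \<le> psum \<beta> k) \<and> psum \<beta> N = 0"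
proof
  assume "\<beta> \<in> Qplus N"
  then obtain n :: "nat \<Rightarrow> nat" where n: "\<beta> = (\<lambda>i. \<Sum>a\<in>{1..<N}. int (n a) * rt a (Suc a) i)"
    by (auto simp: Qplus_def simple_root_eq_rt)
  have "psum \<beta> k = (\<Sum>a\<in>{1..<N}. int (n a) * of_bool (a \<le> k \<and> k < Suc a))" for k
    unfolding n psum_sum psum_scale by (intro sum.cong refl) (simp add: psum_rt)
  moreover have "\<beta> \<in> ivec N"
    unfolding n ivec_def by (auto simp: rt_def intro!: sum.neutral)
  ultimately show "\<beta> \<in> ivec N \<and> (\<forall>k. 0 \<le> psum \<beta> k) \<and> psum \<beta> N = 0"
    by (auto intro!: sum_nonneg sum.neutral)
next
  assume \<beta>: "\<beta> \<in> ivec N \<and> (\<forall>k. 0 \<le> psum \<beta> k) \<and> psum \<beta> N = 0"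
  define \<beta>' where "\<beta>' = (\<lambda>i. \<Sum>a\<in>{1..<N}. int (nat (psum \<beta> a)) * rt a (Suc a) i)"
  have eq: "psum \<beta>' k = (\<Sum>a\<in>{1..<N}. psum \<beta> a * of_bool (a \<le> k \<and> k < Suc a))" for k
    unfolding \<beta>'_def psum_sum psum_scale by (intro sum.cong refl) (use \<beta> in \<open>simp add: psum_rt\<close>)
  have "psum \<beta>' k = psum \<beta> k" for k
  proof -
    have "psum \<beta>' k = (\<Sum>a\<in>{1..<N}. if a = k then psum \<beta> a else 0)"
      unfolding eq by (intro sum.cong refl) auto
    also have "\<dots> = (if k \<in> {1..<N} then psum \<beta> k else 0)"
      by simp
    also have "\<dots> = psum \<beta> k"
      using \<beta> psum_stable[of \<beta> N k] by (cases "k = 0") auto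
    finally show ?thesis .
  qed
  moreover have "\<beta>' \<in> ivec N"
    unfolding \<beta>'_def ivec_def by (auto simp: rt_def intro!: sum.neutral)
  ultimately have "\<beta> = \<beta>'"
    using \<beta> by (intro psum_inj[of _ N]) auto
  then show "\<beta> \<in> Qplus N"
    unfolding \<beta>'_def Qplus_def simple_root_eq_rt by (intro image_eqI[where x = "\<lambda>a. nat (psum \<beta> a)"]) auto
qed

lemma Qplus_ivec: "\<beta> \<in> Qplus N \<Longrightarrow> \<beta> \<in> ivec N"
  and Qplus_psum: "\<beta> \<in> Qplus N \<Longrightarrow> 0 \<le> psum \<beta> k"
  and Qplus_psum_N: "\<beta> \<in> Qplus N \<Longrightarrow> psum \<beta> N = 0"
  by (auto simp: Qplus_iff)

lemma Qplus_zero [simp]: "0 \<in> Qplus N"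
  by (simp add: Qplus_iff)

lemma Qplus_add: "a \<in> Qplus N \<Longrightarrow> b \<in> Qplus N \<Longrightarrow> a + b \<in> Qplus N"
  by (auto simp: Qplus_iff psum_add ivec_add)

lemma Qplus_antisym: "a \<in> Qplus N \<Longrightarrow> - a \<in> Qplus N \<Longrightarrow> a = 0"
proof (rule psum_inj[of _ N])
  assume a: "a \<in> Qplus N" "- a \<in> Qplus N"
  show "psum a k = psum 0 k" for k
    using Qplus_psum[OF a(1), of k] Qplus_psum[OF a(2), of k] psum_diff[of 0 a k] by simp
qed (auto simp: Qplus_ivec)

lemma Qplus_rt: "1 \<le> p \<Longrightarrow> p \<le> r \<Longrightarrow> r \<le> N \<Longrightarrow> rt p r \<in> Qplus N"
  by (auto simp: Qplus_iff psum_rt ivec_rt)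

section \<open>Order intervals and heights in the root cone\<close>

definition ival :: "nat \<Rightarrow> (nat \<Rightarrow> int) \<Rightarrow> (nat \<Rightarrow> int) set" where
  "ival N \<kappa> = {\<beta>. \<beta> \<in> Qplus N \<and> \<kappa> - \<beta> \<in> Qplus N}"

lemma ival_Qplus: "\<beta> \<in> ival N \<kappa> \<Longrightarrow> \<kappa> \<in> Qplus N"
  using Qplus_add[of \<beta> N "\<kappa> - \<beta>"] by (simp add: ival_def)

lemma ival_empty: "\<kappa> \<notin> Qplus N \<Longrightarrow> ival N \<kappa> = {}"
  using ival_Qplus by blast

lemma Qplus_diff_trans: "a - b \<in> Qplus N \<Longrightarrow> b - c \<in> Qplus N \<Longrightarrow> a - c \<in> Qplus N"
  using Qplus_add[of "a - b" N "b - c"] by simp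

lemma zero_in_ival [simp]: "0 \<in> ival N \<kappa> \<longleftrightarrow> \<kappa> \<in> Qplus N"
  by (simp add: ival_def)

lemma self_in_ival [simp]: "\<kappa> \<in> ival N \<kappa> \<longleftrightarrow> \<kappa> \<in> Qplus N"
  by (simp add: ival_def)

text \<open>A vector of the interval is determined by its partial sums up to N, and each of them
  lies between 0 and the corresponding partial sum of \<kappa>.\<close>

lemma finite_ival [simp]: "finite (ival N \<kappa>)"
proof -
  have "inj_on (\<lambda>\<beta>. restrict (psum \<beta>) {..N}) (ival N \<kappa>)"
  proof (rule inj_onI)
    fix a b assume a: "a \<in> ival N \<kappa>" and b: "b \<in> ival N \<kappa>"
      and eq: "restrict (psum a) {..N} = restrict (psum b) {..N}"
    have "psum a k = psum b k" for k
    proof (cases "k \<le> N")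
      case True
      then show ?thesis using fun_cong[OF eq, of k] by simp
    next
      case False
      then show ?thesis
        using a b psum_stable[of a N k] psum_stable[of b N k] by (simp add: ival_def Qplus_iff)
    qed
    then show "a = b"
      using a b by (intro psum_inj[of _ N]) (auto simp: ival_def Qplus_iff)
  qed
  moreover have "(\<lambda>\<beta>. restrict (psum \<beta>) {..N}) ` ival N \<kappa> \<subseteq> PiE {..N} (\<lambda>k. {0..psum \<kappa> k})"
    by (force simp: ival_def Qplus_iff psum_diff)
  moreover have "finite (PiE {..N} (\<lambda>k. {0..psum \<kappa> k}))"
    by (intro finite_PiE) auto
  ultimately show ?thesis
    by (metis finite_imageD finite_subset)
qed

text \<open>On \<open>Qplus\<close> this is the sum of the simple root coefficients. It is truncated
  to a natural number so that it serves as a well-founded measure on all vectors, also outside the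
  cone.\<close>

definition height :: "nat \<Rightarrow> (nat \<Rightarrow> int) \<Rightarrow> nat" where
  "height N \<beta> = nat (\<Sum>k\<in>{1..N}. psum \<beta> k)"

lemma Qplus_nonzero_psum:
  assumes "\<beta> \<in> Qplus N" "\<beta> \<noteq> 0"
  obtains k where "k \<in> {1..N}" "0 < psum \<beta> k"
proof -
  have "\<exists>k\<in>{1..N}. 0 < psum \<beta> k"
  proof (rule ccontr)
    assume *: "\<not> ?thesis"
    have "psum \<beta> k = psum 0 k" for k
    proof (cases "k \<in> {1..N}")
      case True
      then show ?thesis using * Qplus_psum[OF assms(1), of k] by force
    next
      case False
      then show ?thesis
        using psum_stable[of \<beta> N k] assms(1) by (cases "k = 0") (auto simp: Qplus_iff)
    qed
    then have "\<beta> = 0" using assms(1) by (intro psum_inj[of _ N]) (auto simp: Qplus_iff)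
    with assms show False by simp
  qed
  then show ?thesis using that by blast
qed

lemma height_less:
  assumes "\<beta> \<in> Qplus N" "\<kappa> - \<beta> \<in> Qplus N" "\<beta> \<noteq> \<kappa>"
  shows "height N \<beta> < height N \<kappa>"
proof -
  obtain k where k: "k \<in> {1..N}" "0 < psum (\<kappa> - \<beta>) k"
    using Qplus_nonzero_psum[of "\<kappa> - \<beta>" N] assms by auto
  have "(\<Sum>k\<in>{1..N}. psum \<beta> k) < (\<Sum>k\<in>{1..N}. psum \<kappa> k)"
  proof (rule sum_strict_mono_ex1)
    show "\<forall>j\<in>{1..N}. psum \<beta> j \<le> psum \<kappa> j"
      using Qplus_psum[OF assms(2)] by (simp add: psum_diff)
    show "\<exists>j\<in>{1..N}. psum \<beta> j < psum \<kappa> j"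
      using k by (auto simp: psum_diff)
  qed auto
  moreover have "0 \<le> (\<Sum>k\<in>{1..N}. psum \<beta> k)"
    using Qplus_psum[OF assms(1)] by (intro sum_nonneg) auto
  ultimately show ?thesis by (simp add: height_def)
qed

lemma height_ival: "\<beta> \<in> ival N \<kappa> - {\<kappa>} \<Longrightarrow> height N \<beta> < height N \<kappa>"
  by (rule height_less) (auto simp: ival_def)

lemma sum_decomps: "(\<Sum>(\<nu>, \<beta>)\<in>decomps N \<kappa>. f \<nu> \<beta>) = (\<Sum>\<beta>\<in>ival N \<kappa>. f (\<kappa> - \<beta>) \<beta>)"
proof -
  have "decomps N \<kappa> = (\<lambda>\<beta>. (\<kappa> - \<beta>, \<beta>)) ` ival N \<kappa>"
    by (auto simp: decomps_def ival_def image_iff fun_eq_iff fun_diff_def)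
  then show ?thesis
    by (simp add: sum.reindex inj_on_def)
qed

lemma sum_decomps_fst: "(\<Sum>(\<nu>, \<beta>)\<in>decomps N \<kappa>. f \<nu> \<beta>) = (\<Sum>\<nu>\<in>ival N \<kappa>. f \<nu> (\<kappa> - \<nu>))"
  unfolding sum_decomps
  by (rule sum.reindex_bij_witness[of _ "\<lambda>\<beta>. \<kappa> - \<beta>" "\<lambda>\<beta>. \<kappa> - \<beta>"]) (auto simp: ival_def)

section \<open>Convolution of coefficient families and recursion on the height\<close>

definition conv :: "nat \<Rightarrow> ((nat \<Rightarrow> int) \<Rightarrow> complex) \<Rightarrow> ((nat \<Rightarrow> int) \<Rightarrow> complex) \<Rightarrow> (nat \<Rightarrow> int) \<Rightarrow> complex" where
  "conv N a b \<kappa> = (\<Sum>\<beta>\<in>ival N \<kappa>. a (\<kappa> - \<beta>) * b \<beta>)"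

lemma conv_outside: "\<kappa> \<notin> Qplus N \<Longrightarrow> conv N a b \<kappa> = 0"
  by (simp add: conv_def ival_empty)

text \<open>Regrouping of pairs: (\<beta>, \<beta>') is replaced by (\<beta>', \<beta> - \<beta>').
  The second argument of \<open>b\<close> lets an array entry at \<beta>' be carried along with an
  operator coefficient at \<beta> - \<beta>'.\<close>

lemma conv_nested:
  fixes a :: "(nat \<Rightarrow> int) \<Rightarrow> complex" and b :: "(nat \<Rightarrow> int) \<Rightarrow> (nat \<Rightarrow> int) \<Rightarrow> complex"
  shows "(\<Sum>\<beta>\<in>ival N \<kappa>. a (\<kappa> - \<beta>) * (\<Sum>\<beta>'\<in>ival N \<beta>. b (\<beta> - \<beta>') \<beta>')) =
   (\<Sum>\<beta>'\<in>ival N \<kappa>. \<Sum>\<nu>\<in>ival N (\<kappa> - \<beta>'). a (\<kappa> - \<beta>' - \<nu>) * b \<nu> \<beta>')"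
proof -
  have "(\<Sum>\<beta>\<in>ival N \<kappa>. a (\<kappa> - \<beta>) * (\<Sum>\<beta>'\<in>ival N \<beta>. b (\<beta> - \<beta>') \<beta>')) =
    (\<Sum>(\<beta>, \<beta>')\<in>Sigma (ival N \<kappa>) (ival N). a (\<kappa> - \<beta>) * b (\<beta> - \<beta>') \<beta>')"
    unfolding sum_distrib_left by (subst sum.Sigma) (simp_all add: mult.assoc)
  also have "\<dots> = (\<Sum>(\<beta>', \<nu>)\<in>Sigma (ival N \<kappa>) (\<lambda>\<beta>'. ival N (\<kappa> - \<beta>')). a (\<kappa> - \<beta>' - \<nu>) * b \<nu> \<beta>')"
  proof (rule sum.reindex_bij_witness[of _ "\<lambda>(\<beta>', \<nu>). (\<nu> + \<beta>', \<beta>')" "\<lambda>(\<beta>, \<beta>'). (\<beta>', \<beta> - \<beta>')"], goal_cases)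
    case (2 x)
    then show ?case
      using Qplus_diff_trans[of \<kappa> "fst x" N "snd x"] by (auto simp: ival_def)
  next
    case (4 y)
    then show ?case
      using Qplus_add[of "snd y" N "fst y"] by (auto simp: ival_def algebra_simps)
  qed (auto simp: algebra_simps)
  also have "\<dots> = (\<Sum>\<beta>'\<in>ival N \<kappa>. \<Sum>\<nu>\<in>ival N (\<kappa> - \<beta>'). a (\<kappa> - \<beta>' - \<nu>) * b \<nu> \<beta>')"
    by (subst sum.Sigma) simp_all
  finally show ?thesis .
qed

definition delta0 :: "(nat \<Rightarrow> int) \<Rightarrow> complex" where
  "delta0 \<nu> = of_bool (\<nu> = 0)"

text \<open>Well-founded recursion with an arbitrary value type. It produces the q-Whittaker array,
  the eigenseries for generic t and the coefficients of the Macdonald polynomials.\<close>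

lemma ex_height_rec:
  fixes F :: "((nat \<Rightarrow> int) \<Rightarrow> 'a) \<Rightarrow> (nat \<Rightarrow> int) \<Rightarrow> 'a"
  assumes "\<And>c c' \<kappa>. (\<And>\<beta>. height N \<beta> < height N \<kappa> \<Longrightarrow> c \<beta> = c' \<beta>) \<Longrightarrow> F c \<kappa> = F c' \<kappa>"
  shows "\<exists>c. \<forall>\<kappa>. c \<kappa> = F c \<kappa>"
proof -
  have "adm_wf (Wellfounded.measure (height N)) F"
    unfolding adm_wf_def by (intro allI impI assms) simp
  then have "wfrec (Wellfounded.measure (height N)) F = F (wfrec (Wellfounded.measure (height N)) F)"
    by (intro wfrec_fixpoint wf_measure)
  then have "\<forall>\<kappa>. wfrec (Wellfounded.measure (height N)) F \<kappa> = F (wfrec (Wellfounded.measure (height N)) F) \<kappa>"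
    by (simp only: fun_eq_iff[symmetric])
  then show ?thesis by blast
qed

section \<open>Expansions in the ratios\<close>

definition ratio_region :: "nat \<Rightarrow> real \<Rightarrow> (nat \<Rightarrow> complex) set" where
  "ratio_region N \<epsilon> = {x. (\<forall>i\<in>{1..N}. x i \<noteq> 0) \<and> (\<forall>i\<in>{1..<N}. norm (x (i + 1)) < \<epsilon> * norm (x i))}"

lemma hre_iff:
  "has_ratio_expansion N f a \<longleftrightarrow> (\<forall>\<beta>. \<beta> \<notin> Qplus N \<longrightarrow> a \<beta> = 0) \<and>
     (\<exists>\<epsilon>>0. \<forall>x\<in>ratio_region N \<epsilon>. ((\<lambda>\<beta>. a \<beta> * mono_at N x (- \<beta>)) has_sum f x) (Qplus N))"
  by (auto simp: has_ratio_expansion_def ratio_region_def fun_Compl_def)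

lemma ratio_region_nonzero: "x \<in> ratio_region N \<epsilon> \<Longrightarrow> i \<in> {1..N} \<Longrightarrow> x i \<noteq> 0"
  by (auto simp: ratio_region_def)

lemma ratio_region_mono: "\<epsilon> \<le> \<epsilon>' \<Longrightarrow> x \<in> ratio_region N \<epsilon> \<Longrightarrow> x \<in> ratio_region N \<epsilon>'"
  unfolding ratio_region_def by (auto intro: order_less_le_trans mult_right_mono)

lemma ratio_region_less:
  assumes x: "x \<in> ratio_region N 1" and ij: "i < j" "1 \<le> i" "j \<le> N"
  shows "norm (x j) < norm (x i)"
  using ij
proof (induction j)
  case (Suc j)
  have "norm (x (Suc j)) < norm (x j)"
    using x Suc.prems by (auto simp: ratio_region_def)
  then show ?case using Suc by (cases "i = j") auto
qed simp

lemma hre_outside: "has_ratio_expansion N f a \<Longrightarrow> \<beta> \<notin> Qplus N \<Longrightarrow> a \<beta> = 0"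
  by (simp add: hre_iff)

lemma hreE:
  assumes "has_ratio_expansion N f a"
  obtains \<epsilon> where "0 < \<epsilon>" "\<epsilon> \<le> 1"
    "\<And>x. x \<in> ratio_region N \<epsilon> \<Longrightarrow> ((\<lambda>\<beta>. a \<beta> * mono_at N x (- \<beta>)) has_sum f x) (Qplus N)"
proof -
  from assms obtain \<epsilon> where e: "\<epsilon> > 0"
    "\<forall>x\<in>ratio_region N \<epsilon>. ((\<lambda>\<beta>. a \<beta> * mono_at N x (- \<beta>)) has_sum f x) (Qplus N)"
    by (auto simp: hre_iff)
  have "ratio_region N (min \<epsilon> 1) \<subseteq> ratio_region N \<epsilon>"
    using ratio_region_mono[of "min \<epsilon> 1" \<epsilon>] by auto
  then show ?thesis using e by (intro that[of "min \<epsilon> 1"]) auto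
qed

lemma hreI:
  assumes "\<And>\<beta>. \<beta> \<notin> Qplus N \<Longrightarrow> a \<beta> = 0" "0 < \<epsilon>"
    "\<And>x. x \<in> ratio_region N \<epsilon> \<Longrightarrow> ((\<lambda>\<beta>. a \<beta> * mono_at N x (- \<beta>)) has_sum f x) (Qplus N)"
  shows "has_ratio_expansion N f a"
  using assms by (auto simp: hre_iff)

lemma hre_cong:
  assumes "has_ratio_expansion N f a" "0 < \<epsilon>" "\<And>x. x \<in> ratio_region N \<epsilon> \<Longrightarrow> f x = g x"
  shows "has_ratio_expansion N g a"
proof -
  from assms(1) obtain \<delta> where \<delta>: "0 < \<delta>"
    "\<And>x. x \<in> ratio_region N \<delta> \<Longrightarrow> ((\<lambda>\<beta>. a \<beta> * mono_at N x (- \<beta>)) has_sum f x) (Qplus N)"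
    by (rule hreE) blast
  show ?thesis
  proof (rule hreI[where \<epsilon> = "min \<delta> \<epsilon>"])
    show "((\<lambda>\<beta>. a \<beta> * mono_at N x (- \<beta>)) has_sum g x) (Qplus N)" if "x \<in> ratio_region N (min \<delta> \<epsilon>)" for x
      using \<delta>(2)[of x] assms(3)[of x] ratio_region_mono[OF _ that, of \<delta>] ratio_region_mono[OF _ that, of \<epsilon>] by simp
  qed (use \<delta> assms hre_outside in auto)
qed

section \<open>Laurent monomials and the ratios of consecutive variables\<close>

lemma mono_at_add:
  "(\<And>i. i \<in> {1..N} \<Longrightarrow> x i \<noteq> 0) \<Longrightarrow> mono_at N x (a + b) = mono_at N x a * mono_at N x b"
  unfolding mono_at_def prod.distrib[symmetric] by (intro prod.cong) (auto simp: power_int_add)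

lemma mono_at_zero [simp]: "mono_at N x 0 = 1"
  by (simp add: mono_at_def)

lemma mono_at_nonzero: "(\<And>i. i \<in> {1..N} \<Longrightarrow> x i \<noteq> 0) \<Longrightarrow> mono_at N x a \<noteq> 0"
  by (auto simp: mono_at_def power_int_eq_0_iff)

lemma mono_at_minus: "mono_at N x (- a) = inverse (mono_at N x a)"
  by (simp add: mono_at_def power_int_minus flip: prod_inversef)

lemma mono_at_rt:
  assumes "p \<in> {1..N}" "r \<in> {1..N}" "\<And>i. i \<in> {1..N} \<Longrightarrow> x i \<noteq> 0"
  shows "mono_at N x (rt p r) = x p / x r"
proof -
  have "mono_at N x (rt p r) = (\<Prod>i\<in>{1..N}. (if i = p then x p else 1) * (if i = r then inverse (x r) else 1))"
    unfolding mono_at_def by (intro prod.cong refl) (use assms in \<open>auto simp: rt_def power_int_minus\<close>)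
  then show ?thesis using assms by (simp add: prod.distrib field_simps)
qed

lemma mono_at_upd:
  assumes "i \<in> {1..N}"
  shows "mono_at N (x(i := q * x i)) a = q powi a i * mono_at N x a"
proof -
  have "mono_at N (x(i := q * x i)) a = (\<Prod>j\<in>{1..N}. (if j = i then q powi a i else 1) * x j powi a j)"
    unfolding mono_at_def by (intro prod.cong refl) (auto simp: power_int_mult_distrib)
  then show ?thesis using assms by (simp add: prod.distrib mono_at_def)
qed

text \<open>Summation by parts in the exponent: writing each entry as a difference of consecutive
  partial sums turns the monomial into powers of consecutive ratios. The leftover power of the last
  variable carries the total degree and disappears on \<open>Qplus\<close>.\<close>

lemma mono_at_psum_aux:
  assumes "\<And>i. i \<in> {1..Suc n} \<Longrightarrow> x i \<noteq> 0"
  shows "mono_at (Suc n) x (- \<beta>) =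
    (\<Prod>a\<in>{1..n}. (x (Suc a) / x a) powi psum \<beta> a) * x (Suc n) powi (- psum \<beta> (Suc n))"
  using assms
proof (induction n)
  case 0
  then show ?case by (simp add: mono_at_def psum_Suc)
next
  case (Suc n)
  have nz: "x (Suc n) \<noteq> 0" "x (Suc (Suc n)) \<noteq> 0" using Suc.prems by auto
  have "mono_at (Suc (Suc n)) x (- \<beta>) = mono_at (Suc n) x (- \<beta>) * x (Suc (Suc n)) powi (- \<beta> (Suc (Suc n)))"
    by (simp add: mono_at_def)
  also have "mono_at (Suc n) x (- \<beta>) = (\<Prod>a\<in>{1..n}. (x (Suc a) / x a) powi psum \<beta> a) * x (Suc n) powi (- psum \<beta> (Suc n))"
    by (rule Suc.IH) (use Suc.prems in auto)
  finally show ?case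
    using nz by (simp add: psum_Suc[of _ "Suc n"] power_int_minus power_int_add power_int_diff
        power_int_divide_distrib divide_simps)
qed

lemma mono_at_psum:
  assumes "\<beta> \<in> Qplus N" "\<And>i. i \<in> {1..N} \<Longrightarrow> x i \<noteq> 0"
  shows "mono_at N x (- \<beta>) = (\<Prod>a\<in>{1..<N}. (x (Suc a) / x a) ^ nat (psum \<beta> a))"
proof (cases N)
  case 0
  then show ?thesis by (simp add: mono_at_def)
next
  case (Suc n)
  have "mono_at N x (- \<beta>) = (\<Prod>a\<in>{1..n}. (x (Suc a) / x a) powi psum \<beta> a)"
    using mono_at_psum_aux[of n x \<beta>] Qplus_psum_N[OF assms(1)] assms(2) Suc by simp
  also have "\<dots> = (\<Prod>a\<in>{1..<N}. (x (Suc a) / x a) ^ nat (psum \<beta> a))"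
    using Suc Qplus_psum[OF assms(1)] by (intro prod.cong) (auto simp: power_int_def)
  finally show ?thesis .
qed

section \<open>Uniqueness of ratio expansions\<close>

definition nth_prime :: "nat \<Rightarrow> nat" where
  "nth_prime = enumerate {p. prime p}"

lemma prime_nth_prime: "prime (nth_prime a)"
  using enumerate_in_set[OF primes_infinite, of a] by (simp add: nth_prime_def)

lemma nth_prime_nonzero [simp]: "nth_prime a \<noteq> 0"
  using prime_gt_0_nat[OF prime_nth_prime[of a]] by simp

lemma nth_prime_inj: "nth_prime a = nth_prime b \<longleftrightarrow> a = b"
  using inj_enumerate[OF primes_infinite] by (auto simp: nth_prime_def inj_def)

text \<open>The points \<open>x\<^sub>i = (p\<^sub>1 \<cdots> p\<^sub>i\<^sub>-\<^sub>1)\<^bsup>-\<tau>\<^esup>\<close> separate all monomials, by unique factorization.\<close>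

definition prime_code :: "nat \<Rightarrow> (nat \<Rightarrow> int) \<Rightarrow> nat" where
  "prime_code N \<beta> = (\<Prod>a\<in>{1..<N}. nth_prime a ^ nat (psum \<beta> a))"

lemma prime_code_pos: "0 < prime_code N \<beta>"
  unfolding prime_code_def by (intro prod_pos) (simp add: prime_gt_0_nat[OF prime_nth_prime])

lemma prime_code_inj:
  assumes "\<beta> \<in> Qplus N" "\<beta>' \<in> Qplus N" "prime_code N \<beta> = prime_code N \<beta>'"
  shows "\<beta> = \<beta>'"
proof -
  have *: "multiplicity (nth_prime k) (prime_code N \<gamma>) = (if k \<in> {1..<N} then nat (psum \<gamma> k) else 0)" for k \<gamma>
  proof -
    have "multiplicity (nth_prime k) (prime_code N \<gamma>) = (\<Sum>a\<in>{1..<N}. multiplicity (nth_prime k) (nth_prime a ^ nat (psum \<gamma> a)))"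
      unfolding prime_code_def
      by (rule prime_elem_multiplicity_prod_distrib) (use prime_nth_prime in \<open>auto simp: nth_prime_nonzero\<close>)
    also have "\<dots> = (\<Sum>a\<in>{1..<N}. if a = k then nat (psum \<gamma> a) else 0)"
      by (intro sum.cong refl) (auto simp: prime_nth_prime multiplicity_distinct_prime_power nth_prime_inj)
    finally show ?thesis by simp
  qed
  show ?thesis
  proof (rule psum_inj[of _ N])
    fix k
    show "psum \<beta> k = psum \<beta>' k"
    proof (cases "k \<in> {1..<N}")
      case True
      have "nat (psum \<beta> k) = nat (psum \<beta>' k)"
        using *[of k \<beta>] *[of k \<beta>'] True assms(3) by simp
      then show ?thesis using Qplus_psum[OF assms(1), of k] Qplus_psum[OF assms(2), of k] by simp
    next
      case False
      then show ?thesis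
        using assms psum_stable[of \<beta> N k] psum_stable[of \<beta>' N k]
        by (cases "k = 0") (auto simp: Qplus_iff)
    qed
  qed (use assms in \<open>auto simp: Qplus_ivec\<close>)
qed

definition prime_point :: "nat \<Rightarrow> nat \<Rightarrow> complex" where
  "prime_point \<tau> i = (1 / of_nat (\<Prod>a\<in>{1..<i}. nth_prime a)) ^ \<tau>"

lemma prime_point_ratio: "1 \<le> a \<Longrightarrow> prime_point \<tau> (Suc a) = (1 / of_nat (nth_prime a)) ^ \<tau> * prime_point \<tau> a"
  by (simp add: prime_point_def prod.atLeastLessThan_Suc power_mult_distrib[symmetric] mult.commute)

lemma prime_point_nonzero: "prime_point \<tau> i \<noteq> 0"
  by (simp add: prime_point_def)

lemma mono_at_prime_point:
  assumes "\<beta> \<in> Qplus N"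
  shows "mono_at N (prime_point \<tau>) (- \<beta>) = (1 / of_nat (prime_code N \<beta>)) ^ \<tau>"
proof -
  have "mono_at N (prime_point \<tau>) (- \<beta>) = (\<Prod>a\<in>{1..<N}. ((1 / of_nat (nth_prime a)) ^ \<tau>) ^ nat (psum \<beta> a))"
    unfolding mono_at_psum[OF assms prime_point_nonzero]
    by (intro prod.cong refl) (simp add: prime_point_ratio prime_point_nonzero)
  also have "\<dots> = (\<Prod>a\<in>{1..<N}. ((1 / of_nat (nth_prime a)) ^ nat (psum \<beta> a)) ^ \<tau>)"
    by (simp add: power_mult[symmetric] mult.commute)
  also have "\<dots> = (1 / of_nat (prime_code N \<beta>)) ^ \<tau>"
    by (simp add: prime_code_def prod_power_distrib[symmetric] power_one_over prod_dividef)
  finally show ?thesis .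
qed

text \<open>Each consecutive ratio is p^(-\<tau>) for a prime p, hence at most 2^(-\<tau>); one
  threshold for \<tau> serves all positions.\<close>

lemma prime_point_region:
  assumes "0 < \<epsilon>"
  obtains \<tau>0 where "\<And>\<tau>. \<tau>0 \<le> \<tau> \<Longrightarrow> prime_point \<tau> \<in> ratio_region N \<epsilon>"
proof -
  obtain \<tau>0 where \<tau>0: "(1/2::real) ^ \<tau>0 < \<epsilon>"
    using real_arch_pow_inv[OF assms, of "1/2"] by auto
  have "prime_point \<tau> \<in> ratio_region N \<epsilon>" if "\<tau>0 \<le> \<tau>" for \<tau>
  proof -
    have "norm (prime_point \<tau> (i + 1)) < \<epsilon> * norm (prime_point \<tau> i)" if i: "i \<in> {1..<N}" for i
    proof -
      have "(1 / real (nth_prime i)) ^ \<tau> \<le> (1 / 2) ^ \<tau>"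
        using prime_ge_2_nat[OF prime_nth_prime[of i]] by (intro power_mono) (auto simp: field_simps)
      also have "\<dots> \<le> (1 / 2) ^ \<tau>0"
        using \<open>\<tau>0 \<le> \<tau>\<close> by (intro power_decreasing) auto
      finally have "(1 / real (nth_prime i)) ^ \<tau> < \<epsilon>" using \<tau>0 by simp
      then show ?thesis
        using i prime_point_nonzero[of \<tau> i] by (simp add: prime_point_ratio norm_mult norm_power norm_divide)
    qed
    then show ?thesis by (auto simp: ratio_region_def prime_point_nonzero)
  qed
  then show ?thesis using that by blast
qed

text \<open>At the prime points the expansion becomes a Dirichlet series with terms a_\<beta>
  code(\<beta>)^(-\<tau>) that vanishes for all large \<tau>. A term of smallest code would dominate
  as \<tau> grows, so there is none.\<close>

lemma hre_zero_imp:
  assumes "has_ratio_expansion N (\<lambda>x. 0) a"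
  shows "a \<beta> = 0"
proof (rule ccontr)
  assume "a \<beta> \<noteq> 0"
  define S where "S = {\<beta>. a \<beta> \<noteq> 0}"
  have SQ: "S \<subseteq> Qplus N" using hre_outside[OF assms] by (auto simp: S_def)
  obtain \<beta>0 where \<beta>0: "\<beta>0 \<in> S" and min: "\<And>\<beta>. \<beta> \<in> S \<Longrightarrow> prime_code N \<beta>0 \<le> prime_code N \<beta>"
    using ex_has_least_nat[of "\<lambda>\<beta>. \<beta> \<in> S" \<beta> "prime_code N"] \<open>a \<beta> \<noteq> 0\<close> by (auto simp: S_def)
  define m where "m = prime_code N \<beta>0"
  have less: "Suc m \<le> prime_code N \<beta>" if "\<beta> \<in> S - {\<beta>0}" for \<beta>
    using min[of \<beta>] that prime_code_inj[of \<beta> N \<beta>0] \<beta>0 SQ by (force simp: m_def)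
  obtain \<epsilon> where \<epsilon>: "0 < \<epsilon>"
    "\<And>x. x \<in> ratio_region N \<epsilon> \<Longrightarrow> ((\<lambda>\<beta>. a \<beta> * mono_at N x (- \<beta>)) has_sum 0) (Qplus N)"
    using assms by (rule hreE) blast
  obtain \<tau>0 where \<tau>0: "\<And>\<tau>. \<tau>0 \<le> \<tau> \<Longrightarrow> prime_point \<tau> \<in> ratio_region N \<epsilon>"
    using prime_point_region[OF \<epsilon>(1)] by blast
  define f where "f \<tau> \<beta> = a \<beta> * (1 / of_nat (prime_code N \<beta>)) ^ \<tau>" for \<tau> \<beta>
  have "(f \<tau> has_sum 0) S" if "\<tau>0 \<le> \<tau>" for \<tau>
    using \<epsilon>(2)[OF \<tau>0[OF that]]
    by (rule has_sum_cong_neutral[THEN iffD1, rotated 3])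
       (use SQ in \<open>auto simp: S_def f_def mono_at_prime_point\<close>)
  then have hs: "(f \<tau> has_sum - f \<tau> \<beta>0) (S - {\<beta>0})" if "\<tau>0 \<le> \<tau>" for \<tau>
    using has_sum_Diff[of "f \<tau>" S 0 "{\<beta>0}" "f \<tau> \<beta>0"] has_sum_finite[of "{\<beta>0}" "f \<tau>"] \<beta>0 that by simp
  \<comment> \<open>The total mass of the other terms at the exponent \<open>\<tau>0\<close>. From
    there to \<open>\<tau>0 + k\<close> each of them shrinks at least by (1 / Suc m)^k, the leading
    term only by (1 / m)^k.\<close>
  define C where "C = (\<Sum>\<^sub>\<infinity>\<beta>\<in>S - {\<beta>0}. norm (f \<tau>0 \<beta>))"
  have sum0: "(\<lambda>\<beta>. norm (f \<tau>0 \<beta>)) summable_on (S - {\<beta>0})"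
    using hs[of \<tau>0] summable_on_iff_abs_summable_on_complex has_sum_imp_summable by blast
  have bound: "norm (a \<beta>0) \<le> C * real m ^ \<tau>0 * (m / Suc m) ^ k" for k
  proof -
    have le: "norm (f (\<tau>0 + k) \<beta>) \<le> (1 / Suc m) ^ k * norm (f \<tau>0 \<beta>)" if "\<beta> \<in> S - {\<beta>0}" for \<beta>
    proof -
      have "(1 / real (prime_code N \<beta>)) ^ k \<le> (1 / Suc m) ^ k"
        using less[OF that] by (intro power_mono) (auto simp: field_simps)
      then show ?thesis
        using mult_right_mono[of "(1 / real (prime_code N \<beta>)) ^ k" "(1 / real (Suc m)) ^ k" "norm (f \<tau>0 \<beta>)"]
        by (simp add: f_def norm_mult norm_power norm_divide power_add mult_ac)
    qed
    have "f (\<tau>0 + k) summable_on S - {\<beta>0}"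
      by (rule has_sum_imp_summable[OF hs]) simp
    then have sumk: "(\<lambda>\<beta>. norm (f (\<tau>0 + k) \<beta>)) summable_on S - {\<beta>0}"
      unfolding summable_on_iff_abs_summable_on_complex .
    have "norm (f (\<tau>0 + k) \<beta>0) = norm (\<Sum>\<^sub>\<infinity>\<beta>\<in>S - {\<beta>0}. f (\<tau>0 + k) \<beta>)"
      using infsumI[OF hs[of "\<tau>0 + k"]] by simp
    also have "\<dots> \<le> (\<Sum>\<^sub>\<infinity>\<beta>\<in>S - {\<beta>0}. norm (f (\<tau>0 + k) \<beta>))"
      by (rule norm_infsum_bound[OF sumk])
    also have "\<dots> \<le> (\<Sum>\<^sub>\<infinity>\<beta>\<in>S - {\<beta>0}. (1 / Suc m) ^ k * norm (f \<tau>0 \<beta>))"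
    proof (rule infsum_mono)
      show "(\<lambda>\<beta>. norm (f (\<tau>0 + k) \<beta>)) summable_on S - {\<beta>0}" by (rule sumk)
      show "(\<lambda>\<beta>. (1 / real (Suc m)) ^ k * norm (f \<tau>0 \<beta>)) summable_on S - {\<beta>0}"
        by (rule summable_on_cmult_right[OF sum0])
    qed (use le in auto)
    also have "\<dots> = (1 / Suc m) ^ k * C"
      unfolding C_def by (rule infsum_cmult_right) (use sum0 in auto)
    finally have *: "norm (a \<beta>0) * (1 / m) ^ (\<tau>0 + k) \<le> (1 / Suc m) ^ k * C"
      by (simp add: f_def norm_mult norm_power norm_divide m_def)
    have m0: "0 < real m" using prime_code_pos[of N \<beta>0] by (simp add: m_def)
    have "norm (a \<beta>0) = norm (a \<beta>0) * (1 / m) ^ (\<tau>0 + k) * m ^ (\<tau>0 + k)"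
      using m0 by (simp add: power_one_over)
    also have "\<dots> \<le> (1 / Suc m) ^ k * C * m ^ (\<tau>0 + k)"
      using * m0 by (intro mult_right_mono) auto
    also have "\<dots> = C * real m ^ \<tau>0 * (m / Suc m) ^ k"
      by (simp add: power_add power_divide)
    finally show ?thesis .
  qed
  have "(\<lambda>k. C * real m ^ \<tau>0 * (m / Suc m) ^ k) \<longlonglongrightarrow> C * real m ^ \<tau>0 * 0"
    by (intro tendsto_intros LIMSEQ_realpow_zero) auto
  then have "norm (a \<beta>0) \<le> 0"
    using bound by (intro LIMSEQ_le_const[where X = "\<lambda>k. C * real m ^ \<tau>0 * (m / Suc m) ^ k"]) auto
  with \<beta>0 show False by (simp add: S_def)
qed

section \<open>Algebraic operations on ratio expansions\<close>

lemma hre_add: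
  assumes "has_ratio_expansion N f a" "has_ratio_expansion N g b"
  shows "has_ratio_expansion N (\<lambda>x. f x + g x) (\<lambda>\<beta>. a \<beta> + b \<beta>)"
proof -
  from assms(1) obtain \<delta> where \<delta>: "0 < \<delta>"
    "\<And>x. x \<in> ratio_region N \<delta> \<Longrightarrow> ((\<lambda>\<beta>. a \<beta> * mono_at N x (- \<beta>)) has_sum f x) (Qplus N)"
    by (rule hreE) blast
  from assms(2) obtain \<epsilon> where \<epsilon>: "0 < \<epsilon>"
    "\<And>x. x \<in> ratio_region N \<epsilon> \<Longrightarrow> ((\<lambda>\<beta>. b \<beta> * mono_at N x (- \<beta>)) has_sum g x) (Qplus N)"
    by (rule hreE) blast
  show ?thesis
  proof (rule hreI[where \<epsilon> = "min \<delta> \<epsilon>"])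
    show "((\<lambda>\<beta>. (a \<beta> + b \<beta>) * mono_at N x (- \<beta>)) has_sum f x + g x) (Qplus N)"
      if "x \<in> ratio_region N (min \<delta> \<epsilon>)" for x
      using has_sum_add[OF \<delta>(2)[of x] \<epsilon>(2)[of x]]
        ratio_region_mono[OF _ that, of \<delta>] ratio_region_mono[OF _ that, of \<epsilon>]
      by (simp add: ring_distribs)
  qed (use \<delta> \<epsilon> hre_outside[OF assms(1)] hre_outside[OF assms(2)] in auto)
qed

lemma hre_cmult:
  assumes "has_ratio_expansion N f a"
  shows "has_ratio_expansion N (\<lambda>x. c * f x) (\<lambda>\<beta>. c * a \<beta>)"
proof -
  from assms obtain \<delta> where \<delta>: "0 < \<delta>"
    "\<And>x. x \<in> ratio_region N \<delta> \<Longrightarrow> ((\<lambda>\<beta>. a \<beta> * mono_at N x (- \<beta>)) has_sum f x) (Qplus N)"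
    by (rule hreE) blast
  show ?thesis
    by (rule hreI[OF _ \<delta>(1)])
       (use hre_outside[OF assms] has_sum_cmult_right[OF \<delta>(2), of _ c] in \<open>auto simp: mult.assoc\<close>)
qed

lemma hre_unique:
  assumes "has_ratio_expansion N f a" "has_ratio_expansion N f b"
  shows "a = b"
proof
  fix \<beta>
  have "has_ratio_expansion N (\<lambda>x. 0) (\<lambda>\<beta>. a \<beta> + (- 1) * b \<beta>)"
    using hre_add[OF assms(1) hre_cmult[OF assms(2), of "- 1"]] by simp
  from hre_zero_imp[OF this, of \<beta>] show "a \<beta> = b \<beta>" by simp
qed

lemma ratio_expansion_eq: "has_ratio_expansion N f a \<Longrightarrow> ratio_expansion N f = a"
  unfolding ratio_expansion_def by (rule the_equality) (auto intro: hre_unique)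

lemma hre_zero: "has_ratio_expansion N (\<lambda>x. 0) (\<lambda>_. 0)"
  by (rule hreI[of _ _ 1]) auto

lemma hre_sum:
  assumes "finite A" "\<And>i. i \<in> A \<Longrightarrow> has_ratio_expansion N (f i) (a i)"
  shows "has_ratio_expansion N (\<lambda>x. \<Sum>i\<in>A. f i x) (\<lambda>\<beta>. \<Sum>i\<in>A. a i \<beta>)"
  using assms by (induction A) (auto intro!: hre_add hre_zero)

lemma hre_finite:
  assumes "finite S" "S \<subseteq> Qplus N" "\<And>\<beta>. \<beta> \<notin> S \<Longrightarrow> a \<beta> = 0"
  shows "has_ratio_expansion N (\<lambda>x. \<Sum>\<beta>\<in>S. a \<beta> * mono_at N x (- \<beta>)) a"
proof (rule hreI[of _ _ 1])
  show "((\<lambda>\<beta>. a \<beta> * mono_at N x (- \<beta>)) has_sum (\<Sum>\<beta>\<in>S. a \<beta> * mono_at N x (- \<beta>))) (Qplus N)" for x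
    using has_sum_finite[OF assms(1)]
    by (rule has_sum_cong_neutral[THEN iffD1, rotated 3]) (use assms in auto)
qed (use assms in auto)

lemma hre_one: "has_ratio_expansion N (\<lambda>x. 1) delta0"
  using hre_finite[of "{0}" N delta0] by (simp add: delta0_def)

text \<open>Summable complex families are absolutely summable, so the product is a sum over pairs.
  It is regrouped by the total exponent, to which only a finite interval of pairs
  contributes.\<close>

lemma hre_mult:
  assumes "has_ratio_expansion N f a" "has_ratio_expansion N g b"
  shows "has_ratio_expansion N (\<lambda>x. f x * g x) (conv N a b)"
proof -
  from assms(1) obtain \<delta> where \<delta>: "0 < \<delta>"
    "\<And>x. x \<in> ratio_region N \<delta> \<Longrightarrow> ((\<lambda>\<beta>. a \<beta> * mono_at N x (- \<beta>)) has_sum f x) (Qplus N)"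
    by (rule hreE) blast
  from assms(2) obtain \<epsilon> where \<epsilon>: "0 < \<epsilon>"
    "\<And>x. x \<in> ratio_region N \<epsilon> \<Longrightarrow> ((\<lambda>\<beta>. b \<beta> * mono_at N x (- \<beta>)) has_sum g x) (Qplus N)"
    by (rule hreE) blast
  show ?thesis
  proof (rule hreI[where \<epsilon> = "min \<delta> \<epsilon>"])
    fix x assume x: "x \<in> ratio_region N (min \<delta> \<epsilon>)"
    define A where "A \<beta> = a \<beta> * mono_at N x (- \<beta>)" for \<beta>
    define B where "B \<beta> = b \<beta> * mono_at N x (- \<beta>)" for \<beta>
    have nz: "\<And>i. i \<in> {1..N} \<Longrightarrow> x i \<noteq> 0" using ratio_region_nonzero[OF x] .
    have A: "(A has_sum f x) (Qplus N)" and B: "(B has_sum g x) (Qplus N)"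
      using \<delta>(2)[of x] \<epsilon>(2)[of x] ratio_region_mono[OF _ x, of \<delta>] ratio_region_mono[OF _ x, of \<epsilon>]
      by (simp_all add: A_def[abs_def] B_def[abs_def])
    have absA: "(\<lambda>\<beta>. norm (A \<beta>)) summable_on Qplus N" and absB: "(\<lambda>\<beta>. norm (B \<beta>)) summable_on Qplus N"
      using A B summable_on_iff_abs_summable_on_complex has_sum_imp_summable by blast+
    define P where "P p = A (fst p) * B (snd p)" for p
    have "(\<lambda>p. norm (P p)) summable_on Qplus N \<times> Qplus N"
    proof (rule summable_on_SigmaI)
      show "((\<lambda>\<beta>. norm (P (\<nu>, \<beta>))) has_sum norm (A \<nu>) * infsum (\<lambda>\<beta>. norm (B \<beta>)) (Qplus N)) (Qplus N)" for \<nu>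
        using has_sum_cmult_right[OF has_sum_infsum[OF absB]] by (simp add: norm_mult P_def)
    qed (auto intro: summable_on_cmult_left absA)
    then have sP: "P summable_on Qplus N \<times> Qplus N"
      using summable_on_iff_abs_summable_on_complex by blast
    have "(P has_sum f x * g x) (Qplus N \<times> Qplus N)"
    proof (rule has_sum_SigmaI[OF _ _ sP])
      show "((\<lambda>\<beta>. P (\<nu>, \<beta>)) has_sum A \<nu> * g x) (Qplus N)" for \<nu>
        using has_sum_cmult_right[OF B] by (simp add: P_def)
      show "((\<lambda>\<nu>. A \<nu> * g x) has_sum f x * g x) (Qplus N)"
        by (rule has_sum_cmult_left[OF A])
    qed
    then have prod: "((\<lambda>(\<nu>, \<beta>). A \<nu> * B \<beta>) has_sum f x * g x) (Qplus N \<times> Qplus N)"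
      by (simp add: P_def[abs_def] case_prod_unfold)
    have "((\<lambda>(\<kappa>, \<beta>). A (\<kappa> - \<beta>) * B \<beta>) has_sum f x * g x) (Sigma (Qplus N) (ival N))"
      using prod
    proof (rule has_sum_reindex_bij_witness[of _ "\<lambda>(\<kappa>, \<beta>). (\<kappa> - \<beta>, \<beta>)" "\<lambda>(\<nu>, \<beta>). (\<nu> + \<beta>, \<beta>)", THEN iffD1, rotated -1])
      show "\<And>p. p \<in> Qplus N \<times> Qplus N \<Longrightarrow> (case p of (\<nu>, \<beta>) \<Rightarrow> (\<nu> + \<beta>, \<beta>)) \<in> Sigma (Qplus N) (ival N)"
        by (auto simp: ival_def intro: Qplus_add)
    qed (auto simp: ival_def)
    then have "((\<lambda>\<kappa>. \<Sum>\<beta>\<in>ival N \<kappa>. A (\<kappa> - \<beta>) * B \<beta>) has_sum f x * g x) (Qplus N)"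
      by (rule has_sum_SigmaD) auto
    moreover have "(\<Sum>\<beta>\<in>ival N \<kappa>. A (\<kappa> - \<beta>) * B \<beta>) = conv N a b \<kappa> * mono_at N x (- \<kappa>)" for \<kappa>
      unfolding conv_def sum_distrib_right
    proof (rule sum.cong[OF refl])
      fix \<beta>
      have "mono_at N x (- \<kappa>) = mono_at N x (- (\<kappa> - \<beta>)) * mono_at N x (- \<beta>)"
        by (subst mono_at_add[symmetric]) (use nz in \<open>auto simp: algebra_simps\<close>)
      then show "A (\<kappa> - \<beta>) * B \<beta> = a (\<kappa> - \<beta>) * b \<beta> * mono_at N x (- \<kappa>)"
        by (simp add: A_def B_def)
    qed
    ultimately show "((\<lambda>\<beta>. conv N a b \<beta> * mono_at N x (- \<beta>)) has_sum f x * g x) (Qplus N)"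
      by simp
  qed (use \<delta> \<epsilon> conv_outside in auto)
qed

lemma hre_monomial:
  assumes "has_ratio_expansion N f a" "\<gamma> \<in> Qplus N"
  shows "has_ratio_expansion N (\<lambda>x. mono_at N x (- \<gamma>) * f x) (\<lambda>\<beta>. a (\<beta> - \<gamma>))"
proof -
  have sub: "\<beta> - \<gamma> \<in> Qplus N \<Longrightarrow> \<beta> \<in> Qplus N" for \<beta>
    using Qplus_add[of "\<beta> - \<gamma>" N \<gamma>] assms(2) by simp
  from assms(1) obtain \<delta> where \<delta>: "0 < \<delta>"
    "\<And>x. x \<in> ratio_region N \<delta> \<Longrightarrow> ((\<lambda>\<beta>. a \<beta> * mono_at N x (- \<beta>)) has_sum f x) (Qplus N)"
    by (rule hreE) blast
  show ?thesis
  proof (rule hreI[OF _ \<delta>(1)])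
    fix x assume x: "x \<in> ratio_region N \<delta>"
    have nz: "\<And>i. i \<in> {1..N} \<Longrightarrow> x i \<noteq> 0" using ratio_region_nonzero[OF x] .
    have "((\<lambda>\<beta>. mono_at N x (- \<gamma>) * (a \<beta> * mono_at N x (- \<beta>))) has_sum mono_at N x (- \<gamma>) * f x) (Qplus N)"
      by (rule has_sum_cmult_right[OF \<delta>(2)[OF x]])
    also have "(\<lambda>\<beta>. mono_at N x (- \<gamma>) * (a \<beta> * mono_at N x (- \<beta>))) =
        (\<lambda>\<beta>. a (\<beta> - \<gamma>) * mono_at N x (- \<beta>)) \<circ> (\<lambda>\<beta>. \<beta> + \<gamma>)"
    proof
      fix \<beta>
      have "mono_at N x (- (\<beta> + \<gamma>)) = mono_at N x (- \<beta>) * mono_at N x (- \<gamma>)"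
        by (subst mono_at_add[symmetric]) (use nz in auto)
      then show "mono_at N x (- \<gamma>) * (a \<beta> * mono_at N x (- \<beta>)) =
          ((\<lambda>\<beta>. a (\<beta> - \<gamma>) * mono_at N x (- \<beta>)) \<circ> (\<lambda>\<beta>. \<beta> + \<gamma>)) \<beta>"
        by (simp only: comp_def add_diff_cancel_right' mult_ac)
    qed
    finally have "((\<lambda>\<beta>. a (\<beta> - \<gamma>) * mono_at N x (- \<beta>)) has_sum mono_at N x (- \<gamma>) * f x) ((\<lambda>\<beta>. \<beta> + \<gamma>) ` Qplus N)"
      by (rule has_sum_reindex[THEN iffD2, rotated]) (auto intro: inj_onI)
    then show "((\<lambda>\<beta>. a (\<beta> - \<gamma>) * mono_at N x (- \<beta>)) has_sum mono_at N x (- \<gamma>) * f x) (Qplus N)"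
    proof (rule has_sum_cong_neutral[THEN iffD1, rotated 3])
      show "a (\<beta> - \<gamma>) * mono_at N x (- \<beta>) = 0" if "\<beta> \<in> Qplus N - (\<lambda>\<beta>. \<beta> + \<gamma>) ` Qplus N" for \<beta>
        using that hre_outside[OF assms(1), of "\<beta> - \<gamma>"] by (force simp: image_iff)
    qed (auto intro: Qplus_add assms)
  qed (use hre_outside[OF assms(1)] sub in blast)
qed

text \<open>Scaling one variable by q changes the two neighbouring ratios by q and 1 / q; shrinking
  the region by the factor |q| absorbs the unfavourable one.\<close>

lemma hre_shift:
  assumes "has_ratio_expansion N f a" "q \<noteq> 0" "norm q < 1" "i \<in> {1..N}"
  shows "has_ratio_expansion N (\<lambda>x. f (x(i := q * x i))) (\<lambda>\<beta>. q powi (- \<beta> i) * a \<beta>)"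
proof -
  from assms(1) obtain \<delta> where \<delta>: "0 < \<delta>"
    "\<And>x. x \<in> ratio_region N \<delta> \<Longrightarrow> ((\<lambda>\<beta>. a \<beta> * mono_at N x (- \<beta>)) has_sum f x) (Qplus N)"
    by (rule hreE) blast
  show ?thesis
  proof (rule hreI[where \<epsilon> = "\<delta> * norm q"])
    fix x assume x: "x \<in> ratio_region N (\<delta> * norm q)"
    have "x(i := q * x i) \<in> ratio_region N \<delta>"
    proof -
      have "norm ((x(i := q * x i)) (j + 1)) < \<delta> * norm ((x(i := q * x i)) j)" if j: "j \<in> {1..<N}" for j
      proof -
        have lt: "norm (x (j + 1)) < \<delta> * norm q * norm (x j)"
          using x j by (auto simp: ratio_region_def)
        have "\<delta> * norm q * norm (x j) \<le> \<delta> * 1 * norm (x j)"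
          using \<delta>(1) assms(3) by (intro mult_right_mono mult_left_mono) auto
        moreover have "norm q * norm (x (j + 1)) \<le> 1 * norm (x (j + 1))"
          using assms(3) by (intro mult_right_mono) auto
        ultimately show ?thesis using lt by (auto simp: norm_mult)
      qed
      then show ?thesis using ratio_region_nonzero[OF x] assms(2) by (auto simp: ratio_region_def)
    qed
    from \<delta>(2)[OF this]
    show "((\<lambda>\<beta>. q powi (- \<beta> i) * a \<beta> * mono_at N x (- \<beta>)) has_sum f (x(i := q * x i))) (Qplus N)"
      using mono_at_upd[OF assms(4), of x q] by (simp add: mult_ac)
  qed (use \<delta>(1) assms(2) hre_outside[OF assms(1)] in auto)
qed

section \<open>The coefficients of the Macdonald operator\<close>

text \<open>The exponents free of x_1, ..., x_(k-1). Statements about the last N - k + 1 variables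
  are expressed through this set, without renumbering.\<close>

definition Qtail :: "nat \<Rightarrow> nat \<Rightarrow> (nat \<Rightarrow> int) set" where
  "Qtail N k = {\<beta>. \<beta> \<in> Qplus N \<and> (\<forall>i<k. \<beta> i = 0)}"

lemma Qtail_Qplus: "\<beta> \<in> Qtail N k \<Longrightarrow> \<beta> \<in> Qplus N"
  and Qtail_below: "\<beta> \<in> Qtail N k \<Longrightarrow> i < k \<Longrightarrow> \<beta> i = 0"
  and Qtail_zero [simp]: "0 \<in> Qtail N k"
  by (auto simp: Qtail_def)

lemma Qtail_add: "a \<in> Qtail N k \<Longrightarrow> b \<in> Qtail N k \<Longrightarrow> a + b \<in> Qtail N k"
  by (auto simp: Qtail_def intro: Qplus_add)

lemma Qtail_anti: "k \<le> k' \<Longrightarrow> Qtail N k' \<subseteq> Qtail N k"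
  by (auto simp: Qtail_def)

lemma Qtail_Suc: "\<beta> \<in> Qtail N (Suc k) \<longleftrightarrow> \<beta> \<in> Qtail N k \<and> \<beta> k = 0"
  by (auto simp: Qtail_def less_Suc_eq)

lemma Qtail_1 [simp]: "Qtail N (Suc 0) = Qplus N"
  by (auto simp: Qtail_def Qplus_iff ivec_def)

lemma Qtail_psum: "\<beta> \<in> Qtail N k \<Longrightarrow> i < k \<Longrightarrow> psum \<beta> i = 0"
  unfolding psum_def by (rule sum.neutral) (auto simp: Qtail_def)

lemma Qtail_nonneg:
  assumes "\<beta> \<in> Qtail N k" "1 \<le> k"
  shows "0 \<le> \<beta> k"
proof -
  obtain j where "k = Suc j" using assms(2) by (cases k) auto
  then show ?thesis
    using Qplus_psum[OF Qtail_Qplus[OF assms(1)], of k] Qtail_psum[OF assms(1), of j] by (simp add: psum_Suc)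
qed

lemma Qtail_rt: "1 \<le> k \<Longrightarrow> k \<le> p \<Longrightarrow> p \<le> r \<Longrightarrow> r \<le> N \<Longrightarrow> rt p r \<in> Qtail N k"
  by (auto simp: Qtail_def Qplus_rt) (auto simp: rt_def)

text \<open>Only x_N is left, and total degree 0 removes it too; this is the base case of the
  inductions over k.\<close>

lemma Qtail_beyond: "\<beta> \<in> Qtail N N \<Longrightarrow> \<beta> = 0"
proof (rule psum_inj[of _ N])
  assume \<beta>: "\<beta> \<in> Qtail N N"
  show "psum \<beta> k = psum 0 k" for k
    using Qtail_psum[OF \<beta>, of k] psum_stable[of \<beta> N k] \<beta> by (cases "k < N") (auto simp: Qtail_def Qplus_iff)
qed (auto simp: Qtail_def Qplus_iff)

section \<open>Expansion of the coefficients of the difference operators\<close>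

definition smul :: "nat \<Rightarrow> (nat \<Rightarrow> int) \<Rightarrow> nat \<Rightarrow> int" where
  "smul m \<gamma> = (\<lambda>i. int m * \<gamma> i)"

lemma smul_0 [simp]: "smul 0 \<gamma> = 0"
  and smul_zero [simp]: "smul m 0 = 0"
  and smul_Suc: "smul (Suc m) \<gamma> = smul m \<gamma> + \<gamma>"
  by (auto simp: smul_def fun_eq_iff algebra_simps)

lemma smul_1 [simp]: "smul (Suc 0) \<gamma> = \<gamma>"
  by (simp add: smul_def)

lemma Qtail_smul: "\<gamma> \<in> Qtail N k \<Longrightarrow> smul m \<gamma> \<in> Qtail N k"
  by (induction m) (auto simp: smul_Suc Qtail_add)

lemma Qplus_smul: "\<gamma> \<in> Qplus N \<Longrightarrow> smul m \<gamma> \<in> Qplus N"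
  by (induction m) (auto simp: smul_Suc Qplus_add)

lemma smul_rt_inj: "p \<noteq> r \<Longrightarrow> smul m (rt p r) = smul n (rt p r) \<longleftrightarrow> m = n"
  by (auto simp: smul_def rt_def fun_eq_iff dest!: spec[of _ p])

text \<open>The expansion of a + b (z + z^2 + ...) with z = x_r / x_p.\<close>

definition geom_coeff :: "nat \<Rightarrow> nat \<Rightarrow> complex \<Rightarrow> complex \<Rightarrow> (nat \<Rightarrow> int) \<Rightarrow> complex" where
  "geom_coeff p r a b \<nu> = (if \<nu> = 0 then a else if \<exists>m. \<nu> = smul m (rt p r) then b else 0)"

lemma geom_coeff_0 [simp]: "geom_coeff p r a b 0 = a"
  by (simp add: geom_coeff_def)

lemma geom_coeff_nz: "geom_coeff p r a b \<nu> \<noteq> 0 \<Longrightarrow> \<exists>m. \<nu> = smul m (rt p r)"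
  by (auto simp: geom_coeff_def split: if_splits intro: exI[of _ 0])

lemma geom_coeff_smul: "p \<noteq> r \<Longrightarrow> geom_coeff p r a b (smul m (rt p r)) = (if m = 0 then a else b)"
  using smul_rt_inj[of p r m 0] by (auto simp: geom_coeff_def)

lemma hre_geom_coeff:
  assumes bounds: "1 \<le> p" "p < r" "r \<le> N"
  shows "has_ratio_expansion N (\<lambda>x. a + b * (x r / x p / (1 - x r / x p))) (geom_coeff p r a b)"
proof (rule hreI[where \<epsilon> = 1])
  have Q: "smul m (rt p r) \<in> Qplus N" for m
    using Qplus_smul Qplus_rt bounds by simp
  show "geom_coeff p r a b \<beta> = 0" if "\<beta> \<notin> Qplus N" for \<beta>
    using geom_coeff_nz[of p r a b \<beta>] Q that by auto
  fix x assume x: "x \<in> ratio_region N 1"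
  define z where "z = x r / x p"
  have nz: "\<And>i. i \<in> {1..N} \<Longrightarrow> x i \<noteq> 0" using ratio_region_nonzero[OF x] .
  have z: "norm z < 1"
    using ratio_region_less[OF x, of p r] bounds nz[of p] by (simp add: z_def norm_divide)
  have mono: "mono_at N x (- smul m (rt p r)) = z ^ m" for m
  proof (induction m)
    case (Suc m)
    have "mono_at N x (- smul (Suc m) (rt p r)) = mono_at N x (- smul m (rt p r)) * mono_at N x (- rt p r)"
      by (subst mono_at_add[symmetric]) (use nz in \<open>auto simp: smul_Suc\<close>)
    also have "mono_at N x (- rt p r) = z"
      using bounds nz mono_at_rt[of p N r x] unfolding mono_at_minus by (simp add: z_def)
    finally show ?case using Suc by simp
  next
    case 0
    show "mono_at N x (- smul 0 (rt p r)) = z ^ 0" by simp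
  qed
  have "((\<lambda>m. b * z ^ m) has_sum b * (z / (1 - z))) {1..}"
    by (intro has_sum_cmult_right has_sum_geometric_from_1 z)
  then have "((\<lambda>m. if m = 0 then a else b * z ^ m) has_sum b * (z / (1 - z))) {1..}"
    by (rule has_sum_cong[THEN iffD1, rotated]) auto
  then have "((\<lambda>m. if m = 0 then a else b * z ^ m) has_sum (a + b * (z / (1 - z)))) (insert 0 {1..})"
    using has_sum_insert[of 0 "{1::nat..}" "\<lambda>m. if m = 0 then a else b * z ^ m"] by simp
  moreover have "insert 0 {1::nat..} = UNIV" by auto
  moreover have "(\<lambda>m. if m = 0 then a else b * z ^ m) =
      (\<lambda>\<beta>. geom_coeff p r a b \<beta> * mono_at N x (- \<beta>)) \<circ> (\<lambda>m. smul m (rt p r))"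
    unfolding comp_def mono geom_coeff_smul[OF less_imp_neq[OF bounds(2)]] by auto
  ultimately have "((\<lambda>\<beta>. geom_coeff p r a b \<beta> * mono_at N x (- \<beta>)) has_sum (a + b * (z / (1 - z))))
      (range (\<lambda>m. smul m (rt p r)))"
    using bounds by (intro has_sum_reindex[THEN iffD2]) (auto simp: inj_on_def smul_rt_inj)
  then show "((\<lambda>\<beta>. geom_coeff p r a b \<beta> * mono_at N x (- \<beta>)) has_sum (a + b * (x r / x p / (1 - x r / x p)))) (Qplus N)"
    unfolding z_def[symmetric]
  proof (rule has_sum_cong_neutral[THEN iffD1, rotated 3])
    show "geom_coeff p r a b \<beta> * mono_at N x (- \<beta>) = 0" if "\<beta> \<in> Qplus N - range (\<lambda>m. smul m (rt p r))" for \<beta>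
      using geom_coeff_nz[of p r a b \<beta>] that by auto
  qed (use Q in auto)
qed auto

text \<open>The expansion of (x_i - s x_j) / (x_i - x_j) in whichever of x_j / x_i and x_i / x_j is
  small. For s = 1 / t this is a factor of the Macdonald operator divided by t; s = 0 is the
  limit.\<close>

definition pair_coeff :: "complex \<Rightarrow> nat \<Rightarrow> nat \<Rightarrow> (nat \<Rightarrow> int) \<Rightarrow> complex" where
  "pair_coeff s i j = (if i < j then geom_coeff i j 1 (1 - s) else geom_coeff j i s (s - 1))"

text \<open>One family covers all operators in use: k = 1 and s = 1 / t give the Macdonald operator
  up to t^(N-1), s = 0 gives the limit operators, and k > 1 the same operators in the variables x_k,
  ..., x_N.\<close>

definition op_coeff :: "nat \<Rightarrow> nat \<Rightarrow> complex \<Rightarrow> nat \<Rightarrow> (nat \<Rightarrow> int) \<Rightarrow> complex" where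
  "op_coeff N k s i = foldr (\<lambda>j. conv N (pair_coeff s i j)) (filter (\<lambda>j. j \<noteq> i) [k..<Suc N]) delta0"

lemma hre_pair_coeff:
  assumes "i \<in> {1..N}" "j \<in> {1..N}" "i \<noteq> j"
  shows "has_ratio_expansion N (\<lambda>x. (x i - s * x j) / (x i - x j)) (pair_coeff s i j)"
proof (cases "i < j")
  case True
  have "has_ratio_expansion N (\<lambda>x. 1 + (1 - s) * (x j / x i / (1 - x j / x i))) (pair_coeff s i j)"
    using hre_geom_coeff[of i j N 1 "1 - s"] True assms by (simp add: pair_coeff_def)
  then show ?thesis
  proof (rule hre_cong[where \<epsilon> = 1])
    fix x assume x: "x \<in> ratio_region N 1"
    have "x i \<noteq> 0" "x i \<noteq> x j"
      using ratio_region_nonzero[OF x] ratio_region_less[OF x True] assms by auto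
    then show "1 + (1 - s) * (x j / x i / (1 - x j / x i)) = (x i - s * x j) / (x i - x j)"
      by (simp add: field_simps)
  qed auto
next
  case False
  then have ji: "j < i" using assms by auto
  have "has_ratio_expansion N (\<lambda>x. s + (s - 1) * (x i / x j / (1 - x i / x j))) (pair_coeff s i j)"
    using hre_geom_coeff[of j i N s "s - 1"] ji assms by (simp add: pair_coeff_def)
  then show ?thesis
  proof (rule hre_cong[where \<epsilon> = 1])
    fix x assume x: "x \<in> ratio_region N 1"
    have "x j \<noteq> 0" "x i \<noteq> x j"
      using ratio_region_nonzero[OF x] ratio_region_less[OF x ji] assms by auto
    then show "s + (s - 1) * (x i / x j / (1 - x i / x j)) = (x i - s * x j) / (x i - x j)"
      by (simp add: field_simps)
  qed auto
qed

lemma hre_op_coeff: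
  assumes "i \<in> {1..N}" "1 \<le> k"
  shows "has_ratio_expansion N (\<lambda>x. \<Prod>j\<in>{k..N} - {i}. (x i - s * x j) / (x i - x j)) (op_coeff N k s i)"
proof -
  have *: "has_ratio_expansion N (\<lambda>x. \<Prod>j\<leftarrow>js. (x i - s * x j) / (x i - x j))
      (foldr (\<lambda>j. conv N (pair_coeff s i j)) js delta0)" if "set js \<subseteq> {1..N} - {i}" for js
    using that
  proof (induction js)
    case Nil
    then show ?case using hre_one by simp
  next
    case (Cons j js)
    then show ?case
      using hre_mult[OF hre_pair_coeff[of i N j s] Cons.IH] assms by simp
  qed
  have eq: "(\<Prod>j\<leftarrow>filter (\<lambda>j. j \<noteq> i) [k..<Suc N]. f j) = (\<Prod>j\<in>{k..N} - {i}. f j)" for f :: "nat \<Rightarrow> complex"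
    by (subst prod.distinct_set_conv_list[symmetric]) (auto intro!: prod.cong)
  show ?thesis
    using *[of "filter (\<lambda>j. j \<noteq> i) [k..<Suc N]"] assms by (simp add: op_coeff_def eq subset_iff del: upt_Suc)
qed

lemma hre_D1_coeff:
  assumes "i \<in> {1..N}" "t \<noteq> 0"
  shows "has_ratio_expansion N (D1_coeff N t i) (\<lambda>\<nu>. t ^ (N - 1) * op_coeff N 1 (1 / t) i \<nu>)"
proof -
  have "t ^ (N - 1) * (\<Prod>j\<in>{1..N} - {i}. (x i - 1 / t * x j) / (x i - x j)) = D1_coeff N t i x" for x
  proof -
    have "D1_coeff N t i x = (\<Prod>j\<in>{1..N} - {i}. t * ((x i - 1 / t * x j) / (x i - x j)))"
      unfolding D1_coeff_def by (intro prod.cong refl) (use assms in \<open>simp add: right_diff_distrib\<close>)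
    also have "\<dots> = t ^ card ({1..N} - {i}) * (\<Prod>j\<in>{1..N} - {i}. (x i - 1 / t * x j) / (x i - x j))"
      by (simp only: prod.distrib prod_constant)
    finally show ?thesis using assms by simp
  qed
  then show ?thesis
    using hre_cmult[OF hre_op_coeff[of i N 1 "1 / t"], of "t ^ (N - 1)"] assms by (simp add: fun_eq_iff[symmetric])
qed

section \<open>Supports and constant terms of the operator coefficients\<close>

lemma conv_nz:
  assumes "conv N a b \<kappa> \<noteq> 0"
  obtains \<beta> where "\<beta> \<in> ival N \<kappa>" "a (\<kappa> - \<beta>) \<noteq> 0" "b \<beta> \<noteq> 0"
proof -
  have "\<exists>\<beta>\<in>ival N \<kappa>. a (\<kappa> - \<beta>) * b \<beta> \<noteq> 0"
    using assms unfolding conv_def by (rule contrapos_np) (auto intro: sum.neutral)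
  then show ?thesis using that by auto
qed

lemma op_coeff_same: "op_coeff N k s k = foldr (\<lambda>j. conv N (pair_coeff s k j)) [Suc k..<Suc N] delta0" if "k \<le> N"
proof -
  have "filter (\<lambda>j. j \<noteq> k) [k..<Suc N] = [Suc k..<Suc N]"
    using that by (simp add: upt_conv_Cons filter_id_conv del: upt_Suc)
  then show ?thesis by (simp add: op_coeff_def)
qed

lemma op_coeff_rec: "k < i \<Longrightarrow> i \<le> N \<Longrightarrow> op_coeff N k s i = conv N (geom_coeff k i s (s - 1)) (op_coeff N (Suc k) s i)"
  by (simp add: op_coeff_def pair_coeff_def upt_conv_Cons del: upt_Suc)

lemma foldr_pair_coeff_Qtail:
  assumes "set js \<subseteq> {k..N} - {i}" "1 \<le> k" "k \<le> i" "i \<le> N"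
    "foldr (\<lambda>j. conv N (pair_coeff s i j)) js delta0 \<nu> \<noteq> 0"
  shows "\<nu> \<in> Qtail N k"
  using assms(1,5)
proof (induction js arbitrary: \<nu>)
  case Nil
  then have "\<nu> = 0" by (auto simp: delta0_def)
  then show ?case by (simp only: Qtail_zero)
next
  case (Cons j js)
  from Cons.prems(2) obtain \<beta> where \<beta>: "pair_coeff s i j (\<nu> - \<beta>) \<noteq> 0"
    "foldr (\<lambda>j. conv N (pair_coeff s i j)) js delta0 \<beta> \<noteq> 0"
    by (auto elim: conv_nz)
  have "\<nu> - \<beta> \<in> Qtail N k"
    using \<beta>(1) assms(2-4) Cons.prems(1)
    by (auto simp: pair_coeff_def split: if_splits dest!: geom_coeff_nz intro!: Qtail_smul Qtail_rt)
  then show ?case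
    using Qtail_add[of "\<nu> - \<beta>" N k \<beta>] Cons.IH[OF _ \<beta>(2)] Cons.prems(1) by simp
qed

lemma op_coeff_Qtail:
  assumes "1 \<le> k" "k \<le> i" "i \<le> N" "op_coeff N k s i \<nu> \<noteq> 0"
  shows "\<nu> \<in> Qtail N k"
  by (rule foldr_pair_coeff_Qtail[OF _ assms(1,2,3)]) (use assms(4) in \<open>auto simp: op_coeff_def\<close>)

lemma op_coeff_outside: "1 \<le> k \<Longrightarrow> k \<le> i \<Longrightarrow> i \<le> N \<Longrightarrow> \<nu> \<notin> Qtail N k \<Longrightarrow> op_coeff N k s i \<nu> = 0"
  using op_coeff_Qtail by blast

text \<open>For i > k and s = 0 the factor with j = k is -z / (1 - z), z = x_i / x_k. It has no
  constant term, so a whole root e_k - e_i splits off. The support bound of the q-Whittaker array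
  rests on this divisibility.\<close>

lemma Kc0_shift:
  assumes "1 \<le> k" "k \<le> i" "i \<le> N" "op_coeff N k 0 i \<nu> \<noteq> 0"
  shows "\<nu> - rt k i \<in> Qtail N k"
proof (cases "k = i")
  case True
  then show ?thesis using op_coeff_Qtail[OF assms] by simp
next
  case False
  with assms obtain \<beta> where \<beta>: "geom_coeff k i 0 (- 1) (\<nu> - \<beta>) \<noteq> 0" "op_coeff N (Suc k) 0 i \<beta> \<noteq> 0"
    by (auto simp: op_coeff_rec elim: conv_nz)
  from geom_coeff_nz[OF \<beta>(1)] obtain m where m: "\<nu> - \<beta> = smul m (rt k i)" by blast
  obtain m' where m': "m = Suc m'" using \<beta>(1) m by (cases m) auto
  have "\<beta> \<in> Qtail N k"
    using op_coeff_Qtail[OF _ _ _ \<beta>(2)] False assms Qtail_anti[of k "Suc k" N] by auto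
  moreover have "\<nu> - rt k i = smul m' (rt k i) + \<beta>"
    using m by (simp add: m' smul_Suc algebra_simps)
  ultimately show ?thesis using assms by (auto intro!: Qtail_add Qtail_smul Qtail_rt)
qed

lemma ival_0 [simp]: "ival N 0 = {0}"
  using Qplus_antisym[of _ N] by (auto simp: ival_def)

lemma conv_0 [simp]: "conv N a b 0 = a 0 * b 0"
  by (simp add: conv_def)

text \<open>A factor with j < i has constant term s, one with j > i has constant term 1.\<close>

lemma op_coeff_0: "k \<le> i \<Longrightarrow> i \<le> N \<Longrightarrow> op_coeff N k s i 0 = s ^ (i - k)"
proof (induction "i - k" arbitrary: k)
  case 0
  have "foldr (\<lambda>j. conv N (pair_coeff s k j)) js delta0 0 = 1" if "\<forall>j\<in>set js. k < j" for js
    using that by (induction js) (auto simp: delta0_def pair_coeff_def)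
  then show ?case using 0 by (simp add: op_coeff_same flip: zero_fun_def del: upt_Suc)
next
  case (Suc n)
  then have "op_coeff N k s i 0 = s * op_coeff N (Suc k) s i 0" by (simp add: op_coeff_rec)
  also have "op_coeff N (Suc k) s i 0 = s ^ (i - Suc k)" using Suc by simp
  also have "s * s ^ (i - Suc k) = s ^ (i - k)"
    using Suc by (simp flip: power_Suc add: Suc_diff_Suc)
  finally show ?case .
qed

text \<open>For i > k only the factor with j = k contains x_k. Fixing the degree -m in x_k selects
  its term (x_i / x_k)^m, whose coefficient is s for m = 0 and s - 1 otherwise.\<close>

lemma op_coeff_level:
  assumes "1 \<le> k" "k < i" "i \<le> N" "\<nu> k = int m"
  shows "op_coeff N k s i \<nu> = (if m = 0 then s else s - 1) * op_coeff N (Suc k) s i (\<nu> - smul m (rt k i))"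
proof -
  have rtQ: "smul m (rt k i) \<in> Qplus N" using assms by (intro Qplus_smul Qplus_rt) auto
  have "op_coeff N k s i \<nu> = (\<Sum>\<beta>\<in>ival N \<nu>. geom_coeff k i s (s - 1) (\<nu> - \<beta>) * op_coeff N (Suc k) s i \<beta>)"
    using assms by (simp add: op_coeff_rec conv_def)
  also have "\<dots> = (\<Sum>\<beta>\<in>{\<nu> - smul m (rt k i)}. geom_coeff k i s (s - 1) (\<nu> - \<beta>) * op_coeff N (Suc k) s i \<beta>)"
  proof (rule sum.mono_neutral_cong)
    show "geom_coeff k i s (s - 1) (\<nu> - \<beta>) * op_coeff N (Suc k) s i \<beta> = 0" if "\<beta> \<in> ival N \<nu> - {\<nu> - smul m (rt k i)}" for \<beta>
    proof (rule ccontr)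
      assume "geom_coeff k i s (s - 1) (\<nu> - \<beta>) * op_coeff N (Suc k) s i \<beta> \<noteq> 0"
      then obtain m' where m': "\<nu> - \<beta> = smul m' (rt k i)" and "op_coeff N (Suc k) s i \<beta> \<noteq> 0"
        using geom_coeff_nz[of k i s "s - 1" "\<nu> - \<beta>"] by auto
      then have "\<beta> k = 0" using op_coeff_Qtail[of "Suc k" i N s \<beta>] assms by (auto simp: Qtail_def)
      then have "m' = m" using fun_cong[OF m', of k] assms by (simp add: smul_def rt_def)
      then show False using m' that by (auto simp: algebra_simps)
    qed
    show "geom_coeff k i s (s - 1) (\<nu> - \<beta>) * op_coeff N (Suc k) s i \<beta> = 0" if "\<beta> \<in> {\<nu> - smul m (rt k i)} - ival N \<nu>" for \<beta>
      using that rtQ op_coeff_outside[of "Suc k" i N \<beta> s] assms by (auto simp: ival_def Qtail_def)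
  qed auto
  also have "\<dots> = (if m = 0 then s else s - 1) * op_coeff N (Suc k) s i (\<nu> - smul m (rt k i))"
    using assms by (simp add: geom_coeff_smul)
  finally show ?thesis .
qed

text \<open>All nonconstant terms of all factors have positive degree in 1 / x_k, so degree 0 in x_k
  is reached only by the product of the constant terms.\<close>

lemma op_coeff_same_0:
  assumes "1 \<le> k" "k \<le> N" "op_coeff N k s k \<nu> \<noteq> 0" "\<nu> k = 0"
  shows "\<nu> = 0"
proof -
  have "(0 \<le> \<nu> k \<and> (\<nu> k = 0 \<longrightarrow> \<nu> = 0))"
    if "set js \<subseteq> {k<..N}" "foldr (\<lambda>j. conv N (pair_coeff s k j)) js delta0 \<nu> \<noteq> 0" for js \<nu>
    using that
  proof (induction js arbitrary: \<nu>)
    case Nil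
    then show ?case by (simp add: delta0_def split: if_splits)
  next
    case (Cons j js)
    from Cons.prems(2) obtain \<beta> where \<beta>: "pair_coeff s k j (\<nu> - \<beta>) \<noteq> 0"
      "foldr (\<lambda>j. conv N (pair_coeff s k j)) js delta0 \<beta> \<noteq> 0"
      by (auto elim: conv_nz)
    obtain m where m: "\<nu> - \<beta> = smul m (rt k j)"
      using \<beta>(1) Cons.prems(1) geom_coeff_nz[of k j 1 "1 - s" "\<nu> - \<beta>"] by (auto simp: pair_coeff_def)
    have "\<nu> k = int m + \<beta> k"
      using fun_cong[OF m, of k] Cons.prems(1) by (auto simp: smul_def rt_def)
    moreover have "0 \<le> \<beta> k \<and> (\<beta> k = 0 \<longrightarrow> \<beta> = 0)"
      by (rule Cons.IH[OF _ \<beta>(2)]) (use Cons.prems(1) in auto)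
    ultimately show ?case using m by (auto simp flip: zero_fun_def)
  qed
  from this[of "[Suc k..<Suc N]" \<nu>] assms show ?thesis by (auto simp: op_coeff_same subset_iff simp del: upt_Suc)
qed

text \<open>On exponents free of the variables below x_k, the factors with j < k can only contribute
  their constant term s.\<close>

lemma op_coeff_lower:
  assumes "1 \<le> k'" "k' \<le> k" "k \<le> i" "i \<le> N" "\<nu> \<in> Qtail N k"
  shows "op_coeff N k' s i \<nu> = s ^ (k - k') * op_coeff N k s i \<nu>"
  using assms
proof (induction "k - k'" arbitrary: k')
  case (Suc n)
  have "\<nu> k' = 0" using Suc by (auto simp: Qtail_def)
  then have "op_coeff N k' s i \<nu> = s * op_coeff N (Suc k') s i \<nu>"
    using op_coeff_level[of k' i N \<nu> 0 s] Suc by simp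
  also have "op_coeff N (Suc k') s i \<nu> = s ^ (k - Suc k') * op_coeff N k s i \<nu>" using Suc by simp
  also have "s * (s ^ (k - Suc k') * op_coeff N k s i \<nu>) = s ^ (k - k') * op_coeff N k s i \<nu>"
    using Suc by (simp flip: power_Suc mult.assoc add: Suc_diff_Suc)
  finally show ?case .
qed simp

text \<open>Once the factors below i are reduced to constants, each remaining nonconstant term
  involves x_i, which does not occur in \<nu>.\<close>

lemma op_coeff_above:
  assumes "1 \<le> k'" "k' \<le> i" "i < k" "i \<le> N" "\<nu> \<in> Qtail N k" "\<nu> \<noteq> 0"
  shows "op_coeff N k' s i \<nu> = 0"
proof -
  have "\<nu> \<in> Qtail N i" "\<nu> i = 0" using assms Qtail_anti[of i k N] by (auto simp: Qtail_below)
  then show ?thesis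
    using op_coeff_lower[of k' i i N \<nu> s] op_coeff_same_0[of i N s \<nu>] assms by auto
qed

text \<open>A finite convolution of families that are affine in s is a polynomial in s.\<close>

lemma op_coeff_tendsto: "((\<lambda>s. op_coeff N k s i \<nu>) \<longlongrightarrow> op_coeff N k s0 i \<nu>) (at s0)"
proof -
  have "((\<lambda>s. geom_coeff p r (a s) (b s) \<nu>) \<longlongrightarrow> geom_coeff p r (a s0) (b s0) \<nu>) (at s0)"
    if "(a \<longlongrightarrow> a s0) (at s0)" "(b \<longlongrightarrow> b s0) (at s0)" for a b :: "complex \<Rightarrow> complex" and p r \<nu>
    using that by (auto simp: geom_coeff_def)
  note geom_coeff = this
  have "((\<lambda>s. pair_coeff s i j \<nu>) \<longlongrightarrow> pair_coeff s0 i j \<nu>) (at s0)" for j \<nu>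
    unfolding pair_coeff_def by (cases "i < j") (simp_all, auto intro!: geom_coeff tendsto_intros)
  then have "((\<lambda>s. foldr (\<lambda>j. conv N (pair_coeff s i j)) js delta0 \<nu>) \<longlongrightarrow>
      foldr (\<lambda>j. conv N (pair_coeff s0 i j)) js delta0 \<nu>) (at s0)" for js
    by (induction js arbitrary: \<nu>) (auto simp: conv_def intro!: tendsto_intros)
  then show ?thesis by (simp add: op_coeff_def)
qed

section \<open>The q-commutation relation\<close>

definition hfun :: "nat \<Rightarrow> nat \<Rightarrow> nat \<Rightarrow> (nat \<Rightarrow> complex) \<Rightarrow> complex" where
  "hfun N k i x = (\<Prod>j\<in>{k..N} - {i}. x i / (x i - x j))"

lemma hre_hfun: "i \<in> {1..N} \<Longrightarrow> 1 \<le> k \<Longrightarrow> has_ratio_expansion N (hfun N k i) (op_coeff N k 0 i)"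
  using hre_op_coeff[of i N k 0] by (simp add: hfun_def[abs_def])

lemma hre_hfun':
  assumes "1 \<le> k" "k \<le> i" "i \<le> N"
  shows "has_ratio_expansion N (\<lambda>x. x i / x k * hfun N k i x) (\<lambda>\<nu>. op_coeff N k 0 i (\<nu> - rt k i))"
proof (rule hre_cong[where \<epsilon> = 1])
  show "has_ratio_expansion N (\<lambda>x. mono_at N x (- rt k i) * hfun N k i x) (\<lambda>\<nu>. op_coeff N k 0 i (\<nu> - rt k i))"
    using assms by (intro hre_monomial hre_hfun Qplus_rt) auto
  show "mono_at N x (- rt k i) * hfun N k i x = x i / x k * hfun N k i x" if "x \<in> ratio_region N 1" for x
    using mono_at_rt[of k N i x] ratio_region_nonzero[OF that] assms unfolding mono_at_minus by simp
qed auto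

text \<open>Up to the factor 1 / (q x_k), the coefficient of \<Gamma>_i \<Gamma>_j in D0 D1 - q D1
  D0 for the operators without normalization. The power of q corrects for \<Gamma>_i acting on the
  factor 1 / x_k of the normalized D1.\<close>

definition comm_defect :: "complex \<Rightarrow> nat \<Rightarrow> nat \<Rightarrow> nat \<Rightarrow> nat \<Rightarrow> (nat \<Rightarrow> int) \<Rightarrow> complex" where
  "comm_defect q N k i j \<tau> =
     q powi (- of_bool (i \<noteq> k)) * conv N (op_coeff N k 0 i) (\<lambda>\<nu>. q powi (- \<nu> i) * op_coeff N k 0 j (\<nu> - rt k j)) \<tau> -
     conv N (\<lambda>\<nu>. op_coeff N k 0 i (\<nu> - rt k i)) (\<lambda>\<nu>. q powi (- \<nu> i) * op_coeff N k 0 j \<nu>) \<tau>"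

context
  fixes q :: complex and N :: nat
  assumes q0: "q \<noteq> 0" and q1: "norm q < 1"
begin

lemma powi_add: "q powi (m + n) = q powi m * q powi n"
  using q0 by (simp add: power_int_add)

lemma powi_neq_1: "m \<noteq> 0 \<Longrightarrow> q powi m \<noteq> 1"
proof
  assume m: "m \<noteq> 0" and "q powi m = 1"
  then have "norm q powi m = 1" by (metis norm_one norm_power_int)
  moreover have "norm q powi m < 1" if "0 < m"
    using that q0 q1 by (auto simp: power_int_def intro!: power_less_one_iff[THEN iffD2])
  moreover have "1 < norm q powi m" if "m < 0"
    using that q0 q1 by (auto simp: power_int_def one_less_inverse_iff power_less_one_iff)
  ultimately show False using m by force
qed

text \<open>The difference of the two products contains x_j - q x_i, which cancels the denominator
  that \<Gamma>_i creates in the coefficient of \<Gamma>_j; for i = j the difference is 0. What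
  remains is symmetric in i and j except for x_i - x_j.\<close>

lemma hre_comm_defect:
  assumes "1 \<le> k" "i \<in> {k..N}" "j \<in> {k..N}"
  shows "has_ratio_expansion N
    (\<lambda>x. if i = j then 0 else (\<Prod>l\<in>{k..N} - {i, j}. x i / (x i - x l)) * (\<Prod>l\<in>{k..N} - {i, j}. x j / (x j - x l)) *
       x i * x j / (q * x k * (x i - x j)))
    (comm_defect q N k i j)"
proof -
  define U where "U x = x(i := q * x i)" for x :: "nat \<Rightarrow> complex"
  have "has_ratio_expansion N
    (\<lambda>x. q powi (- of_bool (i \<noteq> k)) * (hfun N k i x * (U x j / U x k * hfun N k j (U x))) +
       (- 1) * (x i / x k * hfun N k i x * hfun N k j (U x)))
    (\<lambda>\<tau>. q powi (- of_bool (i \<noteq> k)) * conv N (op_coeff N k 0 i) (\<lambda>\<nu>. q powi (- \<nu> i) * op_coeff N k 0 j (\<nu> - rt k j)) \<tau> +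
       (- 1) * conv N (\<lambda>\<nu>. op_coeff N k 0 i (\<nu> - rt k i)) (\<lambda>\<nu>. q powi (- \<nu> i) * op_coeff N k 0 j \<nu>) \<tau>)"
    unfolding U_def
    by (intro hre_add hre_cmult hre_mult hre_hfun' hre_hfun hre_shift[where i = i, OF _ q0 q1])
       (use assms in auto)
  then have "has_ratio_expansion N
    (\<lambda>x. q powi (- of_bool (i \<noteq> k)) * (hfun N k i x * (U x j / U x k * hfun N k j (U x))) +
       (- 1) * (x i / x k * hfun N k i x * hfun N k j (U x))) (comm_defect q N k i j)"
    by (simp add: comm_defect_def[abs_def])
  then show ?thesis
  \<comment> \<open>With all ratios below |q|, x_j - q x_i does not vanish for any two distinct
    indices, in either order.\<close>
  proof (rule hre_cong[where \<epsilon> = "norm q"])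
    show "0 < norm q" using q0 by simp
    fix x assume x: "x \<in> ratio_region N (norm q)"
    have nz: "x l \<noteq> 0" if "l \<in> {k..N}" for l
      using ratio_region_nonzero[OF x, of l] assms that by auto
    have less: "norm (x b) < norm q * norm (x a)" if "a < b" "a \<in> {k..N}" "b \<in> {k..N}" for a b
    proof -
      have "norm (x b) \<le> norm (x (Suc a))"
        using ratio_region_less[of x N "Suc a" b] ratio_region_mono[OF _ x, of 1] q1 that
        by (cases "b = Suc a") auto
      also have "\<dots> < norm q * norm (x a)"
        using x that assms by (auto simp: ratio_region_def)
      finally show ?thesis .
    qed
    have less1: "norm (x b) < norm (x a)" if "a < b" "a \<in> {k..N}" "b \<in> {k..N}" for a b
      using ratio_region_less[of x N a b] ratio_region_mono[OF _ x, of 1] q1 that assms by auto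
    have neq: "x a \<noteq> q * x b" if "a \<noteq> b" "a \<in> {k..N}" "b \<in> {k..N}" for a b
    proof (cases "a < b")
      case True
      have "norm (q * x b) \<le> 1 * norm (x b)"
        unfolding norm_mult using q1 by (intro mult_right_mono) auto
      then show ?thesis using less1[OF True that(2,3)] by auto
    next
      case False
      then show ?thesis using less[of b a] that by (auto simp: norm_mult)
    qed
    have neq1: "x a \<noteq> x b" if "a \<noteq> b" "a \<in> {k..N}" "b \<in> {k..N}" for a b
      using less1[of a b] less1[of b a] that by (cases "a < b") auto
    have Uk: "U x k = (if i = k then q else 1) * x k" by (simp add: U_def)
    have xk: "x k \<noteq> 0" using nz[of k] assms by auto
    \<comment> \<open>If i = k the shift supplies the factor 1 / q, otherwise the prefactor does;
      the outcome no longer depends on i.\<close>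
    have pre: "q powi (- of_bool (i \<noteq> k)) / U x k = 1 / (q * x k)"
      using q0 xk by (simp add: Uk power_int_minus field_simps)
    have fact: "q powi (- of_bool (i \<noteq> k)) * (hfun N k i x * (U x j / U x k * hfun N k j (U x))) +
       (- 1) * (x i / x k * hfun N k i x * hfun N k j (U x)) =
       hfun N k i x * hfun N k j (U x) * ((U x j - q * x i) / (q * x k))"
    proof -
      have "q powi (- of_bool (i \<noteq> k)) * (hfun N k i x * (U x j / U x k * hfun N k j (U x))) =
         (q powi (- of_bool (i \<noteq> k)) / U x k) * (hfun N k i x * hfun N k j (U x) * U x j)" by simp
      then show ?thesis unfolding pre using q0 xk by (simp add: field_simps)
    qed
    show "q powi (- of_bool (i \<noteq> k)) * (hfun N k i x * (U x j / U x k * hfun N k j (U x))) +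
       (- 1) * (x i / x k * hfun N k i x * hfun N k j (U x)) =
       (if i = j then 0 else (\<Prod>l\<in>{k..N} - {i, j}. x i / (x i - x l)) * (\<Prod>l\<in>{k..N} - {i, j}. x j / (x j - x l)) *
       x i * x j / (q * x k * (x i - x j)))"
    proof (cases "i = j")
      case True
      then show ?thesis unfolding fact by (simp add: U_def)
    next
      case False
      have hi: "hfun N k i x = x i / (x i - x j) * (\<Prod>l\<in>{k..N} - {i, j}. x i / (x i - x l))"
        unfolding hfun_def using False assms
        by (subst prod.remove[of _ j]) (auto simp: insert_commute Diff_insert2[symmetric])
      have "hfun N k j (U x) = U x j / (U x j - U x i) * (\<Prod>l\<in>{k..N} - {i, j}. U x j / (U x j - U x l))"
        unfolding hfun_def using False assms
        by (subst prod.remove[of _ i]) (auto simp: insert_commute[of j i] Diff_insert2[symmetric])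
      also have "(\<Prod>l\<in>{k..N} - {i, j}. U x j / (U x j - U x l)) = (\<Prod>l\<in>{k..N} - {i, j}. x j / (x j - x l))"
        by (intro prod.cong refl) (use False in \<open>auto simp: U_def\<close>)
      finally have hj: "hfun N k j (U x) = x j / (x j - q * x i) * (\<Prod>l\<in>{k..N} - {i, j}. x j / (x j - x l))"
        using False by (simp add: U_def fun_upd_def)
      have "x j - q * x i \<noteq> 0" "x i - x j \<noteq> 0"
        using neq[of j i] neq1[of i j] False assms by auto
      moreover have "U x j = x j" using False by (simp add: U_def)
      ultimately show ?thesis unfolding fact unfolding hi hj using False q0 xk by (simp add: divide_simps)
    qed
  qed
qed

text \<open>Exchanging i and j only reverses the sign of x_i - x_j; uniqueness of expansions carries
  this over to the coefficients.\<close>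

lemma comm_defect_antisym:
  assumes "1 \<le> k" "i \<in> {k..N}" "j \<in> {k..N}"
  shows "comm_defect q N k i j \<tau> + comm_defect q N k j i \<tau> = 0"
proof -
  have "has_ratio_expansion N (\<lambda>x. 0) (\<lambda>\<tau>. comm_defect q N k i j \<tau> + comm_defect q N k j i \<tau>)"
  proof (rule hre_cong[OF hre_add[OF hre_comm_defect[OF assms] hre_comm_defect[OF assms(1,3,2)]], of 1])
    fix x :: "nat \<Rightarrow> complex"
    have "a * x i * x j / (q * x k * (x i - x j)) + a * x j * x i / (q * x k * (x j - x i)) = 0" for a
    proof -
      have "q * x k * (x j - x i) = - (q * x k * (x i - x j))" by (simp add: algebra_simps)
      then show ?thesis by (simp add: mult_ac)
    qed
    from this[of "(\<Prod>l\<in>{k..N} - {i, j}. x i / (x i - x l)) * (\<Prod>l\<in>{k..N} - {i, j}. x j / (x j - x l))"]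
    show "(if i = j then 0 else (\<Prod>l\<in>{k..N} - {i, j}. x i / (x i - x l)) * (\<Prod>l\<in>{k..N} - {i, j}. x j / (x j - x l)) *
       x i * x j / (q * x k * (x i - x j))) +
     (if j = i then 0 else (\<Prod>l\<in>{k..N} - {j, i}. x j / (x j - x l)) * (\<Prod>l\<in>{k..N} - {j, i}. x i / (x i - x l)) *
       x j * x i / (q * x k * (x j - x i))) = 0"
      by (simp add: insert_commute[of j i] mult.commute[of "\<Prod>l\<in>{k..N} - {i, j}. x j / (x j - x l)"])
  qed auto
  from hre_zero_imp[OF this] show ?thesis .
qed

section \<open>The operators D0 and D1 on double series\<close>

text \<open>An array \<open>F \<delta> \<beta>\<close> stands for \<open>x\<^sup>\<lambda> \<Sum> F \<delta> \<beta> \<Lambda>\<^bsup>-\<delta>\<^esup> x\<^bsup>-\<beta>\<^esup>\<close>. On it \<open>D0\<close> is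
  \<open>\<Lambda>\<^sub>k\<^sup>-\<^sup>1 \<Sum>\<^sub>i \<Prod>\<^sub>j x\<^sub>i / (x\<^sub>i - x\<^sub>j) \<Gamma>\<^sub>i\<close>, with indices in \<open>{k..N}\<close>, and \<open>D1\<close> is
  \<open>(x\<^sub>k \<Lambda>\<^sub>k)\<^sup>-\<^sup>1 \<Sum>\<^sub>i x\<^sub>i \<Prod>\<^sub>j x\<^sub>i / (x\<^sub>i - x\<^sub>j) \<Gamma>\<^sub>i\<close>; up to the normalization they satisfy
  \<open>D0 D1 = q D1 D0\<close>.\<close>

type_synonym darray = "(nat \<Rightarrow> int) \<Rightarrow> (nat \<Rightarrow> int) \<Rightarrow> complex"

definition Dzero :: "nat \<Rightarrow> darray \<Rightarrow> darray" where
  "Dzero k F \<delta> \<kappa> = (\<Sum>i\<in>{k..N}. \<Sum>\<beta>\<in>ival N \<kappa>. op_coeff N k 0 i (\<kappa> - \<beta>) * (q powi (- \<beta> i) * F (\<delta> - rt k i) \<beta>))"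

definition Done :: "nat \<Rightarrow> darray \<Rightarrow> darray" where
  "Done k F \<delta> \<kappa> = (\<Sum>i\<in>{k..N}. \<Sum>\<beta>\<in>ival N \<kappa>. op_coeff N k 0 i (\<kappa> - \<beta> - rt k i) * (q powi (- \<beta> i) * F (\<delta> - rt k i) \<beta>))"

text \<open>The q-shift of the intermediate exponent \<beta> splits into that of \<beta> - \<beta>',
  which is \<Gamma>_i acting on the second coefficient, and that of \<beta>', which joins the
  array.\<close>

lemma D_compose:
  fixes A B :: "nat \<Rightarrow> (nat \<Rightarrow> int) \<Rightarrow> complex"
  shows "(\<Sum>i\<in>I. \<Sum>\<beta>\<in>ival N \<kappa>. A i (\<kappa> - \<beta>) * (q powi (- \<beta> i) *
      (\<Sum>j\<in>I. \<Sum>\<beta>'\<in>ival N \<beta>. B j (\<beta> - \<beta>') * (q powi (- \<beta>' j) * F (\<delta> - rt k i - rt k j) \<beta>')))) =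
    (\<Sum>\<beta>'\<in>ival N \<kappa>. \<Sum>i\<in>I. \<Sum>j\<in>I. conv N (A i) (\<lambda>\<nu>. q powi (- \<nu> i) * B j \<nu>) (\<kappa> - \<beta>') *
      (q powi (- \<beta>' i - \<beta>' j) * F (\<delta> - rt k i - rt k j) \<beta>'))"
    (is "?L = ?R")
proof -
  define w where "w i j \<beta>' = q powi (- \<beta>' i - \<beta>' j) * F (\<delta> - rt k i - rt k j) \<beta>'" for i j \<beta>'
  have "?L = (\<Sum>i\<in>I. \<Sum>\<beta>\<in>ival N \<kappa>. \<Sum>j\<in>I. A i (\<kappa> - \<beta>) * (\<Sum>\<beta>'\<in>ival N \<beta>. q powi (- (\<beta> - \<beta>') i) * B j (\<beta> - \<beta>') * w i j \<beta>'))"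
  proof (intro sum.cong refl)
    fix i \<beta>
    have "q powi (- \<beta> i) * (B j (\<beta> - \<beta>') * (q powi (- \<beta>' j) * F (\<delta> - rt k i - rt k j) \<beta>')) =
        q powi (- (\<beta> - \<beta>') i) * B j (\<beta> - \<beta>') * w i j \<beta>'" for j \<beta>'
    proof -
      have "q powi (- (\<beta> - \<beta>') i) * q powi (- \<beta>' i - \<beta>' j) = q powi (- \<beta> i) * q powi (- \<beta>' j)"
        by (simp flip: powi_add)
      then show ?thesis by (simp add: w_def mult_ac)
    qed
    then show "A i (\<kappa> - \<beta>) * (q powi (- \<beta> i) *
      (\<Sum>j\<in>I. \<Sum>\<beta>'\<in>ival N \<beta>. B j (\<beta> - \<beta>') * (q powi (- \<beta>' j) * F (\<delta> - rt k i - rt k j) \<beta>'))) =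
      (\<Sum>j\<in>I. A i (\<kappa> - \<beta>) * (\<Sum>\<beta>'\<in>ival N \<beta>. q powi (- (\<beta> - \<beta>') i) * B j (\<beta> - \<beta>') * w i j \<beta>'))"
      by (simp only: sum_distrib_left)
  qed
  also have "\<dots> = (\<Sum>i\<in>I. \<Sum>j\<in>I. \<Sum>\<beta>\<in>ival N \<kappa>. A i (\<kappa> - \<beta>) * (\<Sum>\<beta>'\<in>ival N \<beta>. q powi (- (\<beta> - \<beta>') i) * B j (\<beta> - \<beta>') * w i j \<beta>'))"
    by (intro sum.cong refl) (rule sum.swap)
  also have "\<dots> = (\<Sum>i\<in>I. \<Sum>j\<in>I. \<Sum>\<beta>'\<in>ival N \<kappa>. conv N (A i) (\<lambda>\<nu>. q powi (- \<nu> i) * B j \<nu>) (\<kappa> - \<beta>') * w i j \<beta>')"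
  proof (rule sum.cong[OF refl], rule sum.cong[OF refl])
    fix i j
    show "(\<Sum>\<beta>\<in>ival N \<kappa>. A i (\<kappa> - \<beta>) * (\<Sum>\<beta>'\<in>ival N \<beta>. q powi (- (\<beta> - \<beta>') i) * B j (\<beta> - \<beta>') * w i j \<beta>')) =
      (\<Sum>\<beta>'\<in>ival N \<kappa>. conv N (A i) (\<lambda>\<nu>. q powi (- \<nu> i) * B j \<nu>) (\<kappa> - \<beta>') * w i j \<beta>')"
      unfolding conv_nested[where a = "A i" and b = "\<lambda>\<nu> \<beta>'. q powi (- \<nu> i) * B j \<nu> * w i j \<beta>'"] conv_def sum_distrib_right
      by (simp only: mult.assoc)
  qed
  also have "\<dots> = ?R"
    unfolding w_def by (subst sum.swap[of _ I "ival N \<kappa>", symmetric]) (intro sum.cong refl sum.swap)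
  finally show ?thesis .
qed

text \<open>\<Gamma>_i and \<Gamma>_j commute and their shifts of \<delta> add up, so the weights
  \<open>w i j\<close> are symmetric and the antisymmetric defects cancel in pairs. The inserted
  power of q is the change of q^(\<delta>_k) under the shift of \<delta> by e_k - e_i; in this form
  the relation is applied to q^(\<delta>_k) D1.\<close>

lemma D_commute:
  assumes "1 \<le> k"
  shows "(\<Sum>i\<in>{k..N}. \<Sum>\<beta>\<in>ival N \<kappa>. op_coeff N k 0 i (\<kappa> - \<beta>) * (q powi (- \<beta> i) *
      (q powi (- of_bool (i \<noteq> k)) * Done k F (\<delta> - rt k i) \<beta>))) = Done k (Dzero k F) \<delta> \<kappa>"
proof -
  define w where "w i j \<beta>' = q powi (- \<beta>' i - \<beta>' j) * F (\<delta> - rt k i - rt k j) \<beta>'" for i j \<beta>'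
  have wsym: "w i j \<beta>' = w j i \<beta>'" for i j \<beta>'
  proof -
    have "- \<beta>' i - \<beta>' j = - \<beta>' j - \<beta>' i" "\<delta> - rt k i - rt k j = \<delta> - rt k j - rt k i"
      by simp_all
    then show ?thesis unfolding w_def by metis
  qed
  have 1: "Done k (Dzero k F) \<delta> \<kappa> = (\<Sum>\<beta>'\<in>ival N \<kappa>. \<Sum>i\<in>{k..N}. \<Sum>j\<in>{k..N}.
      conv N (\<lambda>\<nu>. op_coeff N k 0 i (\<nu> - rt k i)) (\<lambda>\<nu>. q powi (- \<nu> i) * op_coeff N k 0 j \<nu>) (\<kappa> - \<beta>') * w i j \<beta>')"
    unfolding Done_def Dzero_def w_def
    by (rule D_compose[where A = "\<lambda>i \<nu>. op_coeff N k 0 i (\<nu> - rt k i)" and B = "op_coeff N k 0"])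
  have "(\<Sum>i\<in>{k..N}. \<Sum>\<beta>\<in>ival N \<kappa>. (q powi (- of_bool (i \<noteq> k)) * op_coeff N k 0 i (\<kappa> - \<beta>)) * (q powi (- \<beta> i) *
       Done k F (\<delta> - rt k i) \<beta>)) = (\<Sum>\<beta>'\<in>ival N \<kappa>. \<Sum>i\<in>{k..N}. \<Sum>j\<in>{k..N}.
      conv N (\<lambda>\<nu>. q powi (- of_bool (i \<noteq> k)) * op_coeff N k 0 i \<nu>) (\<lambda>\<nu>. q powi (- \<nu> i) * op_coeff N k 0 j (\<nu> - rt k j)) (\<kappa> - \<beta>') * w i j \<beta>')"
    unfolding Done_def w_def
    by (rule D_compose[where A = "\<lambda>i \<nu>. q powi (- of_bool (i \<noteq> k)) * op_coeff N k 0 i \<nu>" and B = "\<lambda>j \<nu>. op_coeff N k 0 j (\<nu> - rt k j)"])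
  moreover have "conv N (\<lambda>\<nu>. q powi (- of_bool (i \<noteq> k)) * op_coeff N k 0 i \<nu>) b \<tau> = q powi (- of_bool (i \<noteq> k)) * conv N (op_coeff N k 0 i) b \<tau>" for i b \<tau>
    by (simp add: conv_def sum_distrib_left mult.assoc)
  ultimately have 2: "(\<Sum>i\<in>{k..N}. \<Sum>\<beta>\<in>ival N \<kappa>. op_coeff N k 0 i (\<kappa> - \<beta>) * (q powi (- \<beta> i) *
      (q powi (- of_bool (i \<noteq> k)) * Done k F (\<delta> - rt k i) \<beta>))) = (\<Sum>\<beta>'\<in>ival N \<kappa>. \<Sum>i\<in>{k..N}. \<Sum>j\<in>{k..N}.
      q powi (- of_bool (i \<noteq> k)) * conv N (op_coeff N k 0 i) (\<lambda>\<nu>. q powi (- \<nu> i) * op_coeff N k 0 j (\<nu> - rt k j)) (\<kappa> - \<beta>') * w i j \<beta>')"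
    by (simp only: mult_ac)
  have "(\<Sum>i\<in>{k..N}. \<Sum>j\<in>{k..N}. comm_defect q N k i j \<tau> * w i j \<beta>') = 0" (is "?S = 0") for \<tau> \<beta>'
  proof -
    have "?S = (\<Sum>i\<in>{k..N}. \<Sum>j\<in>{k..N}. comm_defect q N k j i \<tau> * w i j \<beta>')"
      by (subst sum.swap) (simp only: wsym)
    then have "2 * ?S = (\<Sum>i\<in>{k..N}. \<Sum>j\<in>{k..N}. comm_defect q N k i j \<tau> * w i j \<beta>' + comm_defect q N k j i \<tau> * w i j \<beta>')"
      by (simp only: sum.distrib mult_2)
    also have "\<dots> = 0"
      using comm_defect_antisym[OF assms]
      by (intro sum.neutral ballI) (simp flip: distrib_right)
    finally show ?thesis by simp
  qed
  then have "(\<Sum>\<beta>'\<in>ival N \<kappa>. \<Sum>i\<in>{k..N}. \<Sum>j\<in>{k..N}. comm_defect q N k i j (\<kappa> - \<beta>') * w i j \<beta>') = 0"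
    by simp
  then show ?thesis
    unfolding 1 2 comm_defect_def left_diff_distrib sum_subtractf by simp
qed

text \<open>D0 is triangular in \<kappa> with diagonal entry q^(-\<kappa>_k), because the constant
  term 0^(i-k) of the i-th coefficient vanishes for i > k. This entry differs from 1 unless
  \<kappa>_k = 0, so a fixed point is determined by its part with \<kappa>_k = 0.\<close>

lemma Dzero_unique:
  assumes k: "1 \<le> k" "k \<le> N"
    and F: "\<And>\<delta> \<kappa>. \<delta> \<in> Qtail N k \<Longrightarrow> \<kappa> \<in> Qtail N k \<Longrightarrow> Dzero k F \<delta> \<kappa> = F \<delta> \<kappa>"
    and out: "\<And>\<delta> \<kappa>. \<delta> \<notin> Qtail N k \<Longrightarrow> \<kappa> \<in> Qtail N k \<Longrightarrow> F \<delta> \<kappa> = 0"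
    and zero: "\<And>\<delta> \<kappa>. \<delta> \<in> Qtail N k \<Longrightarrow> \<kappa> \<in> Qtail N k \<Longrightarrow> \<kappa> k = 0 \<Longrightarrow> F \<delta> \<kappa> = 0"
    and \<kappa>: "\<kappa> \<in> Qtail N k"
  shows "F \<delta> \<kappa> = 0"
  using \<kappa>
proof (induction "height N \<kappa>" arbitrary: \<kappa> \<delta> rule: less_induct)
  case less
  show ?case
  proof (cases "\<delta> \<in> Qtail N k \<and> \<kappa> k \<noteq> 0")
    case False
    then show ?thesis using out zero less.prems by blast
  next
    case True
    have sub: "\<beta> \<in> Qtail N k" if "\<beta> \<in> ival N \<kappa>" "op_coeff N k 0 i (\<kappa> - \<beta>) \<noteq> 0" "i \<in> {k..N}" for \<beta> i
    proof -
      have "\<kappa> - \<beta> \<in> Qtail N k" using op_coeff_Qtail[OF k(1) _ _ that(2)] that by auto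
      then show ?thesis using less.prems that(1) by (auto simp: Qtail_def ival_def)
    qed
    have "F \<delta> \<kappa> = Dzero k F \<delta> \<kappa>" using F True less.prems by simp
    also have "\<dots> = (\<Sum>i\<in>{k..N}. \<Sum>\<beta>\<in>ival N \<kappa>. if i = k \<and> \<beta> = \<kappa> then q powi (- \<kappa> k) * F \<delta> \<kappa> else 0)"
      unfolding Dzero_def
    proof (intro sum.cong refl)
      fix i \<beta> assume i: "i \<in> {k..N}" and \<beta>: "\<beta> \<in> ival N \<kappa>"
      show "op_coeff N k 0 i (\<kappa> - \<beta>) * (q powi (- \<beta> i) * F (\<delta> - rt k i) \<beta>) = (if i = k \<and> \<beta> = \<kappa> then q powi (- \<kappa> k) * F \<delta> \<kappa> else 0)"
      proof (cases "\<beta> = \<kappa>")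
        case True
        then show ?thesis using i by (auto simp: op_coeff_0)
      next
        case False
        then have "op_coeff N k 0 i (\<kappa> - \<beta>) \<noteq> 0 \<Longrightarrow> F (\<delta> - rt k i) \<beta> = 0"
          using less.hyps[of \<beta> "\<delta> - rt k i"] height_ival[of \<beta> N \<kappa>] \<beta> sub[OF \<beta> _ i] by auto
        then show ?thesis using False by auto
      qed
    qed
    also have "\<dots> = (\<Sum>i\<in>{k..N}. if i = k then q powi (- \<kappa> k) * F \<delta> \<kappa> else 0)"
    proof (intro sum.cong refl)
      fix i
      show "(\<Sum>\<beta>\<in>ival N \<kappa>. if i = k \<and> \<beta> = \<kappa> then q powi (- \<kappa> k) * F \<delta> \<kappa> else 0) = (if i = k then q powi (- \<kappa> k) * F \<delta> \<kappa> else 0)"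
        using Qtail_Qplus[OF less.prems] by (cases "i = k") auto
    qed
    also have "\<dots> = q powi (- \<kappa> k) * F \<delta> \<kappa>" using k by simp
    finally have "(1 - q powi (- \<kappa> k)) * F \<delta> \<kappa> = 0" by (simp add: algebra_simps)
    then show ?thesis using powi_neq_1[of "- \<kappa> k"] True by simp
  qed
qed

end

section \<open>The universal q-Whittaker coefficients\<close>

definition first_index :: "(nat \<Rightarrow> int) \<Rightarrow> nat" where
  "first_index \<kappa> = (LEAST i. \<kappa> i \<noteq> 0)"

lemma first_index:
  assumes "\<kappa> \<in> Qplus N" "\<kappa> \<noteq> 0"
  shows "\<kappa> (first_index \<kappa>) \<noteq> 0" "\<kappa> \<in> Qtail N (first_index \<kappa>)" "1 \<le> first_index \<kappa>" "first_index \<kappa> \<le> N"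
proof -
  obtain i where "\<kappa> i \<noteq> 0" using assms(2) by (auto simp: fun_eq_iff)
  then show *: "\<kappa> (first_index \<kappa>) \<noteq> 0" unfolding first_index_def by (rule LeastI)
  show "\<kappa> \<in> Qtail N (first_index \<kappa>)" using assms(1) not_less_Least unfolding Qtail_def first_index_def by blast
  show "1 \<le> first_index \<kappa>" "first_index \<kappa> \<le> N" using * Qplus_ivec[OF assms(1)] by (force simp: ivec_def)+
qed

lemma first_index_eq: "\<kappa> \<in> Qtail N k \<Longrightarrow> \<kappa> k \<noteq> 0 \<Longrightarrow> first_index \<kappa> = k"
  unfolding first_index_def by (rule Least_equality) (auto simp: Qtail_def not_less[symmetric])

text \<open>Vanishing of the first entries is vanishing of the first partial sums, and nonnegative
  numbers with sum 0 are 0: \<open>Qtail\<close> is a face of the cone.\<close>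

lemma Qtail_split:
  assumes "a \<in> Qplus N" "b \<in> Qplus N" "a + b \<in> Qtail N k"
  shows "a \<in> Qtail N k"
proof -
  have z: "psum a i = 0" if "i < k" for i
    using Qtail_psum[OF assms(3) that] Qplus_psum[OF assms(1), of i] Qplus_psum[OF assms(2), of i]
    by (simp add: psum_add)
  have "a i = 0" if "i < k" for i
  proof (cases i)
    case 0
    then show ?thesis using Qplus_ivec[OF assms(1)] by (simp add: ivec_def)
  next
    case (Suc j)
    then show ?thesis using z[of i] z[of j] that by (simp add: psum_Suc)
  qed
  then show ?thesis using assms(1) by (simp add: Qtail_def)
qed

lemma Qtail_split_diff: "a \<in> Qplus N \<Longrightarrow> c - a \<in> Qplus N \<Longrightarrow> c \<in> Qtail N k \<Longrightarrow> a \<in> Qtail N k"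
  using Qtail_split[of a N "c - a" k] by simp

lemma ival_Qtail: "\<beta> \<in> ival N \<kappa> \<Longrightarrow> \<kappa> \<in> Qtail N k \<Longrightarrow> \<beta> \<in> Qtail N k"
  by (rule Qtail_split_diff) (auto simp: ival_def)

text \<open>The partial sums before k vanish and the one at k is m, so removing m copies of the
  simple root at k stays in the cone and eliminates x_k.\<close>

lemma Qtail_drop:
  assumes "\<gamma> \<in> Qtail N k" "\<gamma> k = int m" "1 \<le> k" "k < N"
  shows "\<gamma> - smul m (rt k (Suc k)) \<in> Qtail N (Suc k)"
proof -
  have ps: "psum (smul m (rt k (Suc k))) j = int m * of_bool (j = k)" for j
    using assms(3) unfolding smul_def psum_scale by (auto simp: psum_rt)
  have "psum \<gamma> k = int m"
  proof (cases k)
    case (Suc j)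
    then show ?thesis using assms Qtail_psum[OF assms(1), of j] by (simp add: psum_Suc)
  qed (use assms in simp)
  then have "\<gamma> - smul m (rt k (Suc k)) \<in> Qplus N"
    unfolding Qplus_iff
  proof (intro conjI allI)
    show "\<gamma> - smul m (rt k (Suc k)) \<in> ivec N"
      using assms Qplus_ivec[OF Qtail_Qplus[OF assms(1)]] by (auto simp: ivec_def smul_def rt_def)
    show "0 \<le> psum (\<gamma> - smul m (rt k (Suc k))) j" for j
      using \<open>psum \<gamma> k = int m\<close> Qplus_psum[OF Qtail_Qplus[OF assms(1)], of j] by (auto simp: psum_diff ps)
    show "psum (\<gamma> - smul m (rt k (Suc k))) N = 0"
      using assms Qplus_psum_N[OF Qtail_Qplus[OF assms(1)]] by (auto simp: psum_diff ps)
  qed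
  then show ?thesis
    using assms by (auto simp: Qtail_def smul_def rt_def less_Suc_eq)
qed

text \<open>The equation D0 W = W solved for its diagonal term, at the level k where \<kappa> has
  its first nonzero entry and 1 - q^(-\<kappa>_k) is invertible. Here \<open>c\<close> takes
  \<kappa> first, so that the recursion has functions of \<delta> as values.\<close>

definition whit_step :: "complex \<Rightarrow> nat \<Rightarrow> ((nat \<Rightarrow> int) \<Rightarrow> (nat \<Rightarrow> int) \<Rightarrow> complex) \<Rightarrow> (nat \<Rightarrow> int) \<Rightarrow> (nat \<Rightarrow> int) \<Rightarrow> complex" where
  "whit_step q N c \<kappa> = (if \<kappa> = 0 then delta0 else if \<kappa> \<in> Qplus N then
     (\<lambda>\<delta>. (\<Sum>i\<in>{first_index \<kappa>..N}. \<Sum>\<beta>\<in>ival N \<kappa> - {\<kappa>}. op_coeff N (first_index \<kappa>) 0 i (\<kappa> - \<beta>) * (q powi (- \<beta> i) * c \<beta> (\<delta> - rt (first_index \<kappa>) i)))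
        / (1 - q powi (- \<kappa> (first_index \<kappa>)))) else 0)"

definition whit_array :: "complex \<Rightarrow> nat \<Rightarrow> darray" where
  "whit_array q N \<delta> \<kappa> = (SOME c. \<forall>\<kappa>. c \<kappa> = whit_step q N c \<kappa>) \<kappa> \<delta>"

lemma whit_array_rec: "(\<lambda>\<delta>. whit_array q N \<delta> \<kappa>) = whit_step q N (\<lambda>\<kappa> \<delta>. whit_array q N \<delta> \<kappa>) \<kappa>"
proof -
  have "\<exists>c. \<forall>\<kappa>. c \<kappa> = whit_step q N c \<kappa>"
  proof (rule ex_height_rec[of N])
    fix c c' :: "(nat \<Rightarrow> int) \<Rightarrow> (nat \<Rightarrow> int) \<Rightarrow> complex" and \<kappa>
    assume *: "\<And>\<beta>. height N \<beta> < height N \<kappa> \<Longrightarrow> c \<beta> = c' \<beta>"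
    show "whit_step q N c \<kappa> = whit_step q N c' \<kappa>"
      unfolding whit_step_def using *[OF height_ival] by (intro if_cong refl ext arg_cong2[where f = "(/)"] sum.cong) auto
  qed
  from someI_ex[OF this] show ?thesis
    unfolding whit_array_def by (rule spec)
qed

lemma whit_array_0: "whit_array q N \<delta> 0 = delta0 \<delta>"
  using fun_cong[OF whit_array_rec[of q N 0], of \<delta>] by (simp add: whit_step_def)

lemma whit_array_eq:
  assumes "\<kappa> \<in> Qtail N k" "\<kappa> k \<noteq> 0"
  shows "whit_array q N \<delta> \<kappa> = (\<Sum>i\<in>{k..N}. \<Sum>\<beta>\<in>ival N \<kappa> - {\<kappa>}. op_coeff N k 0 i (\<kappa> - \<beta>) * (q powi (- \<beta> i) * whit_array q N (\<delta> - rt k i) \<beta>))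
        / (1 - q powi (- \<kappa> k))"
  using fun_cong[OF whit_array_rec[of q N \<kappa>], of \<delta>] assms Qtail_Qplus[OF assms(1)] first_index_eq[OF assms]
  by (auto simp: whit_step_def)

lemma whit_array_outside: "\<kappa> \<notin> Qplus N \<Longrightarrow> whit_array q N \<delta> \<kappa> = 0"
  using fun_cong[OF whit_array_rec[of q N \<kappa>], of \<delta>] by (auto simp: whit_step_def)

text \<open>A recursion step adds a root e_k - e_i to \<delta> and, by \<open>Kc0_shift\<close>, at
  least that root to \<kappa>. In particular every coefficient in x is a polynomial in the ratios of
  the \<Lambda>.\<close>

lemma whit_array_support:
  assumes "whit_array q N \<delta> \<kappa> \<noteq> 0"
  shows "\<delta> \<in> ival N \<kappa>"
  using assms
proof (induction "height N \<kappa>" arbitrary: \<delta> \<kappa> rule: less_induct)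
  case less
  have \<kappa>: "\<kappa> \<in> Qplus N" using whit_array_outside less.prems by blast
  show ?case
  proof (cases "\<kappa> = 0")
    case True
    then show ?thesis using less.prems by (auto simp: whit_array_0 delta0_def)
  next
    case False
    define k where "k = first_index \<kappa>"
    note k = first_index[OF \<kappa> False, folded k_def]
    have "(\<Sum>i\<in>{k..N}. \<Sum>\<beta>\<in>ival N \<kappa> - {\<kappa>}. op_coeff N k 0 i (\<kappa> - \<beta>) * (q powi (- \<beta> i) * whit_array q N (\<delta> - rt k i) \<beta>)) \<noteq> 0"
      using less.prems whit_array_eq[OF k(2,1), of q \<delta>] by auto
    then obtain i where i: "i \<in> {k..N}" and "(\<Sum>\<beta>\<in>ival N \<kappa> - {\<kappa>}. op_coeff N k 0 i (\<kappa> - \<beta>) * (q powi (- \<beta> i) * whit_array q N (\<delta> - rt k i) \<beta>)) \<noteq> 0"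
      by (rule sum.not_neutral_contains_not_neutral)
    from this(2) obtain \<beta> where \<beta>: "\<beta> \<in> ival N \<kappa> - {\<kappa>}"
      and nz: "op_coeff N k 0 i (\<kappa> - \<beta>) * (q powi (- \<beta> i) * whit_array q N (\<delta> - rt k i) \<beta>) \<noteq> 0"
      by (rule sum.not_neutral_contains_not_neutral)
    have 1: "\<delta> - rt k i \<in> Qplus N" "\<beta> - (\<delta> - rt k i) \<in> Qplus N"
      using less.hyps[OF height_ival[OF \<beta>], of "\<delta> - rt k i"] nz by (auto simp: ival_def)
    have 2: "\<kappa> - \<beta> - rt k i \<in> Qplus N"
      using Kc0_shift[OF k(3), of i N "\<kappa> - \<beta>"] i nz by (auto simp: Qtail_def)
    have "\<delta> \<in> Qplus N"
      using Qplus_add[OF 1(1) Qplus_rt[of k i N]] k i by simp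
    moreover have "\<kappa> - \<delta> \<in> Qplus N"
      using Qplus_add[OF 1(2) 2] by (simp add: algebra_simps)
    ultimately show ?thesis by (simp add: ival_def)
  qed
qed

lemma whit_array_Qtail: "whit_array q N \<delta> \<kappa> \<noteq> 0 \<Longrightarrow> \<kappa> \<in> Qtail N k \<Longrightarrow> \<delta> \<in> Qtail N k"
  using whit_array_support ival_Qtail by blast

section \<open>The q-Pochhammer operators on arrays\<close>

fun inv_qfact :: "complex \<Rightarrow> nat \<Rightarrow> complex" where
  "inv_qfact q 0 = 1"
| "inv_qfact q (Suc n) = inv_qfact q n / (1 - q ^ Suc n)"

text \<open>The operator \<open>inv_qpoch_op\<close> on arrays of numbers, with the Taylor
  coefficients replaced by Euler's 1 / (q; q)_n; the two are identified by
  \<open>qpoch_expansion\<close>.\<close>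

definition qpoch_op :: "complex \<Rightarrow> nat \<Rightarrow> nat \<Rightarrow> darray \<Rightarrow> darray" where
  "qpoch_op q N a F \<delta> \<beta> = (\<Sum>n | \<delta> - smul n (rt a (Suc a)) \<in> Qplus N. inv_qfact q n * F (\<delta> - smul n (rt a (Suc a))) \<beta>)"

definition qpoch_ops :: "complex \<Rightarrow> nat \<Rightarrow> nat \<Rightarrow> darray \<Rightarrow> darray" where
  "qpoch_ops q N k = foldr (\<circ>) (map (qpoch_op q N) [k..<N]) id"

lemma qpoch_ops_N [simp]: "qpoch_ops q N N = id"
  by (simp add: qpoch_ops_def)

lemma qpoch_ops_rec: "k < N \<Longrightarrow> qpoch_ops q N k F = qpoch_op q N k (qpoch_ops q N (Suc k) F)"
  by (simp add: qpoch_ops_def upt_conv_Cons)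

lemma finite_qpoch_op_index:
  assumes "1 \<le> a"
  shows "finite {n. \<delta> - smul n (rt a (Suc a)) \<in> Qplus N}"
proof (rule finite_subset)
  show "{n. \<delta> - smul n (rt a (Suc a)) \<in> Qplus N} \<subseteq> {..nat (psum \<delta> a)}"
  proof
    fix n assume "n \<in> {n. \<delta> - smul n (rt a (Suc a)) \<in> Qplus N}"
    then have "0 \<le> psum (\<delta> - smul n (rt a (Suc a))) a" by (auto intro: Qplus_psum)
    then have "int n \<le> psum \<delta> a"
      using assms unfolding psum_diff smul_def psum_scale by (simp add: psum_rt)
    then show "n \<in> {..nat (psum \<delta> a)}" by simp
  qed
qed simp

lemma qpoch_op_nz:
  assumes "qpoch_op q N a F \<delta> \<beta> \<noteq> 0"
  obtains n where "\<delta> - smul n (rt a (Suc a)) \<in> Qplus N" "F (\<delta> - smul n (rt a (Suc a))) \<beta> \<noteq> 0"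
proof -
  from assms obtain n where "n \<in> {n. \<delta> - smul n (rt a (Suc a)) \<in> Qplus N}"
    "inv_qfact q n * F (\<delta> - smul n (rt a (Suc a))) \<beta> \<noteq> 0"
    unfolding qpoch_op_def by (rule sum.not_neutral_contains_not_neutral)
  then show ?thesis using that by auto
qed

text \<open>The operators from k onwards move \<delta> only by simple roots e_a - e_(a+1) with a
  \<ge> k, so they keep it free of the variables below.\<close>

lemma qpoch_ops_Qtail:
  assumes "1 \<le> k" "k \<le> N" "qpoch_ops q N k (whit_array q N) \<delta> \<beta> \<noteq> 0" "\<beta> \<in> Qtail N k'" "k' \<le> k"
  shows "\<delta> \<in> Qtail N k'"
  using assms
proof (induction "N - k" arbitrary: k \<delta>)
  case 0
  then show ?case using whit_array_Qtail by auto
next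
  case (Suc n)
  then have "qpoch_op q N k (qpoch_ops q N (Suc k) (whit_array q N)) \<delta> \<beta> \<noteq> 0" by (simp add: qpoch_ops_rec)
  then obtain n where n: "qpoch_ops q N (Suc k) (whit_array q N) (\<delta> - smul n (rt k (Suc k))) \<beta> \<noteq> 0"
    by (rule qpoch_op_nz)
  have "\<delta> - smul n (rt k (Suc k)) \<in> Qtail N k'"
    by (rule Suc.hyps(1)[OF _ _ _ n]) (use Suc in auto)
  moreover have "smul n (rt k (Suc k)) \<in> Qtail N k'"
    by (rule Qtail_smul) (use Suc Qtail_rt[of k k "Suc k" N] Qtail_anti[of k' k N] in auto)
  ultimately show ?case using Qtail_add by fastforce
qed

lemma qpoch_ops_Qplus:
  assumes "1 \<le> k" "k \<le> N" "qpoch_ops q N k (whit_array q N) \<delta> \<beta> \<noteq> 0"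
  shows "\<delta> \<in> Qplus N" "\<beta> \<in> Qplus N"
proof -
  show "\<beta> \<in> Qplus N"
    using assms
  proof (induction "N - k" arbitrary: k \<delta>)
    case 0
    then show ?case using whit_array_outside by auto
  next
    case (Suc n)
    then have "qpoch_op q N k (qpoch_ops q N (Suc k) (whit_array q N)) \<delta> \<beta> \<noteq> 0" by (simp add: qpoch_ops_rec)
    then obtain n where n: "qpoch_ops q N (Suc k) (whit_array q N) (\<delta> - smul n (rt k (Suc k))) \<beta> \<noteq> 0"
      by (rule qpoch_op_nz)
    show ?case by (rule Suc.hyps(1)[OF _ _ _ n]) (use Suc in auto)
  qed
  then show "\<delta> \<in> Qplus N"
    using qpoch_ops_Qtail[OF assms, of 1] assms by simp
qed

section \<open>The equations of the array under D0 and D1\<close>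

context
  fixes q :: complex and N :: nat
  assumes q0: "q \<noteq> 0" and q1: "norm q < 1"
begin

text \<open>For \<kappa> free of x_k, both the coefficient and the array entry must have degree 0 in
  x_k, which leaves i = k, \<beta> = \<kappa> and the coefficient 1. The coefficients
  \<open>A\<close> are abstract because the lemma serves D0 and D1 alike.\<close>

lemma level_zero:
  assumes k: "1 \<le> k" "k \<le> N" and \<kappa>: "\<kappa> \<in> Qtail N k" "\<kappa> k = 0"
    and A: "\<And>i \<nu>. i \<in> {k..N} \<Longrightarrow> A i \<nu> \<noteq> 0 \<Longrightarrow> \<nu> \<in> Qtail N k"
      "\<And>i \<nu>. i \<in> {k<..N} \<Longrightarrow> A i \<nu> \<noteq> 0 \<Longrightarrow> \<nu> k \<noteq> 0"
      "\<And>\<nu>. A k \<nu> \<noteq> 0 \<Longrightarrow> \<nu> k = 0 \<Longrightarrow> \<nu> = 0" "A k 0 = (1::complex)"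
  shows "(\<Sum>i\<in>{k..N}. \<Sum>\<beta>\<in>ival N \<kappa>. A i (\<kappa> - \<beta>) * (q powi (- \<beta> i) * F (\<delta> - rt k i) \<beta>)) = F \<delta> \<kappa>"
proof -
  have "(\<Sum>i\<in>{k..N}. \<Sum>\<beta>\<in>ival N \<kappa>. A i (\<kappa> - \<beta>) * (q powi (- \<beta> i) * F (\<delta> - rt k i) \<beta>)) =
      (\<Sum>i\<in>{k..N}. \<Sum>\<beta>\<in>ival N \<kappa>. if i = k \<and> \<beta> = \<kappa> then F \<delta> \<kappa> else 0)"
  proof (intro sum.cong refl)
    fix i \<beta> assume i: "i \<in> {k..N}" and \<beta>: "\<beta> \<in> ival N \<kappa>"
    have "i = k \<and> \<beta> = \<kappa>" if nz: "A i (\<kappa> - \<beta>) \<noteq> 0"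
    proof -
      have "0 \<le> \<beta> k" "0 \<le> (\<kappa> - \<beta>) k"
        by (rule Qtail_nonneg[OF ival_Qtail[OF \<beta> \<kappa>(1)] k(1)], rule Qtail_nonneg[OF A(1)[OF i nz] k(1)])
      then have z: "(\<kappa> - \<beta>) k = 0" using \<kappa>(2) by simp
      have "i = k"
      proof (rule ccontr)
        assume "i \<noteq> k"
        then have "i \<in> {k<..N}" using i by auto
        from A(2)[OF this nz] z show False by contradiction
      qed
      have "\<kappa> - \<beta> = 0" by (rule A(3)) (use z nz \<open>i = k\<close> in simp_all)
      then show ?thesis using \<open>i = k\<close> by simp
    qed
    note ik = this
    show "A i (\<kappa> - \<beta>) * (q powi (- \<beta> i) * F (\<delta> - rt k i) \<beta>) = (if i = k \<and> \<beta> = \<kappa> then F \<delta> \<kappa> else 0)"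
    proof (cases "i = k \<and> \<beta> = \<kappa>")
      case True
      then show ?thesis by (simp add: A(4) \<kappa>(2))
    next
      case False
      then have "A i (\<kappa> - \<beta>) = 0" using ik by blast
      then show ?thesis using False by (simp only: mult_zero_left if_False)
    qed
  qed
  also have "\<dots> = (\<Sum>i\<in>{k..N}. if i = k then F \<delta> \<kappa> else 0)"
  proof (intro sum.cong refl)
    fix i
    show "(\<Sum>\<beta>\<in>ival N \<kappa>. if i = k \<and> \<beta> = \<kappa> then F \<delta> \<kappa> else 0) = (if i = k then F \<delta> \<kappa> else 0)"
      using Qtail_Qplus[OF \<kappa>(1)] by (cases "i = k") auto
  qed
  finally show ?thesis using k by simp
qed

lemma Dzero_split:
  assumes k: "1 \<le> k" "k \<le> N" and \<kappa>: "\<kappa> \<in> Qplus N"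
  shows "Dzero q N k F \<delta> \<kappa> = q powi (- \<kappa> k) * F \<delta> \<kappa> +
    (\<Sum>i\<in>{k..N}. \<Sum>\<beta>\<in>ival N \<kappa> - {\<kappa>}. op_coeff N k 0 i (\<kappa> - \<beta>) * (q powi (- \<beta> i) * F (\<delta> - rt k i) \<beta>))"
proof -
  have "Dzero q N k F \<delta> \<kappa> = (\<Sum>i\<in>{k..N}. (if i = k then q powi (- \<kappa> k) * F \<delta> \<kappa> else 0) +
     (\<Sum>\<beta>\<in>ival N \<kappa> - {\<kappa>}. op_coeff N k 0 i (\<kappa> - \<beta>) * (q powi (- \<beta> i) * F (\<delta> - rt k i) \<beta>)))"
    unfolding Dzero_def[OF q0 q1]
    by (intro sum.cong refl, subst sum.remove[OF finite_ival, of \<kappa>]) (use \<kappa> in \<open>auto simp: op_coeff_0\<close>)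
  then show ?thesis using k by (simp add: sum.distrib)
qed

lemma op_coeff_kernel:
  assumes "1 \<le> k" "i \<in> {k<..N}" "op_coeff N k 0 i \<nu> \<noteq> 0"
  shows "1 \<le> \<nu> k"
proof -
  have "\<nu> - rt k i \<in> Qtail N k" by (rule Kc0_shift) (use assms in auto)
  from Qtail_nonneg[OF this assms(1)] show ?thesis using assms by (auto simp: rt_def)
qed

text \<open>The recursion imposes the equation at one level only. At any smaller k one has
  \<kappa>_k = 0 and D0 acts as the identity, so the equations for all admissible k hold
  together.\<close>

lemma Dzero_whit_array:
  assumes k: "1 \<le> k" "k \<le> N" and \<kappa>: "\<kappa> \<in> Qtail N k"
  shows "Dzero q N k (whit_array q N) \<delta> \<kappa> = whit_array q N \<delta> \<kappa>"
proof (cases "\<kappa> k = 0")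
  case True
  show ?thesis
    unfolding Dzero_def[OF q0 q1]
  proof (rule level_zero[OF k \<kappa> True])
    show "\<nu> \<in> Qtail N k" if "i \<in> {k..N}" "op_coeff N k 0 i \<nu> \<noteq> 0" for i \<nu>
      by (rule op_coeff_Qtail[OF _ _ _ that(2)]) (use k that in auto)
    show "\<nu> k \<noteq> 0" if "i \<in> {k<..N}" "op_coeff N k 0 i \<nu> \<noteq> 0" for i \<nu>
      using op_coeff_kernel[OF k(1) that] by auto
    show "\<nu> = 0" if "op_coeff N k 0 k \<nu> \<noteq> 0" "\<nu> k = 0" for \<nu>
      by (rule op_coeff_same_0[OF k that])
    show "op_coeff N k 0 k 0 = 1" using k by (simp add: op_coeff_0)
  qed
next
  case False
  have "1 - q powi (- \<kappa> k) \<noteq> 0" using powi_neq_1[OF q0 q1, of "- \<kappa> k"] False by simp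
  then have "(1 - q powi (- \<kappa> k)) * whit_array q N \<delta> \<kappa> =
    (\<Sum>i\<in>{k..N}. \<Sum>\<beta>\<in>ival N \<kappa> - {\<kappa>}. op_coeff N k 0 i (\<kappa> - \<beta>) * (q powi (- \<beta> i) * whit_array q N (\<delta> - rt k i) \<beta>))"
    by (simp add: whit_array_eq[OF \<kappa> False])
  then show ?thesis
    unfolding Dzero_split[OF k Qtail_Qplus[OF \<kappa>]] by (simp add: algebra_simps)
qed

lemma Done_level_zero:
  assumes k: "1 \<le> k" "k \<le> N" and \<kappa>: "\<kappa> \<in> Qtail N k" "\<kappa> k = 0"
  shows "Done q N k F \<delta> \<kappa> = F \<delta> \<kappa>"
  unfolding Done_def[OF q0 q1]
proof (rule level_zero[OF k \<kappa>, of "\<lambda>i \<nu>. op_coeff N k 0 i (\<nu> - rt k i)"])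
  fix i \<nu> assume i: "i \<in> {k..N}" and nz: "op_coeff N k 0 i (\<nu> - rt k i) \<noteq> 0"
  have "\<nu> - rt k i \<in> Qtail N k" by (rule op_coeff_Qtail[OF _ _ _ nz]) (use k i in auto)
  then show "\<nu> \<in> Qtail N k" using Qtail_add[OF _ Qtail_rt[of k k i N]] k i by fastforce
next
  fix i \<nu> assume i: "i \<in> {k<..N}" and nz: "op_coeff N k 0 i (\<nu> - rt k i) \<noteq> 0"
  have "\<nu> - rt k i \<in> Qtail N k" by (rule op_coeff_Qtail[OF _ _ _ nz]) (use k i in auto)
  from Qtail_nonneg[OF this k(1)] show "\<nu> k \<noteq> 0" using i by (auto simp: rt_def)
qed (use k op_coeff_same_0[of k N 0] in \<open>auto simp: op_coeff_0\<close>)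

text \<open>After the normalization of \<open>Done\<close>, the operator \<Lambda>_k T_k is
  multiplication by q^(-\<delta>_k). The difference \<open>F\<close> is a fixed point of D0 by
  \<open>D_commute\<close>; where \<kappa>_k = 0 it vanishes, since D1 is the identity there and the
  support bound gives \<delta>_k = 0.\<close>

lemma Done_whit_array:
  assumes k: "1 \<le> k" "k \<le> N" and \<kappa>: "\<kappa> \<in> Qtail N k" and \<delta>: "\<delta> \<in> Qtail N k"
  shows "Done q N k (whit_array q N) \<delta> \<kappa> = q powi (- \<delta> k) * whit_array q N \<delta> \<kappa>"
proof -
  define F where "F \<delta> \<kappa> = q powi (\<delta> k) * Done q N k (whit_array q N) \<delta> \<kappa> - whit_array q N \<delta> \<kappa>" for \<delta> \<kappa>
  have "F \<delta> \<kappa> = 0"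
  proof (rule Dzero_unique[OF q0 q1 k _ _ _ \<kappa>, of F])
    fix \<delta> \<kappa> assume \<delta>: "\<delta> \<in> Qtail N k" and \<kappa>: "\<kappa> \<in> Qtail N k"
    have "Dzero q N k F \<delta> \<kappa> = (\<Sum>i\<in>{k..N}. \<Sum>\<beta>\<in>ival N \<kappa>. op_coeff N k 0 i (\<kappa> - \<beta>) * (q powi (- \<beta> i) *
        (q powi ((\<delta> - rt k i) k) * Done q N k (whit_array q N) (\<delta> - rt k i) \<beta>))) - Dzero q N k (whit_array q N) \<delta> \<kappa>"
      by (simp add: Dzero_def[OF q0 q1] F_def sum_subtractf right_diff_distrib)
    also have "(\<Sum>i\<in>{k..N}. \<Sum>\<beta>\<in>ival N \<kappa>. op_coeff N k 0 i (\<kappa> - \<beta>) * (q powi (- \<beta> i) *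
        (q powi ((\<delta> - rt k i) k) * Done q N k (whit_array q N) (\<delta> - rt k i) \<beta>))) =
        q powi (\<delta> k) * (\<Sum>i\<in>{k..N}. \<Sum>\<beta>\<in>ival N \<kappa>. op_coeff N k 0 i (\<kappa> - \<beta>) * (q powi (- \<beta> i) *
        (q powi (- of_bool (i \<noteq> k)) * Done q N k (whit_array q N) (\<delta> - rt k i) \<beta>)))"
      unfolding sum_distrib_left
    proof (intro sum.cong refl)
      fix i \<beta>
      have "(\<delta> - rt k i) k = \<delta> k + (- of_bool (i \<noteq> k))" by (auto simp: rt_def)
      then have "q powi ((\<delta> - rt k i) k) = q powi (\<delta> k) * q powi (- of_bool (i \<noteq> k))"
        by (simp only: powi_add[OF q0 q1])
      then show "op_coeff N k 0 i (\<kappa> - \<beta>) * (q powi (- \<beta> i) *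
        (q powi ((\<delta> - rt k i) k) * Done q N k (whit_array q N) (\<delta> - rt k i) \<beta>)) = q powi (\<delta> k) * (op_coeff N k 0 i (\<kappa> - \<beta>) * (q powi (- \<beta> i) *
        (q powi (- of_bool (i \<noteq> k)) * Done q N k (whit_array q N) (\<delta> - rt k i) \<beta>)))"
        by (simp only: mult_ac)
    qed
    also have "\<dots> = q powi (\<delta> k) * Done q N k (Dzero q N k (whit_array q N)) \<delta> \<kappa>"
      by (simp only: D_commute[OF q0 q1 k(1)])
    also have "Done q N k (Dzero q N k (whit_array q N)) \<delta> \<kappa> = Done q N k (whit_array q N) \<delta> \<kappa>"
      unfolding Done_def[OF q0 q1]
      by (intro sum.cong refl) (use Dzero_whit_array[OF k ival_Qtail[OF _ \<kappa>]] in simp)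
    finally show "Dzero q N k F \<delta> \<kappa> = F \<delta> \<kappa>"
      by (simp add: Dzero_whit_array[OF k \<kappa>]) (simp add: F_def)
  next
    fix \<delta> \<kappa> assume \<delta>: "\<delta> \<notin> Qtail N k" and \<kappa>: "\<kappa> \<in> Qtail N k"
    have "Done q N k (whit_array q N) \<delta> \<kappa> = 0"
      unfolding Done_def[OF q0 q1]
    proof (intro sum.neutral ballI)
      fix i \<beta> assume i: "i \<in> {k..N}" and \<beta>: "\<beta> \<in> ival N \<kappa>"
      have "whit_array q N (\<delta> - rt k i) \<beta> = 0"
      proof (rule ccontr)
        assume "whit_array q N (\<delta> - rt k i) \<beta> \<noteq> 0"
        then have "\<delta> - rt k i \<in> Qtail N k" using whit_array_Qtail ival_Qtail[OF \<beta> \<kappa>] by blast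
        then show False using Qtail_add[OF _ Qtail_rt[of k k i N]] k i \<delta> by fastforce
      qed
      then show "op_coeff N k 0 i (\<kappa> - \<beta> - rt k i) * (q powi (- \<beta> i) * whit_array q N (\<delta> - rt k i) \<beta>) = 0" by simp
    qed
    moreover have "whit_array q N \<delta> \<kappa> = 0" using whit_array_Qtail[OF _ \<kappa>] \<delta> by blast
    ultimately show "F \<delta> \<kappa> = 0" by (simp add: F_def)
  next
    fix \<delta> \<kappa> assume \<delta>: "\<delta> \<in> Qtail N k" and \<kappa>: "\<kappa> \<in> Qtail N k" "\<kappa> k = 0"
    have "\<delta> k = 0" if "whit_array q N \<delta> \<kappa> \<noteq> 0"
    proof -
      have "\<delta> \<in> Qtail N (Suc k)" using whit_array_Qtail[OF that, of "Suc k"] \<kappa> by (simp add: Qtail_Suc)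
      then show ?thesis by (simp add: Qtail_Suc)
    qed
    then show "F \<delta> \<kappa> = 0"
      by (cases "whit_array q N \<delta> \<kappa> = 0") (auto simp: F_def Done_level_zero[OF k \<kappa>])
  qed
  then have "q powi (\<delta> k) * Done q N k (whit_array q N) \<delta> \<kappa> = whit_array q N \<delta> \<kappa>" by (simp add: F_def)
  then have "q powi (- \<delta> k) * q powi (\<delta> k) * Done q N k (whit_array q N) \<delta> \<kappa> = q powi (- \<delta> k) * whit_array q N \<delta> \<kappa>"
    by simp
  then show ?thesis using q0 by (simp flip: powi_add[OF q0 q1])
qed

lemma one_minus_power_nz: "1 - q ^ Suc n \<noteq> 0"
  using powi_neq_1[OF q0 q1, of "int (Suc n)"] by (metis eq_iff_diff_eq_0 of_nat_eq_0_iff old.nat.distinct(2) power_int_of_nat)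

text \<open>The entries with \<delta>_k = \<kappa>_k = m, the largest \<delta>_k that the support
  allows. The step from m to m + 1 is one application of D1 in the variables after x_k: it
  contributes the eigenvalue q^(-\<delta>'_(k+1)) and the factor -q^m / (1 - q^(-(m+1))) = q^(2m+1)
  / (1 - q^(m+1)). The odd exponents add up to m^2.\<close>

lemma whit_array_extremal:
  assumes k: "1 \<le> k" "k < N" and \<beta>': "\<beta>' \<in> Qtail N (Suc k)" and \<delta>': "\<delta>' k = 0"
  shows "whit_array q N (smul m (rt k (Suc k)) + \<delta>') (smul m (rt k (Suc k)) + \<beta>') =
    q powi (int m * int m - int m * \<delta>' (Suc k)) * inv_qfact q m * whit_array q N \<delta>' \<beta>'"
  using \<beta>' \<delta>'
proof (induction m arbitrary: \<beta>' \<delta>')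
  case 0
  show "whit_array q N (smul 0 (rt k (Suc k)) + \<delta>') (smul 0 (rt k (Suc k)) + \<beta>') =
    q powi (int 0 * int 0 - int 0 * \<delta>' (Suc k)) * inv_qfact q 0 * whit_array q N \<delta>' \<beta>'" by simp
next
  case (Suc m)
  define \<alpha> where "\<alpha> = rt k (Suc k)"
  have \<alpha>k: "smul n \<alpha> k = int n" and \<alpha>Sk: "smul n \<alpha> (Suc k) = - int n" for n
    by (simp_all add: \<alpha>_def smul_def rt_def)
  have \<alpha>: "smul n \<alpha> \<in> Qtail N k" for n
    unfolding \<alpha>_def using k by (intro Qtail_smul Qtail_rt) auto
  define \<kappa> where "\<kappa> = smul (Suc m) \<alpha> + \<beta>'"
  define \<delta> where "\<delta> = smul (Suc m) \<alpha> + \<delta>'"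
  have \<beta>'k: "\<beta>' \<in> Qtail N k" "\<beta>' k = 0" using Suc.prems by (auto simp: Qtail_Suc)
  have \<kappa>: "\<kappa> \<in> Qtail N k" unfolding \<kappa>_def by (intro Qtail_add \<alpha> \<beta>'k)
  have \<kappa>k: "\<kappa> k = int (Suc m)" and \<delta>k: "\<delta> k = int (Suc m)"
    using Suc.prems \<beta>'k by (simp_all add: \<kappa>_def \<delta>_def \<alpha>k)
  have drop: "\<gamma> - smul n \<alpha> \<in> Qtail N (Suc k)" if "\<gamma> \<in> Qtail N k" "\<gamma> k = int n" for \<gamma> n
    unfolding \<alpha>_def by (rule Qtail_drop) (use that k in auto)
  have "whit_array q N \<delta> \<kappa> = q powi (int (Suc m) * int (Suc m) - int (Suc m) * \<delta>' (Suc k)) * inv_qfact q (Suc m) * whit_array q N \<delta>' \<beta>'"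
  proof (cases "\<delta>' \<in> Qtail N (Suc k)")
    case False
    have "whit_array q N \<delta>' \<beta>' = 0" using whit_array_Qtail[OF _ Suc.prems(1)] False by blast
    moreover have "whit_array q N \<delta> \<kappa> = 0"
    proof (rule ccontr)
      assume "whit_array q N \<delta> \<kappa> \<noteq> 0"
      from drop[OF whit_array_Qtail[OF this \<kappa>] \<delta>k] False show False unfolding \<delta>_def add_diff_cancel_left' by contradiction
    qed
    ultimately show ?thesis by simp
  next
    case True
    have \<delta>: "\<delta> \<in> Qtail N k" unfolding \<delta>_def using True by (intro Qtail_add \<alpha>) (simp add: Qtail_Suc)
    have rt_split: "rt k i = \<alpha> + rt (Suc k) i" for i
      by (auto simp: \<alpha>_def rt_def fun_eq_iff)
    define T where "T i \<beta> = op_coeff N k 0 i (\<kappa> - \<beta>) * (q powi (- \<beta> i) * whit_array q N (\<delta> - rt k i) \<beta>)" for i \<beta>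
    \<comment> \<open>The additional exponent m has two origins: for i = Suc k it comes from
      q^(-\<beta>_i), as m\<alpha> has the entry -m there; for larger i it comes from the induction
      hypothesis, where \<delta>' is shifted by e_(k+1) - e_i.\<close>
    define c where "c = q powi (int m * int m - int m * \<delta>' (Suc k) + int m) * inv_qfact q m"
    \<comment> \<open>For i = k the support gives \<beta>_k \<ge> \<delta>_k = \<kappa>_k, so the
      coefficient has degree 0 in x_k and must be the constant one, that is \<beta> =
      \<kappa>.\<close>
    have Tk: "T k \<beta> = 0" if "\<beta> \<in> ival N \<kappa> - {\<kappa>}" for \<beta>
    proof (rule ccontr)
      assume "T k \<beta> \<noteq> 0"
      then have nz: "op_coeff N k 0 k (\<kappa> - \<beta>) \<noteq> 0" "whit_array q N \<delta> \<beta> \<noteq> 0" by (auto simp: T_def)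
      have \<beta>: "\<beta> \<in> Qtail N k" using ival_Qtail[OF _ \<kappa>] that by auto
      have "\<kappa> - \<beta> \<in> Qtail N k" by (rule op_coeff_Qtail[OF _ _ _ nz(1)]) (use k in auto)
      moreover have "\<beta> - \<delta> \<in> Qtail N k"
        using whit_array_support[OF nz(2)] \<beta> \<delta> by (auto simp: ival_def Qtail_def)
      ultimately have "(\<kappa> - \<beta>) k = 0"
        using Qtail_nonneg[of "\<kappa> - \<beta>" N k] Qtail_nonneg[of "\<beta> - \<delta>" N k] \<kappa>k \<delta>k k by simp
      then have "\<kappa> - \<beta> = 0" using op_coeff_same_0[OF k(1) _ nz(1)] k by simp
      then show False using that by simp
    qed
    \<comment> \<open>For i > k the coefficient has degree at least 1 in 1 / x_k and the support
      gives \<beta>_k \<ge> m, so both bounds are attained and the factor with j = k contributes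
      -x_i / x_k. Because e_k - e_i = \<alpha> + (e_(k+1) - e_i), what is left is a coefficient of
      D1 one level up.\<close>
    have Ti: "(\<Sum>\<beta>\<in>ival N \<kappa> - {\<kappa>}. T i \<beta>) = (\<Sum>\<beta>''\<in>ival N \<beta>'. - c * (op_coeff N (Suc k) 0 i (\<beta>' - \<beta>'' - rt (Suc k) i) *
        (q powi (- \<beta>'' i) * whit_array q N (\<delta>' - rt (Suc k) i) \<beta>'')))" if i: "i \<in> {Suc k..N}" for i
    proof -
      have "(\<Sum>\<beta>''\<in>ival N \<beta>'. - c * (op_coeff N (Suc k) 0 i (\<beta>' - \<beta>'' - rt (Suc k) i) *
        (q powi (- \<beta>'' i) * whit_array q N (\<delta>' - rt (Suc k) i) \<beta>''))) = (\<Sum>\<beta>''\<in>ival N \<beta>'. T i (smul m \<alpha> + \<beta>''))"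
      proof (intro sum.cong refl)
        fix \<beta>'' assume \<beta>'': "\<beta>'' \<in> ival N \<beta>'"
        have \<beta>''k: "\<beta>'' \<in> Qtail N (Suc k)" using ival_Qtail[OF \<beta>''] Suc.prems by blast
        then have z: "\<beta>'' k = 0" by (simp add: Qtail_Suc)
        have "op_coeff N k 0 i (\<kappa> - (smul m \<alpha> + \<beta>'')) = - op_coeff N (Suc k) 0 i (\<kappa> - (smul m \<alpha> + \<beta>'') - smul 1 (rt k i))"
          using op_coeff_level[of k i N "\<kappa> - (smul m \<alpha> + \<beta>'')" 1 0] i k \<kappa>k \<alpha>k z by simp
        also have "\<kappa> - (smul m \<alpha> + \<beta>'') - smul 1 (rt k i) = \<beta>' - \<beta>'' - rt (Suc k) i"
          by (simp add: \<kappa>_def smul_Suc rt_split algebra_simps)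
        finally have 1: "op_coeff N k 0 i (\<kappa> - (smul m \<alpha> + \<beta>'')) = - op_coeff N (Suc k) 0 i (\<beta>' - \<beta>'' - rt (Suc k) i)" .
        have "whit_array q N (smul m \<alpha> + (\<delta>' - rt (Suc k) i)) (smul m \<alpha> + \<beta>'') =
          q powi (int m * int m - int m * (\<delta>' - rt (Suc k) i) (Suc k)) * inv_qfact q m * whit_array q N (\<delta>' - rt (Suc k) i) \<beta>''"
          unfolding \<alpha>_def by (rule Suc.IH) (use \<beta>''k Suc.prems i in \<open>auto simp: rt_def\<close>)
        moreover have "\<delta> - rt k i = smul m \<alpha> + (\<delta>' - rt (Suc k) i)"
          by (simp add: \<delta>_def smul_Suc rt_split algebra_simps)
        ultimately have 2: "whit_array q N (\<delta> - rt k i) (smul m \<alpha> + \<beta>'') =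
          q powi (int m * int m - int m * (\<delta>' - rt (Suc k) i) (Suc k)) * inv_qfact q m * whit_array q N (\<delta>' - rt (Suc k) i) \<beta>''"
          by simp
        have "q powi (- (smul m \<alpha> + \<beta>'') i) * q powi (int m * int m - int m * (\<delta>' - rt (Suc k) i) (Suc k)) =
          q powi (int m * int m - int m * \<delta>' (Suc k) + int m) * q powi (- \<beta>'' i)"
          unfolding powi_add[OF q0 q1, symmetric]
          by (rule arg_cong[where f = "\<lambda>n. q powi n"]) (use i in \<open>auto simp: \<alpha>_def smul_def rt_def algebra_simps\<close>)
        then show "- c * (op_coeff N (Suc k) 0 i (\<beta>' - \<beta>'' - rt (Suc k) i) *
          (q powi (- \<beta>'' i) * whit_array q N (\<delta>' - rt (Suc k) i) \<beta>'')) = T i (smul m \<alpha> + \<beta>'')"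
          unfolding T_def 1 2 c_def by (simp add: mult_ac)
      qed
      also have "\<dots> = (\<Sum>\<beta>\<in>(\<lambda>\<beta>''. smul m \<alpha> + \<beta>'') ` ival N \<beta>'. T i \<beta>)"
        by (simp add: sum.reindex)
      also have "\<dots> = (\<Sum>\<beta>\<in>ival N \<kappa> - {\<kappa>}. T i \<beta>)"
      proof (rule sum.mono_neutral_left)
        show "(\<lambda>\<beta>''. smul m \<alpha> + \<beta>'') ` ival N \<beta>' \<subseteq> ival N \<kappa> - {\<kappa>}"
        proof clarify
          fix \<beta>'' assume \<beta>'': "\<beta>'' \<in> ival N \<beta>'"
          have "\<beta>'' \<in> Qtail N (Suc k)" using ival_Qtail[OF \<beta>''] Suc.prems by blast
          then have "\<beta>'' k = 0" by (simp add: Qtail_Suc)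
          then have "smul m \<alpha> + \<beta>'' \<noteq> \<kappa>" using \<kappa>k \<alpha>k[of m] by auto
          moreover have "smul m \<alpha> + \<beta>'' \<in> Qplus N" "\<kappa> - (smul m \<alpha> + \<beta>'') \<in> Qplus N"
            using \<beta>'' Qplus_add[OF Qtail_Qplus[OF \<alpha>[of m]], of \<beta>''] Qplus_add[OF Qtail_Qplus[OF \<alpha>[of 1]], of "\<beta>' - \<beta>''"]
            by (auto simp: ival_def \<kappa>_def smul_Suc algebra_simps)
          ultimately show "smul m \<alpha> + \<beta>'' \<in> ival N \<kappa> - {\<kappa>}" by (simp add: ival_def)
        qed
        show "\<forall>\<beta>\<in>ival N \<kappa> - {\<kappa>} - (\<lambda>\<beta>''. smul m \<alpha> + \<beta>'') ` ival N \<beta>'. T i \<beta> = 0"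
        proof (intro ballI, rule ccontr)
          fix \<beta> assume \<beta>: "\<beta> \<in> ival N \<kappa> - {\<kappa>} - (\<lambda>\<beta>''. smul m \<alpha> + \<beta>'') ` ival N \<beta>'" and "T i \<beta> \<noteq> 0"
          then have nz: "op_coeff N k 0 i (\<kappa> - \<beta>) \<noteq> 0" "whit_array q N (\<delta> - rt k i) \<beta> \<noteq> 0" by (auto simp: T_def)
          have \<beta>k: "\<beta> \<in> Qtail N k" using ival_Qtail[OF _ \<kappa>] \<beta> by auto
          have \<kappa>\<beta>: "\<kappa> - \<beta> \<in> Qtail N k" by (rule op_coeff_Qtail[OF _ _ _ nz(1)]) (use k i in auto)
          have "1 \<le> (\<kappa> - \<beta>) k" by (rule op_coeff_kernel[OF k(1) _ nz(1)]) (use i in auto)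
          moreover have "\<delta> - rt k i \<in> Qtail N k" using whit_array_Qtail[OF nz(2) \<beta>k] .
          then have "\<beta> - (\<delta> - rt k i) \<in> Qtail N k"
            using whit_array_support[OF nz(2)] \<beta>k by (auto simp: ival_def Qtail_def)
          from Qtail_nonneg[OF this k(1)] have "int m \<le> \<beta> k" using \<delta>k i by (auto simp: rt_def)
          ultimately have bk: "\<beta> k = int m" "(\<kappa> - \<beta>) k = int 1" using \<kappa>k by auto
          have "\<beta> - smul m \<alpha> \<in> Qtail N (Suc k)" "\<kappa> - \<beta> - smul 1 \<alpha> \<in> Qtail N (Suc k)"
            by (rule drop[OF \<beta>k bk(1)], rule drop[OF \<kappa>\<beta> bk(2)])
          then have "\<beta> - smul m \<alpha> \<in> ival N \<beta>'"
            by (auto simp: ival_def Qtail_def \<kappa>_def smul_Suc algebra_simps)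
          then have "\<beta> \<in> (\<lambda>\<beta>''. smul m \<alpha> + \<beta>'') ` ival N \<beta>'"
            by (rule rev_image_eqI) simp
          with \<beta> show False by blast
        qed
      qed simp
      finally show ?thesis ..
    qed
    have "(\<Sum>i\<in>{k..N}. \<Sum>\<beta>\<in>ival N \<kappa> - {\<kappa>}. T i \<beta>) = (\<Sum>i\<in>{Suc k..N}. \<Sum>\<beta>\<in>ival N \<kappa> - {\<kappa>}. T i \<beta>)"
      using k Tk by (subst sum.atLeast_Suc_atMost) auto
    also have "\<dots> = - c * Done q N (Suc k) (whit_array q N) \<delta>' \<beta>'"
      unfolding Done_def[OF q0 q1] sum_distrib_left by (rule sum.cong[OF refl Ti])
    also have "\<dots> = - c * (q powi (- \<delta>' (Suc k)) * whit_array q N \<delta>' \<beta>')"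
      using Done_whit_array[OF _ _ Suc.prems(1) True] k by simp
    finally have S: "(\<Sum>i\<in>{k..N}. \<Sum>\<beta>\<in>ival N \<kappa> - {\<kappa>}. T i \<beta>) = - c * (q powi (- \<delta>' (Suc k)) * whit_array q N \<delta>' \<beta>')" .
    define Q where "Q = q powi (int m * int m + int m - int (Suc m) * \<delta>' (Suc k)) * inv_qfact q m * whit_array q N \<delta>' \<beta>'"
    have "c * (q powi (- \<delta>' (Suc k)) * whit_array q N \<delta>' \<beta>') = Q"
    proof -
      have "q powi (int m * int m - int m * \<delta>' (Suc k) + int m) * q powi (- \<delta>' (Suc k)) =
          q powi (int m * int m + int m - int (Suc m) * \<delta>' (Suc k))"
        unfolding powi_add[OF q0 q1, symmetric] by (simp add: algebra_simps)
      then show ?thesis by (simp add: c_def Q_def mult_ac)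
    qed
    with S have "Dzero q N k (whit_array q N) \<delta> \<kappa> = q powi (- int (Suc m)) * whit_array q N \<delta> \<kappa> - Q"
      using Dzero_split[OF k(1) _ Qtail_Qplus[OF \<kappa>], of "whit_array q N" \<delta>] k by (simp only: T_def \<kappa>k) simp
    then have eq: "(1 - q powi (- int (Suc m))) * whit_array q N \<delta> \<kappa> = - Q"
      using Dzero_whit_array[OF k(1) _ \<kappa>, of \<delta>] k by (simp add: algebra_simps)
    have nz: "1 - q powi (- int (Suc m)) \<noteq> 0" using powi_neq_1[OF q0 q1, of "- int (Suc m)"] by simp
    have "(1 - q powi (- int (Suc m))) * (q powi (int (Suc m) * int (Suc m) - int (Suc m) * \<delta>' (Suc k)) * inv_qfact q (Suc m) * whit_array q N \<delta>' \<beta>') = - Q"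
    proof -
      \<comment> \<open>From (m+1)^2 = (m^2 + m) + (m + 1): the factor q^(m+1) turns 1 - q^(-(m+1))
        into -(1 - q^(m+1)), the next factor of (q; q)_(m+1).\<close>
      define z where "z = q powi (int m * int m + int m - int (Suc m) * \<delta>' (Suc k))"
      have "q powi (int (Suc m) * int (Suc m) - int (Suc m) * \<delta>' (Suc k)) = q powi (int (Suc m)) * z"
        unfolding z_def powi_add[OF q0 q1, symmetric] by (simp add: algebra_simps)
      then have "(1 - q powi (- int (Suc m))) * q powi (int (Suc m) * int (Suc m) - int (Suc m) * \<delta>' (Suc k)) =
          q powi (int (Suc m)) * z - (q powi (- int (Suc m)) * q powi (int (Suc m))) * z"
        by (simp only: left_diff_distrib mult.assoc mult_1)
      also have "q powi (- int (Suc m)) * q powi (int (Suc m)) = 1"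
        unfolding powi_add[OF q0 q1, symmetric] by simp
      also have "q powi (int (Suc m)) * z - 1 * z = - (1 - q ^ Suc m) * z"
        unfolding power_int_of_nat by (simp add: algebra_simps)
      finally have e: "(1 - q powi (- int (Suc m))) * q powi (int (Suc m) * int (Suc m) - int (Suc m) * \<delta>' (Suc k)) =
          - (1 - q ^ Suc m) * z" .
      have "- D * z * (y / D) = - z * y" if "D \<noteq> 0" for D y :: complex
        using that by simp
      from this[OF one_minus_power_nz[of m], of "inv_qfact q m"]
      have "(1 - q powi (- int (Suc m))) * q powi (int (Suc m) * int (Suc m) - int (Suc m) * \<delta>' (Suc k)) * inv_qfact q (Suc m)
          = - z * inv_qfact q m"
        by (simp only: e inv_qfact.simps)
      then show ?thesis
        unfolding Q_def z_def[symmetric] by (simp only: mult.assoc[symmetric]) simp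
    qed
    then show ?thesis
      using eq nz by (metis mult_cancel_left)
  qed
  then show ?case by (simp only: \<delta>_def \<kappa>_def \<alpha>_def)
qed

end

section \<open>The operator g on the universal coefficients\<close>

definition norm_sq :: "nat \<Rightarrow> (nat \<Rightarrow> int) \<Rightarrow> int" where
  "norm_sq N \<delta> = (\<Sum>i\<in>{1..N}. (\<delta> i)\<^sup>2)"

lemma norm_sq_rt:
  assumes "k \<in> {1..N}" "i \<in> {1..N}"
  shows "norm_sq N (\<delta> - rt k i) = norm_sq N \<delta> - 2 * \<delta> k + 2 * \<delta> i + 2 * of_bool (i \<noteq> k)"
proof (cases "i = k")
  case False
  have "norm_sq N (\<delta> - rt k i) = (\<Sum>j\<in>{1..N}. (\<delta> j)\<^sup>2 + (if j = k then 1 - 2 * \<delta> k else 0) + (if j = i then 1 + 2 * \<delta> i else 0))"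
    unfolding norm_sq_def by (intro sum.cong refl) (use False in \<open>auto simp: rt_def power2_eq_square algebra_simps\<close>)
  also have "\<dots> = norm_sq N \<delta> + (1 - 2 * \<delta> k) + (1 + 2 * \<delta> i)"
    using assms by (simp add: sum.distrib norm_sq_def)
  finally show ?thesis using False by simp
qed simp

lemma norm_sq_smul:
  assumes "1 \<le> k" "k < N"
  shows "norm_sq N (smul m (rt k (Suc k)) + \<delta>) = norm_sq N \<delta> + 2 * (int m * int m) + 2 * int m * (\<delta> k - \<delta> (Suc k))"
proof -
  have "norm_sq N (smul m (rt k (Suc k)) + \<delta>) = (\<Sum>j\<in>{1..N}. (\<delta> j)\<^sup>2 + (if j = k then int m * int m + 2 * int m * \<delta> k else 0) +
      (if j = Suc k then int m * int m - 2 * int m * \<delta> (Suc k) else 0))"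
    unfolding norm_sq_def by (intro sum.cong refl) (auto simp: smul_def rt_def power2_eq_square algebra_simps)
  also have "\<dots> = norm_sq N \<delta> + (int m * int m + 2 * int m * \<delta> k) + (int m * int m - 2 * int m * \<delta> (Suc k))"
    using assms by (simp add: sum.distrib norm_sq_def)
  finally show ?thesis by (simp add: algebra_simps)
qed

text \<open>q^(-|\<delta>|^2 / 2), the inverse of the constant that the Gaussian in T attaches to
  \<Lambda>^(-\<delta>). The logarithm \<open>lq\<close> gives a meaning to the half-integral
  exponents of general vectors.\<close>

definition inv_gauss :: "nat \<Rightarrow> complex \<Rightarrow> (nat \<Rightarrow> int) \<Rightarrow> complex" where
  "inv_gauss N lq \<delta> = exp (- (lq * of_int (norm_sq N \<delta>) / 2))"

lemma exp_powi: "exp lq = q \<Longrightarrow> q powi n = exp (lq * of_int n)" for q lq :: complex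
  using exp_power_int[of lq n] by (simp add: mult.commute)

lemma inv_gauss_shift:
  assumes "exp lq = q" "norm_sq N \<delta>' = norm_sq N \<delta> + 2 * n"
  shows "inv_gauss N lq \<delta>' = inv_gauss N lq \<delta> * q powi (- n)"
  unfolding inv_gauss_def exp_powi[OF assms(1)] assms(2) exp_add[symmetric]
  by (rule arg_cong[where f = exp]) (simp add: field_simps)

text \<open>The array of G^-1 gamma Psi, where G is the Gaussian in T. Since G multiplies the entry
  (\<delta>, \<beta>) by gamma x^(-\<delta>) q^(|\<delta>|^2 / 2), the entry at \<beta> stems from
  the exponent \<beta> + \<delta> of Psi.\<close>

definition shifted_array :: "complex \<Rightarrow> nat \<Rightarrow> complex \<Rightarrow> darray" where
  "shifted_array q N lq \<delta> \<beta> = inv_gauss N lq \<delta> * whit_array q N \<delta> (\<beta> + \<delta>)"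

context
  fixes q lq :: complex and N :: nat
  assumes q0: "q \<noteq> 0" and q1: "norm q < 1" and lq: "exp lq = q"
begin

text \<open>Put \<beta>' = \<beta> + \<delta> - (e_k - e_i). The Gaussian changes by q^(\<delta>_k -
  \<delta>_i - [i \<noteq> k]), which turns q^(-\<beta>_i) into q^(\<delta>_k) q^(-\<beta>'_i), and
  the coefficient becomes that of D1 at \<kappa> + \<delta>. The eigenvalue q^(-\<delta>_k) of D1
  cancels the prefactor.\<close>

lemma Dzero_shifted_array:
  assumes k: "1 \<le> k" "k \<le> N" and \<delta>: "\<delta> \<in> Qtail N k" and \<kappa>: "\<kappa> \<in> Qtail N k"
  shows "Dzero q N k (shifted_array q N lq) \<delta> \<kappa> = shifted_array q N lq \<delta> \<kappa>"
proof -
  define c where "c = inv_gauss N lq \<delta> * q powi (\<delta> k)"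
  have "Dzero q N k (shifted_array q N lq) \<delta> \<kappa> = (\<Sum>i\<in>{k..N}. \<Sum>\<beta>'\<in>ival N (\<kappa> + \<delta>). c * (op_coeff N k 0 i (\<kappa> + \<delta> - \<beta>' - rt k i) *
      (q powi (- \<beta>' i) * whit_array q N (\<delta> - rt k i) \<beta>')))"
    unfolding Dzero_def[OF q0 q1]
  proof (rule sum.cong[OF refl])
    fix i assume i: "i \<in> {k..N}"
    define L where "L \<beta> = op_coeff N k 0 i (\<kappa> - \<beta>) * (q powi (- \<beta> i) * shifted_array q N lq (\<delta> - rt k i) \<beta>)" for \<beta>
    define R where "R \<beta>' = c * (op_coeff N k 0 i (\<kappa> + \<delta> - \<beta>' - rt k i) * (q powi (- \<beta>' i) * whit_array q N (\<delta> - rt k i) \<beta>'))" for \<beta>'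
    have LR: "L \<beta> = R (\<beta> + (\<delta> - rt k i))" for \<beta>
    proof -
      have inv_gauss_eq: "inv_gauss N lq (\<delta> - rt k i) = inv_gauss N lq \<delta> * q powi (\<delta> k - \<delta> i - of_bool (i \<noteq> k))"
        using inv_gauss_shift[OF lq, of N "\<delta> - rt k i" \<delta> "- \<delta> k + \<delta> i + of_bool (i \<noteq> k)"] norm_sq_rt[of k N i \<delta>] i k
        by (simp add: algebra_simps)
      moreover have "q powi (- \<beta> i) * q powi (\<delta> k - \<delta> i - of_bool (i \<noteq> k)) = q powi (\<delta> k) * q powi (- (\<beta> + (\<delta> - rt k i)) i)"
        unfolding powi_add[OF q0 q1, symmetric]
        by (rule arg_cong[where f = "\<lambda>n. q powi n"]) (auto simp: rt_def)
      moreover have "\<kappa> + \<delta> - (\<beta> + (\<delta> - rt k i)) - rt k i = \<kappa> - \<beta>" by (simp add: algebra_simps)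
      ultimately have "op_coeff N k 0 i (\<kappa> - \<beta>) * whit_array q N (\<delta> - rt k i) (\<beta> + (\<delta> - rt k i)) *
          (inv_gauss N lq \<delta> * (q powi (- \<beta> i) * q powi (\<delta> k - \<delta> i - of_bool (i \<noteq> k)))) = R (\<beta> + (\<delta> - rt k i))"
        by (simp only: R_def c_def mult_ac)
      moreover have "L \<beta> = op_coeff N k 0 i (\<kappa> - \<beta>) * whit_array q N (\<delta> - rt k i) (\<beta> + (\<delta> - rt k i)) *
          (inv_gauss N lq \<delta> * (q powi (- \<beta> i) * q powi (\<delta> k - \<delta> i - of_bool (i \<noteq> k))))"
        unfolding L_def shifted_array_def inv_gauss_eq by (simp only: mult_ac)
      ultimately show ?thesis by simp
    qed
    have "sum L (ival N \<kappa>) = sum R (ival N (\<kappa> + \<delta>))"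
    \<comment> \<open>The translation need not map one interval onto the other. It matches the
      nonzero terms, by the support of the array and the divisibility of the coefficients.\<close>
    proof (rule sum.reindex_bij_witness_not_neutral[where S' = "{\<beta>\<in>ival N \<kappa>. L \<beta> = 0}" and T' = "{\<beta>\<in>ival N (\<kappa> + \<delta>). R \<beta> = 0}"
          and j = "\<lambda>\<beta>. \<beta> + (\<delta> - rt k i)" and i = "\<lambda>\<beta>. \<beta> - (\<delta> - rt k i)"])
      show "\<beta> + (\<delta> - rt k i) \<in> ival N (\<kappa> + \<delta>) - {\<beta>\<in>ival N (\<kappa> + \<delta>). R \<beta> = 0}"
        if "\<beta> \<in> ival N \<kappa> - {\<beta>\<in>ival N \<kappa>. L \<beta> = 0}" for \<beta>
      proof -
        have nz: "op_coeff N k 0 i (\<kappa> - \<beta>) \<noteq> 0" "whit_array q N (\<delta> - rt k i) (\<beta> + (\<delta> - rt k i)) \<noteq> 0"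
          using that by (auto simp: L_def shifted_array_def)
        have "\<kappa> + \<delta> - (\<beta> + (\<delta> - rt k i)) = (\<kappa> - \<beta> - rt k i) + rt k i + rt k i" by (simp add: algebra_simps)
        moreover have "\<kappa> - \<beta> - rt k i \<in> Qplus N" "rt k i \<in> Qplus N"
          using Kc0_shift[OF k(1) _ _ nz(1)] i k by (auto simp: Qtail_def intro: Qplus_rt)
        ultimately have "\<kappa> + \<delta> - (\<beta> + (\<delta> - rt k i)) \<in> Qplus N" by (simp only: Qplus_add)
        moreover have "\<beta> + (\<delta> - rt k i) \<in> Qplus N" using ival_Qplus[OF whit_array_support[OF nz(2)]] .
        ultimately show ?thesis using that by (simp add: ival_def LR)
      qed
      show "\<beta> - (\<delta> - rt k i) \<in> ival N \<kappa> - {\<beta>\<in>ival N \<kappa>. L \<beta> = 0}"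
        if "\<beta> \<in> ival N (\<kappa> + \<delta>) - {\<beta>\<in>ival N (\<kappa> + \<delta>). R \<beta> = 0}" for \<beta>
      proof -
        have nz: "op_coeff N k 0 i (\<kappa> + \<delta> - \<beta> - rt k i) \<noteq> 0" "whit_array q N (\<delta> - rt k i) \<beta> \<noteq> 0"
          using that by (auto simp: R_def)
        have "\<kappa> - (\<beta> - (\<delta> - rt k i)) = \<kappa> + \<delta> - \<beta> - rt k i" by (simp add: algebra_simps)
        moreover have "\<kappa> + \<delta> - \<beta> - rt k i \<in> Qplus N"
          using op_coeff_Qtail[OF k(1) _ _ nz(1)] i by (auto simp: Qtail_def)
        ultimately have "\<kappa> - (\<beta> - (\<delta> - rt k i)) \<in> Qplus N" by (simp only:)
        moreover have "\<beta> - (\<delta> - rt k i) \<in> Qplus N" using whit_array_support[OF nz(2)] by (simp add: ival_def)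
        ultimately show ?thesis using that by (simp add: ival_def LR)
      qed
    qed (auto simp: LR)
    then show "(\<Sum>\<beta>\<in>ival N \<kappa>. op_coeff N k 0 i (\<kappa> - \<beta>) * (q powi (- \<beta> i) * shifted_array q N lq (\<delta> - rt k i) \<beta>)) =
      (\<Sum>\<beta>'\<in>ival N (\<kappa> + \<delta>). c * (op_coeff N k 0 i (\<kappa> + \<delta> - \<beta>' - rt k i) * (q powi (- \<beta>' i) * whit_array q N (\<delta> - rt k i) \<beta>')))"
      unfolding L_def[abs_def] R_def[abs_def] .
  qed
  also have "\<dots> = c * Done q N k (whit_array q N) \<delta> (\<kappa> + \<delta>)"
    unfolding Done_def[OF q0 q1] by (simp only: sum_distrib_left)
  also have "\<dots> = shifted_array q N lq \<delta> \<kappa>"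
    unfolding Done_whit_array[OF q0 q1 k Qtail_add[OF \<kappa> \<delta>] \<delta>] c_def shifted_array_def
    using q0 by (simp add: power_int_minus)
  finally show ?thesis .
qed

lemma qpoch_op_cong:
  "(\<And>\<delta>. F \<delta> \<beta> = G \<delta> \<beta>) \<Longrightarrow> qpoch_op q N a F \<delta> \<beta> = qpoch_op q N a G \<delta> \<beta>"
  unfolding qpoch_op_def by simp

text \<open>Both operators act on \<delta> by translations. The range of n depends on \<delta>,
  however; extending it from \<delta> - (e_k - e_i) to \<delta> only adds terms outside the support
  of \<open>F\<close>.\<close>

lemma Dzero_qpoch_op:
  assumes k: "1 \<le> k" "k \<le> N" and a: "1 \<le> a" and F: "\<And>\<delta> \<beta>. F \<delta> \<beta> \<noteq> 0 \<Longrightarrow> \<delta> \<in> Qplus N"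
  shows "Dzero q N k (qpoch_op q N a F) \<delta> \<kappa> = qpoch_op q N a (Dzero q N k F) \<delta> \<kappa>"
proof -
  define S where "S = {n. \<delta> - smul n (rt a (Suc a)) \<in> Qplus N}"
  have comm: "\<delta> - rt k i - s = \<delta> - s - rt k i" for i s
    by (simp add: algebra_simps)
  have ext: "qpoch_op q N a F (\<delta> - rt k i) \<beta> = (\<Sum>n\<in>S. inv_qfact q n * F (\<delta> - smul n (rt a (Suc a)) - rt k i) \<beta>)"
    if i: "i \<in> {k..N}" for i \<beta>
    unfolding qpoch_op_def
  proof (rule sum.mono_neutral_cong_left)
    show "finite S" unfolding S_def by (rule finite_qpoch_op_index[OF a])
    show "{n. \<delta> - rt k i - smul n (rt a (Suc a)) \<in> Qplus N} \<subseteq> S"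
      using Qplus_add[OF _ Qplus_rt[of k i N]] k i by (force simp: S_def algebra_simps)
    show "\<forall>n\<in>S - {n. \<delta> - rt k i - smul n (rt a (Suc a)) \<in> Qplus N}. inv_qfact q n * F (\<delta> - smul n (rt a (Suc a)) - rt k i) \<beta> = 0"
      using F[of _ \<beta>] unfolding comm by auto
  qed (simp add: comm)
  have "Dzero q N k (qpoch_op q N a F) \<delta> \<kappa> = (\<Sum>i\<in>{k..N}. \<Sum>\<beta>\<in>ival N \<kappa>. \<Sum>n\<in>S. inv_qfact q n *
     (op_coeff N k 0 i (\<kappa> - \<beta>) * (q powi (- \<beta> i) * F (\<delta> - smul n (rt a (Suc a)) - rt k i) \<beta>)))"
    unfolding Dzero_def[OF q0 q1]
    by (intro sum.cong refl) (simp add: ext sum_distrib_left mult_ac)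
  also have "\<dots> = (\<Sum>i\<in>{k..N}. \<Sum>n\<in>S. \<Sum>\<beta>\<in>ival N \<kappa>. inv_qfact q n *
     (op_coeff N k 0 i (\<kappa> - \<beta>) * (q powi (- \<beta> i) * F (\<delta> - smul n (rt a (Suc a)) - rt k i) \<beta>)))"
    by (rule sum.cong[OF refl]) (rule sum.swap)
  also have "\<dots> = (\<Sum>n\<in>S. \<Sum>i\<in>{k..N}. \<Sum>\<beta>\<in>ival N \<kappa>. inv_qfact q n *
     (op_coeff N k 0 i (\<kappa> - \<beta>) * (q powi (- \<beta> i) * F (\<delta> - smul n (rt a (Suc a)) - rt k i) \<beta>)))"
    by (rule sum.swap)
  also have "\<dots> = qpoch_op q N a (Dzero q N k F) \<delta> \<kappa>"
    unfolding qpoch_op_def S_def Dzero_def[OF q0 q1] by (simp only: sum_distrib_left)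
  finally show ?thesis .
qed

lemma Dzero_qpoch_ops:
  assumes k: "1 \<le> k" "k \<le> N" and \<kappa>: "\<kappa> \<in> Qtail N k" and j: "1 \<le> j" "j \<le> N"
  shows "Dzero q N k (qpoch_ops q N j (whit_array q N)) \<delta> \<kappa> = qpoch_ops q N j (whit_array q N) \<delta> \<kappa>"
  using j
proof (induction "N - j" arbitrary: j \<delta>)
  case 0
  then have "j = N" by simp
  then show ?case using Dzero_whit_array[OF q0 q1 k \<kappa>] by simp
next
  case (Suc n)
  have "Dzero q N k (qpoch_op q N j (qpoch_ops q N (Suc j) (whit_array q N))) \<delta> \<kappa> = qpoch_op q N j (Dzero q N k (qpoch_ops q N (Suc j) (whit_array q N))) \<delta> \<kappa>"
    by (rule Dzero_qpoch_op[OF k]) (use qpoch_ops_Qplus(1)[of "Suc j" N q] Suc in auto)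
  also have "\<dots> = qpoch_op q N j (qpoch_ops q N (Suc j) (whit_array q N)) \<delta> \<kappa>"
    by (rule qpoch_op_cong, rule Suc.hyps(1)) (use Suc in auto)
  finally show ?case using Suc by (simp add: qpoch_ops_rec)
qed

text \<open>Both sides are fixed points of D0 at level k, so only \<kappa>_k = 0 has to be compared.
  There the power of q in \<open>whit_array_extremal\<close> cancels against the Gaussian, and 1 /
  (q; q)_m remains, the weight with which the operator at k acts on the case of fewer
  variables.\<close>

lemma qpoch_ops_whit_array:
  assumes "1 \<le> k" "k \<le> N" "\<delta> \<in> Qtail N k" "\<beta> \<in> Qtail N k"
  shows "qpoch_ops q N k (whit_array q N) \<delta> \<beta> = shifted_array q N lq \<delta> \<beta>"
  using assms
proof (induction "N - k" arbitrary: k \<delta> \<beta>)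
  case 0
  then have "k = N" by simp
  then have "\<delta> = 0" "\<beta> = 0" using 0 Qtail_beyond[of _ N] by blast+
  moreover have "qpoch_ops q N N (whit_array q N) 0 0 = shifted_array q N lq 0 0"
    by (simp add: shifted_array_def inv_gauss_def norm_sq_def)
  ultimately show ?case using \<open>k = N\<close> by metis
next
  case (Suc n)
  then have k: "1 \<le> k" "k \<le> N" "k < N" by auto
  note IH = Suc.hyps(1)[of "Suc k"]
  \<comment> \<open>The shifted array need not vanish for \<delta> outside \<open>Qtail\<close>, as
    its second index \<beta> + \<delta> moves along. The cut-off supplies the support condition of
    \<open>Dzero_unique\<close>. A shift by e_k - e_i that leaves \<open>Qtail\<close> also leaves
    \<open>Qplus\<close>, where both arrays are 0, so D0 is not affected.\<close>
  define F where "F \<delta> \<beta> = (if \<delta> \<in> Qtail N k then qpoch_ops q N k (whit_array q N) \<delta> \<beta> - shifted_array q N lq \<delta> \<beta> else 0)" for \<delta> \<beta>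
  have "F \<delta> \<beta> = 0"
  proof (rule Dzero_unique[OF q0 q1 k(1,2) _ _ _ Suc.prems(4), of F])
    fix \<delta> \<kappa> assume \<delta>: "\<delta> \<in> Qtail N k" and \<kappa>: "\<kappa> \<in> Qtail N k"
    have "F (\<delta> - rt k i) \<beta> = qpoch_ops q N k (whit_array q N) (\<delta> - rt k i) \<beta> - shifted_array q N lq (\<delta> - rt k i) \<beta>"
      if i: "i \<in> {k..N}" and \<beta>: "\<beta> \<in> ival N \<kappa>" for i \<beta>
    proof (cases "\<delta> - rt k i \<in> Qtail N k")
      case False
      then have "\<delta> - rt k i \<notin> Qplus N"
        using \<delta> i by (auto simp: Qtail_def rt_def)
      then have "qpoch_ops q N k (whit_array q N) (\<delta> - rt k i) \<beta> = 0" "whit_array q N (\<delta> - rt k i) (\<beta> + (\<delta> - rt k i)) = 0"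
        using qpoch_ops_Qplus(1)[OF k(1,2)] whit_array_support[of q N "\<delta> - rt k i"] by (auto simp: ival_def)
      then show ?thesis using False by (simp add: F_def shifted_array_def)
    qed (simp add: F_def)
    then have "Dzero q N k F \<delta> \<kappa> = Dzero q N k (qpoch_ops q N k (whit_array q N)) \<delta> \<kappa> - Dzero q N k (shifted_array q N lq) \<delta> \<kappa>"
      unfolding Dzero_def[OF q0 q1] sum_subtractf[symmetric] right_diff_distrib[symmetric]
      by (intro sum.cong refl) simp
    then show "Dzero q N k F \<delta> \<kappa> = F \<delta> \<kappa>"
      using \<delta> by (simp add: Dzero_qpoch_ops[OF k(1,2) \<kappa> k(1,2)] Dzero_shifted_array[OF k(1,2) \<delta> \<kappa>]) (simp add: F_def)
  next
    fix \<delta> \<kappa> assume "\<delta> \<notin> Qtail N k"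
    then show "F \<delta> \<kappa> = 0" by (simp add: F_def)
  next
    fix \<delta> \<kappa> assume \<delta>: "\<delta> \<in> Qtail N k" and \<kappa>: "\<kappa> \<in> Qtail N k" "\<kappa> k = 0"
    define m where "m = nat (\<delta> k)"
    have m: "\<delta> k = int m" using Qtail_nonneg[OF \<delta> k(1)] by (simp add: m_def)
    define \<delta>' where "\<delta>' = \<delta> - smul m (rt k (Suc k))"
    have \<delta>': "\<delta>' \<in> Qtail N (Suc k)" unfolding \<delta>'_def by (rule Qtail_drop[OF \<delta> m k(1,3)])
    have \<delta>_eq: "\<delta> = smul m (rt k (Suc k)) + \<delta>'" by (simp add: \<delta>'_def)
    have \<kappa>': "\<kappa> \<in> Qtail N (Suc k)" using \<kappa> by (simp add: Qtail_Suc)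
    have z: "\<delta>' k = 0" using \<delta>' by (simp add: Qtail_Suc)
    have "qpoch_ops q N k (whit_array q N) \<delta> \<kappa> = qpoch_op q N k (qpoch_ops q N (Suc k) (whit_array q N)) \<delta> \<kappa>"
      using k by (simp add: qpoch_ops_rec)
    \<comment> \<open>For \<kappa> free of x_k the operators after k produce only \<delta> free of
      x_k, which forces n = \<delta>_k.\<close>
    also have "\<dots> = (\<Sum>n\<in>{m}. inv_qfact q n * qpoch_ops q N (Suc k) (whit_array q N) (\<delta> - smul n (rt k (Suc k))) \<kappa>)"
      unfolding qpoch_op_def
    proof (rule sum.mono_neutral_right)
      show "finite {n. \<delta> - smul n (rt k (Suc k)) \<in> Qplus N}" by (rule finite_qpoch_op_index[OF k(1)])
      show "{m} \<subseteq> {n. \<delta> - smul n (rt k (Suc k)) \<in> Qplus N}"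
        using \<delta>' by (auto simp: \<delta>'_def Qtail_def)
      show "\<forall>n\<in>{n. \<delta> - smul n (rt k (Suc k)) \<in> Qplus N} - {m}. inv_qfact q n * qpoch_ops q N (Suc k) (whit_array q N) (\<delta> - smul n (rt k (Suc k))) \<kappa> = 0"
      proof (intro ballI, rule ccontr)
        fix n assume n: "n \<in> {n. \<delta> - smul n (rt k (Suc k)) \<in> Qplus N} - {m}"
          and "inv_qfact q n * qpoch_ops q N (Suc k) (whit_array q N) (\<delta> - smul n (rt k (Suc k))) \<kappa> \<noteq> 0"
        then have "\<delta> - smul n (rt k (Suc k)) \<in> Qtail N (Suc k)"
          using qpoch_ops_Qtail[OF _ _ _ \<kappa>', of "Suc k" q] k by auto
        then have "(\<delta> - smul n (rt k (Suc k))) k = 0" unfolding Qtail_Suc by blast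
        then have "n = m" using m by (simp add: smul_def rt_def)
        then show False using n by simp
      qed
    qed
    also have "\<dots> = inv_qfact q m * shifted_array q N lq \<delta>' \<kappa>"
      using IH[OF _ _ _ \<delta>' \<kappa>'] Suc.hyps(2) k by (simp add: \<delta>'_def[symmetric])
    also have "\<dots> = shifted_array q N lq \<delta> \<kappa>"
    proof -
      have e: "\<kappa> + \<delta> = smul m (rt k (Suc k)) + (\<kappa> + \<delta>')" by (simp add: \<delta>'_def)
      have "\<kappa> + \<delta>' \<in> Qtail N (Suc k)" by (rule Qtail_add[OF \<kappa>' \<delta>'])
      then have "whit_array q N \<delta> (\<kappa> + \<delta>) = q powi (int m * int m - int m * \<delta>' (Suc k)) * inv_qfact q m * whit_array q N \<delta>' (\<kappa> + \<delta>')"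
        using whit_array_extremal[OF q0 q1 k(1,3), of "\<kappa> + \<delta>'" \<delta>' m] z unfolding e by (simp only: flip: \<delta>_eq)
      \<comment> \<open>As \<delta>'_k = 0, adding m copies of the root raises the square norm by 2
        (m^2 - m \<delta>'_(k+1)), twice the exponent in the extremal entry.\<close>
      moreover have "inv_gauss N lq \<delta> = inv_gauss N lq \<delta>' * q powi (- (int m * int m - int m * \<delta>' (Suc k)))"
        
        by (rule inv_gauss_shift[OF lq]) (unfold \<delta>_eq norm_sq_smul[OF k(1,3)], simp add: z right_diff_distrib)
      ultimately show ?thesis using q0 by (simp only: shifted_array_def power_int_minus) (simp add: field_simps)
    qed
    finally show "F \<delta> \<kappa> = 0" by (simp add: F_def)
  qed
  then show "qpoch_ops q N k (whit_array q N) \<delta> \<beta> = shifted_array q N lq \<delta> \<beta>" using Suc.prems by (simp add: F_def)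
qed

end

section \<open>Eigenseries and their limit\<close>

text \<open>The matrix of D_1 on the monomials x^(\<lambda>-\<beta>), where L_i = q^(\<lambda>_i).
  With t^(N-1) taken out, the remaining coefficients are polynomials in 1 / t.\<close>

definition eig_mat :: "nat \<Rightarrow> complex \<Rightarrow> complex \<Rightarrow> (nat \<Rightarrow> complex) \<Rightarrow> (nat \<Rightarrow> int) \<Rightarrow> (nat \<Rightarrow> int) \<Rightarrow> complex" where
  "eig_mat N q t L \<kappa> \<beta> = (\<Sum>i\<in>{1..N}. t ^ (N - 1) * op_coeff N 1 (1 / t) i (\<kappa> - \<beta>) * (L i * q powi (- \<beta> i)))"

lemma power_inverse_shift: "t ^ (N - 1) * (1 / t) ^ (i - 1) = t ^ (N - i)"
  if "t \<noteq> 0" "1 \<le> i" "i \<le> N" for t :: complex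
proof -
  have "t ^ (N - 1) = t ^ (N - i) * t ^ (i - 1)" using that by (simp flip: power_add)
  then show ?thesis using that by (simp add: power_one_over)
qed

lemma eig_mat_diag:
  assumes "t \<noteq> 0"
  shows "eig_mat N q t L \<kappa> \<kappa> = e1_s N t (\<lambda>i. L i * q powi (- \<kappa> i))"
  unfolding eig_mat_def e1_s_def
proof (intro sum.cong refl)
  fix i assume i: "i \<in> {1..N}"
  then have "op_coeff N 1 (1 / t) i (\<kappa> - \<kappa>) = (1 / t) ^ (i - 1)"
    using op_coeff_0[of 1 i N "1 / t"] by simp
  then show "t ^ (N - 1) * op_coeff N 1 (1 / t) i (\<kappa> - \<kappa>) * (L i * q powi (- \<kappa> i)) = t ^ (N - i) * (L i * q powi (- \<kappa> i))"
    using power_inverse_shift[of t i N] assms i by simp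
qed

lemma is_eigenseries_iff:
  assumes "t \<noteq> 0"
  shows "is_eigenseries N q t L c \<longleftrightarrow> c 0 = 1 \<and> (\<forall>\<beta>. \<beta> \<notin> Qplus N \<longrightarrow> c \<beta> = 0) \<and>
    (\<forall>\<kappa>\<in>Qplus N. (\<Sum>\<beta>\<in>ival N \<kappa>. eig_mat N q t L \<kappa> \<beta> * c \<beta>) = e1_s N t L * c \<kappa>)"
proof -
  have "(\<Sum>i\<in>{1..N}. \<Sum>(\<nu>, \<beta>)\<in>decomps N \<kappa>. ratio_expansion N (D1_coeff N t i) \<nu> * (L i * q powi (- \<beta> i)) * c \<beta>) =
      (\<Sum>\<beta>\<in>ival N \<kappa>. eig_mat N q t L \<kappa> \<beta> * c \<beta>)" for \<kappa>
  proof -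
    have "(\<Sum>i\<in>{1..N}. \<Sum>(\<nu>, \<beta>)\<in>decomps N \<kappa>. ratio_expansion N (D1_coeff N t i) \<nu> * (L i * q powi (- \<beta> i)) * c \<beta>) =
      (\<Sum>i\<in>{1..N}. \<Sum>\<beta>\<in>ival N \<kappa>. t ^ (N - 1) * op_coeff N 1 (1 / t) i (\<kappa> - \<beta>) * (L i * q powi (- \<beta> i)) * c \<beta>)"
      by (intro sum.cong refl) (subst sum_decomps, use assms in \<open>simp add: ratio_expansion_eq[OF hre_D1_coeff]\<close>)
    then show ?thesis
      by (subst (asm) sum.swap) (simp only: eig_mat_def sum_distrib_right)
  qed
  then show ?thesis unfolding is_eigenseries_def by (simp add: zero_fun_def)
qed

lemma eig_split:
  assumes "t \<noteq> 0" "\<kappa> \<in> Qplus N"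
  shows "(\<Sum>\<beta>\<in>ival N \<kappa>. eig_mat N q t L \<kappa> \<beta> * c \<beta>) = e1_s N t L * c \<kappa> \<longleftrightarrow>
    (\<Sum>\<beta>\<in>ival N \<kappa> - {\<kappa>}. eig_mat N q t L \<kappa> \<beta> * c \<beta>) = (e1_s N t L - e1_s N t (\<lambda>i. L i * q powi (- \<kappa> i))) * c \<kappa>"
  using assms by (subst sum.remove[of _ \<kappa>]) (auto simp: eig_mat_diag algebra_simps)

text \<open>Distinct eigenvalues are demanded only where one of the two series is nonzero. For
  Macdonald polynomials these are finitely many \<kappa>, which allows all large t, whereas
  \<open>generic_t\<close> may exclude values arbitrarily far out.\<close>

lemma eigenseries_unique_at:
  assumes t: "t \<noteq> 0"
    and c: "is_eigenseries N q t L c" "is_eigenseries N q t L c'"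
    and S: "\<And>\<kappa>. \<kappa> \<in> Qplus N - {0} \<Longrightarrow> c \<kappa> \<noteq> 0 \<or> c' \<kappa> \<noteq> 0 \<Longrightarrow> e1_s N t (\<lambda>i. L i * q powi (- \<kappa> i)) \<noteq> e1_s N t L"
  shows "c \<kappa> = c' \<kappa>"
proof (induction "height N \<kappa>" arbitrary: \<kappa> rule: less_induct)
  case less
  show ?case
  proof (cases "\<kappa> \<in> Qplus N - {0} \<and> (c \<kappa> \<noteq> 0 \<or> c' \<kappa> \<noteq> 0)")
    case False
    then show ?thesis using c[unfolded is_eigenseries_iff[OF t]] by (cases "\<kappa> = 0") auto
  next
    case True
    have "(e1_s N t L - e1_s N t (\<lambda>i. L i * q powi (- \<kappa> i))) * c \<kappa> = (\<Sum>\<beta>\<in>ival N \<kappa> - {\<kappa>}. eig_mat N q t L \<kappa> \<beta> * c \<beta>)"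
      using c(1) True t by (simp add: is_eigenseries_iff eig_split)
    also have "\<dots> = (\<Sum>\<beta>\<in>ival N \<kappa> - {\<kappa>}. eig_mat N q t L \<kappa> \<beta> * c' \<beta>)"
      using less height_ival by (intro sum.cong refl) (metis)
    also have "\<dots> = (e1_s N t L - e1_s N t (\<lambda>i. L i * q powi (- \<kappa> i))) * c' \<kappa>"
      using c(2) True t by (simp add: is_eigenseries_iff eig_split)
    finally show ?thesis using S[of \<kappa>] True by auto
  qed
qed

lemma eigenseries_exists:
  assumes t: "t \<noteq> 0" and gen: "t \<in> generic_t N q L"
  shows "\<exists>c. is_eigenseries N q t L c"
proof -
  define F where "F c \<kappa> = (if \<kappa> = 0 then 1 else if \<kappa> \<in> Qplus N then
     (\<Sum>\<beta>\<in>ival N \<kappa> - {\<kappa>}. eig_mat N q t L \<kappa> \<beta> * c \<beta>) / (e1_s N t L - e1_s N t (\<lambda>i. L i * q powi (- \<kappa> i))) else 0)" for c \<kappa>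
  have "\<exists>c. \<forall>\<kappa>. c \<kappa> = F c \<kappa>"
  proof (rule ex_height_rec[of N])
    fix c c' :: "(nat \<Rightarrow> int) \<Rightarrow> complex" and \<kappa>
    assume *: "\<And>\<beta>. height N \<beta> < height N \<kappa> \<Longrightarrow> c \<beta> = c' \<beta>"
    show "F c \<kappa> = F c' \<kappa>"
      unfolding F_def using *[OF height_ival] by (intro if_cong refl ext arg_cong2[where f = "(/)"] sum.cong) auto
  qed
  then obtain c where c: "\<And>\<kappa>. c \<kappa> = F c \<kappa>" by blast
  have c0: "c 0 = 1" using c[of 0] by (simp add: F_def)
  have "is_eigenseries N q t L c"
    unfolding is_eigenseries_iff[OF t]
  proof (intro conjI allI impI ballI c0)
    show "c \<beta> = 0" if "\<beta> \<notin> Qplus N" for \<beta>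
      using c[of \<beta>] that by (auto simp: F_def)
    show "(\<Sum>\<beta>\<in>ival N \<kappa>. eig_mat N q t L \<kappa> \<beta> * c \<beta>) = e1_s N t L * c \<kappa>" if \<kappa>: "\<kappa> \<in> Qplus N" for \<kappa>
    proof (cases "\<kappa> = 0")
      case True
      then show ?thesis by (simp add: eig_mat_diag[OF t])
    next
      case False
      have "\<kappa> \<in> Qplus N - {\<lambda>_. 0}" using \<kappa> False by (simp add: zero_fun_def)
      then have "e1_s N t L - e1_s N t (\<lambda>i. L i * q powi (- \<kappa> i)) \<noteq> 0"
        using gen unfolding generic_t_def by auto
      then show ?thesis
        unfolding eig_split[OF t \<kappa>] using c[of \<kappa>] False \<kappa> by (simp add: F_def)
    qed
  qed
  then show ?thesis by blast
qed

lemma eigenseries_correct: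
  assumes t: "t \<noteq> 0" and gen: "t \<in> generic_t N q L"
  shows "is_eigenseries N q t L (eigenseries N q t L)"
proof -
  obtain c where c: "is_eigenseries N q t L c" using eigenseries_exists[OF assms] by blast
  have "c' = c" if "is_eigenseries N q t L c'" for c'
  proof
    fix \<kappa>
    show "c' \<kappa> = c \<kappa>"
      by (rule eigenseries_unique_at[OF t that c]) (use gen in \<open>auto simp: generic_t_def zero_fun_def\<close>)
  qed
  with c show ?thesis unfolding eigenseries_def by (rule theI)
qed

text \<open>On exponents free of x_1, ..., x_(k-1) the terms with i < k are diagonal and equal their
  share t^(N-i) L_i of the eigenvalue, so they cancel exactly. The rest is divisible by t^(N-k), and
  the resulting equation in 1 / t has a nontrivial limit.\<close>

lemma eig_level:
  assumes t: "t \<noteq> 0" and c: "is_eigenseries N q t L c" and k: "1 \<le> k" "k \<le> N" and \<kappa>: "\<kappa> \<in> Qtail N k"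
  shows "(\<Sum>i\<in>{k..N}. \<Sum>\<beta>\<in>ival N \<kappa>. op_coeff N k (1 / t) i (\<kappa> - \<beta>) * (L i * q powi (- \<beta> i) * c \<beta>)) =
    (\<Sum>i\<in>{k..N}. (1 / t) ^ (i - k) * L i) * c \<kappa>"
proof -
  have split: "{1..N} = {1..<k} \<union> {k..N}" using k by auto
  have dis: "sum f {1..N} = sum f {1..<k} + sum f {k..N}" for f :: "nat \<Rightarrow> complex"
    unfolding split by (rule sum.union_disjoint) auto
  have tk: "t ^ (N - 1) * (1 / t) ^ (k - 1) = t ^ (N - k)"
    by (rule power_inverse_shift) (use t k in auto)
  have tki: "t ^ (N - i) = t ^ (N - k) * (1 / t) ^ (i - k)" if "i \<in> {k..N}" for i
  proof -
    have "t ^ (N - k) = t ^ (N - i) * t ^ (i - k)" using that by (simp flip: power_add)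
    then show ?thesis using t by (simp add: power_one_over)
  qed
  have "e1_s N t L * c \<kappa> = (\<Sum>\<beta>\<in>ival N \<kappa>. eig_mat N q t L \<kappa> \<beta> * c \<beta>)"
    using c Qtail_Qplus[OF \<kappa>] by (simp add: is_eigenseries_iff[OF t])
  also have "\<dots> = (\<Sum>i\<in>{1..N}. \<Sum>\<beta>\<in>ival N \<kappa>. t ^ (N - 1) * op_coeff N 1 (1 / t) i (\<kappa> - \<beta>) * (L i * q powi (- \<beta> i)) * c \<beta>)"
    unfolding eig_mat_def sum_distrib_right by (rule sum.swap)
  also have "\<dots> = (\<Sum>i\<in>{1..<k}. t ^ (N - i) * L i * c \<kappa>) +
    (\<Sum>i\<in>{k..N}. t ^ (N - k) * (\<Sum>\<beta>\<in>ival N \<kappa>. op_coeff N k (1 / t) i (\<kappa> - \<beta>) * (L i * q powi (- \<beta> i) * c \<beta>)))"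
    unfolding dis
  proof (rule arg_cong2[where f = "(+)"]; rule sum.cong[OF refl])
    fix i assume i: "i \<in> {1..<k}"
    have "(\<Sum>\<beta>\<in>ival N \<kappa>. t ^ (N - 1) * op_coeff N 1 (1 / t) i (\<kappa> - \<beta>) * (L i * q powi (- \<beta> i)) * c \<beta>) =
       (\<Sum>\<beta>\<in>{\<kappa>}. t ^ (N - 1) * op_coeff N 1 (1 / t) i (\<kappa> - \<beta>) * (L i * q powi (- \<beta> i)) * c \<beta>)"
    proof (rule sum.mono_neutral_right)
      show "\<forall>\<beta>\<in>ival N \<kappa> - {\<kappa>}. t ^ (N - 1) * op_coeff N 1 (1 / t) i (\<kappa> - \<beta>) * (L i * q powi (- \<beta> i)) * c \<beta> = 0"
      proof
        fix \<beta> assume \<beta>: "\<beta> \<in> ival N \<kappa> - {\<kappa>}"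
        have "\<kappa> - \<beta> \<in> Qtail N k"
          using Qtail_split_diff[of "\<kappa> - \<beta>" N \<kappa> k] \<beta> \<kappa> by (auto simp: ival_def)
        then have "op_coeff N 1 (1 / t) i (\<kappa> - \<beta>) = 0"
          using op_coeff_above[of 1 i k N "\<kappa> - \<beta>" "1 / t"] i k \<beta> by auto
        then show "t ^ (N - 1) * op_coeff N 1 (1 / t) i (\<kappa> - \<beta>) * (L i * q powi (- \<beta> i)) * c \<beta> = 0" by simp
      qed
    qed (use Qtail_Qplus[OF \<kappa>] in auto)
    also have "\<dots> = t ^ (N - 1) * (1 / t) ^ (i - 1) * L i * c \<kappa>"
      using op_coeff_0[of 1 i N "1 / t"] i k Qtail_below[OF \<kappa>, of i] by simp
    also have "t ^ (N - 1) * (1 / t) ^ (i - 1) = t ^ (N - i)"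
      by (rule power_inverse_shift) (use t i k in auto)
    finally show "(\<Sum>\<beta>\<in>ival N \<kappa>. t ^ (N - 1) * op_coeff N 1 (1 / t) i (\<kappa> - \<beta>) * (L i * q powi (- \<beta> i)) * c \<beta>) = t ^ (N - i) * L i * c \<kappa>" .
  next
    fix i assume i: "i \<in> {k..N}"
    show "(\<Sum>\<beta>\<in>ival N \<kappa>. t ^ (N - 1) * op_coeff N 1 (1 / t) i (\<kappa> - \<beta>) * (L i * q powi (- \<beta> i)) * c \<beta>) =
      t ^ (N - k) * (\<Sum>\<beta>\<in>ival N \<kappa>. op_coeff N k (1 / t) i (\<kappa> - \<beta>) * (L i * q powi (- \<beta> i) * c \<beta>))"
      unfolding sum_distrib_left
    proof (rule sum.cong[OF refl])
      fix \<beta> assume \<beta>: "\<beta> \<in> ival N \<kappa>"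
      have "\<kappa> - \<beta> \<in> Qtail N k"
        using Qtail_split_diff[of "\<kappa> - \<beta>" N \<kappa> k] \<beta> \<kappa> by (auto simp: ival_def)
      then have "op_coeff N 1 (1 / t) i (\<kappa> - \<beta>) = (1 / t) ^ (k - 1) * op_coeff N k (1 / t) i (\<kappa> - \<beta>)"
        using op_coeff_lower[of 1 k i N "\<kappa> - \<beta>" "1 / t"] i k by auto
      then show "t ^ (N - 1) * op_coeff N 1 (1 / t) i (\<kappa> - \<beta>) * (L i * q powi (- \<beta> i)) * c \<beta> =
        t ^ (N - k) * (op_coeff N k (1 / t) i (\<kappa> - \<beta>) * (L i * q powi (- \<beta> i) * c \<beta>))"
        by (simp only: tk[symmetric] mult_ac)
    qed
  qed
  finally have "(\<Sum>i\<in>{1..<k}. t ^ (N - i) * L i * c \<kappa>) + (\<Sum>i\<in>{k..N}. t ^ (N - i) * L i * c \<kappa>) =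
    (\<Sum>i\<in>{1..<k}. t ^ (N - i) * L i * c \<kappa>) +
    t ^ (N - k) * (\<Sum>i\<in>{k..N}. \<Sum>\<beta>\<in>ival N \<kappa>. op_coeff N k (1 / t) i (\<kappa> - \<beta>) * (L i * q powi (- \<beta> i) * c \<beta>))"
    by (simp only: e1_s_def dis sum_distrib_left sum_distrib_right distrib_right)
  moreover have "(\<Sum>i\<in>{k..N}. t ^ (N - i) * L i * c \<kappa>) = t ^ (N - k) * ((\<Sum>i\<in>{k..N}. (1 / t) ^ (i - k) * L i) * c \<kappa>)"
    unfolding sum_distrib_left sum_distrib_right by (intro sum.cong refl) (simp only: tki mult_ac)
  ultimately show ?thesis using t by simp
qed

section \<open>The limit of eigenseries as t tends to infinity\<close>

definition whit_coeff :: "nat \<Rightarrow> complex \<Rightarrow> (nat \<Rightarrow> complex) \<Rightarrow> (nat \<Rightarrow> int) \<Rightarrow> complex" where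
  "whit_coeff N q L \<kappa> = (\<Sum>\<delta>\<in>ival N \<kappa>. whit_array q N \<delta> \<kappa> * mono_at N L (- \<delta>))"

context
  fixes q :: complex and N :: nat
  assumes q0: "q \<noteq> 0" and q1: "norm q < 1"
begin

text \<open>The D0 equation of the array, summed against L^(-\<delta>): the shift of \<delta> by e_k
  - e_i becomes the factor L_i / L_k.\<close>

lemma whit_coeff_level:
  assumes L: "\<And>i. i \<in> {1..N} \<Longrightarrow> L i \<noteq> 0" and k: "1 \<le> k" "k \<le> N" and \<kappa>: "\<kappa> \<in> Qtail N k"
  shows "(\<Sum>i\<in>{k..N}. \<Sum>\<beta>\<in>ival N \<kappa>. op_coeff N k 0 i (\<kappa> - \<beta>) * (L i * q powi (- \<beta> i) * whit_coeff N q L \<beta>)) = L k * whit_coeff N q L \<kappa>"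
proof -
  have "L k * whit_coeff N q L \<kappa> = (\<Sum>\<delta>\<in>ival N \<kappa>. \<Sum>i\<in>{k..N}. \<Sum>\<beta>\<in>ival N \<kappa>.
      L k * (op_coeff N k 0 i (\<kappa> - \<beta>) * (q powi (- \<beta> i) * whit_array q N (\<delta> - rt k i) \<beta>)) * mono_at N L (- \<delta>))"
    unfolding whit_coeff_def sum_distrib_left
    by (intro sum.cong refl, subst Dzero_whit_array[OF q0 q1 k \<kappa>, symmetric])
       (simp add: Dzero_def[OF q0 q1] sum_distrib_left sum_distrib_right mult.assoc)
  also have "\<dots> = (\<Sum>i\<in>{k..N}. \<Sum>\<delta>\<in>ival N \<kappa>. \<Sum>\<beta>\<in>ival N \<kappa>.
      L k * (op_coeff N k 0 i (\<kappa> - \<beta>) * (q powi (- \<beta> i) * whit_array q N (\<delta> - rt k i) \<beta>)) * mono_at N L (- \<delta>))"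
    by (rule sum.swap)
  also have "\<dots> = (\<Sum>i\<in>{k..N}. \<Sum>\<beta>\<in>ival N \<kappa>. \<Sum>\<delta>\<in>ival N \<kappa>.
      L k * (op_coeff N k 0 i (\<kappa> - \<beta>) * (q powi (- \<beta> i) * whit_array q N (\<delta> - rt k i) \<beta>)) * mono_at N L (- \<delta>))"
    by (rule sum.cong[OF refl]) (rule sum.swap)
  also have "\<dots> = (\<Sum>i\<in>{k..N}. \<Sum>\<beta>\<in>ival N \<kappa>. op_coeff N k 0 i (\<kappa> - \<beta>) * (L i * q powi (- \<beta> i) * whit_coeff N q L \<beta>))"
  proof (rule sum.cong[OF refl], rule sum.cong[OF refl])
    fix i \<beta> assume i: "i \<in> {k..N}" and \<beta>: "\<beta> \<in> ival N \<kappa>"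
    define G where "G \<delta> = whit_array q N (\<delta> - rt k i) \<beta> * mono_at N L (- \<delta>)" for \<delta>
    have main: "L k * sum G (ival N \<kappa>) = L i * whit_coeff N q L \<beta>" if nz: "op_coeff N k 0 i (\<kappa> - \<beta>) \<noteq> 0"
    proof -
      have sh: "\<kappa> - \<beta> - rt k i \<in> Qplus N" by (rule Qtail_Qplus[OF Kc0_shift[OF k(1) _ _ nz]]) (use i in auto)
      have rtQ: "rt k i \<in> Qplus N" using Qplus_rt k i by simp
      have "sum G (ival N \<kappa>) = sum G ((\<lambda>\<delta>. \<delta> + rt k i) ` ival N \<beta>)"
      proof (rule sum.mono_neutral_right)
        show "(\<lambda>\<delta>. \<delta> + rt k i) ` ival N \<beta> \<subseteq> ival N \<kappa>"
        proof clarify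
          fix \<delta> assume "\<delta> \<in> ival N \<beta>"
          then show "\<delta> + rt k i \<in> ival N \<kappa>"
            using Qplus_add[OF sh, of "\<beta> - \<delta>"] Qplus_add[OF _ rtQ, of \<delta>] by (auto simp: ival_def algebra_simps)
        qed
        show "\<forall>\<delta>\<in>ival N \<kappa> - (\<lambda>\<delta>. \<delta> + rt k i) ` ival N \<beta>. G \<delta> = 0"
        proof (intro ballI, rule ccontr)
          fix \<delta> assume \<delta>: "\<delta> \<in> ival N \<kappa> - (\<lambda>\<delta>. \<delta> + rt k i) ` ival N \<beta>" and "G \<delta> \<noteq> 0"
          then have "\<delta> - rt k i \<in> ival N \<beta>" by (intro whit_array_support[of q]) (simp add: G_def)
          then have "\<delta> \<in> (\<lambda>\<delta>. \<delta> + rt k i) ` ival N \<beta>" by (rule rev_image_eqI) simp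
          with \<delta> show False by blast
        qed
      qed simp
      also have "\<dots> = (\<Sum>\<delta>\<in>ival N \<beta>. G (\<delta> + rt k i))"
        by (subst sum.reindex) (auto intro: inj_onI)
      also have "\<dots> = (\<Sum>\<delta>\<in>ival N \<beta>. L i / L k * (whit_array q N \<delta> \<beta> * mono_at N L (- \<delta>)))"
      proof (rule sum.cong[OF refl])
        fix \<delta>
        have "mono_at N L (- (\<delta> + rt k i)) = mono_at N L (- \<delta>) * mono_at N L (- rt k i)"
          by (subst mono_at_add[symmetric]) (use L in auto)
        also have "mono_at N L (- rt k i) = L i / L k"
          using mono_at_rt[of k N i L] k i L unfolding mono_at_minus by simp
        finally show "G (\<delta> + rt k i) = L i / L k * (whit_array q N \<delta> \<beta> * mono_at N L (- \<delta>))"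
          by (simp only: G_def add_diff_cancel_right' mult_ac)
      qed
      finally show ?thesis using L[of k] k by (simp add: whit_coeff_def sum_distrib_left)
    qed
    have "(\<Sum>\<delta>\<in>ival N \<kappa>. L k * (op_coeff N k 0 i (\<kappa> - \<beta>) * (q powi (- \<beta> i) * whit_array q N (\<delta> - rt k i) \<beta>)) * mono_at N L (- \<delta>)) =
      op_coeff N k 0 i (\<kappa> - \<beta>) * q powi (- \<beta> i) * (L k * sum G (ival N \<kappa>))"
      by (simp only: G_def sum_distrib_left mult_ac)
    then show "(\<Sum>\<delta>\<in>ival N \<kappa>. L k * (op_coeff N k 0 i (\<kappa> - \<beta>) * (q powi (- \<beta> i) * whit_array q N (\<delta> - rt k i) \<beta>)) * mono_at N L (- \<delta>)) =
      op_coeff N k 0 i (\<kappa> - \<beta>) * (L i * q powi (- \<beta> i) * whit_coeff N q L \<beta>)"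
      using main by (cases "op_coeff N k 0 i (\<kappa> - \<beta>) = 0") (simp_all add: mult_ac)
  qed
  finally show ?thesis ..
qed

lemma whit_coeff_0: "whit_coeff N q L 0 = 1"
  by (simp add: whit_coeff_def whit_array_0 delta0_def)

text \<open>At the level of the first nonzero entry of \<kappa>, \<open>eig_level\<close> expresses
  the coefficient through lower ones, with a divisor \<open>d (1 / t)\<close> whose limit L_k (1 -
  q^(-\<kappa>_k)) is nonzero. The filter is arbitrary because formal series need the limit along
  generic t and Macdonald polynomials along all t.\<close>

lemma eigenseries_limit:
  assumes L: "\<And>i. i \<in> {1..N} \<Longrightarrow> L i \<noteq> 0"
    and F: "F \<le> at_infinity" and b: "\<forall>\<^sub>F t in F. is_eigenseries N q t L (b t)"
    and \<kappa>: "\<kappa> \<in> Qplus N"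
  shows "((\<lambda>t. b t \<kappa>) \<longlongrightarrow> whit_coeff N q L \<kappa>) F"
  using \<kappa>
proof (induction "height N \<kappa>" arbitrary: \<kappa> rule: less_induct)
  case less
  have "\<forall>\<^sub>F t in at_infinity. (t::complex) \<noteq> 0"
    unfolding eventually_at_infinity by (intro exI[of _ 1]) auto
  then have tF: "\<forall>\<^sub>F t in F. t \<noteq> 0" using F filter_leD by blast
  have s0: "((\<lambda>t. 1 / t) \<longlongrightarrow> 0) F"
    using tendsto_mono[OF F tendsto_inverse_0] by (simp add: inverse_eq_divide[abs_def])
  show ?case
  proof (cases "\<kappa> = 0")
    case True
    have "\<forall>\<^sub>F t in F. b t \<kappa> = whit_coeff N q L \<kappa>"
      using b tF by eventually_elim (simp add: is_eigenseries_iff True whit_coeff_0)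
    then show ?thesis by (rule tendsto_eventually)
  next
    case False
    define k where "k = first_index \<kappa>"
    note k = first_index[OF less.prems False, folded k_def]
    have dec: "(\<Sum>i\<in>{k..N}. \<Sum>\<beta>\<in>ival N \<kappa>. op_coeff N k s i (\<kappa> - \<beta>) * (L i * q powi (- \<beta> i) * c \<beta>)) =
       (\<Sum>i\<in>{k..N}. s ^ (i - k) * (L i * q powi (- \<kappa> i))) * c \<kappa> +
       (\<Sum>i\<in>{k..N}. \<Sum>\<beta>\<in>ival N \<kappa> - {\<kappa>}. op_coeff N k s i (\<kappa> - \<beta>) * (L i * q powi (- \<beta> i) * c \<beta>))" for s c
      unfolding sum_distrib_right sum.distrib[symmetric]
      by (intro sum.cong refl, subst sum.remove[of _ \<kappa>]) (use less.prems in \<open>auto simp: op_coeff_0 mult.assoc\<close>)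
    define R where "R s c = (\<Sum>i\<in>{k..N}. \<Sum>\<beta>\<in>ival N \<kappa> - {\<kappa>}. op_coeff N k s i (\<kappa> - \<beta>) * (L i * q powi (- \<beta> i) * c \<beta>))" for s c
    define d where "d s = (\<Sum>i\<in>{k..N}. s ^ (i - k) * L i) - (\<Sum>i\<in>{k..N}. s ^ (i - k) * (L i * q powi (- \<kappa> i)))" for s
    have d0: "d 0 = L k * (1 - q powi (- \<kappa> k))"
    proof -
      have z: "(0::complex) ^ (i - k) = of_bool (i = k)" if "i \<in> {k..N}" for i
        using that by (auto simp: power_0_left)
      have "(\<Sum>i\<in>{k..N}. (0::complex) ^ (i - k) * f i) = f k" for f :: "nat \<Rightarrow> complex"
      proof -
        have "(\<Sum>i\<in>{k..N}. (0::complex) ^ (i - k) * f i) = (\<Sum>i\<in>{k..N}. if i = k then f k else 0)"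
          by (intro sum.cong refl) (auto simp: z)
        then show ?thesis using k by simp
      qed
      then show ?thesis by (simp add: d_def right_diff_distrib)
    qed
    have "L k \<noteq> 0" using L[of k] k by simp
    then have dnz: "d 0 \<noteq> 0"
      unfolding d0 using powi_neq_1[OF q0 q1, of "- \<kappa> k"] k(1) by simp
    have dlim: "((\<lambda>t. d (1 / t)) \<longlongrightarrow> d 0) F"
      unfolding d_def by (intro tendsto_intros s0)
    have Kl: "((\<lambda>t. op_coeff N k (1 / t) i \<nu>) \<longlongrightarrow> op_coeff N k 0 i \<nu>) F" for i \<nu>
      using isCont_tendsto_compose[of 0 "\<lambda>s. op_coeff N k s i \<nu>", OF _ s0] op_coeff_tendsto[of N k i \<nu> 0]
      by (simp add: isCont_def)
    have Rlim: "((\<lambda>t. R (1 / t) (b t)) \<longlongrightarrow> R 0 (whit_coeff N q L)) F"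
      unfolding R_def
    proof (intro tendsto_intros Kl)
      fix \<beta> assume "\<beta> \<in> ival N \<kappa> - {\<kappa>}"
      then show "((\<lambda>t. b t \<beta>) \<longlongrightarrow> whit_coeff N q L \<beta>) F"
        using less.hyps[OF height_ival, of \<beta>] by (auto simp: ival_def)
    qed
    have "\<forall>\<^sub>F t in F. d (1 / t) \<noteq> 0"
      using dlim dnz by (rule tendsto_imp_eventually_ne)
    then have "\<forall>\<^sub>F t in F. R (1 / t) (b t) / d (1 / t) = b t \<kappa>"
      using b tF
    proof eventually_elim
      case (elim t)
      have "d (1 / t) * b t \<kappa> = R (1 / t) (b t)"
      proof -
        have "D * y - A * y = S" if "A * y + S = D * y" for A D S y :: complex
          using that by (simp add: algebra_simps)
        from this[OF eig_level[OF elim(3,2) k(3,4,2), unfolded dec]] show ?thesis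
          unfolding d_def R_def left_diff_distrib .
      qed
      then show ?case using elim(1) by (simp add: field_simps)
    qed
    moreover have "((\<lambda>t. R (1 / t) (b t) / d (1 / t)) \<longlongrightarrow> R 0 (whit_coeff N q L) / d 0) F"
      by (rule tendsto_divide[OF Rlim dlim dnz])
    ultimately have "((\<lambda>t. b t \<kappa>) \<longlongrightarrow> R 0 (whit_coeff N q L) / d 0) F"
      by (rule Lim_transform_eventually[rotated])
    moreover have "R 0 (whit_coeff N q L) = d 0 * whit_coeff N q L \<kappa>"
    proof -
      have z: "(\<Sum>i\<in>{k..N}. (0::complex) ^ (i - k) * L i) = L k"
      proof -
        have "(\<Sum>i\<in>{k..N}. (0::complex) ^ (i - k) * L i) = (\<Sum>i\<in>{k..N}. if i = k then L k else 0)"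
          by (intro sum.cong refl) (auto simp: power_0_left)
        then show ?thesis using k by simp
      qed
      show ?thesis
      proof -
        have "S = (D - A) * y" if "A * y + S = D * y" for A D S y :: complex
          using that by (simp add: algebra_simps)
        from this[OF whit_coeff_level[of L, OF L k(3,4,2), unfolded dec]] show ?thesis
          unfolding d_def R_def z .
      qed
    qed
    ultimately show ?thesis using dnz by simp
  qed
qed

section \<open>Generic values of t and the q-Whittaker series\<close>

lemma countable_Qplus: "countable (Qplus N)"
proof (rule countable_image_inj_on)
  show "countable ((\<lambda>\<beta>. map \<beta> [1..<Suc N]) ` Qplus N)" by simp
  show "inj_on (\<lambda>\<beta>. map \<beta> [1..<Suc N]) (Qplus N)"
  proof (rule inj_onI)
    fix a b assume "a \<in> Qplus N" "b \<in> Qplus N" "map a [1..<Suc N] = map b [1..<Suc N]"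
    then have "a i = b i" for i
      by (cases "i \<in> {1..N}") (auto simp: Qplus_iff ivec_def simp del: upt_Suc)
    then show "a = b" by (rule ext)
  qed
qed

text \<open>The difference of the eigenvalues is a polynomial in t in which each i with \<beta>_i
  \<noteq> 0 contributes a nonzero coefficient, in its own degree N - i.\<close>

lemma finite_exceptional:
  assumes L: "\<And>i. i \<in> {1..N} \<Longrightarrow> L i \<noteq> 0" and \<beta>: "\<beta> \<in> Qplus N - {0}"
  shows "finite {t. e1_s N t (\<lambda>i. L i * q powi (- \<beta> i)) = e1_s N t L}"
proof -
  define p where "p = (\<Sum>i\<in>{1..N}. monom (L i * (q powi (- \<beta> i) - 1)) (N - i))"
  have poly: "poly p t = e1_s N t (\<lambda>i. L i * q powi (- \<beta> i)) - e1_s N t L" for t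
    unfolding p_def e1_s_def poly_sum sum_subtractf[symmetric]
    by (intro sum.cong refl) (simp add: poly_monom algebra_simps)
  obtain i where i: "\<beta> i \<noteq> 0" using \<beta> by (auto simp: fun_eq_iff)
  then have iN: "i \<in> {1..N}" using \<beta> by (auto simp: Qplus_iff ivec_def)
  have "coeff p (N - i) = (\<Sum>j\<in>{1..N}. if j = i then L i * (q powi (- \<beta> i) - 1) else 0)"
    unfolding p_def coeff_sum by (intro sum.cong refl) (use iN in auto)
  also have "\<dots> = L i * (q powi (- \<beta> i) - 1)" using iN by simp
  also have "\<dots> \<noteq> 0" using L[OF iN] powi_neq_1[OF q0 q1, of "- \<beta> i"] i by simp
  finally have "p \<noteq> 0" by auto
  from poly_roots_finite[OF this] show ?thesis by (simp add: poly)
qed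

lemma countable_nongeneric:
  assumes L: "\<And>i. i \<in> {1..N} \<Longrightarrow> L i \<noteq> 0"
  shows "countable (- generic_t N q L)"
proof -
  have "- generic_t N q L = (\<Union>\<beta>\<in>Qplus N - {0}. {t. e1_s N t (\<lambda>i. L i * q powi (- \<beta> i)) = e1_s N t L})"
    by (auto simp: generic_t_def zero_fun_def)
  also have "countable \<dots>"
  proof (rule countable_UN)
    show "countable (Qplus N - {0})" using countable_Qplus by (rule countable_subset[rotated]) blast
  qed (rule countable_finite[OF finite_exceptional[OF L]])
  finally show ?thesis .
qed

text \<open>The excluded t are countable, but every neighbourhood of infinity contains a real
  interval. Hence the limit in \<open>whittaker_series\<close> is taken along a proper filter and is
  unique.\<close>

lemma generic_filter:
  assumes L: "\<And>i. i \<in> {1..N} \<Longrightarrow> L i \<noteq> 0"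
  shows "inf at_infinity (principal (generic_t N q L)) \<noteq> bot"
proof
  assume "inf at_infinity (principal (generic_t N q L)) = bot"
  then have "\<forall>\<^sub>F t in inf at_infinity (principal (generic_t N q L)). False" by simp
  then have "\<forall>\<^sub>F t in at_infinity. t \<notin> generic_t N q L"
    by (simp add: eventually_inf_principal)
  then obtain R where R: "\<And>t. R \<le> norm t \<Longrightarrow> t \<notin> generic_t N q L"
    by (auto simp: eventually_at_infinity)
  have "complex_of_real ` {\<bar>R\<bar><..<\<bar>R\<bar> + 1} \<subseteq> - generic_t N q L"
    using R by auto
  then have "countable (complex_of_real ` {\<bar>R\<bar><..<\<bar>R\<bar> + 1})"
    by (rule countable_subset) (rule countable_nongeneric[OF L])
  then have "countable {\<bar>R\<bar><..<\<bar>R\<bar> + 1}"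
    by (rule countable_image_inj_on) (rule inj_onI, rule of_real_eq_iff[THEN iffD1])
  then show False using uncountable_open_interval[of "\<bar>R\<bar>" "\<bar>R\<bar> + 1"] by simp
qed

lemma whittaker_series_eq:
  assumes L: "\<And>i. i \<in> {1..N} \<Longrightarrow> L i \<noteq> 0" and "\<beta> \<in> Qplus N"
  shows "whittaker_series N q L \<beta> = whit_coeff N q L \<beta>"
  unfolding whittaker_series_def
proof (rule tendsto_Lim[OF generic_filter[OF L]])
  have "\<forall>\<^sub>F t in at_infinity. (t::complex) \<noteq> 0"
    unfolding eventually_at_infinity by (intro exI[of _ 1]) auto
  then have "\<forall>\<^sub>F t in inf at_infinity (principal (generic_t N q L)). is_eigenseries N q t L (eigenseries N q t L)"
    unfolding eventually_inf_principal by eventually_elim (auto intro: eigenseries_correct)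
  then show "((\<lambda>t. eigenseries N q t L \<beta>) \<longlongrightarrow> whit_coeff N q L \<beta>) (inf at_infinity (principal (generic_t N q L)))"
    by (intro eigenseries_limit L assms) auto
qed

text \<open>For fixed \<beta> the limit is a finite sum of monomials in the ratios of the \<Lambda>,
  hence its own expansion.\<close>

lemma whittaker_coefficient:
  assumes "\<beta> \<in> Qplus N"
  shows "ratio_expansion N (\<lambda>L. whittaker_series N q L \<beta>) \<delta> = whit_array q N \<delta> \<beta>"
proof -
  have "has_ratio_expansion N (\<lambda>L. whit_coeff N q L \<beta>) (\<lambda>\<delta>. whit_array q N \<delta> \<beta>)"
    unfolding whit_coeff_def
  proof (rule hre_finite)
    show "ival N \<beta> \<subseteq> Qplus N" by (auto simp: ival_def)
    show "whit_array q N \<delta> \<beta> = 0" if "\<delta> \<notin> ival N \<beta>" for \<delta>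
      using whit_array_support that by blast
  qed simp
  then have "has_ratio_expansion N (\<lambda>L. whittaker_series N q L \<beta>) (\<lambda>\<delta>. whit_array q N \<delta> \<beta>)"
  proof (rule hre_cong[where \<epsilon> = 1])
    fix L assume "L \<in> ratio_region N 1"
    then show "whit_coeff N q L \<beta> = whittaker_series N q L \<beta>"
      using whittaker_series_eq[of L, OF _ assms] ratio_region_nonzero[of L N 1] by simp
  qed simp
  then show ?thesis by (simp add: ratio_expansion_eq)
qed

end

section \<open>Symmetry of the Macdonald operator on coefficients\<close>

definition unit_vec :: "nat \<Rightarrow> nat \<Rightarrow> int" where
  "unit_vec i = (\<lambda>l. of_bool (l = i))"

lemma rt_unit_vec: "rt p r = unit_vec p - unit_vec r"
  by (simp add: rt_def unit_vec_def fun_eq_iff)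

definition nonzeros :: "nat \<Rightarrow> (nat \<Rightarrow> complex) set" where
  "nonzeros N = {x. \<forall>i\<in>{1..N}. x i \<noteq> 0}"

lemma region_nonzeros: "ratio_region N \<epsilon> \<subseteq> nonzeros N"
  by (auto simp: ratio_region_def nonzeros_def)

lemma mono_at_unit_vec: "i \<in> {1..N} \<Longrightarrow> mono_at N x (unit_vec i) = x i"
proof -
  assume i: "i \<in> {1..N}"
  have "mono_at N x (unit_vec i) = (\<Prod>j\<in>{1..N}. if j = i then x i else 1)"
    unfolding mono_at_def unit_vec_def by (intro prod.cong) auto
  then show ?thesis using i by simp
qed

text \<open>The exponents lie in the cone below x_1^d, where expansions are unique. \<open>D\<close>
  is the domain on which the sum represents \<open>g\<close>: the whole torus for polynomials, a
  region of small ratios for expanded rational functions.\<close>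

definition rep :: "nat \<Rightarrow> (nat \<Rightarrow> complex) set \<Rightarrow> nat \<Rightarrow> ((nat \<Rightarrow> complex) \<Rightarrow> complex) \<Rightarrow> ((nat \<Rightarrow> int) \<Rightarrow> complex) \<Rightarrow> bool" where
  "rep N D d g X \<longleftrightarrow> (\<forall>\<mu>. X \<mu> \<noteq> 0 \<longrightarrow> smul d (unit_vec (Suc 0)) - \<mu> \<in> Qplus N) \<and>
     (\<forall>x\<in>D. ((\<lambda>\<mu>. X \<mu> * mono_at N x \<mu>) has_sum g x) UNIV)"

lemma rep_subset: "rep N D d g X \<Longrightarrow> D' \<subseteq> D \<Longrightarrow> rep N D' d g X"
  by (auto simp: rep_def)

lemma rep_cong: "rep N D d g X \<Longrightarrow> (\<And>x. x \<in> D \<Longrightarrow> g x = g' x) \<Longrightarrow> rep N D d g' X"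
  by (simp add: rep_def)

lemma rep_add: "rep N D d g X \<Longrightarrow> rep N D d h Y \<Longrightarrow> rep N D d (\<lambda>x. g x + h x) (\<lambda>\<mu>. X \<mu> + Y \<mu>)"
  unfolding rep_def by (auto simp: ring_distribs intro!: has_sum_add) (metis add.right_neutral add.left_neutral)

lemma rep_cmult: "rep N D d g X \<Longrightarrow> rep N D d (\<lambda>x. c * g x) (\<lambda>\<mu>. c * X \<mu>)"
  unfolding rep_def by (auto simp: mult.assoc intro!: has_sum_cmult_right)

lemma rep_zero: "rep N D d (\<lambda>x. 0) (\<lambda>\<mu>. 0)"
  by (simp add: rep_def)

lemma rep_sum: "finite A \<Longrightarrow> (\<And>i. i \<in> A \<Longrightarrow> rep N D d (g i) (X i)) \<Longrightarrow> rep N D d (\<lambda>x. \<Sum>i\<in>A. g i x) (\<lambda>\<mu>. \<Sum>i\<in>A. X i \<mu>)"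
  by (induction A rule: finite_induct) (simp_all add: rep_zero rep_add)

lemma has_sum_shift:
  assumes "((\<lambda>\<mu>. f \<mu>) has_sum s) UNIV"
  shows "((\<lambda>\<mu>. f (\<mu> - (v :: nat \<Rightarrow> int))) has_sum s) UNIV"
  using assms by (rule has_sum_reindex_bij_witness[of _ "\<lambda>\<mu>. \<mu> - v" "\<lambda>\<mu>. \<mu> + v", THEN iffD1, rotated -1]) auto

text \<open>Division by a top monomial x^\<theta> turns a series with exponents in \<theta> - Qplus
  into a ratio expansion, so that uniqueness becomes available.\<close>

lemma cone_to_hre:
  assumes sup: "\<And>\<mu>. X \<mu> \<noteq> 0 \<Longrightarrow> \<theta> - \<mu> \<in> Qplus N" and "0 < \<epsilon>"
    and sums: "\<And>x. x \<in> ratio_region N \<epsilon> \<Longrightarrow> ((\<lambda>\<mu>. X \<mu> * mono_at N x \<mu>) has_sum g x) UNIV"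
  shows "has_ratio_expansion N (\<lambda>x. mono_at N x (- \<theta>) * g x) (\<lambda>\<beta>. X (\<theta> - \<beta>))"
proof (rule hreI[OF _ assms(2)])
  show "X (\<theta> - \<beta>) = 0" if "\<beta> \<notin> Qplus N" for \<beta>
    using sup[of "\<theta> - \<beta>"] that by auto
  fix x assume x: "x \<in> ratio_region N \<epsilon>"
  have "((\<lambda>\<mu>. mono_at N x (- \<theta>) * (X \<mu> * mono_at N x \<mu>)) has_sum mono_at N x (- \<theta>) * g x) UNIV"
    by (rule has_sum_cmult_right[OF sums[OF x]])
  then have "((\<lambda>\<beta>. X (\<theta> - \<beta>) * mono_at N x (- \<beta>)) has_sum mono_at N x (- \<theta>) * g x) UNIV"
  proof (rule has_sum_reindex_bij_witness[of _ "\<lambda>\<beta>. \<theta> - \<beta>" "\<lambda>\<mu>. \<theta> - \<mu>", THEN iffD1, rotated -1])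
    fix \<mu>
    have "mono_at N x (- (\<theta> - \<mu>)) = mono_at N x (- \<theta>) * mono_at N x \<mu>"
      by (subst mono_at_add[symmetric]) (use ratio_region_nonzero[OF x] in auto)
    then show "X (\<theta> - (\<theta> - \<mu>)) * mono_at N x (- (\<theta> - \<mu>)) = mono_at N x (- \<theta>) * (X \<mu> * mono_at N x \<mu>)"
      by (simp only: diff_diff_eq2 add_diff_cancel_left' mult_ac)
  qed auto
  then show "((\<lambda>\<beta>. X (\<theta> - \<beta>) * mono_at N x (- \<beta>)) has_sum mono_at N x (- \<theta>) * g x) (Qplus N)"
  proof (rule has_sum_cong_neutral[THEN iffD1, rotated 3])
    show "X (\<theta> - \<beta>) * mono_at N x (- \<beta>) = 0" if "\<beta> \<in> UNIV - Qplus N" for \<beta>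
      using sup[of "\<theta> - \<beta>"] that by auto
  qed auto
qed

lemma hre_to_cone:
  assumes "has_ratio_expansion N (\<lambda>x. mono_at N x (- \<theta>) * g x) a"
  obtains \<epsilon> where "0 < \<epsilon>" "\<epsilon> \<le> 1"
    "\<And>x. x \<in> ratio_region N \<epsilon> \<Longrightarrow> ((\<lambda>\<mu>. a (\<theta> - \<mu>) * mono_at N x \<mu>) has_sum g x) UNIV"
proof -
  from assms obtain \<epsilon> where \<epsilon>: "0 < \<epsilon>" "\<epsilon> \<le> 1"
    "\<And>x. x \<in> ratio_region N \<epsilon> \<Longrightarrow> ((\<lambda>\<beta>. a \<beta> * mono_at N x (- \<beta>)) has_sum mono_at N x (- \<theta>) * g x) (Qplus N)"
    by (rule hreE) blast
  have "((\<lambda>\<mu>. a (\<theta> - \<mu>) * mono_at N x \<mu>) has_sum g x) UNIV" if x: "x \<in> ratio_region N \<epsilon>" for x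
  proof -
    have nz: "\<And>i. i \<in> {1..N} \<Longrightarrow> x i \<noteq> 0" using ratio_region_nonzero[OF x] .
    have "((\<lambda>\<beta>. a \<beta> * mono_at N x (- \<beta>)) has_sum mono_at N x (- \<theta>) * g x) UNIV"
      using \<epsilon>(3)[OF x] by (rule has_sum_cong_neutral[THEN iffD1, rotated 3]) (use hre_outside[OF assms] in auto)
    then have "((\<lambda>\<beta>. mono_at N x \<theta> * (a \<beta> * mono_at N x (- \<beta>))) has_sum mono_at N x \<theta> * (mono_at N x (- \<theta>) * g x)) UNIV"
      by (rule has_sum_cmult_right)
    also have "mono_at N x \<theta> * (mono_at N x (- \<theta>) * g x) = g x"
      using mono_at_nonzero[of N x \<theta>, OF nz] by (simp add: mono_at_minus)
    finally show ?thesis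
    proof (rule has_sum_reindex_bij_witness[of _ "\<lambda>\<mu>. \<theta> - \<mu>" "\<lambda>\<beta>. \<theta> - \<beta>", THEN iffD1, rotated -1])
      fix \<beta>
      have "mono_at N x (\<theta> + - \<beta>) = mono_at N x \<theta> * mono_at N x (- \<beta>)"
        by (rule mono_at_add) (use nz in auto)
      then show "a (\<theta> - (\<theta> - \<beta>)) * mono_at N x (\<theta> - \<beta>) = mono_at N x \<theta> * (a \<beta> * mono_at N x (- \<beta>))"
        by (simp only: diff_diff_eq2 add_diff_cancel_left' mult_ac add_uminus_conv_diff)
    qed auto
  qed
  with \<epsilon> that show ?thesis by blast
qed

lemma rep_to_hre:
  assumes "rep N (ratio_region N \<epsilon>) d g X" "0 < \<epsilon>"
  shows "has_ratio_expansion N (\<lambda>x. mono_at N x (- smul d (unit_vec (Suc 0))) * g x) (\<lambda>\<beta>. X (smul d (unit_vec (Suc 0)) - \<beta>))"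
  by (rule cone_to_hre[OF _ assms(2)]) (use assms(1) in \<open>auto simp: rep_def\<close>)

lemma rep_unique:
  assumes "rep N (ratio_region N \<epsilon>) d g X" "rep N (ratio_region N \<epsilon>) d g Y" "0 < \<epsilon>"
  shows "X = Y"
proof
  fix \<mu>
  from hre_unique[OF rep_to_hre[OF assms(1,3)] rep_to_hre[OF assms(2,3)]]
  have "X (smul d (unit_vec (Suc 0)) - (smul d (unit_vec (Suc 0)) - \<mu>)) = Y (smul d (unit_vec (Suc 0)) - (smul d (unit_vec (Suc 0)) - \<mu>))" by (rule fun_cong)
  then show "X \<mu> = Y \<mu>" by simp
qed

definition diff_op :: "complex \<Rightarrow> complex \<Rightarrow> nat \<Rightarrow> nat \<Rightarrow> ((nat \<Rightarrow> int) \<Rightarrow> complex) \<Rightarrow> (nat \<Rightarrow> int) \<Rightarrow> complex" where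
  "diff_op a b i j X \<mu> = a * X (\<mu> - unit_vec i) - b * X (\<mu> - unit_vec j)"

text \<open>Multiplication by any x_l raises d by one, because e_1 - e_l belongs to
  \<open>Qplus\<close>.\<close>

lemma rep_diff_op:
  assumes X: "rep N D d g X" and ij: "i \<in> {1..N}" "j \<in> {1..N}" and D: "D \<subseteq> nonzeros N"
  shows "rep N D (Suc d) (\<lambda>x. (a * x i - b * x j) * g x) (diff_op a b i j X)"
  unfolding rep_def
proof (intro conjI allI impI ballI)
  have sup: "smul (Suc d) (unit_vec (Suc 0)) - \<mu> \<in> Qplus N" if "X (\<mu> - unit_vec l) \<noteq> 0" "l \<in> {1..N}" for \<mu> l
  proof -
    have "smul d (unit_vec (Suc 0)) - (\<mu> - unit_vec l) \<in> Qplus N" using X that by (simp add: rep_def)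
    moreover have "rt (Suc 0) l \<in> Qplus N" using that by (intro Qplus_rt) auto
    ultimately have "smul d (unit_vec (Suc 0)) - (\<mu> - unit_vec l) + rt (Suc 0) l \<in> Qplus N" by (rule Qplus_add)
    then show ?thesis by (simp add: smul_Suc rt_unit_vec algebra_simps)
  qed
  show "smul (Suc d) (unit_vec (Suc 0)) - \<mu> \<in> Qplus N" if "diff_op a b i j X \<mu> \<noteq> 0" for \<mu>
    using that sup[of \<mu> i] sup[of \<mu> j] ij by (cases "X (\<mu> - unit_vec i) = 0") (auto simp: diff_op_def)
  fix x assume x: "x \<in> D"
  then have nz: "\<And>i. i \<in> {1..N} \<Longrightarrow> x i \<noteq> 0" using D by (auto simp: nonzeros_def)
  have S: "((\<lambda>\<mu>. X \<mu> * mono_at N x \<mu>) has_sum g x) UNIV" using X x by (simp add: rep_def)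
  have sh: "((\<lambda>\<mu>. c * X (\<mu> - unit_vec l) * mono_at N x \<mu>) has_sum c * x l * g x) UNIV" if l: "l \<in> {1..N}" for l c
  proof -
    have fac: "mono_at N x \<mu> = x l * mono_at N x (\<mu> - unit_vec l)" for \<mu>
    proof -
      have "mono_at N x (unit_vec l + (\<mu> - unit_vec l)) = mono_at N x (unit_vec l) * mono_at N x (\<mu> - unit_vec l)"
        by (rule mono_at_add) (use nz in auto)
      then show ?thesis using l by (simp add: mono_at_unit_vec)
    qed
    have "(\<lambda>\<mu>. c * X (\<mu> - unit_vec l) * mono_at N x \<mu>) = (\<lambda>\<mu>. (c * x l) * (X (\<mu> - unit_vec l) * mono_at N x (\<mu> - unit_vec l)))"
      by (intro ext) (subst fac, simp only: mult_ac)
    then show ?thesis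
      using has_sum_cmult_right[OF has_sum_shift[OF S], of "c * x l" "unit_vec l"] by simp
  qed
  have "((\<lambda>\<mu>. a * X (\<mu> - unit_vec i) * mono_at N x \<mu> + (- b) * X (\<mu> - unit_vec j) * mono_at N x \<mu>) has_sum
      (a * x i * g x + (- b) * x j * g x)) UNIV"
    by (intro has_sum_add sh ij)
  then show "((\<lambda>\<mu>. diff_op a b i j X \<mu> * mono_at N x \<mu>) has_sum (a * x i - b * x j) * g x) UNIV"
    by (simp add: diff_op_def left_diff_distrib)
qed

section \<open>Homogeneous polynomials inside a cone\<close>

definition nonneg_supp :: "((nat \<Rightarrow> int) \<Rightarrow> complex) \<Rightarrow> bool" where
  "nonneg_supp X \<longleftrightarrow> (\<forall>\<mu>. X \<mu> \<noteq> 0 \<longrightarrow> (\<forall>i. 0 \<le> \<mu> i))"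

text \<open>Only finitely many nonnegative exponents lie in the cone of degree d, so these are the
  homogeneous polynomials of that degree.\<close>

definition npoly :: "nat \<Rightarrow> nat \<Rightarrow> ((nat \<Rightarrow> complex) \<Rightarrow> complex) \<Rightarrow> bool" where
  "npoly N d g \<longleftrightarrow> (\<exists>X. nonneg_supp X \<and> rep N (nonzeros N) d g X)"

lemma npoly_diff_op:
  assumes "npoly N d g" "i \<in> {1..N}" "j \<in> {1..N}"
  shows "npoly N (Suc d) (\<lambda>x. (a * x i - b * x j) * g x)"
proof -
  from assms(1) obtain X where X: "nonneg_supp X" "rep N (nonzeros N) d g X" by (auto simp: npoly_def)
  have "0 \<le> \<mu> l" if "0 \<le> (\<mu> - unit_vec m) l" for \<mu> :: "nat \<Rightarrow> int" and m l
    using that by (cases "l = m") (auto simp: unit_vec_def)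
  then have "nonneg_supp (diff_op a b i j X)"
    using X(1) unfolding nonneg_supp_def diff_op_def by (metis diff_zero mult_zero_right)
  then show ?thesis
    using rep_diff_op[OF X(2) assms(2,3)] unfolding npoly_def by blast
qed

lemma npoly_prod:
  assumes "npoly N d g" "finite S" "S \<subseteq> {1..N} \<times> {1..N}"
  shows "npoly N (d + card S) (\<lambda>x. (\<Prod>(i, j)\<in>S. a * x i - x j) * g x)"
  using assms(2,3)
proof (induction S rule: finite_induct)
  case (insert p S)
  obtain i j where p: "p = (i, j)" by (cases p)
  have "npoly N (Suc (d + card S)) (\<lambda>x. (a * x i - 1 * x j) * ((\<Prod>(i, j)\<in>S. a * x i - x j) * g x))"
    by (rule npoly_diff_op) (use insert p in auto)
  then show ?case using insert by (simp add: p mult.assoc)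
qed (use assms(1) in simp)

lemma npoly_sum:
  assumes "finite A" "\<And>i. i \<in> A \<Longrightarrow> npoly N d (g i)"
  shows "npoly N d (\<lambda>x. \<Sum>i\<in>A. g i x)"
proof -
  from assms(2) have "\<exists>X. nonneg_supp X \<and> rep N (nonzeros N) d (g i) X" if "i \<in> A" for i
    using that by (simp add: npoly_def)
  then obtain X where X: "\<And>i. i \<in> A \<Longrightarrow> nonneg_supp (X i)" "\<And>i. i \<in> A \<Longrightarrow> rep N (nonzeros N) d (g i) (X i)"
    by metis
  have "nonneg_supp (\<lambda>\<mu>. \<Sum>i\<in>A. X i \<mu>)"
    unfolding nonneg_supp_def
  proof (intro allI impI)
    fix \<mu> l assume "(\<Sum>i\<in>A. X i \<mu>) \<noteq> 0"
    then obtain i where "i \<in> A" "X i \<mu> \<noteq> 0" by (rule sum.not_neutral_contains_not_neutral)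
    then show "0 \<le> \<mu> l" using X(1) by (auto simp: nonneg_supp_def)
  qed
  then show ?thesis using rep_sum[OF assms(1) X(2)] by (auto simp: npoly_def)
qed

text \<open>The partial sums of a nonnegative vector do not exceed its total d.\<close>

lemma nonneg_cone:
  assumes "\<mu> \<in> ivec N" "\<And>i. 0 \<le> \<mu> i" "psum \<mu> N = int d" "1 \<le> N"
  shows "smul d (unit_vec (Suc 0)) - \<mu> \<in> Qplus N"
proof -
  have ps: "psum (smul d (unit_vec (Suc 0))) k = (if k = 0 then 0 else int d)" for k
    by (induction k) (auto simp: psum_Suc smul_def unit_vec_def psum_def)
  have mono: "psum \<mu> k \<le> psum \<mu> N" for k
  proof (cases "k \<le> N")
    case True
    then show ?thesis unfolding psum_def using assms(2) by (intro sum_mono2) auto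
  qed (use psum_stable[OF assms(1), of k] in simp)
  show ?thesis
    unfolding Qplus_iff
  proof (intro conjI allI)
    show "smul d (unit_vec (Suc 0)) - \<mu> \<in> ivec N"
      using assms by (auto simp: ivec_def smul_def unit_vec_def)
    show "0 \<le> psum (smul d (unit_vec (Suc 0)) - \<mu>) k" for k
      using mono[of k] assms(3) by (auto simp: psum_diff ps)
    show "psum (smul d (unit_vec (Suc 0)) - \<mu>) N = 0" using assms by (simp add: psum_diff ps)
  qed
qed

lemma cone_degree:
  assumes "smul d (unit_vec (Suc 0)) - \<mu> \<in> Qplus N" "1 \<le> N"
  shows "\<mu> \<in> ivec N" "psum \<mu> N = int d"
proof -
  have e: "smul d (unit_vec (Suc 0)) \<in> ivec N" using assms(2) by (auto simp: ivec_def smul_def unit_vec_def)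
  have ps: "psum (smul d (unit_vec (Suc 0))) k = (if k = 0 then 0 else int d)" for k
    by (induction k) (auto simp: psum_Suc smul_def unit_vec_def psum_def)
  show "\<mu> \<in> ivec N" using ivec_diff[OF e Qplus_ivec[OF assms(1)]] by simp
  show "psum \<mu> N = int d" using Qplus_psum_N[OF assms(1)] assms(2) by (simp add: psum_diff ps)
qed

section \<open>Adjacent transpositions\<close>

abbreviation sw :: "nat \<Rightarrow> nat \<Rightarrow> nat" where
  "sw a \<equiv> Transposition.transpose a (Suc a)"

lemma sw_invol [simp]: "\<mu> \<circ> sw a \<circ> sw a = \<mu>"
  by (simp add: comp_assoc)

lemma sw_eq: "sw a i = j \<longleftrightarrow> i = sw a j"
  by (metis transpose_involutory)

lemma sw_inj: "sw a i = sw a j \<longleftrightarrow> i = j"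
  by (simp add: sw_eq)

lemma sw_permutes: "a \<in> {1..<N} \<Longrightarrow> sw a permutes {1..N}"
  by (rule permutes_swap_id) auto

lemma sw_mem: "a \<in> {1..<N} \<Longrightarrow> sw a i \<in> {1..N} \<longleftrightarrow> i \<in> {1..N}"
  using permutes_in_image[OF sw_permutes] .

lemma unit_vec_sw: "unit_vec i \<circ> sw a = unit_vec (sw a i)"
  unfolding unit_vec_def comp_def sw_eq ..

lemma diff_sw: "(\<mu> - \<nu>) \<circ> sw a = (\<mu> \<circ> sw a) - (\<nu> \<circ> sw a)"
  by (simp add: fun_eq_iff)

lemma mono_at_sw:
  assumes "a \<in> {1..<N}"
  shows "mono_at N (x \<circ> sw a) \<mu> = mono_at N x (\<mu> \<circ> sw a)"
proof -
  have "mono_at N x (\<mu> \<circ> sw a) = (\<Prod>i\<in>{1..N}. (\<lambda>i. x (sw a i) powi \<mu> i) (sw a i))"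
    by (simp add: mono_at_def)
  also have "\<dots> = (\<Prod>i\<in>{1..N}. x (sw a i) powi \<mu> i)"
    by (rule prod.permute[OF sw_permutes[OF assms], unfolded comp_def, symmetric])
  finally show ?thesis by (simp add: mono_at_def)
qed

lemma has_sum_sw:
  assumes "((\<lambda>\<mu>. f \<mu>) has_sum s) UNIV"
  shows "((\<lambda>\<mu>. f (\<mu> \<circ> sw a)) has_sum s) UNIV"
  using assms by (rule has_sum_reindex_bij_witness[of _ "\<lambda>\<mu>. \<mu> \<circ> sw a" "\<lambda>\<mu>. \<mu> \<circ> sw a", THEN iffD1, rotated -1]) auto

lemma psum_sw_N:
  assumes "a \<in> {1..<N}"
  shows "psum (\<mu> \<circ> sw a) N = psum \<mu> N"
  unfolding psum_def by (rule sum.permute[OF sw_permutes[OF assms], symmetric])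

lemma ivec_sw:
  assumes "a \<in> {1..<N}"
  shows "\<mu> \<circ> sw a \<in> ivec N \<longleftrightarrow> \<mu> \<in> ivec N"
proof -
  have "\<mu> \<circ> sw a \<in> ivec N" if "\<mu> \<in> ivec N" for \<mu>
    unfolding ivec_def
  proof (rule CollectI, intro allI impI)
    fix i assume "i \<notin> {1..N}"
    then have "sw a i \<notin> {1..N}" using sw_mem[OF assms] by simp
    then show "(\<mu> \<circ> sw a) i = 0" using that by (simp add: ivec_def)
  qed
  from this[of \<mu>] this[of "\<mu> \<circ> sw a"] show ?thesis by auto
qed

text \<open>The cone is not stable under permutations, but the set of nonnegative vectors of total d
  is, and it lies in the cone. So the permuted coefficients represent a function again, and
  uniqueness applies.\<close>

lemma npoly_antisym:
  assumes g: "rep N (nonzeros N) d g X" "nonneg_supp X" and a: "a \<in> {1..<N}"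
    and anti: "\<And>x. x \<in> ratio_region N 1 \<Longrightarrow> g (x \<circ> sw a) = - g x"
  shows "X (\<mu> \<circ> sw a) = - X \<mu>"
proof -
  have N: "1 \<le> N" using a by auto
  have "rep N (ratio_region N 1) d (\<lambda>x. - 1 * g x) (\<lambda>\<mu>. X (\<mu> \<circ> sw a))"
    unfolding rep_def
  proof (intro conjI allI impI ballI)
    fix \<mu> assume "X (\<mu> \<circ> sw a) \<noteq> 0"
    then have 1: "smul d (unit_vec (Suc 0)) - (\<mu> \<circ> sw a) \<in> Qplus N" and 2: "\<And>i. 0 \<le> (\<mu> \<circ> sw a) i"
      using g by (auto simp: rep_def nonneg_supp_def)
    have "\<mu> \<in> ivec N" "psum \<mu> N = int d"
      using cone_degree[OF 1 N] ivec_sw[OF a] psum_sw_N[OF a] by auto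
    moreover have "0 \<le> \<mu> i" for i using 2[of "sw a i"] by simp
    ultimately show "smul d (unit_vec (Suc 0)) - \<mu> \<in> Qplus N" by (intro nonneg_cone N)
  next
    fix x assume x: "x \<in> ratio_region N 1"
    have "x \<circ> sw a \<in> nonzeros N"
      using ratio_region_nonzero[OF x] sw_mem[OF a] by (auto simp: nonzeros_def)
    then have "((\<lambda>\<mu>. X \<mu> * mono_at N (x \<circ> sw a) \<mu>) has_sum g (x \<circ> sw a)) UNIV"
      using g(1) by (simp add: rep_def)
    from has_sum_sw[OF this, of a]
    show "((\<lambda>\<mu>. X (\<mu> \<circ> sw a) * mono_at N x \<mu>) has_sum - 1 * g x) UNIV"
      by (simp add: mono_at_sw[OF a] anti[OF x])
  qed
  moreover have "rep N (ratio_region N 1) d (\<lambda>x. - 1 * g x) (\<lambda>\<mu>. - 1 * X \<mu>)"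
    by (intro rep_cmult rep_subset[OF g(1) region_nonzeros])
  ultimately have "(\<lambda>\<mu>. X (\<mu> \<circ> sw a)) = (\<lambda>\<mu>. - 1 * X \<mu>)"
    by (intro rep_unique[of N 1]) auto
  from fun_cong[OF this, of \<mu>] show ?thesis by simp
qed

section \<open>Multiplication by products of differences, on coefficients\<close>

definition diff_ops :: "(nat \<times> nat) list \<Rightarrow> ((nat \<Rightarrow> int) \<Rightarrow> complex) \<Rightarrow> (nat \<Rightarrow> int) \<Rightarrow> complex" where
  "diff_ops l X = foldr (\<lambda>(i, j). diff_op 1 1 i j) l X"

lemma rep_diff_ops:
  assumes X: "rep N D d g X" and l: "set l \<subseteq> {1..N} \<times> {1..N}" and D: "D \<subseteq> nonzeros N"
  shows "rep N D (d + length l) (\<lambda>x. (\<Prod>(i, j)\<leftarrow>l. x i - x j) * g x) (diff_ops l X)"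
  using l
proof (induction l)
  case (Cons p l)
  obtain i j where p: "p = (i, j)" by (cases p)
  have "rep N D (Suc (d + length l)) (\<lambda>x. (1 * x i - 1 * x j) * ((\<Prod>(i, j)\<leftarrow>l. x i - x j) * g x)) (diff_op 1 1 i j (diff_ops l X))"
    by (rule rep_diff_op[OF _ _ _ D]) (use Cons p in auto)
  then show ?case by (simp add: p diff_ops_def mult.assoc)
qed (use X in \<open>simp add: diff_ops_def\<close>)

lemma diff_ops_diff: "diff_ops l (\<lambda>\<mu>. X \<mu> - Y \<mu>) \<mu> = diff_ops l X \<mu> - diff_ops l Y \<mu>"
  by (induction l arbitrary: \<mu>) (auto simp: diff_ops_def diff_op_def algebra_simps split: prod.splits)

lemma diff_ops_Cons: "diff_ops ((i, j) # l) X \<mu> = diff_ops l X (\<mu> - unit_vec i) - diff_ops l X (\<mu> - unit_vec j)"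
  by (simp add: diff_ops_def diff_op_def)

lemma diff_ops_sw: "diff_ops l (\<lambda>\<mu>. X (\<mu> \<circ> sw a)) \<mu> = diff_ops (map (map_prod (sw a) (sw a)) l) X (\<mu> \<circ> sw a)"
proof (induction l arbitrary: \<mu>)
  case Nil
  show ?case by (simp add: diff_ops_def)
next
  case (Cons p l)
  obtain i j where p: "p = (i, j)" by (cases p)
  show "diff_ops (p # l) (\<lambda>\<mu>. X (\<mu> \<circ> sw a)) \<mu> = diff_ops (map (map_prod (sw a) (sw a)) (p # l)) X (\<mu> \<circ> sw a)"
    unfolding p list.map map_prod_simp diff_ops_Cons Cons.IH diff_sw unit_vec_sw ..
qed

text \<open>Vanishing far out in the direction \<open>e\<^sub>i - e\<^sub>j\<close> makes multiplication by \<open>x\<^sub>i - x\<^sub>j\<close> injective.\<close>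

definition vanishing_dir :: "nat \<Rightarrow> nat \<Rightarrow> ((nat \<Rightarrow> int) \<Rightarrow> complex) \<Rightarrow> bool" where
  "vanishing_dir i j X \<longleftrightarrow> (\<forall>\<mu>. \<exists>K. \<forall>n\<ge>K. X (\<mu> + smul n (rt i j)) = 0)"

lemma vanishing_dir_diff_op:
  assumes "vanishing_dir k l X"
  shows "vanishing_dir k l (diff_op a b i j X)"
  unfolding vanishing_dir_def
proof
  fix \<mu>
  from assms obtain K1 K2 where K: "\<And>n. n \<ge> K1 \<Longrightarrow> X (\<mu> - unit_vec i + smul n (rt k l)) = 0"
    "\<And>n. n \<ge> K2 \<Longrightarrow> X (\<mu> - unit_vec j + smul n (rt k l)) = 0"
    unfolding vanishing_dir_def by meson
  have comm: "\<mu> + s - unit_vec i = \<mu> - unit_vec i + s" for s i by (simp add: algebra_simps)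
  show "\<exists>K. \<forall>n\<ge>K. diff_op a b i j X (\<mu> + smul n (rt k l)) = 0"
    using K by (intro exI[of _ "max K1 K2"]) (simp add: diff_op_def comm)
qed

text \<open>A family killed by x_i - x_j is constant along the direction e_i - e_j, so a single zero
  on each line suffices.\<close>

lemma diff_op_injective:
  assumes zero: "\<And>\<mu>. diff_op 1 1 i j X \<mu> = 0" and van: "vanishing_dir i j X \<or> vanishing_dir j i X"
  shows "X \<mu> = 0"
proof -
  have eq: "X (\<mu> - unit_vec i) = X (\<mu> - unit_vec j)" for \<mu> using zero[of \<mu>] by (simp add: diff_op_def)
  have step: "X (\<mu> + rt i j) = X \<mu>" for \<mu>
    using eq[of "\<mu> + unit_vec i"] by (simp add: rt_unit_vec algebra_simps)
  have step': "X (\<mu> + rt j i) = X \<mu>" for \<mu>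
    using eq[of "\<mu> + unit_vec j"] by (simp add: rt_unit_vec algebra_simps)
  have "X (\<mu> + smul n (rt i j)) = X \<mu>" for n
    by (induction n) (simp, simp only: smul_Suc add.assoc[symmetric] step)
  moreover have "X (\<mu> + smul n (rt j i)) = X \<mu>" for n
    by (induction n) (simp, simp only: smul_Suc add.assoc[symmetric] step')
  ultimately show ?thesis using van unfolding vanishing_dir_def by (metis order_refl)
qed

lemma diff_ops_injective:
  assumes "\<And>\<mu>. diff_ops l X \<mu> = 0"
    and "\<And>i j. (i, j) \<in> set l \<Longrightarrow> vanishing_dir i j X \<or> vanishing_dir j i X"
  shows "X \<mu> = 0"
  using assms
proof (induction l arbitrary: \<mu>)
  case (Cons p l)
  obtain i j where p: "p = (i, j)" by (cases p)
  have van: "vanishing_dir k m (diff_ops l' X)" if "vanishing_dir k m X" for k m l'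
    using that by (induction l') (auto simp: diff_ops_def intro: vanishing_dir_diff_op)
  have "diff_ops l X \<mu> = 0" for \<mu>
  proof (rule diff_op_injective[of i j])
    show "diff_op 1 1 i j (diff_ops l X) \<mu> = 0" for \<mu> using Cons.prems(1)[of \<mu>] by (simp add: diff_ops_def p)
    show "vanishing_dir i j (diff_ops l X) \<or> vanishing_dir j i (diff_ops l X)"
      using Cons.prems(2)[of i j] van by (auto simp: p)
  qed
  then show ?case using Cons.prems(2) by (intro Cons.IH) auto
qed (simp add: diff_ops_def)

section \<open>Removal of the denominators of D_1\<close>

lemma D1_coeff_sw:
  assumes "a \<in> {1..<N}" "i \<in> {1..N}"
  shows "D1_coeff N t i (x \<circ> sw a) = D1_coeff N t (sw a i) x"
proof -
  have "bij_betw (sw a) ({1..N} - {i}) ({1..N} - {sw a i})"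
    using permutes_imp_bij[OF sw_permutes[OF assms(1)]] assms sw_mem[OF assms(1), of i]
    by (intro bij_betw_DiffI) (auto simp: bij_betw_def)
  then have "(\<Prod>j\<in>{1..N} - {sw a i}. (t * x (sw a i) - x j) / (x (sw a i) - x j)) =
    (\<Prod>j\<in>{1..N} - {i}. (t * x (sw a i) - x (sw a j)) / (x (sw a i) - x (sw a j)))"
    by (rule prod.reindex_bij_betw[symmetric])
  then show ?thesis by (simp add: D1_coeff_def)
qed

lemma D1_sw:
  assumes a: "a \<in> {1..<N}" and f: "\<And>x. x \<in> nonzeros N \<Longrightarrow> f (x \<circ> sw a) = f x"
    and x: "x \<in> nonzeros N" and q: "q \<noteq> 0"
  shows "D1 N q t f (x \<circ> sw a) = D1 N q t f x"
proof -
  have "D1 N q t f (x \<circ> sw a) = (\<Sum>i\<in>{1..N}. D1_coeff N t (sw a i) x * f (x(sw a i := q * x (sw a i))))"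
    unfolding D1_def
  proof (rule sum.cong[OF refl])
    fix i assume i: "i \<in> {1..N}"
    have "(x \<circ> sw a)(i := q * (x \<circ> sw a) i) = x(sw a i := q * x (sw a i)) \<circ> sw a"
      by (auto simp: fun_eq_iff sw_eq)
    moreover have "x(sw a i := q * x (sw a i)) \<in> nonzeros N"
      using x q by (auto simp: nonzeros_def)
    ultimately show "D1_coeff N t i (x \<circ> sw a) * f ((x \<circ> sw a)(i := q * (x \<circ> sw a) i)) =
      D1_coeff N t (sw a i) x * f (x(sw a i := q * x (sw a i)))"
      by (simp only: D1_coeff_sw[OF a i] f)
  qed
  also have "\<dots> = D1 N q t f x"
    unfolding D1_def by (rule sum.permute[OF sw_permutes[OF a], unfolded comp_def, symmetric])
  finally show ?thesis .
qed

text \<open>Ordered pairs, so that (i, j) and (j, i) both occur: the set is invariant under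
  exchanging a and Suc a, and no signs have to be tracked.\<close>

definition off_pairs :: "nat \<Rightarrow> nat \<Rightarrow> (nat \<times> nat) set" where
  "off_pairs N a = {(i, j). i \<in> {1..N} \<and> j \<in> {1..N} \<and> i \<noteq> j} - {(a, Suc a), (Suc a, a)}"

lemma finite_off_pairs: "finite (off_pairs N a)"
  by (rule finite_subset[of _ "{1..N} \<times> {1..N}"]) (auto simp: off_pairs_def)

text \<open>A common denominator of the coefficients of D_1. The adjacent pair enters only once,
  which makes the product antisymmetric under the exchange of a and Suc a.\<close>

definition semi_vand :: "nat \<Rightarrow> nat \<Rightarrow> (nat \<Rightarrow> complex) \<Rightarrow> complex" where
  "semi_vand N a x = (x a - x (Suc a)) * (\<Prod>(i, j)\<in>off_pairs N a. x i - x j)"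

lemma off_pairs_sw:
  assumes a: "a \<in> {1..<N}"
  shows "bij_betw (map_prod (sw a) (sw a)) (off_pairs N a) (off_pairs N a)"
proof -
  have mem: "map_prod (sw a) (sw a) p \<in> off_pairs N a" if "p \<in> off_pairs N a" for p
  proof -
    obtain i j where p: "p = (i, j)" by (cases p)
    have "sw a i \<in> {1..N}" "sw a j \<in> {1..N}" "sw a i \<noteq> sw a j"
      using that sw_mem[OF a, of i] sw_mem[OF a, of j] by (simp_all add: p off_pairs_def sw_inj)
    moreover have "(sw a i, sw a j) \<notin> {(a, Suc a), (Suc a, a)}"
      using that by (auto simp: p off_pairs_def sw_eq)
    ultimately show ?thesis by (simp add: p off_pairs_def)
  qed
  show ?thesis
    by (rule bij_betw_byWitness[where f' = "map_prod (sw a) (sw a)"]) (use mem in auto)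
qed

lemma prod_off_pairs_sw:
  assumes "a \<in> {1..<N}"
  shows "(\<Prod>(i, j)\<in>off_pairs N a. x (sw a i) - x (sw a j)) = (\<Prod>(i, j)\<in>off_pairs N a. x i - x j)"
  using prod.reindex_bij_betw[OF off_pairs_sw[OF assms], of "\<lambda>(i, j). x i - x j"]
  by (simp add: case_prod_unfold)

lemma semi_vand_sw: "a \<in> {1..<N} \<Longrightarrow> semi_vand N a (x \<circ> sw a) = - semi_vand N a x"
  using prod_off_pairs_sw[of a N x] by (simp add: semi_vand_def algebra_simps)

text \<open>The denominator of the i-th coefficient is the product over the pairs (i, j). They all
  lie in \<open>off_pairs\<close> unless i is a or Suc a; then the missing one is x_a - x_(Suc a) up
  to sign. Numerator and denominator have equal degree, so only the degree of the multiplier is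
  added.\<close>

lemma semi_vand_D1_coeff:
  assumes a: "a \<in> {1..<N}" and i: "i \<in> {1..N}" and g: "npoly N d g"
  shows "\<exists>h. npoly N (d + Suc (card (off_pairs N a))) h \<and>
    (\<forall>x. inj_on x {1..N} \<longrightarrow> h x = semi_vand N a x * D1_coeff N t i x * g x)"
proof -
  \<comment> \<open>The indices j for which the denominator x_i - x_j is taken from
    \<open>off_pairs\<close>.\<close>
  define J where "J = {1..N} - {i} - (if i = a then {Suc a} else if i = Suc a then {a} else {})"
  define R where "R = Pair i ` J"
  have R: "R \<subseteq> off_pairs N a" using a i by (auto simp: R_def J_def off_pairs_def split: if_splits)
  have cR: "card R = card J" by (simp add: R_def card_image inj_on_def)
  define T where "T = Pair i ` ({1..N} - {i})"
  have cT: "card T = N - 1" using i by (simp add: T_def card_image inj_on_def)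
  define h where "h x = (\<Prod>(k, l)\<in>T. t * x k - x l) * ((\<Prod>(k, l)\<in>off_pairs N a - R. 1 * x k - x l) * g x)" for x
  have sub: "off_pairs N a - R \<subseteq> {1..N} \<times> {1..N}" "T \<subseteq> {1..N} \<times> {1..N}"
    using i by (auto simp: off_pairs_def T_def)
  have "npoly N (d + card (off_pairs N a - R) + card T) h"
    unfolding h_def using finite_off_pairs[of N a] sub
    by (intro npoly_prod g) (auto simp: T_def)
  moreover have cards: "card (off_pairs N a - R) = card (off_pairs N a) - card J" "card J \<le> card (off_pairs N a)"
    using card_Diff_subset[of R "off_pairs N a"] card_mono[OF finite_off_pairs R] finite_subset[OF R finite_off_pairs] R
    by (simp_all add: cR)
  ultimately have np: "npoly N (d + (card (off_pairs N a) - card J) + (N - 1)) h" by (simp add: cT)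
  have hx: "h x * (\<Prod>j\<in>J. x i - x j) = (\<Prod>(k, l)\<in>off_pairs N a. x k - x l) * (\<Prod>j\<in>{1..N} - {i}. t * x i - x j) * g x" for x
  proof -
    have "(\<Prod>(k, l)\<in>off_pairs N a. x k - x l) = (\<Prod>(k, l)\<in>off_pairs N a - R. x k - x l) * (\<Prod>(k, l)\<in>R. x k - x l)"
      by (rule prod.subset_diff[OF R finite_off_pairs])
    also have "(\<Prod>(k, l)\<in>R. x k - x l) = (\<Prod>j\<in>J. x i - x j)"
      unfolding R_def by (subst prod.reindex) (auto simp: inj_on_def)
    finally show ?thesis
      unfolding h_def T_def by (subst prod.reindex) (auto simp: inj_on_def)
  qed
  have inj_nz: "(\<Prod>j\<in>J. x i - x j) \<noteq> 0" if "inj_on x {1..N}" for x :: "nat \<Rightarrow> complex"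
  proof -
    have "x i - x j \<noteq> 0" if j: "j \<in> J" for j
    proof -
      have "j \<in> {1..N}" "j \<noteq> i" using j by (auto simp: J_def)
      then show ?thesis using inj_onD[OF \<open>inj_on x {1..N}\<close>, of i j] i by auto
    qed
    moreover have "finite J" by (simp add: J_def)
    ultimately show ?thesis by simp
  qed
  show ?thesis
  proof (cases "i = a \<or> i = Suc a")
    case False
    then have J: "J = {1..N} - {i}" by (simp add: J_def)
    have cJ: "card J = N - 1" unfolding J using i by simp
    have "npoly N (Suc (d + (card (off_pairs N a) - card J) + (N - 1))) (\<lambda>x. (1 * x a - 1 * x (Suc a)) * h x)"
      by (rule npoly_diff_op[OF np]) (use a in auto)
    moreover have "Suc (d + (card (off_pairs N a) - card J) + (N - 1)) = d + Suc (card (off_pairs N a))"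
      using cards(2) cJ by simp
    ultimately have np': "npoly N (d + Suc (card (off_pairs N a))) (\<lambda>x. (1 * x a - 1 * x (Suc a)) * h x)"
      by (simp only:)
    have "(1 * x a - 1 * x (Suc a)) * h x = semi_vand N a x * D1_coeff N t i x * g x" if "inj_on x {1..N}" for x
    proof -
      have "h x = (\<Prod>(k, l)\<in>off_pairs N a. x k - x l) * (\<Prod>j\<in>{1..N} - {i}. t * x i - x j) * g x / (\<Prod>j\<in>J. x i - x j)"
        by (rule eq_divide_imp[OF inj_nz[OF that] hx[of x]])
      then show ?thesis
        unfolding semi_vand_def D1_coeff_def prod_dividef J by simp
    qed
    with np' show ?thesis by (intro exI[of _ "\<lambda>x. (1 * x a - 1 * x (Suc a)) * h x"] conjI allI impI)
  next
    case True
    define b where "b = (if i = a then Suc a else a)"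
    have b: "b \<in> {1..N} - {i}" "J = {1..N} - {i} - {b}" using True a by (auto simp: b_def J_def)
    define s where "s = (if i = a then 1 else - 1 :: complex)"
    have cJ: "card J = N - 2" unfolding b(2) using b(1) i by (simp add: card_Diff_singleton)
    have N2: "2 \<le> N" using a by auto
    have pb: "(\<Prod>j\<in>{1..N} - {i}. x i - x j) = (x i - x b) * (\<Prod>j\<in>J. x i - x j)" for x :: "nat \<Rightarrow> complex"
      unfolding b(2) by (rule prod.remove) (use b in auto)
    have sb: "x a - x (Suc a) = s * (x i - x b)" for x :: "nat \<Rightarrow> complex"
      using True by (auto simp: s_def b_def)
    have "\<exists>X. nonneg_supp X \<and> rep N (nonzeros N) (d + (card (off_pairs N a) - card J) + (N - 1)) h X"
      using np by (simp add: npoly_def)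
    then obtain X where "nonneg_supp X" "rep N (nonzeros N) (d + (card (off_pairs N a) - card J) + (N - 1)) h X" by blast
    then have "npoly N (d + (card (off_pairs N a) - card J) + (N - 1)) (\<lambda>x. s * h x)"
      unfolding npoly_def by (intro exI[of _ "\<lambda>\<mu>. s * X \<mu>"]) (auto intro: rep_cmult simp: nonneg_supp_def)
    moreover have "d + (card (off_pairs N a) - card J) + (N - 1) = d + Suc (card (off_pairs N a))"
      using cards(2) cJ N2 by simp
    ultimately have np': "npoly N (d + Suc (card (off_pairs N a))) (\<lambda>x. s * h x)"
      by (simp only:)
    have "s * h x = semi_vand N a x * D1_coeff N t i x * g x" if "inj_on x {1..N}" for x
    proof -
      have "x i - x b \<noteq> 0" using inj_onD[OF that, of i b] i b(1) by auto
      moreover have "h x = (\<Prod>(k, l)\<in>off_pairs N a. x k - x l) * (\<Prod>j\<in>{1..N} - {i}. t * x i - x j) * g x / (\<Prod>j\<in>J. x i - x j)"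
        by (rule eq_divide_imp[OF inj_nz[OF that] hx[of x]])
      ultimately show ?thesis
        unfolding semi_vand_def D1_coeff_def prod_dividef pb sb by simp
    qed
    with np' show ?thesis by (intro exI[of _ "\<lambda>x. s * h x"] conjI allI impI)
  qed
qed

lemma region_inj:
  assumes "x \<in> ratio_region N 1"
  shows "inj_on x {1..N}"
proof (rule inj_onI)
  fix i j assume "i \<in> {1..N}" "j \<in> {1..N}" "x i = x j"
  then show "i = j"
    using ratio_region_less[OF assms, of i j] ratio_region_less[OF assms, of j i] by (cases i j rule: linorder_cases) auto
qed

lemma psum_rt_sw_less:
  assumes "k < l" "(k, l) \<noteq> (a, Suc a)"
  shows "sw a k < sw a l"
  using assms by (auto simp: Transposition.transpose_def)

text \<open>\<open>B\<close> is the expansion of D_1 f in a region that the exchange of variables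
  leaves, so symmetry of the function does not pass to \<open>B\<close> directly. Multiplication by
  \<open>semi_vand\<close> makes D_1 f an antisymmetric polynomial, with antisymmetric coefficients;
  the factors x_i - x_j are then cancelled on the side of coefficients.\<close>

lemma D1_coefficients_symmetric:
  assumes a: "a \<in> {1..<N}" and q: "q \<noteq> 0"
    and f: "rep N (nonzeros N) d f X" "nonneg_supp X" "\<And>\<mu>. X (\<mu> \<circ> sw a) = X \<mu>"
    and B: "rep N (ratio_region N \<epsilon>) d (D1 N q t f) B" "0 < \<epsilon>" "\<epsilon> \<le> 1"
    and Bv: "\<And>i j. 1 \<le> i \<Longrightarrow> i < j \<Longrightarrow> j \<le> N \<Longrightarrow> vanishing_dir i j B"
  shows "B (\<mu> \<circ> sw a) = B \<mu>"
proof -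
  have N: "1 \<le> N" using a by auto
  have fsym: "f (x \<circ> sw a) = f x" if x: "x \<in> nonzeros N" for x
  proof -
    have "x \<circ> sw a \<in> nonzeros N" using x sw_mem[OF a] by (auto simp: nonzeros_def)
    then have "((\<lambda>\<mu>. X \<mu> * mono_at N (x \<circ> sw a) \<mu>) has_sum f (x \<circ> sw a)) UNIV"
      using f(1) by (simp add: rep_def)
    from has_sum_sw[OF this, of a] have "((\<lambda>\<mu>. X \<mu> * mono_at N x \<mu>) has_sum f (x \<circ> sw a)) UNIV"
      by (simp add: mono_at_sw[OF a] f(3))
    moreover have "((\<lambda>\<mu>. X \<mu> * mono_at N x \<mu>) has_sum f x) UNIV" using f(1) x by (simp add: rep_def)
    ultimately show ?thesis by (rule has_sum_unique)
  qed
  define m where "m = d + Suc (card (off_pairs N a))"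
  have "\<exists>h. npoly N m h \<and> (\<forall>x. inj_on x {1..N} \<longrightarrow> h x = semi_vand N a x * D1_coeff N t i x * f (x(i := q * x i)))"
    if i: "i \<in> {1..N}" for i
    unfolding m_def
  proof (rule semi_vand_D1_coeff[OF a i])
    have "rep N (nonzeros N) d (\<lambda>x. f (x(i := q * x i))) (\<lambda>\<mu>. q powi \<mu> i * X \<mu>)"
      unfolding rep_def
    proof (intro conjI ballI)
      show "\<forall>\<mu>. q powi \<mu> i * X \<mu> \<noteq> 0 \<longrightarrow> smul d (unit_vec (Suc 0)) - \<mu> \<in> Qplus N" using f(1) by (simp add: rep_def)
      fix x assume x: "x \<in> nonzeros N"
      then have "x(i := q * x i) \<in> nonzeros N" using q by (auto simp: nonzeros_def)
      then have "((\<lambda>\<mu>. X \<mu> * mono_at N (x(i := q * x i)) \<mu>) has_sum f (x(i := q * x i))) UNIV"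
        using f(1) by (simp add: rep_def)
      then show "((\<lambda>\<mu>. q powi \<mu> i * X \<mu> * mono_at N x \<mu>) has_sum f (x(i := q * x i))) UNIV"
        unfolding mono_at_upd[OF i] by (simp only: mult_ac)
    qed
    moreover have "nonneg_supp (\<lambda>\<mu>. q powi \<mu> i * X \<mu>)" using f(2) by (simp add: nonneg_supp_def)
    ultimately show "npoly N d (\<lambda>x. f (x(i := q * x i)))" unfolding npoly_def by blast
  qed
  then obtain h where h: "\<And>i. i \<in> {1..N} \<Longrightarrow> npoly N m (h i)"
    "\<And>i x. i \<in> {1..N} \<Longrightarrow> inj_on x {1..N} \<Longrightarrow> h i x = semi_vand N a x * D1_coeff N t i x * f (x(i := q * x i))"
    by metis
  define E where "E x = (\<Sum>i\<in>{1..N}. h i x)" for x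
  have "npoly N m E" unfolding E_def by (rule npoly_sum) (use h in auto)
  then obtain Y where Y: "nonneg_supp Y" "rep N (nonzeros N) m E Y" by (auto simp: npoly_def)
  have Ex: "E x = semi_vand N a x * D1 N q t f x" if "inj_on x {1..N}" for x
    unfolding E_def D1_def sum_distrib_left by (intro sum.cong refl) (simp add: h(2)[OF _ that])
  have anti: "Y (\<mu> \<circ> sw a) = - Y \<mu>" for \<mu>
  proof (rule npoly_antisym[OF Y(2,1) a])
    fix x assume x: "x \<in> ratio_region N 1"
    have "inj_on (x \<circ> sw a) {1..N}"
      using region_inj[OF x] permutes_inj_on[OF sw_permutes[OF a]] permutes_image[OF sw_permutes[OF a]]
      by (intro comp_inj_on) auto
    then show "E (x \<circ> sw a) = - E x"
      using Ex[of x] Ex[of "x \<circ> sw a"] region_inj[OF x] D1_sw[of a N f x q t, OF a fsym _ q]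
        subsetD[OF region_nonzeros x] semi_vand_sw[OF a, of x] by simp
  qed
  obtain l0 where l0: "set l0 = off_pairs N a" "distinct l0"
    using finite_distinct_list[OF finite_off_pairs] by blast
  \<comment> \<open>The factor of (a, Suc a) stands last and is thus the innermost one: all others
    can be stripped off before it.\<close>
  define l where "l = l0 @ [(a, Suc a)]"
  define l' where "l' = map (map_prod (sw a) (sw a)) l"
  have ll: "length l = Suc (card (off_pairs N a))" using l0 distinct_card[of l0] by (simp add: l_def)
  have "off_pairs N a \<subseteq> {1..N} \<times> {1..N}" by (auto simp: off_pairs_def)
  then have lsub: "set l \<subseteq> {1..N} \<times> {1..N}" using a by (simp add: l_def l0)
  have l'sub: "set l' \<subseteq> {1..N} \<times> {1..N}"
  proof
    fix p assume "p \<in> set l'"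
    then obtain i j where ij: "(i, j) \<in> set l" and p: "p = (sw a i, sw a j)" by (auto simp: l'_def)
    have i: "i \<in> {1..N}" and j: "j \<in> {1..N}" using subsetD[OF lsub ij] by blast+
    show "p \<in> {1..N} \<times> {1..N}"
      unfolding p by (intro SigmaI sw_mem[OF a, THEN iffD2] i j)
  qed
  have pl0: "(\<Prod>(i, j)\<leftarrow>l0. F i j) = (\<Prod>(i, j)\<in>off_pairs N a. F i j)" for F :: "nat \<Rightarrow> nat \<Rightarrow> complex"
    using prod.distinct_set_conv_list[OF l0(2), of "\<lambda>(i, j). F i j"] l0(1) by simp
  have pl: "(\<Prod>(i, j)\<leftarrow>l. x i - x j) = semi_vand N a x" for x
    by (simp add: l_def pl0 semi_vand_def)
  have pl': "(\<Prod>(i, j)\<leftarrow>l'. x i - x j) = - semi_vand N a x" for x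
  proof -
    have "(\<Prod>(i, j)\<leftarrow>l'. x i - x j) = (\<Prod>(i, j)\<leftarrow>l. (x \<circ> sw a) i - (x \<circ> sw a) j)"
      by (simp add: l'_def comp_def case_prod_unfold)
    then show ?thesis unfolding pl semi_vand_sw[OF a] .
  qed
  have sub1: "ratio_region N \<epsilon> \<subseteq> nonzeros N" by (rule region_nonzeros)
  have inj\<epsilon>: "inj_on x {1..N}" if "x \<in> ratio_region N \<epsilon>" for x
    using region_inj ratio_region_mono[OF B(3) that] by blast
  have YR: "rep N (ratio_region N \<epsilon>) m (\<lambda>x. semi_vand N a x * D1 N q t f x) Y"
    by (rule rep_cong[OF rep_subset[OF Y(2) sub1] Ex[OF inj\<epsilon>]])
  have e1: "diff_ops l B = Y"
  proof (rule rep_unique[OF _ YR B(2)])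
    show "rep N (ratio_region N \<epsilon>) m (\<lambda>x. semi_vand N a x * D1 N q t f x) (diff_ops l B)"
      using rep_diff_ops[OF B(1) lsub sub1] unfolding pl ll m_def .
  qed
  have e2: "diff_ops l' B = (\<lambda>\<mu>. - 1 * Y \<mu>)"
  proof (rule rep_unique[OF _ rep_cmult[OF YR] B(2)])
    show "rep N (ratio_region N \<epsilon>) m (\<lambda>x. - 1 * (semi_vand N a x * D1 N q t f x)) (diff_ops l' B)"
      using rep_diff_ops[OF B(1) l'sub sub1] unfolding pl' by (simp add: l'_def ll m_def)
  qed
  \<comment> \<open>Antisymmetric under the exchange by construction. Multiplication by the full
    product sends it to Y(\<mu>) + Y(\<mu> o sw), which is 0.\<close>
  define C where "C \<mu> = B \<mu> - B (\<mu> \<circ> sw a)" for \<mu>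
  have "diff_ops l C \<mu> = 0" for \<mu>
  proof -
    have "diff_ops l C \<mu> = diff_ops l B \<mu> - diff_ops l (\<lambda>\<mu>. B (\<mu> \<circ> sw a)) \<mu>"
      unfolding C_def[abs_def] by (rule diff_ops_diff)
    also have "diff_ops l (\<lambda>\<mu>. B (\<mu> \<circ> sw a)) \<mu> = diff_ops l' B (\<mu> \<circ> sw a)" unfolding l'_def by (rule diff_ops_sw)
    finally show ?thesis unfolding e1 e2 anti by simp
  qed
  then have z: "diff_ops l0 (diff_op 1 1 a (Suc a) C) \<mu> = 0" for \<mu>
    by (simp add: l_def diff_ops_def)
  have vC: "vanishing_dir i j C" if ij: "1 \<le> i" "i < j" "j \<le> N" "(i, j) \<noteq> (a, Suc a)" for i j
    unfolding vanishing_dir_def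
  proof
    fix \<mu>
    have mem: "sw a i \<in> {1..N}" "sw a j \<in> {1..N}" using ij sw_mem[OF a] by auto
    obtain K1 where K1: "\<And>n. n \<ge> K1 \<Longrightarrow> B (\<mu> + smul n (rt i j)) = 0"
      using Bv[OF ij(1-3)] unfolding vanishing_dir_def by meson
    obtain K2 where K2: "\<And>n. n \<ge> K2 \<Longrightarrow> B ((\<mu> \<circ> sw a) + smul n (rt (sw a i) (sw a j))) = 0"
      using Bv[of "sw a i" "sw a j"] psum_rt_sw_less[OF ij(2,4)] mem unfolding vanishing_dir_def by force
    have "(\<mu> + smul n (rt i j)) \<circ> sw a = (\<mu> \<circ> sw a) + smul n (rt (sw a i) (sw a j))" for n
      by (auto simp: fun_eq_iff smul_def rt_def sw_eq)
    then show "\<exists>K. \<forall>n\<ge>K. C (\<mu> + smul n (rt i j)) = 0"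
      using K1 K2 by (intro exI[of _ "max K1 K2"]) (simp add: C_def)
  qed
  have C0: "diff_op 1 1 a (Suc a) C \<mu> = 0" for \<mu>
  proof (rule diff_ops_injective[OF z])
    fix i j assume "(i, j) \<in> set l0"
    then have ij: "i \<in> {1..N}" "j \<in> {1..N}" "i \<noteq> j" "(i, j) \<noteq> (a, Suc a)" "(j, i) \<noteq> (a, Suc a)"
      using l0 by (auto simp: off_pairs_def)
    then show "vanishing_dir i j (diff_op 1 1 a (Suc a) C) \<or> vanishing_dir j i (diff_op 1 1 a (Suc a) C)"
      using vC[of i j] vC[of j i] vanishing_dir_diff_op by (cases "i < j") force+
  qed
  \<comment> \<open>Along e_a - e_(a+1) no vanishing is known for C, since B vanishes far out one
    way and its mirror image the other way. But C is constant along this line, which contains \<mu>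
    and its image under the exchange, so antisymmetry forces C = 0.\<close>
  have eq: "C (\<mu> - unit_vec a) = C (\<mu> - unit_vec (Suc a))" for \<mu> using C0[of \<mu>] by (simp add: diff_op_def)
  have step: "C (\<mu> + rt a (Suc a)) = C \<mu>" for \<mu>
    using eq[of "\<mu> + unit_vec a"] by (simp add: rt_unit_vec algebra_simps)
  have steps: "C (\<mu> + smul n (rt a (Suc a))) = C \<mu>" for n \<mu>
    by (induction n) (simp, simp only: smul_Suc add.assoc[symmetric] step)
  have "C (\<mu> \<circ> sw a) = C \<mu>"
  proof (cases "\<mu> a \<le> \<mu> (Suc a)")
    case True
    then have "\<mu> \<circ> sw a = \<mu> + smul (nat (\<mu> (Suc a) - \<mu> a)) (rt a (Suc a))"
      by (auto simp: fun_eq_iff smul_def rt_def transpose_def)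
    then show ?thesis using steps by simp
  next
    case False
    then have "\<mu> = (\<mu> \<circ> sw a) + smul (nat (\<mu> a - \<mu> (Suc a))) (rt a (Suc a))"
      by (auto simp: fun_eq_iff smul_def rt_def transpose_def)
    then show ?thesis using steps[of "\<mu> \<circ> sw a" "nat (\<mu> a - \<mu> (Suc a))"] by simp
  qed
  then show ?thesis by (simp add: C_def)
qed

section \<open>Macdonald polynomials for large t\<close>

definition dominant :: "nat \<Rightarrow> (nat \<Rightarrow> int) \<Rightarrow> bool" where
  "dominant N \<mu> \<longleftrightarrow> (\<forall>i\<in>{1..<N}. \<mu> (Suc i) \<le> \<mu> i)"

lemma dominant_antimono:
  assumes "dominant N \<mu>" "i \<le> j" "1 \<le> i" "j \<le> N"
  shows "\<mu> j \<le> \<mu> i"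
  using assms(2,4)
proof (induction j rule: dec_induct)
  case (step n)
  then have "\<mu> (Suc n) \<le> \<mu> n" using assms by (auto simp: dominant_def)
  then show ?case using step by simp
qed simp

lemma psum_permute:
  assumes "\<sigma> permutes {1..N}"
  shows "psum (\<mu> \<circ> \<sigma>) N = psum \<mu> N"
  unfolding psum_def by (rule sum.permute[OF assms, symmetric])

lemma ivec_permute:
  assumes "\<sigma> permutes {1..N}" "\<mu> \<in> ivec N"
  shows "\<mu> \<circ> \<sigma> \<in> ivec N"
  using assms permutes_not_in[OF assms(1)] by (auto simp: ivec_def)

text \<open>The indices of J beyond k carry entries at most \<mu>_k, those of {1..k} missing from J
  entries at least \<mu>_k, and there are equally many of both.\<close>

lemma dominant_psum_permute:
  assumes \<mu>: "dominant N \<mu>" and \<sigma>: "\<sigma> permutes {1..N}" and k: "k \<le> N"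
  shows "psum (\<mu> \<circ> \<sigma>) k \<le> psum \<mu> k"
proof (cases "k = 0")
  case False
  define J where "J = \<sigma> ` {1..k}"
  have J: "J \<subseteq> {1..N}" using permutes_in_image[OF \<sigma>] k by (force simp: J_def)
  have cJ: "card J = k" unfolding J_def using permutes_inj_on[OF \<sigma>] by (simp add: card_image)
  have fJ: "finite J" by (simp add: J_def)
  have "psum (\<mu> \<circ> \<sigma>) k = sum \<mu> J"
    unfolding psum_def J_def by (rule sum.reindex[OF permutes_inj_on[OF \<sigma>], symmetric])
  also have "\<dots> = sum \<mu> (J \<inter> {1..k}) + sum \<mu> (J - {1..k})"
    by (rule sum.Int_Diff[OF fJ])
  also have "sum \<mu> (J - {1..k}) \<le> of_nat (card (J - {1..k})) * \<mu> k"
    using J False dominant_antimono[OF \<mu>] by (intro sum_bounded_above) force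
  also have "card (J - {1..k}) = card ({1..k} - J)"
    using card_Diff_subset_Int[of J "{1..k}"] card_Diff_subset_Int[of "{1..k}" J] fJ cJ
    by (simp add: Int_commute)
  also have "of_nat (card ({1..k} - J)) * \<mu> k \<le> sum \<mu> ({1..k} - J)"
    using dominant_antimono[OF \<mu>] k by (intro sum_bounded_below) force
  also have "sum \<mu> (J \<inter> {1..k}) + sum \<mu> ({1..k} - J) = psum \<mu> k"
    unfolding psum_def using sum.Int_Diff[of "{1..k}" \<mu> J] by (simp add: Int_commute)
  finally show ?thesis by (simp add: comp_def)
qed simp

lemma dominant_unique:
  assumes "dominant N \<mu>" "dominant N (\<mu> \<circ> \<sigma>)" "\<sigma> permutes {1..N}"
  shows "\<mu> \<circ> \<sigma> = \<mu>"
proof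
  fix i
  have eq: "psum (\<mu> \<circ> \<sigma>) k = psum \<mu> k" if "k \<le> N" for k
  proof (rule antisym)
    show "psum (\<mu> \<circ> \<sigma>) k \<le> psum \<mu> k" by (rule dominant_psum_permute[OF assms(1,3) that])
    have "\<mu> \<circ> \<sigma> \<circ> inv \<sigma> = \<mu>" using permutes_inv_o[OF assms(3)] by (simp add: comp_assoc)
    then show "psum \<mu> k \<le> psum (\<mu> \<circ> \<sigma>) k"
      using dominant_psum_permute[OF assms(2) permutes_inv[OF assms(3)] that] by simp
  qed
  show "(\<mu> \<circ> \<sigma>) i = \<mu> i"
  proof (cases "i \<in> {1..N}")
    case True
    then obtain j where "i = Suc j" by (cases i) auto
    then show ?thesis using eq[of i] eq[of j] True by (simp add: psum_Suc)
  next
    case False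
    then show ?thesis using permutes_not_in[OF assms(3)] by simp
  qed
qed

text \<open>A permutation that maximizes the sum of (N - i) \<mu>(\<sigma> i) is sorted: exchanging
  the neighbours a and a + 1 changes the sum by exactly their difference.\<close>

lemma dominant_exists: "\<exists>\<sigma>. \<sigma> permutes {1..N} \<and> dominant N (\<mu> \<circ> \<sigma>)"
proof -
  define w where "w \<sigma> = (\<Sum>i\<in>{1..N}. (int N - int i) * \<mu> (\<sigma> i))" for \<sigma>
  have fin: "finite {\<sigma>. \<sigma> permutes {1..N}}" by (simp add: finite_permutations)
  have "id \<in> {\<sigma>. \<sigma> permutes {1..N}}" by (simp add: permutes_id)
  then have ne: "w ` {\<sigma>. \<sigma> permutes {1..N}} \<noteq> {}" by blast
  obtain \<sigma> where \<sigma>: "\<sigma> permutes {1..N}" and max: "\<And>\<pi>. \<pi> permutes {1..N} \<Longrightarrow> w \<pi> \<le> w \<sigma>"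
  proof -
    obtain \<sigma> where "\<sigma> \<in> {\<sigma>. \<sigma> permutes {1..N}}" "Max (w ` {\<sigma>. \<sigma> permutes {1..N}}) = w \<sigma>"
      using Max_in[OF finite_imageI[OF fin] ne] by blast
    moreover have "w \<pi> \<le> Max (w ` {\<sigma>. \<sigma> permutes {1..N}})" if "\<pi> permutes {1..N}" for \<pi>
      using that by (intro Max_ge finite_imageI fin imageI) simp
    ultimately show ?thesis using that by simp
  qed
  have "\<mu> (\<sigma> (Suc a)) \<le> \<mu> (\<sigma> a)" if a: "a \<in> {1..<N}" for a
  proof -
    have "(\<sigma> \<circ> sw a) permutes {1..N}" by (rule permutes_compose[OF sw_permutes[OF a] \<sigma>])
    from max[OF this] have "0 \<le> w \<sigma> - w (\<sigma> \<circ> sw a)" by simp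
    also have "w \<sigma> - w (\<sigma> \<circ> sw a) = (\<Sum>i\<in>{1..N}. (int N - int i) * (\<mu> (\<sigma> i) - \<mu> (\<sigma> (sw a i))))"
      by (simp add: w_def sum_subtractf right_diff_distrib)
    also have "\<dots> = (\<Sum>i\<in>{1..N}. (if i = a then (int N - int a) * (\<mu> (\<sigma> a) - \<mu> (\<sigma> (Suc a))) else 0) +
        (if i = Suc a then (int N - int (Suc a)) * (\<mu> (\<sigma> (Suc a)) - \<mu> (\<sigma> a)) else 0))"
      by (intro sum.cong refl) (auto simp: Transposition.transpose_def)
    also have "\<dots> = \<mu> (\<sigma> a) - \<mu> (\<sigma> (Suc a))"
      using a by (simp add: sum.distrib algebra_simps)
    finally show ?thesis by simp
  qed
  with \<sigma> show ?thesis by (auto simp: dominant_def)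
qed

definition sort_desc :: "nat \<Rightarrow> (nat \<Rightarrow> int) \<Rightarrow> nat \<Rightarrow> int" where
  "sort_desc N \<mu> = \<mu> \<circ> (SOME \<sigma>. \<sigma> permutes {1..N} \<and> dominant N (\<mu> \<circ> \<sigma>))"

lemma sort_desc:
  obtains \<sigma> where "\<sigma> permutes {1..N}" "sort_desc N \<mu> = \<mu> \<circ> \<sigma>" "dominant N (sort_desc N \<mu>)"
  using someI_ex[OF dominant_exists[of N \<mu>]] unfolding sort_desc_def by blast

lemma sort_desc_permute:
  assumes \<pi>: "\<pi> permutes {1..N}"
  shows "sort_desc N (\<mu> \<circ> \<pi>) = sort_desc N \<mu>"
proof -
  obtain \<sigma> where \<sigma>: "\<sigma> permutes {1..N}" "sort_desc N \<mu> = \<mu> \<circ> \<sigma>" "dominant N (sort_desc N \<mu>)" by (rule sort_desc)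
  obtain \<sigma>' where \<sigma>': "\<sigma>' permutes {1..N}" "sort_desc N (\<mu> \<circ> \<pi>) = \<mu> \<circ> \<pi> \<circ> \<sigma>'" "dominant N (sort_desc N (\<mu> \<circ> \<pi>))" by (rule sort_desc)
  define \<rho> where "\<rho> = inv \<sigma> \<circ> (\<pi> \<circ> \<sigma>')"
  have \<rho>: "\<rho> permutes {1..N}"
    unfolding \<rho>_def by (intro permutes_compose permutes_inv \<sigma> \<sigma>' \<pi>)
  have "\<sigma> \<circ> \<rho> = \<pi> \<circ> \<sigma>'"
    unfolding \<rho>_def comp_assoc[symmetric] permutes_inv_o(1)[OF \<sigma>(1)] by simp
  then have "sort_desc N (\<mu> \<circ> \<pi>) = sort_desc N \<mu> \<circ> \<rho>"
    unfolding \<sigma>(2) \<sigma>'(2) by (simp add: comp_assoc)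
  then show ?thesis using dominant_unique[of N "sort_desc N \<mu>" \<rho>] \<sigma>(3) \<sigma>'(3) \<rho> by simp
qed

lemma sort_desc_dominant:
  assumes "dominant N \<mu>"
  shows "sort_desc N \<mu> = \<mu>"
proof -
  obtain \<sigma> where "\<sigma> permutes {1..N}" "sort_desc N \<mu> = \<mu> \<circ> \<sigma>" "dominant N (sort_desc N \<mu>)" by (rule sort_desc)
  then show ?thesis using dominant_unique[of N \<mu> \<sigma>] assms by simp
qed

lemma sort_desc_ge:
  assumes "\<mu> \<in> ivec N"
  shows "sort_desc N \<mu> - \<mu> \<in> Qplus N" "sort_desc N \<mu> \<in> ivec N"
proof -
  obtain \<sigma> where \<sigma>: "\<sigma> permutes {1..N}" "sort_desc N \<mu> = \<mu> \<circ> \<sigma>" "dominant N (sort_desc N \<mu>)" by (rule sort_desc)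
  show iv: "sort_desc N \<mu> \<in> ivec N" using ivec_permute \<sigma> assms by simp
  have inv_eq: "sort_desc N \<mu> \<circ> inv \<sigma> = \<mu>" unfolding \<sigma>(2) using permutes_inv_o[OF \<sigma>(1)] by (simp add: comp_assoc)
  have le: "psum \<mu> k \<le> psum (sort_desc N \<mu>) k" for k
  proof (cases "k \<le> N")
    case True
    then show ?thesis using dominant_psum_permute[OF \<sigma>(3) permutes_inv[OF \<sigma>(1)]] by (simp add: inv_eq)
  next
    case False
    then show ?thesis
      using psum_stable[OF assms, of k] psum_stable[OF iv, of k] psum_permute[OF \<sigma>(1), of \<mu>] by (simp add: \<sigma>(2))
  qed
  show "sort_desc N \<mu> - \<mu> \<in> Qplus N"
    using le ivec_diff[OF iv assms] psum_permute[OF \<sigma>(1), of \<mu>] by (simp add: Qplus_iff psum_diff \<sigma>(2))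
qed

text \<open>Extension by zero to integer exponents, so that differences such as \<lambda> - \<kappa>
  can be used as indices.\<close>

definition ext_coeff :: "((nat \<Rightarrow> nat) \<Rightarrow> complex) \<Rightarrow> (nat \<Rightarrow> int) \<Rightarrow> complex" where
  "ext_coeff p \<mu> = (if \<forall>i. 0 \<le> \<mu> i then p (\<lambda>i. nat (\<mu> i)) else 0)"

lemma ext_coeff_int [simp]: "ext_coeff p (\<lambda>i. int (\<nu> i)) = p \<nu>"
  by (simp add: ext_coeff_def)

lemma ext_coeff_nz: "ext_coeff p \<mu> \<noteq> 0 \<Longrightarrow> \<exists>\<nu>. \<mu> = (\<lambda>i. int (\<nu> i)) \<and> p \<nu> \<noteq> 0"
  by (intro exI[of _ "\<lambda>i. nat (\<mu> i)"]) (auto simp: ext_coeff_def fun_eq_iff split: if_splits)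

section \<open>Polynomials on lines and cleared denominators\<close>

lemma finite_bounded_ivec: "finite {\<mu>. \<mu> \<in> ivec N \<and> (\<forall>i. 0 \<le> \<mu> i) \<and> psum \<mu> N = d}"
proof (rule finite_subset)
  show "finite {\<mu> :: nat \<Rightarrow> int. \<forall>i. (i \<in> {1..N} \<longrightarrow> \<mu> i \<in> {0..d}) \<and> (i \<notin> {1..N} \<longrightarrow> \<mu> i = 0)}"
    by (rule finite_set_of_finite_funs) auto
  show "{\<mu>. \<mu> \<in> ivec N \<and> (\<forall>i. 0 \<le> \<mu> i) \<and> psum \<mu> N = d} \<subseteq>
      {\<mu>. \<forall>i. (i \<in> {1..N} \<longrightarrow> \<mu> i \<in> {0..d}) \<and> (i \<notin> {1..N} \<longrightarrow> \<mu> i = 0)}"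
  proof clarify
    fix \<mu> i assume \<mu>: "\<mu> \<in> ivec N" "\<forall>i. 0 \<le> \<mu> i"
    have "\<mu> i \<le> psum \<mu> N" if "i \<in> {1..N}"
      unfolding psum_def using \<mu> that by (intro member_le_sum) auto
    then show "(i \<in> {1..N} \<longrightarrow> \<mu> i \<in> {0..psum \<mu> N}) \<and> (i \<notin> {1..N} \<longrightarrow> \<mu> i = 0)"
      using \<mu> by (auto simp: ivec_def)
  qed
qed

lemma poly_at_has_sum:
  assumes "finite {\<mu>. ext_coeff p \<mu> \<noteq> 0}"
  shows "((\<lambda>\<mu>. ext_coeff p \<mu> * mono_at N x \<mu>) has_sum poly_at N p x) UNIV"
proof -
  define S where "S = {\<nu>. p \<nu> \<noteq> 0}"
  have inj: "inj_on (\<lambda>\<nu> i. int (\<nu> i)) S" by (auto simp: inj_on_def fun_eq_iff)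
  have img: "(\<lambda>\<nu> i. int (\<nu> i)) ` S = {\<mu>. ext_coeff p \<mu> \<noteq> 0}"
    unfolding S_def using ext_coeff_nz[of p] by force
  have "(\<Sum>\<mu> | ext_coeff p \<mu> \<noteq> 0. ext_coeff p \<mu> * mono_at N x \<mu>) = poly_at N p x"
    unfolding img[symmetric] sum.reindex[OF inj] poly_at_def comp_def ext_coeff_int mono_at_def power_int_of_nat
    by (simp add: S_def)
  then have "((\<lambda>\<mu>. ext_coeff p \<mu> * mono_at N x \<mu>) has_sum poly_at N p x) {\<mu>. ext_coeff p \<mu> \<noteq> 0}"
    using has_sum_finite[OF assms, of "\<lambda>\<mu>. ext_coeff p \<mu> * mono_at N x \<mu>"] by simp
  then show ?thesis
    by (rule has_sum_cong_neutral[THEN iffD1, rotated 3]) auto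
qed

lemma poly_at_line:
  assumes "finite {\<nu>. p \<nu> \<noteq> 0}"
  shows "\<exists>P. \<forall>\<tau>. poly_at N p (\<lambda>i. x i + \<tau> * y i) = poly P \<tau>"
proof -
  define P where "P = (\<Sum>\<nu> | p \<nu> \<noteq> 0. smult (p \<nu>) (\<Prod>i\<in>{1..N}. [:x i, y i:] ^ \<nu> i))"
  have "poly_at N p (\<lambda>i. x i + \<tau> * y i) = poly P \<tau>" for \<tau>
    unfolding P_def poly_at_def poly_sum poly_smult poly_prod poly_power by simp
  then show ?thesis by blast
qed

lemma D1_common_denominator:
  assumes "inj_on x {1..N}" and i: "i \<in> {1..N}"
  shows "(\<Prod>i\<in>{1..N}. \<Prod>j\<in>{1..N} - {i}. x i - x j) * D1_coeff N t i x =
     (\<Prod>j\<in>{1..N} - {i}. t * x i - x j) * (\<Prod>k\<in>{1..N} - {i}. \<Prod>j\<in>{1..N} - {k}. x k - x j)"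
proof -
  have "(\<Prod>j\<in>{1..N} - {i}. x i - x j) \<noteq> 0"
    using inj_onD[OF assms(1), of i] i by auto
  then show ?thesis
    unfolding D1_coeff_def prod_dividef by (subst prod.remove[OF _ i]) auto
qed

text \<open>Polynomial identities extend from the cone of small ratios along the lines through a point
  of the cone.\<close>

lemma D1_identity_extends:
  assumes p: "finite {\<nu>. p \<nu> \<noteq> 0}" and \<epsilon>: "0 < \<epsilon>" "\<epsilon> \<le> 1"
    and eq: "\<And>x. x \<in> ratio_region N \<epsilon> \<Longrightarrow> D1 N q t (poly_at N p) x = e * poly_at N p x"
    and x: "inj_on x {1..N}"
  shows "D1 N q t (poly_at N p) x = e * poly_at N p x"
proof -
  obtain \<tau>0 where "prime_point \<tau>0 \<in> ratio_region N \<epsilon>"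
    using prime_point_region[OF \<epsilon>(1), of N] by blast
  then obtain y where y: "y \<in> ratio_region N \<epsilon>" by blast
  define V where "V z = (\<Prod>i\<in>{1..N}. \<Prod>j\<in>{1..N} - {i}. z i - z j)" for z :: "nat \<Rightarrow> complex"
  \<comment> \<open>The eigenvalue equation times \<open>V\<close>, with every denominator cancelled
    in advance; so it stays a polynomial along the whole line, including points where coordinates
    coincide.\<close>
  define G where "G z = (\<Sum>i\<in>{1..N}. (\<Prod>j\<in>{1..N} - {i}. t * z i - z j) *
     (\<Prod>k\<in>{1..N} - {i}. \<Prod>j\<in>{1..N} - {k}. z k - z j) * poly_at N p (z(i := q * z i))) - e * V z * poly_at N p z" for z
  have G: "G z = V z * (D1 N q t (poly_at N p) z - e * poly_at N p z)" if "inj_on z {1..N}" for z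
  proof -
    have "V z * D1 N q t (poly_at N p) z = (\<Sum>i\<in>{1..N}. V z * D1_coeff N t i z * poly_at N p (z(i := q * z i)))"
      by (simp add: D1_def sum_distrib_left mult.assoc)
    also have "\<dots> = (\<Sum>i\<in>{1..N}. (\<Prod>j\<in>{1..N} - {i}. t * z i - z j) *
       (\<Prod>k\<in>{1..N} - {i}. \<Prod>j\<in>{1..N} - {k}. z k - z j) * poly_at N p (z(i := q * z i)))"
      unfolding V_def by (intro sum.cong refl) (simp only: D1_common_denominator[OF that])
    finally show ?thesis by (simp add: G_def right_diff_distrib mult_ac)
  qed
  have Vnz: "V z \<noteq> 0" if "inj_on z {1..N}" for z
  proof -
    have "z i - z j \<noteq> 0" if "i \<in> {1..N}" "j \<in> {1..N} - {i}" for i j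
      using inj_onD[OF \<open>inj_on z {1..N}\<close>, of i j] that by auto
    then show ?thesis by (simp add: V_def)
  qed
  have "\<exists>P. \<forall>\<tau>. G (\<lambda>i. x i + \<tau> * y i) = poly P \<tau>"
  proof -
    define u where "u i = [:x i, y i:]" for i
    have u: "x i + \<tau> * y i = poly (u i) \<tau>" for i \<tau> by (simp add: u_def)
    have "\<exists>R. \<forall>\<tau>. poly_at N p ((\<lambda>l. x l + \<tau> * y l)(i := q * (x i + \<tau> * y i))) = poly R \<tau>" for i
    proof -
      have "(\<lambda>l. x l + \<tau> * y l)(i := q * (x i + \<tau> * y i)) =
          (\<lambda>l. (x(i := q * x i)) l + \<tau> * (y(i := q * y i)) l)" for \<tau>
        by (auto simp: fun_eq_iff algebra_simps)
      then show ?thesis using poly_at_line[OF p, of N "x(i := q * x i)" "y(i := q * y i)"] by metis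
    qed
    then obtain R where R: "\<And>i \<tau>. poly_at N p ((\<lambda>l. x l + \<tau> * y l)(i := q * (x i + \<tau> * y i))) = poly (R i) \<tau>"
      by metis
    obtain R0 where R0: "\<And>\<tau>. poly_at N p (\<lambda>l. x l + \<tau> * y l) = poly R0 \<tau>"
      using poly_at_line[OF p, of N x y] by metis
    define P where "P = (\<Sum>i\<in>{1..N}. (\<Prod>j\<in>{1..N} - {i}. smult t (u i) - u j) *
       (\<Prod>k\<in>{1..N} - {i}. \<Prod>j\<in>{1..N} - {k}. u k - u j) * R i) -
       smult e (\<Prod>i\<in>{1..N}. \<Prod>j\<in>{1..N} - {i}. u i - u j) * R0"
    have "G (\<lambda>i. x i + \<tau> * y i) = poly P \<tau>" for \<tau>
      unfolding G_def V_def R R0 unfolding P_def u by (simp add: poly_sum poly_prod mult.assoc)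
    then show ?thesis by blast
  qed
  then obtain P where P: "\<And>\<tau>. G (\<lambda>i. x i + \<tau> * y i) = poly P \<tau>" by blast
  have eventually_eig: "\<forall>\<^sub>F r in at_top. (\<lambda>i. x i + complex_of_real r * y i) \<in> ratio_region N \<epsilon>"
  proof -
    have lim: "((\<lambda>r. norm (x i / complex_of_real r + y i)) \<longlongrightarrow> norm (y i)) at_top" for i
    proof -
      have "((\<lambda>r. x i / complex_of_real r) \<longlongrightarrow> 0) at_top"
      proof -
        have "((\<lambda>r. inverse (complex_of_real r)) \<longlongrightarrow> 0) at_top"
          using tendsto_of_real[OF tendsto_inverse_0_at_top[OF filterlim_ident], where ?'a = complex] by simp
        from tendsto_mult_right_zero[OF this, of "x i"] show ?thesis by (simp add: divide_inverse)
      qed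
      from tendsto_norm[OF tendsto_add[OF this tendsto_const[of "y i"]]] show ?thesis by simp
    qed
    have sc: "x i + complex_of_real r * y i = complex_of_real r * (x i / complex_of_real r + y i)" if "0 < r" for i r
      using that by (simp add: field_simps)
    have 1: "\<forall>\<^sub>F r in at_top. \<forall>i\<in>{1..N}. 0 < norm (x i / complex_of_real r + y i)"
      by (intro eventually_ball_finite ballI order_tendstoD(1)[OF lim]) (use ratio_region_nonzero[OF y] in auto)
    have 2: "\<forall>\<^sub>F r in at_top. \<forall>i\<in>{1..<N}. norm (x (i + 1) / complex_of_real r + y (i + 1)) < \<epsilon> * norm (x i / complex_of_real r + y i)"
    proof (intro eventually_ball_finite ballI)
      fix i assume i: "i \<in> {1..<N}"
      have "((\<lambda>r. \<epsilon> * norm (x i / complex_of_real r + y i) - norm (x (i + 1) / complex_of_real r + y (i + 1))) \<longlongrightarrow>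
          \<epsilon> * norm (y i) - norm (y (i + 1))) at_top"
        by (intro tendsto_intros lim)
      moreover have "0 < \<epsilon> * norm (y i) - norm (y (i + 1))" using y i by (simp add: ratio_region_def)
      ultimately have "\<forall>\<^sub>F r in at_top. 0 < \<epsilon> * norm (x i / complex_of_real r + y i) - norm (x (i + 1) / complex_of_real r + y (i + 1))"
        by (rule order_tendstoD(1))
      then show "\<forall>\<^sub>F r in at_top. norm (x (i + 1) / complex_of_real r + y (i + 1)) < \<epsilon> * norm (x i / complex_of_real r + y i)"
        by eventually_elim simp
    qed simp
    show ?thesis
      using 1 2 eventually_gt_at_top[of 0]
    proof eventually_elim
      case (elim r)
      show ?case
        unfolding ratio_region_def mem_Collect_eq sc[OF elim(3)] norm_mult
        using elim by auto
    qed
  qed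
  then obtain r0 where r0: "\<And>r. r0 \<le> r \<Longrightarrow> (\<lambda>i. x i + complex_of_real r * y i) \<in> ratio_region N \<epsilon>"
    by (auto simp: eventually_at_top_linorder)
  have "poly P (complex_of_real r) = 0" if "r0 \<le> r" for r
  proof -
    have "inj_on (\<lambda>i. x i + complex_of_real r * y i) {1..N}"
      by (rule region_inj[OF ratio_region_mono[OF \<epsilon>(2) r0[OF that]]])
    from G[OF this] show ?thesis using eq[OF r0[OF that]] P[of "complex_of_real r"] by simp
  qed
  then have "complex_of_real ` {r0..} \<subseteq> {z. poly P z = 0}" by auto
  moreover have "infinite (complex_of_real ` {r0..})"
    by (subst finite_image_iff) (auto simp: inj_on_def infinite_Ici)
  ultimately have "P = 0" using poly_roots_finite[of P] finite_subset by blast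
  then have "G x = 0" using P[of 0] by simp
  then show ?thesis using G[OF x] Vnz[OF x] by simp
qed

section \<open>The Macdonald polynomial of a fixed partition and its limit\<close>

locale partition_setup =
  fixes N :: nat and q :: complex and lam :: "nat \<Rightarrow> nat"
  assumes N1: "1 \<le> N" and q0: "q \<noteq> 0" and q1: "norm q < 1" and lam: "is_partition N lam"
begin

definition lamv :: "nat \<Rightarrow> int" where
  "lamv = (\<lambda>i. int (lam i))"

definition Lq :: "nat \<Rightarrow> complex" where
  "Lq = (\<lambda>i. q ^ lam i)"

definition deg :: nat where
  "deg = (\<Sum>i\<in>{1..N}. lam i)"

text \<open>The \<kappa> for which \<lambda> - \<kappa> can be an exponent of a polynomial: a finite
  set, independent of t, that contains all exponents of P_\<lambda>.\<close>

definition small :: "(nat \<Rightarrow> int) set" where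
  "small = {\<kappa> \<in> Qplus N. \<forall>i. 0 \<le> (lamv - \<kappa>) i}"

lemma Lq_nz: "Lq i \<noteq> 0"
  using q0 by (simp add: Lq_def)

lemma lamv_ivec: "lamv \<in> ivec N"
  using lam by (auto simp: lamv_def is_partition_def ivec_def)

lemma lamv_dominant: "dominant N lamv"
  using lam by (auto simp: lamv_def is_partition_def dominant_def)

lemma psum_lamv: "psum lamv N = int deg"
  by (simp add: psum_def lamv_def deg_def)

lemma finite_small: "finite small"
proof (rule finite_subset)
  show "finite ((\<lambda>\<mu>. lamv - \<mu>) ` {\<mu>. \<mu> \<in> ivec N \<and> (\<forall>i. 0 \<le> \<mu> i) \<and> psum \<mu> N = int deg})"
    by (intro finite_imageI finite_bounded_ivec)
  show "small \<subseteq> (\<lambda>\<mu>. lamv - \<mu>) ` {\<mu>. \<mu> \<in> ivec N \<and> (\<forall>i. 0 \<le> \<mu> i) \<and> psum \<mu> N = int deg}"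
  proof
    fix \<kappa> assume \<kappa>: "\<kappa> \<in> small"
    then have "lamv - \<kappa> \<in> {\<mu>. \<mu> \<in> ivec N \<and> (\<forall>i. 0 \<le> \<mu> i) \<and> psum \<mu> N = int deg}"
      using lamv_ivec by (auto simp: small_def Qplus_iff psum_diff psum_lamv intro: ivec_diff)
    moreover have "\<kappa> = lamv - (lamv - \<kappa>)" by simp
    ultimately show "\<kappa> \<in> (\<lambda>\<mu>. lamv - \<mu>) ` {\<mu>. \<mu> \<in> ivec N \<and> (\<forall>i. 0 \<le> \<mu> i) \<and> psum \<mu> N = int deg}" by blast
  qed
qed

lemma dominated_iff: "dominated N \<nu> lam \<longleftrightarrow> lamv - (\<lambda>i. int (\<nu> i)) \<in> Qplus N"
proof -
  have e: "(\<Sum>i\<in>{1..k}. \<nu> i) \<le> (\<Sum>i\<in>{1..k}. lam i) \<longleftrightarrow> 0 \<le> psum (lamv - (\<lambda>i. int (\<nu> i))) k"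
    "(\<Sum>i\<in>{1..k}. \<nu> i) = (\<Sum>i\<in>{1..k}. lam i) \<longleftrightarrow> psum (lamv - (\<lambda>i. int (\<nu> i))) k = 0" for k
    by (simp_all add: psum_def lamv_def sum_subtractf eq_commute[of "sum lam _"] flip: of_nat_sum)
  have iv: "(\<forall>i. i \<notin> {1..N} \<longrightarrow> \<nu> i = 0) \<longleftrightarrow> lamv - (\<lambda>i. int (\<nu> i)) \<in> ivec N"
    using lamv_ivec by (auto simp: ivec_def)
  have ps: "(\<forall>k\<in>{1..N}. 0 \<le> psum (lamv - (\<lambda>i. int (\<nu> i))) k) \<longleftrightarrow> (\<forall>k. 0 \<le> psum (lamv - (\<lambda>i. int (\<nu> i))) k)"
    if "lamv - (\<lambda>i. int (\<nu> i)) \<in> ivec N"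
  proof -
    have "0 \<le> psum (lamv - (\<lambda>i. int (\<nu> i))) k" if *: "\<forall>k\<in>{1..N}. 0 \<le> psum (lamv - (\<lambda>i. int (\<nu> i))) k" for k
    proof -
      consider "k = 0" | "k \<in> {1..N}" | "N \<le> k" by fastforce
      then show ?thesis
      proof cases
        case 2
        then show ?thesis by (rule bspec[OF *])
      next
        case 3
        have "N \<in> {1..N}" using N1 by simp
        then show ?thesis unfolding psum_stable[OF \<open>lamv - (\<lambda>i. int (\<nu> i)) \<in> ivec N\<close> 3] by (rule bspec[OF *])
      qed simp
    qed
    then show ?thesis by blast
  qed
  have taut: "(D \<longleftrightarrow> A \<and> B \<and> C) \<Longrightarrow> (A \<Longrightarrow> B \<longleftrightarrow> B') \<Longrightarrow> (D \<longleftrightarrow> A \<and> B' \<and> C)" for A B B' C D :: bool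
    by blast
  show ?thesis unfolding Qplus_iff
  proof (rule taut[OF _ ps])
    show "dominated N \<nu> lam \<longleftrightarrow> lamv - (\<lambda>i. int (\<nu> i)) \<in> ivec N \<and>
      (\<forall>k\<in>{1..N}. 0 \<le> psum (lamv - (\<lambda>i. int (\<nu> i))) k) \<and> psum (lamv - (\<lambda>i. int (\<nu> i))) N = 0"
      unfolding dominated_def by (intro arg_cong2[where f = "(\<and>)"] iv ball_cong refl e)
  qed
qed

text \<open>Moving x^(-\<lambda>) past \<Gamma>_i costs q^(-\<lambda>_i), which \<open>Lq\<close>
  compensates. Then D_1 acts on expansions by the matrix \<open>eig_mat\<close>.\<close>

lemma hre_D1:
  assumes t: "t \<noteq> 0" and f: "has_ratio_expansion N (\<lambda>x. mono_at N x (- lamv) * f x) a"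
  shows "has_ratio_expansion N (\<lambda>x. mono_at N x (- lamv) * D1 N q t f x)
    (\<lambda>\<kappa>. \<Sum>\<beta>\<in>ival N \<kappa>. eig_mat N q t Lq \<kappa> \<beta> * a \<beta>)"
proof -
  have "has_ratio_expansion N (\<lambda>x. \<Sum>i\<in>{1..N}. Lq i * (D1_coeff N t i x *
      (mono_at N (x(i := q * x i)) (- lamv) * f (x(i := q * x i)))))
    (\<lambda>\<kappa>. \<Sum>i\<in>{1..N}. Lq i * conv N (\<lambda>\<nu>. t ^ (N - 1) * op_coeff N 1 (1 / t) i \<nu>) (\<lambda>\<beta>. q powi (- \<beta> i) * a \<beta>) \<kappa>)"
    by (intro hre_sum hre_cmult hre_mult hre_D1_coeff t hre_shift[OF f q0 q1]) auto
  moreover have "(\<Sum>i\<in>{1..N}. Lq i * conv N (\<lambda>\<nu>. t ^ (N - 1) * op_coeff N 1 (1 / t) i \<nu>) (\<lambda>\<beta>. q powi (- \<beta> i) * a \<beta>) \<kappa>) =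
      (\<Sum>\<beta>\<in>ival N \<kappa>. eig_mat N q t Lq \<kappa> \<beta> * a \<beta>)" for \<kappa>
    unfolding conv_def eig_mat_def sum_distrib_left sum_distrib_right
    by (subst sum.swap) (simp only: mult_ac)
  ultimately have "has_ratio_expansion N (\<lambda>x. \<Sum>i\<in>{1..N}. Lq i * (D1_coeff N t i x *
      (mono_at N (x(i := q * x i)) (- lamv) * f (x(i := q * x i)))))
    (\<lambda>\<kappa>. \<Sum>\<beta>\<in>ival N \<kappa>. eig_mat N q t Lq \<kappa> \<beta> * a \<beta>)" by simp
  moreover have "(\<Sum>i\<in>{1..N}. Lq i * (D1_coeff N t i x *
      (mono_at N (x(i := q * x i)) (- lamv) * f (x(i := q * x i))))) = mono_at N x (- lamv) * D1 N q t f x" for x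
    unfolding D1_def sum_distrib_left
  proof (rule sum.cong[OF refl])
    fix i assume i: "i \<in> {1..N}"
    have "Lq i * q powi (- lamv) i = 1" using q0 by (simp add: Lq_def lamv_def power_int_minus)
    then have "Lq i * mono_at N (x(i := q * x i)) (- lamv) = mono_at N x (- lamv)"
      unfolding mono_at_upd[OF i] mult.assoc[symmetric] by simp
    then show "Lq i * (D1_coeff N t i x * (mono_at N (x(i := q * x i)) (- lamv) * f (x(i := q * x i)))) =
      mono_at N x (- lamv) * (D1_coeff N t i x * f (x(i := q * x i)))"
      by (metis mult.assoc mult.left_commute)
  qed
  ultimately show ?thesis by simp
qed

text \<open>Dominance is the order given by \<open>Qplus\<close>, so P_\<lambda> is a terminating
  series below x^\<lambda>; its differential-free eigenvalue equation, expanded on the cone, is the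
  recursion of an eigenseries.\<close>

lemma macdonald_eigenseries:
  assumes t: "t \<noteq> 0" and p: "is_macdonald N q t lam p"
  shows "is_eigenseries N q t Lq (\<lambda>\<kappa>. ext_coeff p (lamv - \<kappa>))"
    and "\<And>\<kappa>. ext_coeff p (lamv - \<kappa>) \<noteq> 0 \<Longrightarrow> \<kappa> \<in> small"
    and "((\<lambda>\<mu>. ext_coeff p \<mu> * mono_at N x \<mu>) has_sum poly_at N p x) UNIV"
proof -
  have sup: "lamv - \<mu> \<in> Qplus N" if nz: "ext_coeff p \<mu> \<noteq> 0" for \<mu>
  proof -
    obtain \<nu> where \<nu>: "\<mu> = (\<lambda>i. int (\<nu> i))" "p \<nu> \<noteq> 0" using ext_coeff_nz[OF nz] by blast
    then have "dominated N \<nu> lam" using p by (auto simp: is_macdonald_def)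
    then show ?thesis unfolding \<nu>(1) dominated_iff .
  qed
  show small: "\<kappa> \<in> small" if nz: "ext_coeff p (lamv - \<kappa>) \<noteq> 0" for \<kappa>
  proof -
    obtain \<nu> where "lamv - \<kappa> = (\<lambda>i. int (\<nu> i))" using ext_coeff_nz[OF nz] by blast
    then have "0 \<le> (lamv - \<kappa>) i" for i by simp
    then show ?thesis using sup[OF nz] by (simp add: small_def)
  qed
  have "{\<mu>. ext_coeff p \<mu> \<noteq> 0} \<subseteq> (\<lambda>\<kappa>. lamv - \<kappa>) ` small"
  proof
    fix \<mu> assume "\<mu> \<in> {\<mu>. ext_coeff p \<mu> \<noteq> 0}"
    then have "lamv - \<mu> \<in> small" by (intro small) simp
    moreover have "\<mu> = lamv - (lamv - \<mu>)" by simp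
    ultimately show "\<mu> \<in> (\<lambda>\<kappa>. lamv - \<kappa>) ` small" by blast
  qed
  then have fin: "finite {\<mu>. ext_coeff p \<mu> \<noteq> 0}" using finite_small finite_subset by blast
  show S: "((\<lambda>\<mu>. ext_coeff p \<mu> * mono_at N x \<mu>) has_sum poly_at N p x) UNIV" for x
    by (rule poly_at_has_sum[OF fin])
  have f: "has_ratio_expansion N (\<lambda>x. mono_at N x (- lamv) * poly_at N p x) (\<lambda>\<kappa>. ext_coeff p (lamv - \<kappa>))"
    by (rule cone_to_hre[where \<epsilon> = 1]) (use sup S in auto)
  have "has_ratio_expansion N (\<lambda>x. e1_s N t Lq * (mono_at N x (- lamv) * poly_at N p x))
     (\<lambda>\<kappa>. \<Sum>\<beta>\<in>ival N \<kappa>. eig_mat N q t Lq \<kappa> \<beta> * ext_coeff p (lamv - \<beta>))"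
  proof (rule hre_cong[OF hre_D1[OF t f], where \<epsilon> = 1])
    fix x assume "x \<in> ratio_region N 1"
    then have "D1 N q t (poly_at N p) x = e1_s N t (\<lambda>i. q ^ lam i) * poly_at N p x"
      using p region_inj by (simp add: is_macdonald_def)
    then show "mono_at N x (- lamv) * D1 N q t (poly_at N p) x = e1_s N t Lq * (mono_at N x (- lamv) * poly_at N p x)"
      by (simp add: Lq_def)
  qed simp
  from hre_unique[OF this hre_cmult[OF f]]
  have eq: "(\<Sum>\<beta>\<in>ival N \<kappa>. eig_mat N q t Lq \<kappa> \<beta> * ext_coeff p (lamv - \<beta>)) = e1_s N t Lq * ext_coeff p (lamv - \<kappa>)" for \<kappa>
    by (rule fun_cong)
  have "ext_coeff p lamv = 1" using p unfolding lamv_def by (simp add: is_macdonald_def)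
  then show "is_eigenseries N q t Lq (\<lambda>\<kappa>. ext_coeff p (lamv - \<kappa>))"
    unfolding is_eigenseries_iff[OF t] using eq small by (auto simp: small_def)
qed

text \<open>Distinct eigenvalues on the finite set \<open>small\<close> only; this holds for all
  sufficiently large t.\<close>

definition good_t :: "complex \<Rightarrow> bool" where
  "good_t t \<longleftrightarrow> t \<noteq> 0 \<and> (\<forall>\<kappa>\<in>small - {0}. e1_s N t (\<lambda>i. Lq i * q powi (- \<kappa> i)) \<noteq> e1_s N t Lq)"

lemma eventually_good: "\<forall>\<^sub>F t in at_infinity. good_t t"
proof -
  have fin: "\<forall>\<^sub>F t in at_infinity. t \<notin> S" if "finite S" for S :: "complex set"
  proof -
    obtain R where "\<And>z. z \<in> S \<Longrightarrow> norm z \<le> R" using finite_imp_bounded[OF \<open>finite S\<close>] by (auto simp: bounded_iff)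
    then show ?thesis unfolding eventually_at_infinity by (intro exI[of _ "R + 1"]) force
  qed
  have "\<forall>\<^sub>F t in at_infinity. \<forall>\<kappa>\<in>small - {0}. t \<notin> {t. e1_s N t (\<lambda>i. Lq i * q powi (- \<kappa> i)) = e1_s N t Lq}"
    using finite_small
    by (intro eventually_ball_finite ballI fin finite_exceptional[OF q0 q1] Lq_nz) (auto simp: small_def)
  with fin[of "{0}"] show ?thesis
    by (auto simp: good_t_def elim: eventually_elim2)
qed

lemma macdonald_unique:
  assumes "good_t t" "is_macdonald N q t lam p" "is_macdonald N q t lam p'"
  shows "p = p'"
proof
  fix \<nu>
  have t: "t \<noteq> 0" using assms(1) by (simp add: good_t_def)
  have "ext_coeff p (lamv - \<kappa>) = ext_coeff p' (lamv - \<kappa>)" for \<kappa>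
    by (rule eigenseries_unique_at[OF t macdonald_eigenseries(1)[OF t assms(2)] macdonald_eigenseries(1)[OF t assms(3)]])
       (use macdonald_eigenseries(2)[OF t assms(2)] macdonald_eigenseries(2)[OF t assms(3)] assms(1) in \<open>auto simp: good_t_def\<close>)
  from this[of "lamv - (\<lambda>i. int (\<nu> i))"] show "p \<nu> = p' \<nu>" by simp
qed

text \<open>The eigenvalue equation is solved at dominant exponents only, the other coefficients
  being prescribed by symmetry. The equations at non-dominant exponents then follow from the
  symmetry of the coefficients of D_1 p.\<close>

lemma macdonald_exists:
  assumes "good_t t"
  shows "\<exists>p. is_macdonald N q t lam p"
proof -
  have t: "t \<noteq> 0" using assms by (simp add: good_t_def)
  define ok where "ok \<kappa> \<longleftrightarrow> \<kappa> \<in> Qplus N \<and> dominant N (lamv - \<kappa>)" for \<kappa>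
  \<comment> \<open>A coefficient at \<beta> is read off at its sorted representative. Sorting
    raises the exponent \<lambda> - \<beta>, so the height does not grow and stays below that of
    \<kappa>.\<close>
  define F where "F c \<kappa> = (if \<kappa> = 0 then 1 else if ok \<kappa> then
     (\<Sum>\<beta>\<in>ival N \<kappa> - {\<kappa>}. eig_mat N q t Lq \<kappa> \<beta> * c (lamv - sort_desc N (lamv - \<beta>))) /
       (e1_s N t Lq - e1_s N t (\<lambda>i. Lq i * q powi (- \<kappa> i))) else 0)" for c \<kappa>
  have lower: "height N (lamv - sort_desc N (lamv - \<beta>)) < height N \<kappa>" if \<beta>: "\<beta> \<in> ival N \<kappa> - {\<kappa>}" for \<beta> \<kappa>
  proof -
    have "lamv - \<beta> \<in> ivec N" using \<beta> by (intro ivec_diff lamv_ivec) (auto simp: ival_def Qplus_iff)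
    then have "sort_desc N (lamv - \<beta>) - (lamv - \<beta>) \<in> Qplus N" by (rule sort_desc_ge)
    moreover have "\<beta> - (lamv - sort_desc N (lamv - \<beta>)) = sort_desc N (lamv - \<beta>) - (lamv - \<beta>)" by (simp add: algebra_simps)
    ultimately have Q: "\<beta> - (lamv - sort_desc N (lamv - \<beta>)) \<in> Qplus N" by (simp only:)
    have "psum (lamv - sort_desc N (lamv - \<beta>)) k \<le> psum \<beta> k" for k
      using Qplus_psum[OF Q, of k] by (simp add: psum_diff)
    then have "height N (lamv - sort_desc N (lamv - \<beta>)) \<le> height N \<beta>"
      unfolding height_def by (intro nat_mono sum_mono) auto
    then show ?thesis using height_ival[OF \<beta>] by simp
  qed
  have "\<exists>c. \<forall>\<kappa>. c \<kappa> = F c \<kappa>"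
  proof (rule ex_height_rec[of N])
    fix c c' :: "(nat \<Rightarrow> int) \<Rightarrow> complex" and \<kappa>
    assume *: "\<And>\<beta>. height N \<beta> < height N \<kappa> \<Longrightarrow> c \<beta> = c' \<beta>"
    show "F c \<kappa> = F c' \<kappa>"
      unfolding F_def using *[OF lower] by (intro if_cong refl arg_cong2[where f = "(/)"] sum.cong) auto
  qed
  then obtain v where v: "\<And>\<kappa>. v \<kappa> = F v \<kappa>" by blast
  have v0: "v 0 = 1" using v[of 0] by (simp add: F_def)
  have v_ok: "\<kappa> \<in> Qplus N" if "v \<kappa> \<noteq> 0" for \<kappa>
    using that v[of \<kappa>] by (cases "\<kappa> = 0") (auto simp: F_def ok_def split: if_splits)
  \<comment> \<open>A dominant exponent has its least entry in the last place, and there it is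
    nonnegative since \<kappa>_N \<le> 0 on \<open>Qplus\<close>.\<close>
  have dom_small: "\<kappa> \<in> small" if \<kappa>: "\<kappa> \<in> Qplus N" "dominant N (lamv - \<kappa>)" for \<kappa>
  proof -
    have iv: "lamv - \<kappa> \<in> ivec N" by (intro ivec_diff lamv_ivec Qplus_ivec \<kappa>)
    obtain n where n: "N = Suc n" using N1 by (cases N) auto
    have "\<kappa> N \<le> 0"
      using Qplus_psum_N[OF \<kappa>(1)] Qplus_psum[OF \<kappa>(1), of n] by (simp add: n psum_Suc)
    then have "0 \<le> (lamv - \<kappa>) N" by (simp add: lamv_def)
    then have "0 \<le> (lamv - \<kappa>) i" for i
      using dominant_antimono[OF \<kappa>(2), of i N] iv by (cases "i \<in> {1..N}") (auto simp: ivec_def)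
    then show ?thesis using \<kappa> by (simp add: small_def)
  qed
  define X where "X \<mu> = (if \<mu> \<in> ivec N then v (lamv - sort_desc N \<mu>) else 0)" for \<mu>
  have X_perm: "X (\<mu> \<circ> \<sigma>) = X \<mu>" if \<sigma>: "\<sigma> permutes {1..N}" for \<mu> \<sigma>
  proof -
    have "\<mu> \<circ> \<sigma> \<circ> inv \<sigma> = \<mu>" using permutes_inv_o[OF \<sigma>] by (simp add: comp_assoc)
    then have "\<mu> \<circ> \<sigma> \<in> ivec N \<longleftrightarrow> \<mu> \<in> ivec N"
      using ivec_permute[OF \<sigma>, of \<mu>] ivec_permute[OF permutes_inv[OF \<sigma>], of "\<mu> \<circ> \<sigma>"] by auto
    then show ?thesis by (simp add: X_def sort_desc_permute[OF \<sigma>])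
  qed
  have X_supp: "lamv - \<mu> \<in> Qplus N" "\<And>i. 0 \<le> \<mu> i" if nz: "X \<mu> \<noteq> 0" for \<mu>
  proof -
    have iv: "\<mu> \<in> ivec N" and vnz: "v (lamv - sort_desc N \<mu>) \<noteq> 0" using nz by (auto simp: X_def split: if_splits)
    obtain \<sigma> where \<sigma>: "\<sigma> permutes {1..N}" "sort_desc N \<mu> = \<mu> \<circ> \<sigma>" "dominant N (sort_desc N \<mu>)" by (rule sort_desc)
    show "lamv - \<mu> \<in> Qplus N"
      using Qplus_add[OF v_ok[OF vnz] sort_desc_ge(1)[OF iv]] by (simp add: algebra_simps)
    have "lamv - sort_desc N \<mu> \<in> small" using dom_small[OF v_ok[OF vnz]] \<sigma>(3) by simp
    then have "0 \<le> sort_desc N \<mu> i" for i by (simp add: small_def)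
    then have "0 \<le> \<mu> (\<sigma> (inv \<sigma> i))" for i using \<sigma>(2) by simp
    then show "0 \<le> \<mu> i" for i using permutes_inverses(1)[OF \<sigma>(1)] by metis
  qed
  have X_lam: "X lamv = 1" by (simp add: X_def lamv_ivec sort_desc_dominant[OF lamv_dominant] v0)
  \<comment> \<open>The coefficients of D_1 p expanded on the cone, a priori an infinite
    series.\<close>
  define B where "B \<mu> = (if lamv - \<mu> \<in> Qplus N then \<Sum>\<beta>\<in>ival N (lamv - \<mu>). eig_mat N q t Lq (lamv - \<mu>) \<beta> * X (lamv - \<beta>) else 0)" for \<mu>
  define p where "p \<nu> = X (\<lambda>i. int (\<nu> i))" for \<nu>
  have Xp: "ext_coeff p \<mu> = X \<mu>" for \<mu>
    using X_supp(2)[of \<mu>] by (auto simp: ext_coeff_def p_def)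
  have degQ: "smul deg (unit_vec (Suc 0)) - lamv \<in> Qplus N"
    by (rule nonneg_cone[OF lamv_ivec _ psum_lamv N1]) (simp add: lamv_def)
  have cone: "smul deg (unit_vec (Suc 0)) - \<mu> \<in> Qplus N" if "lamv - \<mu> \<in> Qplus N" for \<mu>
    using Qplus_add[OF degQ that] by simp
  have "{\<mu>. X \<mu> \<noteq> 0} \<subseteq> {\<mu>. \<mu> \<in> ivec N \<and> (\<forall>i. 0 \<le> \<mu> i) \<and> psum \<mu> N = int deg}"
  proof
    fix \<mu> assume "\<mu> \<in> {\<mu>. X \<mu> \<noteq> 0}"
    then have "X \<mu> \<noteq> 0" by simp
    then show "\<mu> \<in> {\<mu>. \<mu> \<in> ivec N \<and> (\<forall>i. 0 \<le> \<mu> i) \<and> psum \<mu> N = int deg}"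
      using X_supp(2)[of \<mu>] cone_degree[OF cone[OF X_supp(1)] N1, of \<mu>] by simp
  qed
  then have finX: "finite {\<mu>. X \<mu> \<noteq> 0}" by (rule finite_subset[OF _ finite_bounded_ivec])
  have S: "((\<lambda>\<mu>. X \<mu> * mono_at N x \<mu>) has_sum poly_at N p x) UNIV" for x
    using poly_at_has_sum[of p N x] finX by (simp add: Xp)
  have repX: "rep N (nonzeros N) deg (poly_at N p) X"
    unfolding rep_def using S X_supp(1) cone by blast
  have f: "has_ratio_expansion N (\<lambda>x. mono_at N x (- lamv) * poly_at N p x) (\<lambda>\<kappa>. X (lamv - \<kappa>))"
    by (rule cone_to_hre[where \<epsilon> = 1]) (use X_supp(1) S in auto)
  obtain \<epsilon> where \<epsilon>: "0 < \<epsilon>" "\<epsilon> \<le> 1" and SB0: "\<And>x. x \<in> ratio_region N \<epsilon> \<Longrightarrow>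
      ((\<lambda>\<mu>. (\<Sum>\<beta>\<in>ival N (lamv - \<mu>). eig_mat N q t Lq (lamv - \<mu>) \<beta> * X (lamv - \<beta>)) * mono_at N x \<mu>) has_sum D1 N q t (poly_at N p) x) UNIV"
    using hre_to_cone[OF hre_D1[OF t f]] by blast
  have B_eq: "(\<Sum>\<beta>\<in>ival N (lamv - \<mu>). eig_mat N q t Lq (lamv - \<mu>) \<beta> * X (lamv - \<beta>)) = B \<mu>" for \<mu>
    by (simp add: B_def ival_empty)
  have SB: "((\<lambda>\<mu>. B \<mu> * mono_at N x \<mu>) has_sum D1 N q t (poly_at N p) x) UNIV" if "x \<in> ratio_region N \<epsilon>" for x
    using SB0[OF that] unfolding B_eq .
  have B_supp: "lamv - \<mu> \<in> Qplus N" if "B \<mu> \<noteq> 0" for \<mu>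
    using that by (auto simp: B_def split: if_splits)
  have repB: "rep N (ratio_region N \<epsilon>) deg (D1 N q t (poly_at N p)) B"
    unfolding rep_def using SB B_supp cone by blast
  have B_van: "vanishing_dir i j B" if ij: "1 \<le> i" "i < j" "j \<le> N" for i j
    unfolding vanishing_dir_def
  proof
    fix \<mu>
    have "B (\<mu> + smul n (rt i j)) = 0" if n: "nat (psum (lamv - \<mu>) i) + 1 \<le> n" for n
    proof (rule ccontr)
      assume "B (\<mu> + smul n (rt i j)) \<noteq> 0"
      from Qplus_psum[OF B_supp[OF this], of i] have "int n \<le> psum (lamv - \<mu>) i"
        using ij by (simp add: psum_diff psum_add smul_def psum_scale psum_rt)
      then show False using n by linarith
    qed
    then show "\<exists>K. \<forall>n\<ge>K. B (\<mu> + smul n (rt i j)) = 0" by blast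
  qed
  have B_sw: "B (\<mu> \<circ> sw a) = B \<mu>" if a: "a \<in> {1..<N}" for a \<mu>
    by (rule D1_coefficients_symmetric[OF a q0 repX _ _ repB \<epsilon> B_van])
       (use X_supp(2) X_perm[OF sw_permutes[OF a]] in \<open>auto simp: nonneg_supp_def\<close>)
  have B_dom: "B (lamv - \<kappa>) = e1_s N t Lq * X (lamv - \<kappa>)" if \<kappa>: "\<kappa> \<in> Qplus N" "dominant N (lamv - \<kappa>)" for \<kappa>
  proof -
    have Xv: "X (lamv - \<beta>) = v (lamv - sort_desc N (lamv - \<beta>))" if "\<beta> \<in> Qplus N" for \<beta>
      using ivec_diff[OF lamv_ivec Qplus_ivec[OF that]] by (simp add: X_def)
    have X\<kappa>: "X (lamv - \<kappa>) = v \<kappa>" using Xv[OF \<kappa>(1)] by (simp add: sort_desc_dominant[OF \<kappa>(2)])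
    have "(\<Sum>\<beta>\<in>ival N \<kappa>. eig_mat N q t Lq \<kappa> \<beta> * X (lamv - \<beta>)) = e1_s N t Lq * X (lamv - \<kappa>)"
    proof (cases "\<kappa> = 0")
      case True
      have "(\<Sum>\<beta>\<in>ival N 0. eig_mat N q t Lq 0 \<beta> * X (lamv - \<beta>)) = e1_s N t Lq * X (lamv - 0)"
        by (simp add: eig_mat_diag[OF t])
      then show ?thesis unfolding True .
    next
      case False
      then have nz: "e1_s N t Lq - e1_s N t (\<lambda>i. Lq i * q powi (- \<kappa> i)) \<noteq> 0"
        using assms dom_small[OF \<kappa>] by (auto simp: good_t_def)
      have "(\<Sum>\<beta>\<in>ival N \<kappa> - {\<kappa>}. eig_mat N q t Lq \<kappa> \<beta> * X (lamv - \<beta>)) =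
        (\<Sum>\<beta>\<in>ival N \<kappa> - {\<kappa>}. eig_mat N q t Lq \<kappa> \<beta> * v (lamv - sort_desc N (lamv - \<beta>)))"
        by (intro sum.cong refl) (auto simp: ival_def Xv)
      also have "\<dots> = (e1_s N t Lq - e1_s N t (\<lambda>i. Lq i * q powi (- \<kappa> i))) * v \<kappa>"
        using v[of \<kappa>] False \<kappa> nz by (simp add: F_def ok_def)
      finally show ?thesis using eig_split[OF t \<kappa>(1), of q Lq "\<lambda>\<beta>. X (lamv - \<beta>)"] X\<kappa> by simp
    qed
    then show ?thesis using \<kappa>(1) by (simp add: B_def)
  qed
  \<comment> \<open>A non-dominant \<mu> has an ascent. Exchanging it raises \<mu> and lowers the
    height of \<lambda> - \<mu>, while B and X do not change.\<close>
  have B_all: "B \<mu> = e1_s N t Lq * X \<mu>" for \<mu>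
  proof (induction "height N (lamv - \<mu>)" arbitrary: \<mu> rule: less_induct)
    case less
    show ?case
    proof (cases "lamv - \<mu> \<in> Qplus N")
      case False
      then have "B \<mu> = 0" "X \<mu> = 0" using B_supp X_supp(1) by blast+
      then show ?thesis by simp
    next
      case True
      show ?thesis
      proof (cases "dominant N \<mu>")
        case dom: True
        show ?thesis using B_dom[of "lamv - \<mu>"] True dom by simp
      next
        case False
        then obtain a where a: "a \<in> {1..<N}" "\<mu> a < \<mu> (Suc a)" by (auto simp: dominant_def not_le)
        define \<mu>' where "\<mu>' = \<mu> \<circ> sw a"
        have eq: "\<mu>' = \<mu> + smul (nat (\<mu> (Suc a) - \<mu> a)) (rt a (Suc a))"
          using a by (auto simp: \<mu>'_def fun_eq_iff smul_def rt_def Transposition.transpose_def)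
        have sq: "smul (nat (\<mu> (Suc a) - \<mu> a)) (rt a (Suc a)) \<in> Qplus N"
          using a by (intro Qplus_smul Qplus_rt) auto
        have "B \<mu>' = e1_s N t Lq * X \<mu>'"
        proof (cases "lamv - \<mu>' \<in> Qplus N")
          case False
          then have "B \<mu>' = 0" "X \<mu>' = 0" using B_supp X_supp(1) by blast+
          then show ?thesis by simp
        next
          case True
          have "height N (lamv - \<mu>') < height N (lamv - \<mu>)"
          proof (rule height_less[OF True])
            show "lamv - \<mu> - (lamv - \<mu>') \<in> Qplus N" using sq by (simp add: eq)
            have "\<mu>' a \<noteq> \<mu> a" using a by (simp add: \<mu>'_def)
            then show "lamv - \<mu>' \<noteq> lamv - \<mu>" by auto
          qed
          then show ?thesis by (rule less.hyps)
        qed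
        then show ?thesis unfolding \<mu>'_def B_sw[OF a(1)] X_perm[OF sw_permutes[OF a(1)]] .
      qed
    qed
  qed
  have finp: "finite {\<nu>. p \<nu> \<noteq> 0}"
  proof -
    have "(\<lambda>\<nu> i. int (\<nu> i)) ` {\<nu>. p \<nu> \<noteq> 0} \<subseteq> {\<mu>. X \<mu> \<noteq> 0}" by (auto simp: p_def)
    then have "finite ((\<lambda>\<nu> i. int (\<nu> i)) ` {\<nu>. p \<nu> \<noteq> 0})" using finX finite_subset by blast
    then show ?thesis by (rule finite_imageD) (auto simp: inj_on_def fun_eq_iff)
  qed
  have "is_macdonald N q t lam p"
    unfolding is_macdonald_def
  proof (intro conjI allI impI)
    show "p lam = 1" using X_lam by (simp add: p_def lamv_def)
    show "dominated N \<nu> lam" if "p \<nu> \<noteq> 0" for \<nu>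
      unfolding dominated_iff using X_supp(1) that by (simp add: p_def)
    show "p (\<nu> \<circ> \<sigma>) = p \<nu>" if "\<sigma> permutes {1..N}" for \<sigma> \<nu>
      using X_perm[OF that, of "\<lambda>i. int (\<nu> i)"] by (simp add: p_def comp_def)
    fix x :: "nat \<Rightarrow> complex" assume x: "inj_on x {1..N}"
    have "D1 N q t (poly_at N p) x = e1_s N t Lq * poly_at N p x"
    proof (rule D1_identity_extends[OF finp \<epsilon> _ x])
      fix x assume x: "x \<in> ratio_region N \<epsilon>"
      have "((\<lambda>\<mu>. B \<mu> * mono_at N x \<mu>) has_sum e1_s N t Lq * poly_at N p x) UNIV"
        unfolding B_all mult.assoc by (rule has_sum_cmult_right[OF S])
      with SB[OF x] show "D1 N q t (poly_at N p) x = e1_s N t Lq * poly_at N p x" by (rule has_sum_unique)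
    qed
    then show "D1 N q t (poly_at N p) x = e1_s N t (\<lambda>i. q ^ lam i) * poly_at N p x" by (simp add: Lq_def)
  qed
  then show ?thesis by blast
qed

text \<open>For all large t only the finitely many exponents of \<open>small\<close> occur, so the
  limit is taken term by term. Outside \<open>small\<close> the limit coefficients are limits of
  zeros.\<close>

lemma q_whittaker_sum:
  assumes x: "\<And>i. i \<in> {1..N} \<Longrightarrow> x i \<noteq> 0"
  shows "((\<lambda>\<kappa>. whit_coeff N q Lq \<kappa> * mono_at N x (lamv - \<kappa>)) has_sum q_whittaker N q lam x) (Qplus N)"
proof -
  define P where "P t = (THE p. is_macdonald N q t lam p)" for t
  have P: "is_macdonald N q t lam (P t)" if "good_t t" for t
    unfolding P_def using macdonald_exists[OF that] macdonald_unique[OF that] by (metis theI)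
  have eventually_eig: "\<forall>\<^sub>F t in at_infinity. is_eigenseries N q t Lq (\<lambda>\<kappa>. ext_coeff (P t) (lamv - \<kappa>))"
    using eventually_good by eventually_elim (rule macdonald_eigenseries(1), auto simp: good_t_def intro: P)
  have lim: "((\<lambda>t. ext_coeff (P t) (lamv - \<kappa>)) \<longlongrightarrow> whit_coeff N q Lq \<kappa>) at_infinity" if "\<kappa> \<in> Qplus N" for \<kappa>
    using eigenseries_limit[OF q0 q1 _ order_refl eventually_eig that] Lq_nz by blast
  have out: "whit_coeff N q Lq \<kappa> = 0" if \<kappa>: "\<kappa> \<in> Qplus N" "\<kappa> \<notin> small" for \<kappa>
  proof (rule tendsto_unique[OF _ lim[OF \<kappa>(1)]])
    have "\<forall>\<^sub>F t in at_infinity. ext_coeff (P t) (lamv - \<kappa>) = 0"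
      using eventually_good
    proof eventually_elim
      case (elim t)
      then have "t \<noteq> 0" by (simp add: good_t_def)
      then show ?case using macdonald_eigenseries(2)[OF _ P[OF elim], of \<kappa>] \<kappa>(2) by blast
    qed
    then show "((\<lambda>t. ext_coeff (P t) (lamv - \<kappa>)) \<longlongrightarrow> 0) at_infinity" by (rule tendsto_eventually)
  qed (rule trivial_limit_at_infinity)
  have "((\<lambda>t. macdonald N q t lam x) \<longlongrightarrow> (\<Sum>\<kappa>\<in>small. whit_coeff N q Lq \<kappa> * mono_at N x (lamv - \<kappa>))) at_infinity"
  proof (rule Lim_transform_eventually)
    show "((\<lambda>t. \<Sum>\<kappa>\<in>small. ext_coeff (P t) (lamv - \<kappa>) * mono_at N x (lamv - \<kappa>)) \<longlongrightarrow>
        (\<Sum>\<kappa>\<in>small. whit_coeff N q Lq \<kappa> * mono_at N x (lamv - \<kappa>))) at_infinity"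
      by (intro tendsto_intros lim) (simp add: small_def)
    show "\<forall>\<^sub>F t in at_infinity. (\<Sum>\<kappa>\<in>small. ext_coeff (P t) (lamv - \<kappa>) * mono_at N x (lamv - \<kappa>)) = macdonald N q t lam x"
      using eventually_good
    proof eventually_elim
      case (elim t)
      then have t: "t \<noteq> 0" by (simp add: good_t_def)
      note M = macdonald_eigenseries[OF t P[OF elim]]
      have "((\<lambda>\<mu>. ext_coeff (P t) \<mu> * mono_at N x \<mu>) has_sum macdonald N q t lam x) UNIV"
        using M(3) by (simp add: macdonald_def P_def)
      then have "((\<lambda>\<mu>. ext_coeff (P t) \<mu> * mono_at N x \<mu>) has_sum macdonald N q t lam x) ((\<lambda>\<kappa>. lamv - \<kappa>) ` small)"
      proof (rule has_sum_cong_neutral[THEN iffD1, rotated 3])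
        fix \<mu> assume \<mu>: "\<mu> \<in> UNIV - (\<lambda>\<kappa>. lamv - \<kappa>) ` small"
        have "lamv - \<mu> \<notin> small"
        proof
          assume "lamv - \<mu> \<in> small"
          then have "lamv - (lamv - \<mu>) \<in> (\<lambda>\<kappa>. lamv - \<kappa>) ` small" by (rule imageI)
          then show False using \<mu> by simp
        qed
        then show "ext_coeff (P t) \<mu> * mono_at N x \<mu> = 0" using M(2)[of "lamv - \<mu>"] by auto
      qed auto
      then have "macdonald N q t lam x = (\<Sum>\<mu>\<in>(\<lambda>\<kappa>. lamv - \<kappa>) ` small. ext_coeff (P t) \<mu> * mono_at N x \<mu>)"
        using has_sum_finite[OF finite_imageI[OF finite_small]] has_sum_unique by blast
      also have "\<dots> = (\<Sum>\<kappa>\<in>small. ext_coeff (P t) (lamv - \<kappa>) * mono_at N x (lamv - \<kappa>))"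
        by (subst sum.reindex) (auto simp: inj_on_def)
      finally show ?case ..
    qed
  qed
  from tendsto_Lim[OF trivial_limit_at_infinity this]
  have qw: "q_whittaker N q lam x = (\<Sum>\<kappa>\<in>small. whit_coeff N q Lq \<kappa> * mono_at N x (lamv - \<kappa>))"
    by (simp add: q_whittaker_def)
  show ?thesis
    unfolding qw using has_sum_finite[OF finite_small]
    by (rule has_sum_cong_neutral[THEN iffD1, rotated 3]) (use out in \<open>auto simp: small_def\<close>)
qed

end

section \<open>Assembling the operator g\<close>

text \<open>Each factor satisfies |1 - q^n| \<ge> 1 - |q|. The resulting small disc of convergence
  suffices to identify Taylor coefficients at 0.\<close>

lemma inv_qfact_bound:
  assumes "norm q < 1"
  shows "norm (inv_qfact q n) \<le> (1 / (1 - norm q)) ^ n"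
proof (induction n)
  case (Suc n)
  have "norm (q ^ Suc n) \<le> norm q"
    using assms mult_left_mono[of "norm q ^ n" 1 "norm q"] power_le_one[of "norm q" n] by (simp add: norm_mult norm_power)
  then have "1 - norm q \<le> norm (1 - q ^ Suc n)"
    using norm_triangle_ineq2[of 1 "q ^ Suc n"] by simp
  then have "norm (inv_qfact q n) / norm (1 - q ^ Suc n) \<le> (1 / (1 - norm q)) ^ n / (1 - norm q)"
    using Suc assms by (intro frac_le) auto
  then show ?case by (simp add: norm_divide)
qed simp

text \<open>Euler's expansion, obtained from \<open>G(q z) = (1 - z) G(z)\<close> for \<open>G(z) = \<Sum>\<^sub>n z\<^sup>n / (q;q)\<^sub>n\<close>.\<close>

lemma qpoch_expansion:
  assumes "q \<noteq> 0" "norm q < 1"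
  shows "fps_nth (fps_expansion (\<lambda>z. inverse (qpoch_inf q z)) 0) n = inv_qfact q n"
proof -
  define r where "r = 1 - norm q"
  have r: "0 < r" "r \<le> 1" using assms by (auto simp: r_def)
  have sumG: "summable (\<lambda>n. inv_qfact q n * z ^ n)" if z: "norm z < r" for z
  proof (rule summable_comparison_test)
    show "\<exists>M. \<forall>n\<ge>M. norm (inv_qfact q n * z ^ n) \<le> (norm z / r) ^ n"
    proof (intro exI allI impI)
      fix n
      have "norm (inv_qfact q n) * norm z ^ n \<le> (1 / r) ^ n * norm z ^ n"
        unfolding r_def by (intro mult_right_mono inv_qfact_bound assms) auto
      then show "norm (inv_qfact q n * z ^ n) \<le> (norm z / r) ^ n"
        by (simp add: norm_mult norm_power power_divide)
    qed
    show "summable (\<lambda>n. (norm z / r) ^ n)"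
      using z r by (intro summable_geometric) simp
  qed
  define G where "G z = (\<Sum>n. inv_qfact q n * z ^ n)" for z
  have G0: "G 0 = 1" unfolding G_def by (simp add: powser_zero[of "inv_qfact q"])
  have contG: "isCont G 0"
    unfolding G_def
    by (rule isCont_powser[of "inv_qfact q" "of_real (r / 2)"]) (use r in \<open>auto intro!: sumG\<close>)
  have rec: "G (q * z) = (1 - z) * G z" if z: "norm z < r" for z
  proof -
    have qz: "norm (q * z) < r"
      using z assms mult_left_le_one_le[of "norm z" "norm q"] by (simp add: norm_mult)
    have "(1 - q ^ Suc n) * inv_qfact q (Suc n) = inv_qfact q n" for n
      using one_minus_power_nz[OF assms, of n] by simp
    note * = this
    have step: "inv_qfact q (Suc n) * (q * z) ^ Suc n = inv_qfact q (Suc n) * z ^ Suc n - z * (inv_qfact q n * z ^ n)" for n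
    proof -
      have "z * (inv_qfact q n * z ^ n) = inv_qfact q n * z ^ Suc n" by simp
      also have "\<dots> = (1 - q ^ Suc n) * inv_qfact q (Suc n) * z ^ Suc n" by (simp only: *)
      finally have e: "z * (inv_qfact q n * z ^ n) = (1 - q ^ Suc n) * inv_qfact q (Suc n) * z ^ Suc n" .
      show ?thesis
        unfolding e power_mult_distrib by (simp add: algebra_simps del: power_Suc inv_qfact.simps)
    qed
    have S1: "summable (\<lambda>n. inv_qfact q (Suc n) * z ^ Suc n)" and S2: "summable (\<lambda>n. z * (inv_qfact q n * z ^ n))"
      using sumG[OF z] by (simp_all only: summable_Suc_iff[of "\<lambda>n. inv_qfact q n * z ^ n"] summable_mult)
    have "G (q * z) = 1 + (\<Sum>n. inv_qfact q (Suc n) * (q * z) ^ Suc n)"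
      unfolding G_def using suminf_split_head[OF sumG[OF qz]] by simp
    also have "\<dots> = 1 + ((\<Sum>n. inv_qfact q (Suc n) * z ^ Suc n) - (\<Sum>n. z * (inv_qfact q n * z ^ n)))"
      unfolding step by (simp only: suminf_diff[OF S1 S2])
    also have "(\<Sum>n. z * (inv_qfact q n * z ^ n)) = z * G z"
      unfolding G_def by (rule suminf_mult[OF sumG[OF z]])
    also have "(\<Sum>n. inv_qfact q (Suc n) * z ^ Suc n) = G z - 1"
      unfolding G_def using suminf_split_head[OF sumG[OF z]] by simp
    finally show ?thesis by (simp add: algebra_simps)
  qed
  have inv: "inverse (qpoch_inf q z) = G z" if z: "norm z < r" for z
  proof -
    have qn: "norm (q ^ n * z) < r" for n
    proof -
      have "norm (q ^ n * z) \<le> 1 * norm z"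
        unfolding norm_mult norm_power using assms by (intro mult_right_mono power_le_one) auto
      then show ?thesis using z by simp
    qed
    \<comment> \<open>Iterating the functional equation; the remaining factor tends to G(0) = 1 by
      continuity.\<close>
    have prod: "(\<Prod>k\<le>n. 1 - q ^ k * z) * G z = G (q ^ Suc n * z)" for n
    proof (induction n)
      case (Suc n)
      have "G (q ^ Suc (Suc n) * z) = (1 - q ^ Suc n * z) * G (q ^ Suc n * z)"
        using rec[OF qn[of "Suc n"]] by (simp add: mult.assoc)
      then show ?case using Suc by (simp add: mult_ac)
    qed (use rec[OF z] in simp)
    have "summable (\<lambda>n. norm (q ^ n * z))"
      using assms by (simp add: norm_mult norm_power summable_mult2)
    then have "abs_convergent_prod (\<lambda>n. 1 + - (q ^ n * z))"
      by (intro summable_imp_abs_convergent_prod) simp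
    then have "convergent_prod (\<lambda>n. 1 - q ^ n * z)"
      using abs_convergent_prod_imp_convergent_prod by fastforce
    from convergent_prod_LIMSEQ[OF this]
    have "(\<lambda>n. (\<Prod>k\<le>n. 1 - q ^ k * z) * G z) \<longlonglongrightarrow> qpoch_inf q z * G z"
      unfolding qpoch_inf_def by (rule tendsto_mult_right)
    moreover have "(\<lambda>n. G (q ^ Suc n * z)) \<longlonglongrightarrow> G 0"
    proof (rule isCont_tendsto_compose[OF contG])
      have "(\<lambda>n. q ^ Suc n * z) \<longlonglongrightarrow> 0 * z"
        by (intro tendsto_mult tendsto_const LIMSEQ_Suc[OF LIMSEQ_power_zero]) (rule assms(2))
      then show "(\<lambda>n. q ^ Suc n * z) \<longlonglongrightarrow> 0" by simp
    qed
    ultimately have "qpoch_inf q z * G z = 1"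
      unfolding prod G0 by (rule LIMSEQ_unique)
    then show ?thesis by (simp add: inverse_unique)
  qed
  have "(\<lambda>z. inverse (qpoch_inf q z)) has_fps_expansion Abs_fps (inv_qfact q)"
  proof (rule has_fps_expansionI)
    have "\<forall>\<^sub>F z in nhds 0. z \<in> ball 0 r" using r by (intro eventually_nhds_in_open) auto
    then show "\<forall>\<^sub>F z in nhds 0. (\<lambda>n. fps_nth (Abs_fps (inv_qfact q)) n * z ^ n) sums inverse (qpoch_inf q z)"
    proof eventually_elim
      case (elim z)
      then have "norm z < r" by simp
      from summable_sums[OF sumG[OF this]] show ?case by (simp add: inv[OF \<open>norm z < r\<close>] G_def)
    qed
  qed
  then have "fps_expansion (\<lambda>z. inverse (qpoch_inf q z)) 0 = Abs_fps (inv_qfact q)"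
    by (rule fps_expansion_eqI)
  then show ?thesis by simp
qed

text \<open>The operators act on \<delta> alone, so for fixed \<beta> and u a common factor such as
  x^(-\<beta>) passes through all of them.\<close>

lemma inv_qpoch_ops:
  fixes F :: ext_series and G :: darray and \<delta> :: "nat \<Rightarrow> int" and xs :: "nat list"
  assumes q: "q \<noteq> 0" "norm q < 1" and F: "\<And>\<delta>. F \<delta> \<beta> u = G \<delta> \<beta> * c"
  shows "foldr (\<circ>) (map (inv_qpoch_op N q) xs) id F \<delta> \<beta> u = foldr (\<circ>) (map (qpoch_op q N) xs) id G \<delta> \<beta> * c"
proof -
  have e: "(\<lambda>i. \<delta> i - int n * simple_root a i) = \<delta> - smul n (rt a (Suc a))" for n a \<delta>
    by (simp add: fun_eq_iff smul_def simple_root_eq_rt)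
  define P where "P xs \<longleftrightarrow> (\<forall>\<delta>. foldr (\<circ>) (map (inv_qpoch_op N q) xs) id F \<delta> \<beta> u =
      foldr (\<circ>) (map (qpoch_op q N) xs) id G \<delta> \<beta> * c)" for xs
  have "P xs"
  proof (induction xs)
    case Nil
    show ?case by (simp add: P_def F)
  next
    case (Cons a xs)
    then show ?case
      by (simp add: P_def inv_qpoch_op_def qpoch_op_def e qpoch_expansion[OF q] sum_distrib_right mult.assoc)
  qed
  then show ?thesis by (simp add: P_def)
qed

lemma gauss_ops:
  "foldr (\<circ>) (map (gauss_T_op lq) l) id F \<delta> \<beta> u =
    exp (\<Sum>a\<leftarrow>l. (u a - of_int (\<delta> a) * lq)\<^sup>2 / (2 * lq)) * F \<delta> \<beta> u"
  by (induction l) (simp_all add: gauss_T_op_def exp_add mult.assoc)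

text \<open>Expanding the square with l = log q: (u - \<delta> l)^2 / (2 l) - l \<delta>^2 / 2 = u^2
  / (2 l) - u \<delta>, in each coordinate.\<close>

lemma gaussian_shift:
  assumes "lq \<noteq> 0"
  shows "exp (\<Sum>a\<in>{1..N}. (u a - of_int (\<delta> a) * lq)\<^sup>2 / (2 * lq)) * inv_gauss N lq \<delta> =
    gamma_fun N lq u * mono_at N (\<lambda>i. exp (u i)) (- \<delta>)"
proof -
  have "mono_at N (\<lambda>i. exp (u i)) (- \<delta>) = exp (\<Sum>a\<in>{1..N}. - (u a * of_int (\<delta> a)))"
    unfolding mono_at_def exp_sum[OF finite_atLeastAtMost]
    by (intro prod.cong refl) (simp add: exp_power_int mult.commute)
  moreover have "inv_gauss N lq \<delta> = exp (\<Sum>a\<in>{1..N}. - (lq * (of_int (\<delta> a))\<^sup>2 / 2))"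
    unfolding inv_gauss_def norm_sq_def by (simp add: sum_negf sum_distrib_left sum_divide_distrib)
  ultimately have "exp (\<Sum>a\<in>{1..N}. (u a - of_int (\<delta> a) * lq)\<^sup>2 / (2 * lq)) * inv_gauss N lq \<delta> =
      exp (\<Sum>a\<in>{1..N}. (u a - of_int (\<delta> a) * lq)\<^sup>2 / (2 * lq) + - (lq * (of_int (\<delta> a))\<^sup>2 / 2))"
    "gamma_fun N lq u * mono_at N (\<lambda>i. exp (u i)) (- \<delta>) = exp (\<Sum>a\<in>{1..N}. (u a)\<^sup>2 / (2 * lq) + - (u a * of_int (\<delta> a)))"
    by (simp_all only: gamma_fun_def sum.distrib exp_add)
  moreover have "(u a - of_int (\<delta> a) * lq)\<^sup>2 / (2 * lq) + - (lq * (of_int (\<delta> a))\<^sup>2 / 2) =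
      (u a)\<^sup>2 / (2 * lq) + - (u a * of_int (\<delta> a))" for a
    using assms by (simp add: power2_eq_square field_simps)
  ultimately show ?thesis by simp
qed

context partition_setup
begin

text \<open>Each pair (\<delta>, \<kappa> - \<delta>) contributes gamma x^(-\<kappa>) W(\<delta>,
  \<kappa>) q^(-<\<lambda>, \<delta>>), so the sum over \<delta> reassembles the coefficient of Psi
  at \<kappa>, specialized to \<Lambda>_i = q^(\<lambda>_i).\<close>

lemma g_part:
  assumes lq: "exp lq = q" and \<kappa>: "\<kappa> \<in> Qplus N"
  shows "g_whittaker_part N q lq lam \<kappa> u =
    gamma_fun N lq u * (whit_coeff N q Lq \<kappa> * mono_at N (\<lambda>i. exp (u i)) (lamv - \<kappa>))"
proof -
  define x where "x = (\<lambda>i. exp (u i))"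
  have xnz: "\<And>i. i \<in> {1..N} \<Longrightarrow> x i \<noteq> 0" by (simp add: x_def)
  have lq0: "lq \<noteq> 0" using lq q1 by auto
  have g_split: "g_op N q lq F = foldr (\<circ>) (map (gauss_T_op lq) [1..<N + 1]) id (foldr (\<circ>) (map (inv_qpoch_op N q) [1..<N]) id F)" for F
    unfolding g_op_def by (rule comp_apply)
  have gop: "g_op N q lq (whittaker_ext N q) \<delta> (\<kappa> - \<delta>) u = gamma_fun N lq u * (whit_array q N \<delta> \<kappa> * mono_at N x (- \<kappa>))"
    if \<delta>: "\<delta> \<in> ival N \<kappa>" for \<delta>
  proof -
    have Q: "\<delta> \<in> Qplus N" "\<kappa> - \<delta> \<in> Qplus N" using \<delta> by (auto simp: ival_def)
    have ext: "whittaker_ext N q \<delta>' (\<kappa> - \<delta>) u = whit_array q N \<delta>' (\<kappa> - \<delta>) * mono_at N x (- (\<kappa> - \<delta>))" for \<delta>'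
      unfolding whittaker_ext_def whittaker_coefficient[OF q0 q1 Q(2)] x_def fun_Compl_def ..
    have "g_op N q lq (whittaker_ext N q) \<delta> (\<kappa> - \<delta>) u =
      exp (\<Sum>a\<leftarrow>[1..<N + 1]. (u a - of_int (\<delta> a) * lq)\<^sup>2 / (2 * lq)) *
      (foldr (\<circ>) (map (qpoch_op q N) [1..<N]) id (whit_array q N) \<delta> (\<kappa> - \<delta>) * mono_at N x (- (\<kappa> - \<delta>)))"
      unfolding g_split gauss_ops inv_qpoch_ops[where F = "whittaker_ext N q" and G = "whit_array q N" and \<beta> = "\<kappa> - \<delta>" and u = u and
          c = "mono_at N x (- (\<kappa> - \<delta>))", OF q0 q1 ext] ..
    also have "foldr (\<circ>) (map (qpoch_op q N) [1..<N]) id (whit_array q N) \<delta> (\<kappa> - \<delta>) = inv_gauss N lq \<delta> * whit_array q N \<delta> \<kappa>"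
      using qpoch_ops_whit_array[OF q0 q1 lq order_refl N1] Q by (simp add: qpoch_ops_def shifted_array_def)
    also have "(\<Sum>a\<leftarrow>[1..<N + 1]. (u a - of_int (\<delta> a) * lq)\<^sup>2 / (2 * lq)) = (\<Sum>a\<in>{1..N}. (u a - of_int (\<delta> a) * lq)\<^sup>2 / (2 * lq))"
      by (subst sum_list_distinct_conv_sum_set) (auto intro: sum.cong)
    also have "exp \<dots> * (inv_gauss N lq \<delta> * whit_array q N \<delta> \<kappa> * mono_at N x (- (\<kappa> - \<delta>))) =
      (exp (\<Sum>a\<in>{1..N}. (u a - of_int (\<delta> a) * lq)\<^sup>2 / (2 * lq)) * inv_gauss N lq \<delta>) * (whit_array q N \<delta> \<kappa> * mono_at N x (- (\<kappa> - \<delta>)))"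
      by (simp only: mult_ac)
    also have "\<dots> = gamma_fun N lq u * (whit_array q N \<delta> \<kappa> * (mono_at N x (- \<delta>) * mono_at N x (- (\<kappa> - \<delta>))))"
      unfolding gaussian_shift[OF lq0] by (simp only: x_def mult_ac)
    also have "mono_at N x (- \<delta>) * mono_at N x (- (\<kappa> - \<delta>)) = mono_at N x (- \<delta> + - (\<kappa> - \<delta>))"
      by (rule mono_at_add[OF xnz, symmetric])
    also have "- \<delta> + - (\<kappa> - \<delta>) = - \<kappa>" by simp
    finally show ?thesis .
  qed
  have "g_whittaker_part N q lq lam \<kappa> u = mono_at N x lamv *
     (\<Sum>\<delta>\<in>ival N \<kappa>. g_op N q lq (whittaker_ext N q) \<delta> (\<kappa> - \<delta>) u * mono_at N Lq (- \<delta>))"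
    unfolding g_whittaker_part_def sum_decomps_fst by (simp add: x_def lamv_def Lq_def fun_Compl_def)
  also have "(\<Sum>\<delta>\<in>ival N \<kappa>. g_op N q lq (whittaker_ext N q) \<delta> (\<kappa> - \<delta>) u * mono_at N Lq (- \<delta>)) =
     gamma_fun N lq u * mono_at N x (- \<kappa>) * whit_coeff N q Lq \<kappa>"
    unfolding whit_coeff_def sum_distrib_left by (intro sum.cong refl) (simp add: gop mult_ac)
  also have "mono_at N x lamv * (gamma_fun N lq u * mono_at N x (- \<kappa>) * whit_coeff N q Lq \<kappa>) =
     gamma_fun N lq u * (whit_coeff N q Lq \<kappa> * (mono_at N x lamv * mono_at N x (- \<kappa>)))"
    by (simp only: mult_ac)
  also have "mono_at N x lamv * mono_at N x (- \<kappa>) = mono_at N x (lamv - \<kappa>)"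
    using mono_at_add[of N x lamv "- \<kappa>", OF xnz] by simp
  finally show ?thesis by (simp add: x_def)
qed

end

text \<open>The identity holds degree by degree in x: by \<open>g_part\<close> each part is gamma
  times the corresponding term of the specialized series.\<close>

theorem theorem2p11:
  fixes N :: nat and q lq :: complex and lam :: "nat \<Rightarrow> nat" and u :: "nat \<Rightarrow> complex"
  assumes "1 \<le> N" and "q \<noteq> 0" and "norm q < 1" and "exp lq = q"
    and "is_partition N lam"
  shows "((\<lambda>\<kappa>. g_whittaker_part N q lq lam \<kappa> u) has_sum
           (gamma_fun N lq u * q_whittaker N q lam (\<lambda>i. exp (u i)))) (Qplus N)"
proof -
  interpret partition_setup N q lam
    by unfold_locales (use assms in auto)
  have "((\<lambda>\<kappa>. gamma_fun N lq u * (whit_coeff N q Lq \<kappa> * mono_at N (\<lambda>i. exp (u i)) (lamv - \<kappa>))) has_sum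
      gamma_fun N lq u * q_whittaker N q lam (\<lambda>i. exp (u i))) (Qplus N)"
    by (intro has_sum_cmult_right q_whittaker_sum) simp
  then show ?thesis
    by (rule has_sum_cong[THEN iffD1, rotated]) (simp add: g_part assms(4))
qed

end
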